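(* Let $\lambda(z)\in\mathcal O_U^n$, $x^o\in N$, and let $P\in M(m,{}_U\mathcal D_* )$ satisfy $$\det\bar\sigma_*(P)(x,z,\xi)\neq0\quad\text{for all }(x,z,\xi)\in N\times U\times\bigl([0,\infty)^n\setminus\{0\}\bigr)$$ and $$\det\bigl(\sigma_*(P)(x^o,z^o,\lambda(z^o)+\gamma)\bigr)\neq0\quad\text{for all }\gamma\in\mathbb N^n\setminus\{0\}.$$ Suppose that $P_1,\ldots,P_p\in M(m,{}_U\widetilde{\mathcal D}_* )$ satisfy $$[P,P_i]=S_iP+\sum_{j=1}^pT_{ij}P_j\qquad(i=1,\ldots,p)$$ with $S_i\in M(m,{}_U\widetilde{\mathcal D}_* )$ and $T_{ij}\in M(m,{}_U\mathcal D_* )$, and suppose moreover $\sigma_*(T_{ij})=0$ for all $i,j$. Then, after shrinking $U\ni z^o$ and $N\ni x^o$ (and $M$) if necessary, the map $\beta_{\lambda(z)}:u\mapsto t^{-\lambda(z)}u|_{t=0}$ is a bijection from $$\bigl\{u\,;\,t^{-\lambda(z)}u\in{}_U\mathcal A_M^m\text{ and }Pu=P_iu=0\text{ for }i=1,\ldots,p\bigr\}$$ onto $$\bigl\{v\in{}_U\mathcal A_N^m\,;\,\sigma_*(P)(x,z,\lambda(z))v=0,\ \sigma_*(P_i)(x,z,\lambda(z),\partial_x)v=0\ (i=1,\ldots,p)\bigr\}.$$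
   Context: Setting. $M$ is a connected real analytic manifold of dimension $n+n'$, and $N_1,\ldots,N_n$ are one-codimensional submanifolds normally crossing at $N=N_1\cap\cdots\cap N_n$, with $N$ connected. A coordinate system $(t,x)=(t_1,\ldots,t_n,x_1,\ldots,x_{n'})$ is fixed in which $N_i=\{t_i=0\}$; $M$ is taken to be the domain of these coordinates, so $N=\{t=0\}$ with coordinates $x$. $\mathbb N=\{0,1,2,\ldots\}$. $\mathcal A_N$: complex-valued real analytic functions on $N$; $\mathcal A_M$: those defined on a neighborhood of $N$ in $M$ (identified if they agree near $N$). $\vartheta_i=t_i\partial/\partial t_i$, $\vartheta^\alpha=\prod\vartheta_i^{\alpha_i}$, $t^\lambda=\prod t_i^{\lambda_i}$, $\partial_x^\beta=\partial^{|\beta|}/\partial x_1^{\beta_1}\cdots\partial x_{n'}^{\beta_{n'}}$. $M(m,R)$ is the ring of $m\times m$ matrices over $R$. Parameters. $U$ is a connected open neighborhood of $z^o\in\mathbb C^\ell$ ($\ell\ge0$), $\mathcal O_U$ the holomorphic functions on $U$; ${}_U\mathcal A_M$, ${}_U\mathcal A_N$ are the spaces of real analytic functions as in $\mathcal A_M$, $\mathcal A_N$ depending on the holomorphic parameter $z\in U$. ${}_U\widetilde{\mathcal D}_*$ is the ring of operators (finite sums) $P=\sum_{\alpha\in\mathbb N^n,\beta\in\mathbb N^{n'}}a_{\alpha,\beta}(t,x,z)\vartheta^\alpha\partial_x^\beta$ with $a_{\alpha,\beta}\in{}_U\mathcal A_M$, and ${}_U\mathcal D_*$ is the subring of those with $a_{\alpha,\beta}(0,x,z)=0$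 whenever $\beta\ne0$. $\sigma_*(P)(x,z,\xi,\partial_x)=\sum_{\alpha,\beta}a_{\alpha,\beta}(0,x,z)\xi^\alpha\partial_x^\beta$, taken entrywise for matrices; for $P\in M(m,{}_U\mathcal D_* )$ it involves no $\partial_x$ and is written $\sigma_*(P)(x,z,\xi)$. $\operatorname{ord}P$ is the maximal $|\alpha|+|\beta|$ with $a_{\alpha,\beta}\neq0$ in some entry; for $P\in M(m,{}_U\mathcal D_* )$, $\bar\sigma_*(P)(x,z,\xi)$ is the matrix with entries $\sum_{|\alpha|=\operatorname{ord}P}a_{\alpha,0}(0,x,z)\xi^\alpha$. *)

theory Defs
  imports "HOL-Analysis.Analysis"
begin

text \<open>
  The dimensions \<open>n\<close>, \<open>n'\<close>, \<open>l\<close> are natural numbers and may be \<open>0\<close>. As in \<^const>\<open>Euclidean_space\<close>,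
  a point of a \<open>k\<close>-dimensional coordinate space is a function on \<open>nat\<close> that vanishes
  from the index \<open>k\<close> on; the coordinates are numbered \<open>0, \<dots>, k - 1\<close>. The matrix size is
  \<open>CARD('m)\<close>.
\<close>

definition Complex_space :: "nat \<Rightarrow> (nat \<Rightarrow> complex) topology" where
  "Complex_space l = subtopology (product_topology (\<lambda>_. euclidean) UNIV) {z. \<forall>i\<ge>l. z i = 0}"

type_synonym pt = "(nat \<Rightarrow> real) \<times> (nat \<Rightarrow> real) \<times> (nat \<Rightarrow> complex)"

definition txz_space :: "nat \<Rightarrow> nat \<Rightarrow> nat \<Rightarrow> pt topology" where
  "txz_space n n' l =
     prod_topology (Euclidean_space n) (prod_topology (Euclidean_space n') (Complex_space l))"

definition multi_indices :: "nat \<Rightarrow> (nat \<Rightarrow> nat) set" where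
  "multi_indices k = {\<alpha>. \<forall>i\<ge>k. \<alpha> i = 0}"

definition mpow :: "nat \<Rightarrow> (nat \<Rightarrow> 'a::comm_monoid_mult) \<Rightarrow> (nat \<Rightarrow> nat) \<Rightarrow> 'a" where
  "mpow k x \<alpha> = (\<Prod>i<k. x i ^ \<alpha> i)"


subsection \<open>Analytic functions with holomorphic parameters\<close>

text \<open>
  A function is real analytic in \<open>(t, x)\<close> and depends holomorphically on \<open>z\<close> (jointly) at a point
  if it is there the sum of a convergent power series in the real variables \<open>(t, x)\<close>
  and the complex variables \<open>z\<close>.
\<close>

definition analytic_at_pt :: "nat \<Rightarrow> nat \<Rightarrow> nat \<Rightarrow> (pt \<Rightarrow> complex) \<Rightarrow> pt \<Rightarrow> bool" where
  "analytic_at_pt n n' l f = (\<lambda>(t0, x0, z0). \<exists>r>0. \<exists>c.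
     \<forall>(t, x, z) \<in> topspace (txz_space n n' l).
       (\<forall>i<n. \<bar>t i - t0 i\<bar> < r) \<and> (\<forall>j<n'. \<bar>x j - x0 j\<bar> < r) \<and> (\<forall>k<l. cmod (z k - z0 k) < r) \<longrightarrow>
       ((\<lambda>(\<alpha>, \<beta>, \<delta>). c \<alpha> \<beta> \<delta> * of_real (mpow n (\<lambda>i. t i - t0 i) \<alpha>)
            * of_real (mpow n' (\<lambda>j. x j - x0 j) \<beta>) * mpow l (\<lambda>k. z k - z0 k) \<delta>)
         has_sum f (t, x, z)) (multi_indices n \<times> multi_indices n' \<times> multi_indices l))"

definition hol :: "nat \<Rightarrow> (nat \<Rightarrow> complex) set \<Rightarrow> ((nat \<Rightarrow> complex) \<Rightarrow> complex) set" where
  "hol l U = {f. \<forall>z\<in>U. analytic_at_pt 0 0 l (\<lambda>(t, x, z). f z) (\<lambda>_. 0, \<lambda>_. 0, z)}"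

definition locus :: "((nat \<Rightarrow> real) \<times> (nat \<Rightarrow> real)) set \<Rightarrow> (nat \<Rightarrow> real) set" where
  "locus M = {x. (\<lambda>_. 0, x) \<in> M}"

definition near :: "nat \<Rightarrow> nat \<Rightarrow> nat \<Rightarrow> ((nat \<Rightarrow> real) \<times> (nat \<Rightarrow> real)) set \<Rightarrow> (nat \<Rightarrow> complex) set
    \<Rightarrow> (pt \<Rightarrow> bool) \<Rightarrow> bool" where
  \<comment> \<open>\<open>Q\<close> holds on some neighbourhood of \<open>N \<times> U\<close> in \<open>M \<times> U\<close>, where \<open>N = locus M\<close>\<close>
  "near n n' l M U Q \<longleftrightarrow>
     (\<exists>W. openin (txz_space n n' l) W \<and> W \<subseteq> {(t, x, z). (t, x) \<in> M \<and> z \<in> U} \<and>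
          (\<forall>x\<in>locus M. \<forall>z\<in>U. (\<lambda>_. 0, x, z) \<in> W) \<and> (\<forall>p\<in>W. Q p))"

text \<open>
  Representatives of the elements of \<open>_U A_M^m\<close>; the values outside a neighbourhood of \<open>N \<times> U\<close>
  are irrelevant.
\<close>

definition UAM :: "nat \<Rightarrow> nat \<Rightarrow> nat \<Rightarrow> ((nat \<Rightarrow> real) \<times> (nat \<Rightarrow> real)) set \<Rightarrow> (nat \<Rightarrow> complex) set
    \<Rightarrow> (pt \<Rightarrow> complex ^ 'm) set" where
  "UAM n n' l M U = {w. near n n' l M U (\<lambda>p. \<forall>i. analytic_at_pt n n' l (\<lambda>q. w q $ i) p)}"

definition UAN :: "nat \<Rightarrow> nat \<Rightarrow> (nat \<Rightarrow> real) set \<Rightarrow> (nat \<Rightarrow> complex) set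
    \<Rightarrow> ((nat \<Rightarrow> real) \<times> (nat \<Rightarrow> complex) \<Rightarrow> complex ^ 'm) set" where
  "UAN n' l N U = {v \<in> extensional (N \<times> U). \<forall>x\<in>N. \<forall>z\<in>U. \<forall>i.
     analytic_at_pt 0 n' l (\<lambda>(t, x, z). v (x, z) $ i) (\<lambda>_. 0, x, z)}"


subsection \<open>Differential operators\<close>

definition theta :: "nat \<Rightarrow> (pt \<Rightarrow> 'a::real_normed_vector) \<Rightarrow> pt \<Rightarrow> 'a" where
  "theta i f = (\<lambda>(t, x, z). t i *\<^sub>R vector_derivative (\<lambda>s. f (t(i := s), x, z)) (at (t i)))"

definition dx :: "nat \<Rightarrow> (pt \<Rightarrow> 'a::real_normed_vector) \<Rightarrow> pt \<Rightarrow> 'a" where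
  "dx j f = (\<lambda>(t, x, z). vector_derivative (\<lambda>s. f (t, x(j := s), z)) (at (x j)))"

definition dxN :: "nat \<Rightarrow> ((nat \<Rightarrow> real) \<times> (nat \<Rightarrow> complex) \<Rightarrow> 'a::real_normed_vector)
    \<Rightarrow> (nat \<Rightarrow> real) \<times> (nat \<Rightarrow> complex) \<Rightarrow> 'a" where
  "dxN j v = (\<lambda>(x, z). vector_derivative (\<lambda>s. v (x(j := s), z)) (at (x j)))"

text \<open>\<open>multi_iter D k \<alpha>\<close> is \<open>D_(k-1)^\<alpha>_(k-1) \<circ> \<dots> \<circ> D_0^\<alpha>_0\<close>; the families it is used for commute.\<close>

primrec multi_iter :: "(nat \<Rightarrow> 'f \<Rightarrow> 'f) \<Rightarrow> nat \<Rightarrow> (nat \<Rightarrow> nat) \<Rightarrow> 'f \<Rightarrow> 'f" where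
  "multi_iter D 0 \<alpha> f = f"
| "multi_iter D (Suc k) \<alpha> f = (D k ^^ \<alpha> k) (multi_iter D k \<alpha> f)"

text \<open>
  A matrix of operators is represented by its (uniquely determined germs of) matrix coefficients:
  \<open>A \<alpha> \<beta>\<close> is the coefficient of \<open>\<vartheta>^\<alpha> \<partial>_x^\<beta>\<close>.
\<close>

type_synonym 'm oper = "(nat \<Rightarrow> nat) \<Rightarrow> (nat \<Rightarrow> nat) \<Rightarrow> pt \<Rightarrow> complex ^ 'm ^ 'm"

definition supp :: "'m::finite oper \<Rightarrow> ((nat \<Rightarrow> nat) \<times> (nat \<Rightarrow> nat)) set" where
  "supp A = {(\<alpha>, \<beta>). A \<alpha> \<beta> \<noteq> (\<lambda>_. 0)}"

definition UDtilde :: "nat \<Rightarrow> nat \<Rightarrow> nat \<Rightarrow> ((nat \<Rightarrow> real) \<times> (nat \<Rightarrow> real)) set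
    \<Rightarrow> (nat \<Rightarrow> complex) set \<Rightarrow> 'm::finite oper set" where
  "UDtilde n n' l M U = {A. finite (supp A) \<and> supp A \<subseteq> multi_indices n \<times> multi_indices n' \<and>
     (\<forall>\<alpha> \<beta>. near n n' l M U (\<lambda>p. \<forall>i j. analytic_at_pt n n' l (\<lambda>q. A \<alpha> \<beta> q $ i $ j) p))}"

definition UD :: "nat \<Rightarrow> nat \<Rightarrow> nat \<Rightarrow> ((nat \<Rightarrow> real) \<times> (nat \<Rightarrow> real)) set
    \<Rightarrow> (nat \<Rightarrow> complex) set \<Rightarrow> 'm::finite oper set" where
  "UD n n' l M U = {A \<in> UDtilde n n' l M U.
     \<forall>\<alpha> \<beta>. \<beta> \<noteq> (\<lambda>_. 0) \<longrightarrow> (\<forall>x\<in>locus M. \<forall>z\<in>U. A \<alpha> \<beta> (\<lambda>_. 0, x, z) = 0)}"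

definition op_apply :: "nat \<Rightarrow> nat \<Rightarrow> 'm::finite oper \<Rightarrow> (pt \<Rightarrow> complex ^ 'm) \<Rightarrow> pt \<Rightarrow> complex ^ 'm::finite" where
  "op_apply n n' A u p =
     (\<Sum>(\<alpha>, \<beta>)\<in>supp A. A \<alpha> \<beta> p *v multi_iter theta n \<alpha> (multi_iter dx n' \<beta> u) p)"

definition ord_op :: "nat \<Rightarrow> nat \<Rightarrow> nat \<Rightarrow> ((nat \<Rightarrow> real) \<times> (nat \<Rightarrow> real)) set
    \<Rightarrow> (nat \<Rightarrow> complex) set \<Rightarrow> 'm::finite oper \<Rightarrow> nat" where
  "ord_op n n' l M U A =
     Sup {(\<Sum>i<n. \<alpha> i) + (\<Sum>j<n'. \<beta> j) | \<alpha> \<beta>. \<not> near n n' l M U (\<lambda>p. A \<alpha> \<beta> p = 0)}"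

definition sigma_op :: "nat \<Rightarrow> nat \<Rightarrow> 'm::finite oper \<Rightarrow> ((nat \<Rightarrow> complex) \<Rightarrow> nat \<Rightarrow> complex)
    \<Rightarrow> ((nat \<Rightarrow> real) \<times> (nat \<Rightarrow> complex) \<Rightarrow> complex ^ 'm)
    \<Rightarrow> (nat \<Rightarrow> real) \<times> (nat \<Rightarrow> complex) \<Rightarrow> complex ^ 'm::finite" where
  \<comment> \<open>\<open>\<sigma>_*(A)(x, z, \<xi>(z), \<partial>_x) v\<close>\<close>
  "sigma_op n n' A \<xi> v = (\<lambda>(x, z). \<Sum>(\<alpha>, \<beta>)\<in>supp A.
     mpow n (\<xi> z) \<alpha> *s (A \<alpha> \<beta> (\<lambda>_. 0, x, z) *v multi_iter dxN n' \<beta> v (x, z)))"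

definition sigma_mat :: "nat \<Rightarrow> 'm::finite oper \<Rightarrow> (nat \<Rightarrow> real) \<Rightarrow> (nat \<Rightarrow> complex) \<Rightarrow> (nat \<Rightarrow> complex)
    \<Rightarrow> complex ^ 'm ^ 'm" where
  \<comment> \<open>\<open>\<sigma>_*(A)(x, z, \<xi>)\<close> as a matrix, for \<open>A\<close> in \<open>UD\<close>: the terms with \<open>\<beta> \<noteq> 0\<close> vanish on \<open>t = 0\<close>\<close>
  "sigma_mat n A x z \<xi> = (\<chi> i j. \<Sum>\<alpha> | (\<alpha>, \<lambda>_. 0) \<in> supp A.
     A \<alpha> (\<lambda>_. 0) (\<lambda>_. 0, x, z) $ i $ j * mpow n \<xi> \<alpha>)"

definition sigma_bar_mat :: "nat \<Rightarrow> nat \<Rightarrow> nat \<Rightarrow> ((nat \<Rightarrow> real) \<times> (nat \<Rightarrow> real)) set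
    \<Rightarrow> (nat \<Rightarrow> complex) set \<Rightarrow> 'm::finite oper \<Rightarrow> (nat \<Rightarrow> real) \<Rightarrow> (nat \<Rightarrow> complex) \<Rightarrow> (nat \<Rightarrow> complex)
    \<Rightarrow> complex ^ 'm ^ 'm" where
  "sigma_bar_mat n n' l M U A x z \<xi> =
     (\<chi> i j. \<Sum>\<alpha> | (\<alpha>, \<lambda>_. 0) \<in> supp A \<and> (\<Sum>k<n. \<alpha> k) = ord_op n n' l M U A.
        A \<alpha> (\<lambda>_. 0) (\<lambda>_. 0, x, z) $ i $ j * mpow n \<xi> \<alpha>)"


subsection \<open>Solutions and their boundary values\<close>

text \<open>
  For complex exponents \<open>t^\<lambda>\<close> is multivalued; functions \<open>u\<close> with \<open>t^(-\<lambda>) u\<close> analytic near \<open>N\<close> are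
  regarded as functions on the sector \<open>t_i > 0\<close>, where the principal branch is used.
\<close>

definition tpow :: "nat \<Rightarrow> (nat \<Rightarrow> real) \<Rightarrow> (nat \<Rightarrow> complex) \<Rightarrow> complex" where
  "tpow n t a = (\<Prod>i<n. of_real (t i) powr a i)"

definition near_pos :: "nat \<Rightarrow> nat \<Rightarrow> nat \<Rightarrow> ((nat \<Rightarrow> real) \<times> (nat \<Rightarrow> real)) set
    \<Rightarrow> (nat \<Rightarrow> complex) set \<Rightarrow> (pt \<Rightarrow> bool) \<Rightarrow> bool" where
  "near_pos n n' l M U Q \<longleftrightarrow> near n n' l M U (\<lambda>(t, x, z). (\<forall>i<n. t i > 0) \<longrightarrow> Q (t, x, z))"

definition untwist :: "nat \<Rightarrow> ((nat \<Rightarrow> complex) \<Rightarrow> nat \<Rightarrow> complex) \<Rightarrow> (pt \<Rightarrow> complex ^ 'm)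
    \<Rightarrow> pt \<Rightarrow> complex ^ 'm" where
  \<comment> \<open>\<open>t^(-\<lambda>(z)) u\<close>\<close>
  "untwist n lam u = (\<lambda>(t, x, z). tpow n t (\<lambda>i. - lam z i) *s u (t, x, z))"

definition extends_untwist :: "nat \<Rightarrow> nat \<Rightarrow> nat \<Rightarrow> ((nat \<Rightarrow> real) \<times> (nat \<Rightarrow> real)) set
    \<Rightarrow> (nat \<Rightarrow> complex) set \<Rightarrow> ((nat \<Rightarrow> complex) \<Rightarrow> nat \<Rightarrow> complex)
    \<Rightarrow> (pt \<Rightarrow> complex ^ 'm) \<Rightarrow> (pt \<Rightarrow> complex ^ 'm) \<Rightarrow> bool" where
  "extends_untwist n n' l M U lam u w \<longleftrightarrow>
     w \<in> UAM n n' l M U \<and> near_pos n n' l M U (\<lambda>q. w q = untwist n lam u q)"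

definition germ_rel :: "nat \<Rightarrow> nat \<Rightarrow> nat \<Rightarrow> ((nat \<Rightarrow> real) \<times> (nat \<Rightarrow> real)) set
    \<Rightarrow> (nat \<Rightarrow> complex) set \<Rightarrow> ((pt \<Rightarrow> complex ^ 'm) \<times> (pt \<Rightarrow> complex ^ 'm)) set" where
  "germ_rel n n' l M U = {(u, u'). near_pos n n' l M U (\<lambda>q. u q = u' q)}"

definition solutions :: "nat \<Rightarrow> nat \<Rightarrow> nat \<Rightarrow> ((nat \<Rightarrow> real) \<times> (nat \<Rightarrow> real)) set
    \<Rightarrow> (nat \<Rightarrow> complex) set \<Rightarrow> ((nat \<Rightarrow> complex) \<Rightarrow> nat \<Rightarrow> complex) \<Rightarrow> 'm::finite oper \<Rightarrow> nat
    \<Rightarrow> (nat \<Rightarrow> 'm::finite oper) \<Rightarrow> (pt \<Rightarrow> complex ^ 'm::finite) set" where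
  "solutions n n' l M U lam P p Ps = {u.
     (\<exists>w. extends_untwist n n' l M U lam u w) \<and>
     near_pos n n' l M U (\<lambda>q. op_apply n n' P u q = 0) \<and>
     (\<forall>i<p. near_pos n n' l M U (\<lambda>q. op_apply n n' (Ps i) u q = 0))}"

text \<open>All analytic extensions \<open>w\<close> of \<open>t^(-\<lambda>) u\<close> agree on \<open>N \<times> U\<close>, by continuity.\<close>

definition boundary_value :: "nat \<Rightarrow> nat \<Rightarrow> nat \<Rightarrow> ((nat \<Rightarrow> real) \<times> (nat \<Rightarrow> real)) set
    \<Rightarrow> (nat \<Rightarrow> complex) set \<Rightarrow> ((nat \<Rightarrow> complex) \<Rightarrow> nat \<Rightarrow> complex) \<Rightarrow> (pt \<Rightarrow> complex ^ 'm)
    \<Rightarrow> (nat \<Rightarrow> real) \<times> (nat \<Rightarrow> complex) \<Rightarrow> complex ^ 'm" where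
  "boundary_value n n' l M U lam u =
     (\<lambda>(x, z)\<in>locus M \<times> U. (SOME w. extends_untwist n n' l M U lam u w) (\<lambda>_. 0, x, z))"

definition boundary_solutions :: "nat \<Rightarrow> nat \<Rightarrow> nat \<Rightarrow> ((nat \<Rightarrow> real) \<times> (nat \<Rightarrow> real)) set
    \<Rightarrow> (nat \<Rightarrow> complex) set \<Rightarrow> ((nat \<Rightarrow> complex) \<Rightarrow> nat \<Rightarrow> complex) \<Rightarrow> 'm::finite oper \<Rightarrow> nat
    \<Rightarrow> (nat \<Rightarrow> 'm::finite oper) \<Rightarrow> ((nat \<Rightarrow> real) \<times> (nat \<Rightarrow> complex) \<Rightarrow> complex ^ 'm::finite) set" where
  "boundary_solutions n n' l M U lam P p Ps = {v \<in> UAN n' l (locus M) U.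
     \<forall>x\<in>locus M. \<forall>z\<in>U. sigma_mat n P x z (lam z) *v v (x, z) = 0 \<and>
       (\<forall>i<p. sigma_op n n' (Ps i) lam v (x, z) = 0)}"

definition admissible :: "nat \<Rightarrow> nat \<Rightarrow> nat \<Rightarrow> ((nat \<Rightarrow> real) \<times> (nat \<Rightarrow> real)) set
    \<Rightarrow> (nat \<Rightarrow> complex) set \<Rightarrow> (nat \<Rightarrow> real) \<Rightarrow> (nat \<Rightarrow> complex) \<Rightarrow> bool" where
  "admissible n n' l M U x0 z0 \<longleftrightarrow>
     openin (prod_topology (Euclidean_space n) (Euclidean_space n')) M \<and>
     connectedin (prod_topology (Euclidean_space n) (Euclidean_space n')) M \<and>
     connectedin (Euclidean_space n') (locus M) \<and> x0 \<in> locus M \<and>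
     openin (Complex_space l) U \<and> connectedin (Complex_space l) U \<and> z0 \<in> U"

end

(*
  Conjugating by t^lambda turns the system into one for w = t^(-lambda) u, and everything is reduced to
  power series at the points of N x U. The coefficient of t^gamma x^beta z^delta in the conjugated
  equation for P is sigma_*(P)(x, z, lambda + gamma) applied to the same coefficient of w, up to
  coefficients of lower weight, where t_i has a large weight s and x_j, z_k have weight 1: d/dx_j lowers
  the weight by one only, and it comes with a factor vanishing on t = 0. As the matrices
  sigma_*(P)(x, z, lambda + gamma) are invertible for gamma <> 0, with a bound of order |gamma|^(ord P)
  from the condition on the principal symbol, the boundary value determines w, and a formal solution
  exists; it converges because the remainder is contracting for a suitable weighted norm.
  Local solutions agree on overlaps by uniqueness and so glue to a solution near N x U.
  For the further equations, g_i = P_i u satisfies P g_i = sum_j T_ij g_j and has boundary value zero,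
  and since sigma_*(T_ij) = 0 the uniqueness argument still gives g_i = 0. The commutator relation is
  given for analytic functions; it passes to the conjugated operators since it is polynomial in lambda
  and holds for the functions t^k w with k a multi-index.
*)
theory Submission
  imports Defs "HOL-Library.Poly_Mapping"
begin

datatype var = Tv nat | Xv nat | Zv nat

type_synonym mindex = "var \<Rightarrow>\<^sub>0 nat"

abbreviation lookup :: "mindex \<Rightarrow> var \<Rightarrow> nat" where
  "lookup \<equiv> Poly_Mapping.lookup"

abbreviation keys :: "mindex \<Rightarrow> var set" where
  "keys \<equiv> Poly_Mapping.keys"

definition unit_index :: "var \<Rightarrow> mindex" where
  "unit_index v = Poly_Mapping.single v 1"

lemma lookup_unit_index: "lookup (unit_index v) u = (if u = v then 1 else 0)"
  by (auto simp: unit_index_def lookup_single)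

lemma lookup_unit_index_same [simp]: "lookup (unit_index v) v = 1"
  by (simp add: lookup_unit_index)

lemma keys_unit_index [simp]: "keys (unit_index v) = {v}"
  by (simp add: unit_index_def)

definition splits :: "mindex \<Rightarrow> (mindex \<times> mindex) set" where
  "splits \<kappa> = {(a, b). a + b = \<kappa>}"

lemma finite_splits [simp]: "finite (splits \<kappa>)"
proof -
  have "inj_on (\<lambda>(a, b). lookup a) (splits \<kappa>)"
    by (auto simp: inj_on_def splits_def poly_mapping_eq_iff[symmetric])
  moreover have "(\<lambda>(a, b). lookup a) ` splits \<kappa> \<subseteq>
      (\<lambda>g v. if v \<in> keys \<kappa> then g v else 0) ` (keys \<kappa> \<rightarrow>\<^sub>E {..Max (insert 0 (lookup \<kappa> ` keys \<kappa>))})"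
  proof clarsimp
    fix a b :: mindex
    assume ab: "(a, b) \<in> splits \<kappa>"
    have le: "lookup a v \<le> lookup \<kappa> v" for v
      using ab by (auto simp: splits_def lookup_add)
    have "lookup a = (\<lambda>v. if v \<in> keys \<kappa> then restrict (lookup a) (keys \<kappa>) v else 0)"
      using le by (auto simp: fun_eq_iff in_keys_iff) (metis le_zero_eq)
    moreover have "restrict (lookup a) (keys \<kappa>) \<in> keys \<kappa> \<rightarrow>\<^sub>E {..Max (insert 0 (lookup \<kappa> ` keys \<kappa>))}"
      using le by (auto intro!: order.trans[OF le] Max_ge)
    ultimately show "lookup a \<in> (\<lambda>g v. if v \<in> keys \<kappa> then g v else 0) `
        (keys \<kappa> \<rightarrow>\<^sub>E {..Max (insert 0 (lookup \<kappa> ` keys \<kappa>))})"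
      by blast
  qed
  moreover have "finite ((\<lambda>g v. if v \<in> keys \<kappa> then g v else (0::nat)) `
        (keys \<kappa> \<rightarrow>\<^sub>E {..Max (insert 0 (lookup \<kappa> ` keys \<kappa>))}))"
    by (intro finite_imageI finite_PiE) auto
  ultimately show ?thesis
    by (meson finite_imageD finite_subset)
qed

lemma mindex_add_eq_0_iff: "(a::mindex) + b = 0 \<longleftrightarrow> a = 0 \<and> b = 0"
  by (auto simp: poly_mapping_eq_iff fun_eq_iff lookup_add)

lemma splits_0 [simp]: "splits 0 = {(0, 0)}"
  by (auto simp: splits_def mindex_add_eq_0_iff)

lemma sum_splits_left: "(\<Sum>(a, b)\<in>splits (c + \<kappa>). if a = c then h b else 0) = (h \<kappa> :: 'a::comm_monoid_add)"
proof -
  have "(\<Sum>(a, b)\<in>splits (c + \<kappa>). if a = c then h b else 0) = (\<Sum>(a, b)\<in>{(c, \<kappa>)}. if a = c then h b else 0)"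
    by (rule sum.mono_neutral_right[OF finite_splits]) (auto simp: splits_def split: if_splits)
  then show ?thesis by simp
qed

lemma unit_index_neq_0 [simp]: "unit_index v \<noteq> 0"
  by (metis lookup_unit_index_same lookup_zero zero_neq_one)

subsection \<open>The ring of formal power series\<close>

typedef mps = "UNIV :: (mindex \<Rightarrow> complex) set" morphisms cf Mps
  by simp

lemma cf_Mps [simp]: "cf (Mps f) = f"
  by (simp add: Mps_inverse)

lemma mps_eqI: "(\<And>\<kappa>. cf f \<kappa> = cf g \<kappa>) \<Longrightarrow> f = g"
  by (metis cf_inject ext)

instantiation mps :: comm_ring_1
begin

definition "0 = Mps (\<lambda>_. 0)"
definition "1 = Mps (\<lambda>\<kappa>. if \<kappa> = 0 then 1 else 0)"
definition "f + g = Mps (\<lambda>\<kappa>. cf f \<kappa> + cf g \<kappa>)"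
definition "f - g = Mps (\<lambda>\<kappa>. cf f \<kappa> - cf g \<kappa>)"
definition "- f = Mps (\<lambda>\<kappa>. - cf f \<kappa>)"
definition "f * g = Mps (\<lambda>\<kappa>. \<Sum>(a, b)\<in>splits \<kappa>. cf f a * cf g b)"

lemma cf_mult: "cf (f * g) \<kappa> = (\<Sum>(a, b)\<in>splits \<kappa>. cf f a * cf g b)"
  by (simp add: times_mps_def)

instance
proof
  fix f g h :: mps
  show "f + g + h = f + (g + h)" "f + g = g + f" "0 + f = f" "- f + f = 0" "f - g = f + - g"
    by (simp_all add: plus_mps_def zero_mps_def uminus_mps_def minus_mps_def add_ac cf_inverse)
  show "(0::mps) \<noteq> 1"
  proof
    assume "(0::mps) = 1"
    then have "cf 0 0 = cf 1 0" by simp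
    then show False by (simp add: zero_mps_def one_mps_def)
  qed
  show "1 * f = f"
  proof (rule mps_eqI)
    fix \<kappa>
    have "cf (1 * f) \<kappa> = (\<Sum>(a, b)\<in>splits (0 + \<kappa>). if a = 0 then cf f b else 0)"
      unfolding cf_mult by (intro sum.cong) (auto simp: one_mps_def)
    also have "\<dots> = cf f \<kappa>"
      by (rule sum_splits_left)
    finally show "cf (1 * f) \<kappa> = cf f \<kappa>" .
  qed
  show "f * g = g * f"
  proof (rule mps_eqI)
    fix \<kappa>
    show "cf (f * g) \<kappa> = cf (g * f) \<kappa>"
      unfolding cf_mult
      by (rule sum.reindex_bij_witness[of _ prod.swap prod.swap])
        (auto simp: splits_def add.commute)
  qed
  show "(f + g) * h = f * h + g * h"
    by (rule mps_eqI)
      (simp add: cf_mult plus_mps_def sum.distrib[symmetric] algebra_simps case_prod_unfold)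
  show "f * g * h = f * (g * h)"
  proof (rule mps_eqI)
    fix \<kappa>
    let ?S = "SIGMA (a, b) : splits \<kappa>. splits a" and ?S' = "SIGMA (a, b) : splits \<kappa>. splits b"
    have "cf (f * g * h) \<kappa> = (\<Sum>((a, b), (c, d))\<in>?S. cf f c * cf g d * cf h b)"
      unfolding cf_mult
      by (simp add: sum_distrib_right case_prod_unfold sum.Sigma)
    also have "\<dots> = (\<Sum>((a, b), (c, d))\<in>?S'. cf f a * (cf g c * cf h d))"
      by (rule sum.reindex_bij_witness[of _ "\<lambda>((a, b), (c, d)). ((a + c, d), (a, c))"
            "\<lambda>((a, b), (c, d)). ((c, d + b), (d, b))"])
        (auto simp: splits_def add_ac)
    also have "\<dots> = cf (f * (g * h)) \<kappa>"
      unfolding cf_mult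
      by (simp add: sum_distrib_left case_prod_unfold sum.Sigma)
    finally show "cf (f * g * h) \<kappa> = cf (f * (g * h)) \<kappa>" .
  qed
qed

end

lemma cf_add [simp]: "cf (f + g) \<kappa> = cf f \<kappa> + cf g \<kappa>"
  and cf_diff [simp]: "cf (f - g) \<kappa> = cf f \<kappa> - cf g \<kappa>"
  and cf_minus [simp]: "cf (- f) \<kappa> = - cf f \<kappa>"
  and cf_0 [simp]: "cf 0 \<kappa> = 0"
  and cf_1: "cf 1 \<kappa> = (if \<kappa> = 0 then 1 else 0)"
  by (simp_all add: plus_mps_def minus_mps_def uminus_mps_def zero_mps_def one_mps_def)

lemma cf_sum [simp]: "cf (sum f A) \<kappa> = (\<Sum>a\<in>A. cf (f a) \<kappa>)"
  by (induction A rule: infinite_finite_induct) auto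

definition cst :: "complex \<Rightarrow> mps" where
  "cst a = Mps (\<lambda>\<kappa>. if \<kappa> = 0 then a else 0)"

definition mvar :: "var \<Rightarrow> mps" where
  "mvar v = Mps (\<lambda>\<kappa>. if \<kappa> = unit_index v then 1 else 0)"

lemma cf_cst: "cf (cst a) \<kappa> = (if \<kappa> = 0 then a else 0)"
  by (simp add: cst_def)

lemma cf_mvar: "cf (mvar v) \<kappa> = (if \<kappa> = unit_index v then 1 else 0)"
  by (simp add: mvar_def)

lemma cf_cst_mult [simp]: "cf (cst a * f) \<kappa> = a * cf f \<kappa>"
proof -
  have "cf (cst a * f) \<kappa> = (\<Sum>(c, b)\<in>splits (0 + \<kappa>). if c = 0 then a * cf f b else 0)"
    unfolding cf_mult by (intro sum.cong) (auto simp: cf_cst)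
  also have "\<dots> = a * cf f \<kappa>"
    by (rule sum_splits_left)
  finally show ?thesis .
qed

lemma cst_0 [simp]: "cst 0 = 0" and cst_1 [simp]: "cst 1 = 1"
  by (auto intro!: mps_eqI simp: cf_cst cf_1)

lemma cst_add: "cst (a + b) = cst a + cst b"
  and cst_mult: "cst (a * b) = cst a * cst b"
  by (auto intro!: mps_eqI simp: cf_cst)

lemma of_nat_mps: "of_nat k = cst (of_nat k)"
  by (induction k) (auto simp: cst_add)

lemma cf_of_nat_mult: "cf (of_nat k * f) \<kappa> = of_nat k * cf f \<kappa>"
  by (simp add: of_nat_mps)

lemma cf_mvar_mult_shift [simp]: "cf (mvar v * f) (\<kappa> + unit_index v) = cf f \<kappa>"
proof -
  have "cf (mvar v * f) (\<kappa> + unit_index v) =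
      (\<Sum>(c, b)\<in>splits (unit_index v + \<kappa>). if c = unit_index v then cf f b else 0)"
    unfolding cf_mult by (intro sum.cong) (auto simp: cf_mvar add.commute)
  also have "\<dots> = cf f \<kappa>"
    by (rule sum_splits_left)
  finally show ?thesis .
qed

lemma mindex_remove:
  fixes \<kappa> :: mindex
  assumes "lookup \<kappa> v \<noteq> 0"
  shows "\<exists>\<mu>. \<kappa> = \<mu> + unit_index v"
  using assms
  by (intro exI[of _ "\<kappa> - unit_index v"])
     (auto simp: poly_mapping_eq_iff fun_eq_iff lookup_add lookup_minus lookup_unit_index)

lemma cf_mvar_mult_0:
  assumes "lookup \<kappa> v = 0"
  shows "cf (mvar v * f) \<kappa> = 0"
  unfolding cf_mult
proof (intro sum.neutral ballI)
  fix ab assume "ab \<in> splits \<kappa>"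
  then have "lookup (fst ab) v = 0"
    using assms by (auto simp: splits_def lookup_add)
  then have "fst ab \<noteq> unit_index v"
    by auto
  then show "(case ab of (a, b) \<Rightarrow> cf (mvar v) a * cf f b) = 0"
    by (auto simp: cf_mvar case_prod_unfold)
qed

lemma mvar_mult_cancel: "mvar v * f = mvar v * g \<Longrightarrow> f = g"
  by (metis cf_mvar_mult_shift mps_eqI)

lemma mvar_power_mult_cancel: "mvar v ^ k * f = 0 \<Longrightarrow> f = 0"
  by (induction k) (auto simp: mult.assoc dest!: mvar_mult_cancel[of v _ 0, simplified])

definition eul :: "var \<Rightarrow> mps \<Rightarrow> mps" where
  "eul v f = Mps (\<lambda>\<kappa>. of_nat (lookup \<kappa> v) * cf f \<kappa>)"

definition D :: "var \<Rightarrow> mps \<Rightarrow> mps" where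
  "D v f = Mps (\<lambda>\<kappa>. of_nat (lookup \<kappa> v + 1) * cf f (\<kappa> + unit_index v))"

lemma cf_eul [simp]: "cf (eul v f) \<kappa> = of_nat (lookup \<kappa> v) * cf f \<kappa>"
  by (simp add: eul_def)

lemma cf_D: "cf (D v f) \<kappa> = of_nat (lookup \<kappa> v + 1) * cf f (\<kappa> + unit_index v)"
  by (simp add: D_def)

lemma eul_linear: "eul v (f + g) = eul v f + eul v g" "eul v 0 = 0" "eul v (f - g) = eul v f - eul v g"
  by (auto intro!: mps_eqI simp: algebra_simps)

lemma D_linear: "D v (f + g) = D v f + D v g" "D v 0 = 0" "D v (f - g) = D v f - D v g"
  by (auto intro!: mps_eqI simp: algebra_simps cf_D)

lemma mvar_mult_D: "mvar v * D v f = eul v f"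
proof (rule mps_eqI)
  fix \<kappa>
  show "cf (mvar v * D v f) \<kappa> = cf (eul v f) \<kappa>"
  proof (cases "lookup \<kappa> v = 0")
    case True
    then show ?thesis by (simp add: cf_mvar_mult_0)
  next
    case False
    then obtain \<mu> where "\<kappa> = \<mu> + unit_index v"
      using mindex_remove by blast
    then show ?thesis
      by (simp only: cf_mvar_mult_shift) (simp add: cf_D lookup_add)
  qed
qed

lemma eul_mult: "eul v (f * g) = eul v f * g + f * eul v g"
proof (rule mps_eqI)
  fix \<kappa>
  show "cf (eul v (f * g)) \<kappa> = cf (eul v f * g + f * eul v g) \<kappa>"
    unfolding cf_mult cf_eul cf_add sum_distrib_left sum.distrib[symmetric]
    by (rule sum.cong) (auto simp: splits_def lookup_add algebra_simps)
qed

lemma D_mult: "D v (f * g) = D v f * g + f * D v g"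
proof (rule mvar_mult_cancel[of v])
  have "mvar v * D v (f * g) = eul v f * g + f * eul v g"
    by (simp add: mvar_mult_D eul_mult)
  also have "\<dots> = mvar v * (D v f * g + f * D v g)"
    unfolding mvar_mult_D[symmetric] by (simp add: algebra_simps)
  finally show "mvar v * D v (f * g) = mvar v * (D v f * g + f * D v g)" .
qed

lemma eul_mvar: "eul v (mvar u) = (if u = v then mvar u else 0)"
  by (rule mps_eqI) (auto simp: cf_mvar lookup_unit_index)

lemma D_mvar: "D v (mvar u) = (if u = v then 1 else 0)"
  by (rule mvar_mult_cancel[of v]) (simp add: mvar_mult_D eul_mvar)

lemma eul_cst [simp]: "eul v (cst a) = 0"
  by (rule mps_eqI) (simp add: cf_cst)

lemma D_cst [simp]: "D v (cst a) = 0"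
  by (rule mvar_mult_cancel[of v]) (simp add: mvar_mult_D)

subsection \<open>Degrees and monomials\<close>

definition wdeg :: "(var \<Rightarrow> nat) \<Rightarrow> mindex \<Rightarrow> nat" where
  "wdeg c \<kappa> = (\<Sum>v\<in>keys \<kappa>. c v * lookup \<kappa> v)"

lemma wdeg_superset: "finite A \<Longrightarrow> keys \<kappa> \<subseteq> A \<Longrightarrow> wdeg c \<kappa> = (\<Sum>v\<in>A. c v * lookup \<kappa> v)"
  unfolding wdeg_def by (rule sum.mono_neutral_left) (auto simp: in_keys_iff)

lemma wdeg_add [simp]: "wdeg c (a + b) = wdeg c a + wdeg c b"
proof -
  let ?A = "keys a \<union> keys b"
  have "keys (a + b) \<subseteq> ?A"
    by (rule Poly_Mapping.keys_add)
  then have "wdeg c (a + b) = (\<Sum>v\<in>?A. c v * lookup (a + b) v)"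
    by (rule wdeg_superset[rotated]) simp_all
  also have "\<dots> = (\<Sum>v\<in>?A. c v * lookup a v) + (\<Sum>v\<in>?A. c v * lookup b v)"
    by (simp add: lookup_add sum.distrib distrib_left)
  also have "\<dots> = wdeg c a + wdeg c b"
    using wdeg_superset[of ?A a c] wdeg_superset[of ?A b c] by simp
  finally show ?thesis .
qed

lemma wdeg_0 [simp]: "wdeg c 0 = 0"
  by (simp add: wdeg_def)

lemma wdeg_unit_index [simp]: "wdeg c (unit_index v) = c v"
  by (simp add: wdeg_def)

definition mon :: "mindex \<Rightarrow> (var \<Rightarrow> 'a) \<Rightarrow> 'a::comm_monoid_mult" where
  "mon \<kappa> \<zeta> = (\<Prod>v\<in>keys \<kappa>. \<zeta> v ^ lookup \<kappa> v)"

lemma mon_superset: "finite A \<Longrightarrow> keys \<kappa> \<subseteq> A \<Longrightarrow> mon \<kappa> \<zeta> = (\<Prod>v\<in>A. \<zeta> v ^ lookup \<kappa> v)"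
  unfolding mon_def by (rule prod.mono_neutral_left) (auto simp: in_keys_iff)

lemma mon_add: "mon (a + b) \<zeta> = mon a \<zeta> * mon b \<zeta>"
proof -
  let ?A = "keys a \<union> keys b"
  have "keys (a + b) \<subseteq> ?A"
    by (rule Poly_Mapping.keys_add)
  then have "mon (a + b) \<zeta> = (\<Prod>v\<in>?A. \<zeta> v ^ lookup (a + b) v)"
    by (rule mon_superset[rotated]) simp_all
  also have "\<dots> = (\<Prod>v\<in>?A. \<zeta> v ^ lookup a v) * (\<Prod>v\<in>?A. \<zeta> v ^ lookup b v)"
    by (simp add: lookup_add prod.distrib power_add)
  also have "\<dots> = mon a \<zeta> * mon b \<zeta>"
    using mon_superset[of ?A a \<zeta>] mon_superset[of ?A b \<zeta>] by simp
  finally show ?thesis .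
qed

lemma mon_0 [simp]: "mon 0 \<zeta> = 1"
  by (simp add: mon_def)

lemma mon_unit_index [simp]: "mon (unit_index v) \<zeta> = \<zeta> v"
  by (simp add: mon_def)

lemma mon_at_0: "mon \<kappa> (\<lambda>_. 0) = (if \<kappa> = 0 then 1 else (0::'a::{comm_semiring_1,semiring_no_zero_divisors}))"
proof (cases "\<kappa> = 0")
  case False
  then obtain v where "lookup \<kappa> v \<noteq> 0"
    by (auto simp: poly_mapping_eq_iff fun_eq_iff)
  then have "mon \<kappa> (\<lambda>_. 0::'a) = 0"
    unfolding mon_def by (intro prod_zero) (auto simp: in_keys_iff zero_power intro!: bexI[of _ v])
  then show ?thesis using False by simp
qed auto

lemma norm_mon: "norm (mon \<kappa> \<zeta> :: complex) = mon \<kappa> (\<lambda>v. norm (\<zeta> v))"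
  by (simp add: mon_def prod_norm norm_power[symmetric])

lemma mon_nonneg: "(\<And>v. 0 \<le> s v) \<Longrightarrow> 0 \<le> mon \<kappa> (s :: var \<Rightarrow> real)"
  by (auto simp: mon_def intro!: prod_nonneg)

lemma mon_const: "mon \<kappa> (\<lambda>_. s) = (s::'a::comm_semiring_1) ^ wdeg (\<lambda>_. 1) \<kappa>"
  by (simp add: mon_def wdeg_def power_sum)

lemma mindex_induct [case_names zero add]:
  fixes \<kappa> :: mindex
  assumes "P 0" "\<And>\<kappa> v. P \<kappa> \<Longrightarrow> P (\<kappa> + unit_index v)"
  shows "P \<kappa>"
proof (induction "wdeg (\<lambda>_. 1) \<kappa>" arbitrary: \<kappa>)
  case 0
  then have "lookup \<kappa> v = 0" for v
    by (auto simp: wdeg_def in_keys_iff)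
  then have "\<kappa> = 0"
    by (simp add: poly_mapping_eq_iff fun_eq_iff)
  then show ?case using assms(1) by simp
next
  case (Suc k)
  then have "\<kappa> \<noteq> 0"
    by auto
  then obtain v where "lookup \<kappa> v \<noteq> 0"
    by (auto simp: poly_mapping_eq_iff fun_eq_iff)
  then obtain \<mu> where \<mu>: "\<kappa> = \<mu> + unit_index v"
    using mindex_remove by blast
  then have "P \<mu>"
    using Suc by auto
  then show ?case using assms(2) \<mu> by simp
qed

no_notation Infinite_Set_Sum.abs_summable_on (infix "abs'_summable'_on" 50)

subsection \<open>Weighted norms and sums of power series\<close>

definition bd :: "(mindex \<Rightarrow> real) \<Rightarrow> mps \<Rightarrow> real \<Rightarrow> bool" where
  "bd \<omega> f B \<longleftrightarrow> (\<forall>F. finite F \<longrightarrow> (\<Sum>\<kappa>\<in>F. cmod (cf f \<kappa>) * \<omega> \<kappa>) \<le> B)"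

lemma bdI: "(\<And>F. finite F \<Longrightarrow> (\<Sum>\<kappa>\<in>F. cmod (cf f \<kappa>) * \<omega> \<kappa>) \<le> B) \<Longrightarrow> bd \<omega> f B"
  by (simp add: bd_def)

lemma bdD: "bd \<omega> f B \<Longrightarrow> finite F \<Longrightarrow> (\<Sum>\<kappa>\<in>F. cmod (cf f \<kappa>) * \<omega> \<kappa>) \<le> B"
  by (simp add: bd_def)

lemma bd_nonneg: "bd \<omega> f B \<Longrightarrow> 0 \<le> B"
  using bdD[of \<omega> f B "{}"] by simp

lemma bd_le: "bd \<omega> f B \<Longrightarrow> B \<le> B' \<Longrightarrow> bd \<omega> f B'"
  unfolding bd_def by (meson order_trans)

lemma bd_mono:
  assumes "bd \<omega> f B" "\<And>\<kappa>. cf g \<kappa> \<noteq> 0 \<Longrightarrow> cmod (cf g \<kappa>) * \<omega>' \<kappa> \<le> cmod (cf f \<kappa>) * \<omega> \<kappa>"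
    "\<And>\<kappa>. 0 \<le> \<omega> \<kappa>"
  shows "bd \<omega>' g B"
proof (rule bdI)
  fix F :: "mindex set" assume F: "finite F"
  have "(\<Sum>\<kappa>\<in>F. cmod (cf g \<kappa>) * \<omega>' \<kappa>) \<le> (\<Sum>\<kappa>\<in>F. cmod (cf f \<kappa>) * \<omega> \<kappa>)"
    by (intro sum_mono) (metis assms(2,3) mult_nonneg_nonneg mult_zero_left norm_ge_zero norm_zero)
  then show "(\<Sum>\<kappa>\<in>F. cmod (cf g \<kappa>) * \<omega>' \<kappa>) \<le> B"
    using bdD[OF assms(1) F] by linarith
qed

lemma bd_0 [simp]: "bd \<omega> 0 B \<longleftrightarrow> 0 \<le> B"
  by (auto simp: bd_def)

lemma bd_add:
  assumes "bd \<omega> f A" "bd \<omega> g B" "\<And>\<kappa>. 0 \<le> \<omega> \<kappa>"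
  shows "bd \<omega> (f + g) (A + B)"
proof (rule bdI)
  fix F :: "mindex set" assume F: "finite F"
  have "(\<Sum>\<kappa>\<in>F. cmod (cf (f + g) \<kappa>) * \<omega> \<kappa>) \<le> (\<Sum>\<kappa>\<in>F. cmod (cf f \<kappa>) * \<omega> \<kappa> + cmod (cf g \<kappa>) * \<omega> \<kappa>)"
    using assms(3)
    by (intro sum_mono) (auto simp flip: distrib_right intro!: mult_right_mono norm_triangle_ineq)
  also have "\<dots> \<le> A + B"
    using bdD[OF assms(1) F] bdD[OF assms(2) F] by (simp add: sum.distrib)
  finally show "(\<Sum>\<kappa>\<in>F. cmod (cf (f + g) \<kappa>) * \<omega> \<kappa>) \<le> A + B" .
qed

lemma bd_uminus [simp]: "bd \<omega> (- f) B = bd \<omega> f B"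
  by (simp add: bd_def)

lemma bd_sum:
  assumes "\<And>i. i \<in> I \<Longrightarrow> bd \<omega> (f i) (A i)" "\<And>\<kappa>. 0 \<le> \<omega> \<kappa>"
  shows "bd \<omega> (sum f I) (sum A I)"
  using assms(1) by (induction I rule: infinite_finite_induct) (auto intro!: bd_add assms(2))

lemma bd_mult:
  assumes f: "bd \<omega>1 f A" and g: "bd \<omega>2 g B"
    and nonneg: "\<And>\<kappa>. 0 \<le> \<omega>1 \<kappa>" "\<And>\<kappa>. 0 \<le> \<omega>2 \<kappa>" "\<And>\<kappa>. 0 \<le> \<omega> \<kappa>"
    and le: "\<And>a b. cf f a \<noteq> 0 \<Longrightarrow> cf g b \<noteq> 0 \<Longrightarrow> \<omega> (a + b) \<le> \<omega>1 a * \<omega>2 b"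
  shows "bd \<omega> (f * g) (A * B)"
proof (rule bdI)
  fix F :: "mindex set" assume F: "finite F"
  let ?h = "\<lambda>(a, b). (cmod (cf f a) * \<omega>1 a) * (cmod (cf g b) * \<omega>2 b)"
  let ?G = "\<Union>\<kappa>\<in>F. splits \<kappa>"
  have G: "finite ?G" using F by auto
  have h_nonneg: "0 \<le> ?h p" for p
    using nonneg by (auto simp: case_prod_unfold)
  have "cmod (cf (f * g) \<kappa>) * \<omega> \<kappa> \<le> (\<Sum>p\<in>splits \<kappa>. ?h p)" for \<kappa>
  proof -
    have "cmod (cf (f * g) \<kappa>) * \<omega> \<kappa> \<le> (\<Sum>(a, b)\<in>splits \<kappa>. cmod (cf f a) * cmod (cf g b)) * \<omega> \<kappa>"
      unfolding cf_mult using nonneg(3)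
      by (intro mult_right_mono sum_norm_le) (auto simp: norm_mult)
    also have "\<dots> = (\<Sum>(a, b)\<in>splits \<kappa>. cmod (cf f a) * cmod (cf g b) * \<omega> \<kappa>)"
      by (simp add: sum_distrib_right case_prod_unfold)
    also have "\<dots> \<le> (\<Sum>p\<in>splits \<kappa>. ?h p)"
    proof (intro sum_mono, clarsimp)
      fix a b assume "(a, b) \<in> splits \<kappa>"
      then have \<kappa>: "\<kappa> = a + b" by (simp add: splits_def)
      have "cmod (cf f a) * cmod (cf g b) * \<omega> \<kappa> \<le> cmod (cf f a) * cmod (cf g b) * (\<omega>1 a * \<omega>2 b)"
      proof (cases "cf f a = 0 \<or> cf g b = 0")
        case False
        then show ?thesis
          using le[of a b] unfolding \<kappa> by (intro mult_left_mono) auto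
      qed auto
      then show "cmod (cf f a) * cmod (cf g b) * \<omega> \<kappa> \<le> cmod (cf f a) * \<omega>1 a * (cmod (cf g b) * \<omega>2 b)"
        by (simp add: mult_ac)
    qed
    finally show ?thesis .
  qed
  then have "(\<Sum>\<kappa>\<in>F. cmod (cf (f * g) \<kappa>) * \<omega> \<kappa>) \<le> (\<Sum>\<kappa>\<in>F. \<Sum>p\<in>splits \<kappa>. ?h p)"
    by (intro sum_mono)
  also have "\<dots> = (\<Sum>p\<in>?G. ?h p)"
  proof (rule sum.UNION_disjoint[symmetric])
    show "\<forall>i\<in>F. \<forall>j\<in>F. i \<noteq> j \<longrightarrow> splits i \<inter> splits j = {}"
      by (auto simp: splits_def)
  qed (use F in simp_all)
  also have "\<dots> \<le> (\<Sum>p\<in>fst ` ?G \<times> snd ` ?G. ?h p)"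
    using G h_nonneg by (intro sum_mono2) (auto intro: rev_image_eqI)
  also have "\<dots> = (\<Sum>a\<in>fst ` ?G. cmod (cf f a) * \<omega>1 a) * (\<Sum>b\<in>snd ` ?G. cmod (cf g b) * \<omega>2 b)"
    by (simp add: sum_product sum.cartesian_product)
  also have "\<dots> \<le> A * B"
    using bdD[OF f] bdD[OF g] G bd_nonneg[OF f] nonneg
    by (intro mult_mono) (auto intro!: sum_nonneg)
  finally show "(\<Sum>\<kappa>\<in>F. cmod (cf (f * g) \<kappa>) * \<omega> \<kappa>) \<le> A * B" .
qed

lemma bd_coeff: "bd \<omega> f B \<Longrightarrow> cmod (cf f \<kappa>) * \<omega> \<kappa> \<le> B"
  using bdD[of \<omega> f B "{\<kappa>}"] by simp

definition hs :: "mps \<Rightarrow> (var \<Rightarrow> complex) \<Rightarrow> complex \<Rightarrow> bool" where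
  "hs f \<zeta> y \<longleftrightarrow> ((\<lambda>\<kappa>. cf f \<kappa> * mon \<kappa> \<zeta>) has_sum y) UNIV"

abbreviation mon_abs :: "(var \<Rightarrow> complex) \<Rightarrow> mindex \<Rightarrow> real" where
  "mon_abs \<zeta> \<kappa> \<equiv> mon \<kappa> (\<lambda>v. cmod (\<zeta> v))"

lemma mon_abs_nonneg: "0 \<le> mon_abs \<zeta> \<kappa>"
  by (simp add: mon_nonneg)

lemma hs_unique: "hs f \<zeta> y \<Longrightarrow> hs f \<zeta> y' \<Longrightarrow> y = y'"
  unfolding hs_def by (rule has_sum_unique)

lemma hs_imp_bd:
  assumes "hs f \<zeta> y"
  shows "\<exists>B. bd (mon_abs \<zeta>) f B"
proof -
  have "(\<lambda>\<kappa>. cf f \<kappa> * mon \<kappa> \<zeta>) abs_summable_on UNIV"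
    using assms by (auto simp: hs_def has_sum_imp_summable simp flip: summable_on_iff_abs_summable_on_complex)
  then have "bdd_above (sum (\<lambda>\<kappa>. norm (cf f \<kappa> * mon \<kappa> \<zeta>)) ` {F. F \<subseteq> UNIV \<and> finite F})"
    by (simp only: abs_summable_iff_bdd_above)
  then show ?thesis
    by (auto simp: bdd_above_def bd_def norm_mult norm_mon)
qed

lemma bd_abs_summable:
  assumes "bd (mon_abs \<zeta>) f B"
  shows "(\<lambda>\<kappa>. cf f \<kappa> * mon \<kappa> \<zeta>) abs_summable_on UNIV"
  unfolding abs_summable_iff_bdd_above
  by (rule bdd_aboveI2[of _ _ B]) (use assms in \<open>auto simp: bd_def norm_mult norm_mon\<close>)

lemma bd_imp_hs:
  assumes "bd (mon_abs \<zeta>) f B"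
  shows "hs f \<zeta> (infsum (\<lambda>\<kappa>. cf f \<kappa> * mon \<kappa> \<zeta>) UNIV)"
  unfolding hs_def
  by (rule has_sum_infsum) (simp add: bd_abs_summable[OF assms] abs_summable_summable)

lemma hs_add: "hs f \<zeta> y \<Longrightarrow> hs g \<zeta> y' \<Longrightarrow> hs (f + g) \<zeta> (y + y')"
  unfolding hs_def by (auto simp: distrib_right intro: has_sum_add)

lemma hs_uminus: "hs f \<zeta> y \<Longrightarrow> hs (- f) \<zeta> (- y)"
  unfolding hs_def by (auto simp: has_sum_uminus)

lemma hs_diff: "hs f \<zeta> y \<Longrightarrow> hs g \<zeta> y' \<Longrightarrow> hs (f - g) \<zeta> (y - y')"
  using hs_add[of f \<zeta> y "- g" "- y'"] by (simp add: hs_uminus)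

lemma hs_single_term:
  assumes "\<And>\<mu>. \<mu> \<noteq> \<kappa> \<Longrightarrow> cf f \<mu> * mon \<mu> \<zeta> = 0"
  shows "hs f \<zeta> (cf f \<kappa> * mon \<kappa> \<zeta>)"
  unfolding hs_def by (rule has_sum_finite_neutralI[of "{\<kappa>}"]) (use assms in auto)

lemma hs_cst: "hs (cst a) \<zeta> a"
  using hs_single_term[of 0 "cst a"] by (simp add: cf_cst)

lemma hs_mvar: "hs (mvar v) \<zeta> (\<zeta> v)"
  using hs_single_term[of "unit_index v" "mvar v"] by (simp add: cf_mvar)

lemma hs_at_0: "hs f (\<lambda>_. 0) (cf f 0)"
  using hs_single_term[of 0 f "\<lambda>_. 0"] by (simp add: mon_at_0)

lemma abs_summable_on_pairs:
  fixes g :: "'a \<Rightarrow> 'b \<Rightarrow> complex"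
  assumes "\<And>x. (g x) abs_summable_on UNIV" "\<And>x. infsum (\<lambda>y. norm (g x y)) UNIV \<le> h x" "h summable_on UNIV"
  shows "(\<lambda>(x, y). g x y) abs_summable_on (UNIV \<times> UNIV)"
proof (rule iffD2[OF Infinite_Sum.abs_summable_on_Sigma_iff], intro conjI ballI)
  fix x
  show "(\<lambda>y. norm (case (x, y) of (x, y) \<Rightarrow> g x y)) summable_on UNIV"
    using assms(1) by simp
  have "(\<lambda>x. infsum (\<lambda>y. norm (g x y)) UNIV) summable_on UNIV"
    by (rule summable_on_comparison_test[OF assms(3)]) (auto intro: assms(2) infsum_nonneg)
  then show "(\<lambda>x. infsum (\<lambda>y. norm (case (x, y) of (x, y) \<Rightarrow> g x y)) UNIV) abs_summable_on UNIV"
    by (simp add: infsum_nonneg)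
qed

lemma hs_mult:
  assumes "hs f \<zeta> y" "hs g \<zeta> y'"
  shows "hs (f * g) \<zeta> (y * y')"
proof -
  let ?a = "\<lambda>\<kappa>. cf f \<kappa> * mon \<kappa> \<zeta>" and ?b = "\<lambda>\<kappa>. cf g \<kappa> * mon \<kappa> \<zeta>"
  have a: "?a abs_summable_on UNIV" and b: "?b abs_summable_on UNIV"
    using assms hs_imp_bd bd_abs_summable by blast+
  have sa: "(?a has_sum y) UNIV" and sb: "(?b has_sum y') UNIV"
    using assms by (auto simp: hs_def)
  have "(\<lambda>(\<mu>, \<nu>). ?a \<mu> * ?b \<nu>) abs_summable_on (UNIV \<times> UNIV)"
  proof (rule abs_summable_on_pairs)
    show "(\<lambda>\<nu>. ?a \<mu> * ?b \<nu>) abs_summable_on UNIV" for \<mu>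
      unfolding norm_mult[of "?a _"] using b by (rule summable_on_cmult_right)
    show "(\<Sum>\<^sub>\<infinity>\<nu>. norm (?a \<mu> * ?b \<nu>)) \<le> norm (?a \<mu>) * (\<Sum>\<^sub>\<infinity>\<nu>. norm (?b \<nu>))" for \<mu>
      unfolding norm_mult[of "?a _"] infsum_cmult_right' by simp
    show "(\<lambda>\<mu>. norm (?a \<mu>) * (\<Sum>\<^sub>\<infinity>\<nu>. norm (?b \<nu>))) summable_on UNIV"
      using a by (rule summable_on_cmult_left)
  qed
  then have "(\<lambda>(\<mu>, \<nu>). ?a \<mu> * ?b \<nu>) summable_on (UNIV \<times> UNIV)"
    using abs_summable_summable by blast
  then have "((\<lambda>(\<mu>, \<nu>). ?a \<mu> * ?b \<nu>) has_sum (y * y')) (UNIV \<times> UNIV)"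
    using sa sb
    by (intro has_sum_SigmaI[where g = "\<lambda>\<mu>. ?a \<mu> * y'"]) (auto intro: has_sum_cmult_right has_sum_cmult_left)
  also have "?this \<longleftrightarrow> ((\<lambda>(\<kappa>, \<mu>, \<nu>). ?a \<mu> * ?b \<nu>) has_sum (y * y')) (SIGMA \<kappa>:UNIV. splits \<kappa>)"
    by (rule has_sum_reindex_bij_witness[of _ "\<lambda>(\<kappa>, \<mu>, \<nu>). (\<mu>, \<nu>)" "\<lambda>(\<mu>, \<nu>). (\<mu> + \<nu>, \<mu>, \<nu>)"])
      (auto simp: splits_def)
  finally have "((\<lambda>(\<kappa>, \<mu>, \<nu>). ?a \<mu> * ?b \<nu>) has_sum (y * y')) (SIGMA \<kappa>:UNIV. splits \<kappa>)" .
  then have "((\<lambda>\<kappa>. cf (f * g) \<kappa> * mon \<kappa> \<zeta>) has_sum (y * y')) UNIV"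
  proof (rule has_sum_SigmaD)
    fix \<kappa>
    show "((\<lambda>p. case (\<kappa>, p) of (\<kappa>, \<mu>, \<nu>) \<Rightarrow> ?a \<mu> * ?b \<nu>) has_sum cf (f * g) \<kappa> * mon \<kappa> \<zeta>) (splits \<kappa>)"
      unfolding cf_mult sum_distrib_right
      by (rule has_sum_finiteI[OF finite_splits]) (auto simp: splits_def mon_add mult_ac intro!: sum.cong)
  qed
  then show ?thesis by (simp add: hs_def)
qed

lemma hs_power: "hs f \<zeta> y \<Longrightarrow> hs (f ^ k) \<zeta> (y ^ k)"
  using hs_cst[of 1 \<zeta>] by (induction k) (auto intro: hs_mult)

lemma hs_prod: "(\<And>i. i \<in> I \<Longrightarrow> hs (f i) \<zeta> (y i)) \<Longrightarrow> hs (prod f I) \<zeta> (prod y I)"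
  using hs_cst[of 1 \<zeta>] by (induction I rule: infinite_finite_induct) (auto intro: hs_mult)

lemma hs_mon: "(\<And>v. hs (f v) \<zeta> (y v)) \<Longrightarrow> hs (mon \<kappa> f) \<zeta> (mon \<kappa> y)"
  unfolding mon_def by (intro hs_prod hs_power)

lemma bd_mon:
  assumes "\<And>v. bd (\<lambda>\<kappa>. mon \<kappa> s) (f v) (B v)" "\<And>v. 0 \<le> s v"
  shows "bd (\<lambda>\<kappa>. mon \<kappa> s) (mon \<mu> f) (mon \<mu> B)"
proof (induction \<mu> rule: mindex_induct)
  case zero
  show ?case
  proof (rule bdI)
    fix F :: "mindex set" assume F: "finite F"
    have "(\<Sum>\<kappa>\<in>F. cmod (cf (mon 0 f) \<kappa>) * mon \<kappa> s) = (\<Sum>\<kappa>\<in>F. if \<kappa> = 0 then 1 else 0)"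
      by (intro sum.cong) (auto simp: cf_1)
    also have "\<dots> \<le> 1" using F by simp
    finally show "(\<Sum>\<kappa>\<in>F. cmod (cf (mon 0 f) \<kappa>) * mon \<kappa> s) \<le> mon 0 B" by simp
  qed
next
  case (add \<kappa> v)
  show ?case
    unfolding mon_add mon_unit_index
    by (rule bd_mult[OF add.IH assms(1)]) (auto simp: mon_add mon_nonneg assms(2))
qed

definition shifted_mon :: "(var \<Rightarrow> complex) \<Rightarrow> mindex \<Rightarrow> mps" where
  "shifted_mon \<eta> \<kappa> = mon \<kappa> (\<lambda>v. cst (\<eta> v) + mvar v)"

lemma hs_shifted_mon: "hs (shifted_mon \<eta> \<kappa>) \<zeta> (mon \<kappa> (\<lambda>v. \<eta> v + \<zeta> v))"
  unfolding shifted_mon_def by (intro hs_mon hs_add hs_cst hs_mvar)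

lemma bd_shifted_mon: "bd (mon_abs \<zeta>) (shifted_mon \<eta> \<kappa>) (mon \<kappa> (\<lambda>v. cmod (\<eta> v) + cmod (\<zeta> v)))"
  unfolding shifted_mon_def
proof (rule bd_mon)
  fix v
  show "bd (mon_abs \<zeta>) (cst (\<eta> v) + mvar v) (cmod (\<eta> v) + cmod (\<zeta> v))"
  proof (rule bdI)
    fix F :: "mindex set" assume F: "finite F"
    have "(\<Sum>\<kappa>\<in>F. cmod (cf (cst (\<eta> v) + mvar v) \<kappa>) * mon_abs \<zeta> \<kappa>) \<le>
        (\<Sum>\<kappa>\<in>F. (if \<kappa> = 0 then cmod (\<eta> v) else 0) + (if \<kappa> = unit_index v then cmod (\<zeta> v) else 0))"
      by (intro sum_mono) (auto simp: cf_cst cf_mvar)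
    also have "\<dots> \<le> cmod (\<eta> v) + cmod (\<zeta> v)"
      using F by (simp add: sum.distrib)
    finally show "(\<Sum>\<kappa>\<in>F. cmod (cf (cst (\<eta> v) + mvar v) \<kappa>) * mon_abs \<zeta> \<kappa>) \<le> cmod (\<eta> v) + cmod (\<zeta> v)" .
  qed
qed auto

lemma D_mon: "D v (mon \<kappa> (\<lambda>v. cst (\<eta> v) + mvar v)) * (cst (\<eta> v) + mvar v)
    = of_nat (lookup \<kappa> v) * mon \<kappa> (\<lambda>v. cst (\<eta> v) + mvar v)"
proof (induction \<kappa> rule: mindex_induct)
  case zero
  show ?case using D_cst[of v 1] by simp
next
  case (add \<kappa> u)
  have "D v (mon \<kappa> (\<lambda>v. cst (\<eta> v) + mvar v) * (cst (\<eta> u) + mvar u)) * (cst (\<eta> v) + mvar v) =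
      D v (mon \<kappa> (\<lambda>v. cst (\<eta> v) + mvar v)) * (cst (\<eta> v) + mvar v) * (cst (\<eta> u) + mvar u) +
      mon \<kappa> (\<lambda>v. cst (\<eta> v) + mvar v) * (if u = v then cst (\<eta> v) + mvar v else 0)"
    by (auto simp: D_mult D_linear D_mvar algebra_simps)
  then show ?case
    unfolding add.IH mon_add mon_unit_index
    by (auto simp: lookup_add lookup_unit_index algebra_simps)
qed

lemma cf_shifted_mon_0: "cf (shifted_mon \<eta> \<kappa>) 0 = mon \<kappa> \<eta>"
  using hs_unique[OF hs_at_0 hs_shifted_mon, of \<eta> \<kappa>] by simp

lemma cf_shifted_mon_unit_index:
  "cf (shifted_mon \<eta> (\<kappa> + unit_index v)) (unit_index v) = of_nat (lookup \<kappa> v + 1) * mon \<kappa> \<eta>"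
proof -
  let ?y = "\<lambda>v. cst (\<eta> v) + mvar v"
  have cancel: "f * ?y v = g * ?y v \<Longrightarrow> f = g" for f g
  proof -
    assume *: "f * ?y v = g * ?y v"
    have "(f - g) * ?y v = 0" using * by (simp add: algebra_simps)
    define h where "h = f - g"
    have h: "cst (\<eta> v) * h = - (mvar v * h)"
      using * by (simp add: h_def algebra_simps add_eq_0_iff)
    show "f = g"
    proof (cases "\<eta> v = 0")
      case True
      then show ?thesis using h mvar_mult_cancel[of v h 0] by (simp add: h_def)
    next
      case False
      have "lookup \<kappa> v = k \<Longrightarrow> cf h \<kappa> = 0" for k \<kappa>
      proof (induction k arbitrary: \<kappa>)
        case 0
        have "cf (cst (\<eta> v) * h) \<kappa> = 0"
          unfolding h using 0 by (simp add: cf_mvar_mult_0)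
        then show ?case using False by simp
      next
        case (Suc k)
        then obtain \<mu> where \<mu>: "\<kappa> = \<mu> + unit_index v"
          using mindex_remove[of \<kappa> v] by auto
        then have "cf h \<mu> = 0"
          using Suc by (simp add: lookup_add)
        then have "cf (cst (\<eta> v) * h) \<kappa> = 0"
          unfolding h by (simp add: \<mu>)
        then show ?case using False by simp
      qed
      then have "h = 0" by (intro mps_eqI) simp
      then show ?thesis by (simp add: h_def)
    qed
  qed
  have "D v (mon (\<kappa> + unit_index v) ?y) * ?y v = of_nat (lookup \<kappa> v + 1) * mon (\<kappa> + unit_index v) ?y"
    unfolding D_mon[of v "\<kappa> + unit_index v" \<eta>] by (simp only: lookup_add lookup_unit_index_same)
  also have "\<dots> = of_nat (lookup \<kappa> v + 1) * mon \<kappa> ?y * ?y v"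
    by (simp only: mon_add mon_unit_index mult.assoc)
  finally have "D v (mon (\<kappa> + unit_index v) ?y) = of_nat (lookup \<kappa> v + 1) * mon \<kappa> ?y"
    by (rule cancel)
  then have "cf (D v (shifted_mon \<eta> (\<kappa> + unit_index v))) 0 = of_nat (lookup \<kappa> v + 1) * mon \<kappa> \<eta>"
    by (simp only: shifted_mon_def cf_of_nat_mult) (simp only: cf_shifted_mon_0 flip: shifted_mon_def)
  then show ?thesis
    by (simp add: cf_D)
qed

lemma cf_shifted_mon_eq_0:
  assumes "lookup \<kappa> v = 0" "lookup \<mu> v \<noteq> 0"
  shows "cf (shifted_mon \<eta> \<kappa>) \<mu> = 0"
  using assms(2,1)
proof (induction \<kappa> arbitrary: \<mu> rule: mindex_induct)
  case zero
  then show ?case by (auto simp: shifted_mon_def cf_1)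
next
  case (add \<kappa> u)
  have uv: "u \<noteq> v" "lookup \<kappa> v = 0"
    using add.prems by (auto simp: lookup_add lookup_unit_index split: if_splits)
  have "cf (shifted_mon \<eta> \<kappa> * (cst (\<eta> u) + mvar u)) \<mu> = 0"
    unfolding cf_mult
  proof (intro sum.neutral ballI)
    fix p assume "p \<in> splits \<mu>"
    then obtain a b where p: "p = (a, b)" "\<mu> = a + b" by (auto simp: splits_def)
    have "cf (cst (\<eta> u)) b + cf (mvar u) b = 0" if "cf (shifted_mon \<eta> \<kappa>) a \<noteq> 0"
    proof -
      have "lookup a v = 0" using add.IH[of a] uv that by auto
      then have "lookup b v \<noteq> 0" using p add.prems(1) by (auto simp: lookup_add)
      then have "b \<noteq> 0" "b \<noteq> unit_index u"
        using uv by (auto simp: lookup_unit_index)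
      then show ?thesis
        by (simp add: cf_cst cf_mvar)
    qed
    then show "(case p of (a, b) \<Rightarrow> cf (shifted_mon \<eta> \<kappa>) a * cf (cst (\<eta> u) + mvar u) b) = 0"
      by (auto simp: p)
  qed
  then show ?case by (simp add: shifted_mon_def mon_add)
qed

definition recenter :: "(var \<Rightarrow> complex) \<Rightarrow> mps \<Rightarrow> mps" where
  "recenter \<eta> f = Mps (\<lambda>\<mu>. infsum (\<lambda>\<kappa>. cf f \<kappa> * cf (shifted_mon \<eta> \<kappa>) \<mu>) UNIV)"

lemma hs_recenter:
  assumes "bd (\<lambda>\<kappa>. mon \<kappa> (\<lambda>v. cmod (\<eta> v) + cmod (\<zeta> v))) f B"
  shows "hs f (\<lambda>v. \<eta> v + \<zeta> v) y \<Longrightarrow> hs (recenter \<eta> f) \<zeta> y"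
    and "cmod (mon \<mu> \<zeta>) \<noteq> 0 \<Longrightarrow> (\<lambda>\<kappa>. cf f \<kappa> * cf (shifted_mon \<eta> \<kappa>) \<mu>) summable_on UNIV"
proof -
  let ?h = "\<lambda>(\<kappa>, \<mu>). cf f \<kappa> * (cf (shifted_mon \<eta> \<kappa>) \<mu> * mon \<mu> \<zeta>)"
  have sm: "(\<lambda>\<mu>. cf (shifted_mon \<eta> \<kappa>) \<mu> * mon \<mu> \<zeta>) abs_summable_on UNIV" for \<kappa>
    by (rule bd_abs_summable[OF bd_shifted_mon])
  have le: "infsum (\<lambda>\<mu>. norm (cf (shifted_mon \<eta> \<kappa>) \<mu> * mon \<mu> \<zeta>)) UNIV \<le>
      mon \<kappa> (\<lambda>v. cmod (\<eta> v) + cmod (\<zeta> v))" for \<kappa>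
    using bd_shifted_mon[of \<zeta> \<eta> \<kappa>]
    by (intro infsum_le_finite_sums sm) (auto simp: bd_def norm_mult norm_mon)
  have "(\<lambda>\<kappa>. cf f \<kappa> * of_real (mon \<kappa> (\<lambda>v. cmod (\<eta> v) + cmod (\<zeta> v)))) abs_summable_on UNIV"
    unfolding abs_summable_iff_bdd_above
    by (rule bdd_aboveI2[of _ _ B])
      (use assms in \<open>auto simp: bd_def norm_mult abs_of_nonneg mon_nonneg\<close>)
  then have bnd: "(\<lambda>\<kappa>. norm (cf f \<kappa>) * mon \<kappa> (\<lambda>v. cmod (\<eta> v) + cmod (\<zeta> v))) summable_on UNIV"
    by (simp add: norm_mult abs_of_nonneg mon_nonneg)
  have abs: "?h abs_summable_on (UNIV \<times> UNIV)"
  proof (rule abs_summable_on_pairs[OF _ _ bnd])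
    show "(\<lambda>\<mu>. cf f \<kappa> * (cf (shifted_mon \<eta> \<kappa>) \<mu> * mon \<mu> \<zeta>)) abs_summable_on UNIV" for \<kappa>
      unfolding norm_mult[of "cf f _"] using sm by (rule summable_on_cmult_right)
    show "(\<Sum>\<^sub>\<infinity>\<mu>. norm (cf f \<kappa> * (cf (shifted_mon \<eta> \<kappa>) \<mu> * mon \<mu> \<zeta>))) \<le>
        norm (cf f \<kappa>) * mon \<kappa> (\<lambda>v. cmod (\<eta> v) + cmod (\<zeta> v))" for \<kappa>
      unfolding norm_mult[of "cf f _"] infsum_cmult_right' using le by (intro mult_left_mono) auto
  qed
  then have summ: "?h summable_on (UNIV \<times> UNIV)"
    using abs_summable_summable by blast
  then have swap: "(\<lambda>(\<mu>, \<kappa>). cf f \<kappa> * (cf (shifted_mon \<eta> \<kappa>) \<mu> * mon \<mu> \<zeta>)) summable_on (UNIV \<times> UNIV)"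
    by (subst summable_on_swap) (simp add: case_prod_unfold)
  have inner: "((\<lambda>\<kappa>. cf f \<kappa> * (cf (shifted_mon \<eta> \<kappa>) \<mu> * mon \<mu> \<zeta>)) summable_on UNIV)" for \<mu>
    using swap summable_on_SigmaD1[of "\<lambda>\<mu> \<kappa>. cf f \<kappa> * (cf (shifted_mon \<eta> \<kappa>) \<mu> * mon \<mu> \<zeta>)" UNIV "\<lambda>_. UNIV" \<mu>]
    by simp
  show "(\<lambda>\<kappa>. cf f \<kappa> * cf (shifted_mon \<eta> \<kappa>) \<mu>) summable_on UNIV" if "cmod (mon \<mu> \<zeta>) \<noteq> 0"
    using summable_on_cmult_left[OF inner[of \<mu>], of "inverse (mon \<mu> \<zeta>)"] that by (simp add: mult.assoc)
  show "hs (recenter \<eta> f) \<zeta> y" if y: "hs f (\<lambda>v. \<eta> v + \<zeta> v) y"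
  proof -
    have "(?h has_sum y) (UNIV \<times> UNIV)"
      using y by (intro has_sum_SigmaI[OF _ _ summ])
        (auto intro!: has_sum_cmult_right hs_shifted_mon[unfolded hs_def] simp: hs_def)
    then have "((\<lambda>(\<mu>, \<kappa>). cf f \<kappa> * (cf (shifted_mon \<eta> \<kappa>) \<mu> * mon \<mu> \<zeta>)) has_sum y) (UNIV \<times> UNIV)"
      by (subst has_sum_swap) (simp add: case_prod_unfold)
    then have "((\<lambda>\<mu>. cf (recenter \<eta> f) \<mu> * mon \<mu> \<zeta>) has_sum y) UNIV"
    proof (rule has_sum_SigmaD)
      fix \<mu>
      have "((\<lambda>\<kappa>. cf f \<kappa> * (cf (shifted_mon \<eta> \<kappa>) \<mu> * mon \<mu> \<zeta>)) has_sum
          infsum (\<lambda>\<kappa>. cf f \<kappa> * cf (shifted_mon \<eta> \<kappa>) \<mu> * mon \<mu> \<zeta>) UNIV) UNIV"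
        using inner[of \<mu>] by (simp add: mult.assoc)
      also have "infsum (\<lambda>\<kappa>. cf f \<kappa> * cf (shifted_mon \<eta> \<kappa>) \<mu> * mon \<mu> \<zeta>) UNIV = cf (recenter \<eta> f) \<mu> * mon \<mu> \<zeta>"
        by (simp add: recenter_def infsum_cmult_left')
      finally show "((\<lambda>\<kappa>. case (\<mu>, \<kappa>) of (\<mu>, \<kappa>) \<Rightarrow> cf f \<kappa> * (cf (shifted_mon \<eta> \<kappa>) \<mu> * mon \<mu> \<zeta>))
          has_sum cf (recenter \<eta> f) \<mu> * mon \<mu> \<zeta>) UNIV"
        by simp
    qed
    then show ?thesis by (simp add: hs_def)
  qed
qed

lemma hs_D:
  assumes "(\<lambda>\<kappa>. cf f \<kappa> * cf (shifted_mon \<eta> \<kappa>) (unit_index v)) summable_on UNIV"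
  shows "hs (D v f) \<eta> (cf (recenter \<eta> f) (unit_index v))"
proof -
  let ?h = "\<lambda>\<kappa>. cf f \<kappa> * cf (shifted_mon \<eta> \<kappa>) (unit_index v)"
  have "(?h has_sum cf (recenter \<eta> f) (unit_index v)) UNIV"
    using assms by (simp add: recenter_def)
  also have "?this \<longleftrightarrow> (?h has_sum cf (recenter \<eta> f) (unit_index v)) (range (\<lambda>\<kappa>. \<kappa> + unit_index v))"
  proof (rule has_sum_cong_neutral)
    fix \<kappa> assume "\<kappa> \<in> UNIV - range (\<lambda>\<kappa>. \<kappa> + unit_index v)"
    then have "lookup \<kappa> v = 0" using mindex_remove by blast
    then show "?h \<kappa> = 0" by (simp add: cf_shifted_mon_eq_0)
  qed auto
  also have "\<dots> \<longleftrightarrow> ((?h \<circ> (\<lambda>\<kappa>. \<kappa> + unit_index v)) has_sum cf (recenter \<eta> f) (unit_index v)) UNIV"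
    by (rule has_sum_reindex) (simp add: inj_on_def)
  also have "?h \<circ> (\<lambda>\<kappa>. \<kappa> + unit_index v) = (\<lambda>\<kappa>. cf (D v f) \<kappa> * mon \<kappa> \<eta>)"
    by (auto simp: fun_eq_iff cf_D cf_shifted_mon_unit_index)
  finally show ?thesis by (simp add: hs_def)
qed

subsection \<open>Uniqueness of power series expansions\<close>

lemma finite_polynomial_eq_0:
  fixes c :: "('v \<Rightarrow> nat) \<Rightarrow> complex"
  assumes "finite V" "finite A" "\<And>\<alpha> v. \<alpha> \<in> A \<Longrightarrow> v \<notin> V \<Longrightarrow> \<alpha> v = 0"
    and "\<And>N. (\<And>v. 1 \<le> N v) \<Longrightarrow> (\<Sum>\<alpha>\<in>A. c \<alpha> * (\<Prod>v\<in>V. of_nat (N v) ^ \<alpha> v)) = 0"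
    and "\<alpha> \<in> A"
  shows "c \<alpha> = 0"
  using assms
proof (induction V arbitrary: A c \<alpha> rule: finite_induct)
  case empty
  then have "A \<subseteq> {\<lambda>_. 0}" by auto
  then have "A = {\<alpha>}" using empty by auto
  then show ?case using empty(3)[of "\<lambda>_. 1"] by simp
next
  case (insert w V)
  let ?B = "\<lambda>k. {\<beta> \<in> A. \<beta> w = k}" and ?z = "\<lambda>\<beta>. \<beta>(w := 0)"
  define K where "K = Max ((\<lambda>\<beta>. \<beta> w) ` A)"
  have K: "\<beta> w \<le> K" if "\<beta> \<in> A" for \<beta>
    using that insert.prems(1) by (auto simp: K_def)
  have inj: "inj_on ?z (?B k)" for k
  proof (rule inj_onI)
    fix \<beta> \<beta>' assume *: "\<beta> \<in> ?B k" "\<beta>' \<in> ?B k" "?z \<beta> = ?z \<beta>'"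
    show "\<beta> = \<beta>'"
    proof
      fix v show "\<beta> v = \<beta>' v"
      proof (cases "v = w")
        case False
        then show ?thesis using fun_cong[OF *(3), of v] by simp
      qed (use *(1,2) in simp)
    qed
  qed
  define d where "d k \<beta> = c (\<beta>(w := k))" for k \<beta>
  have "(\<Sum>\<beta>\<in>?z ` ?B (\<alpha> w). d (\<alpha> w) \<beta> * (\<Prod>v\<in>V. of_nat (N v) ^ \<beta> v)) = 0"
    if N: "\<And>v. 1 \<le> N v" for N :: "'v \<Rightarrow> nat"
  proof -
    define e where "e k = (\<Sum>\<beta>\<in>?B k. c \<beta> * (\<Prod>v\<in>V. of_nat (N v) ^ \<beta> v))" for k
    have sum: "(\<Sum>k\<le>K. e k * of_nat s ^ k) = 0" if "s \<ge> 1" for s :: nat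
    proof -
      have "(\<Sum>k\<le>K. e k * of_nat s ^ k) =
          (\<Sum>k\<le>K. \<Sum>\<beta>\<in>?B k. c \<beta> * (\<Prod>v\<in>V. of_nat (N v) ^ \<beta> v) * of_nat s ^ \<beta> w)"
        by (simp add: e_def sum_distrib_right)
      also have "\<dots> = (\<Sum>\<beta>\<in>A. c \<beta> * (\<Prod>v\<in>V. of_nat (N v) ^ \<beta> v) * of_nat s ^ \<beta> w)"
        using insert.prems(1) K by (intro sum.group) auto
      also have "\<dots> = (\<Sum>\<beta>\<in>A. c \<beta> * (\<Prod>v\<in>insert w V. of_nat ((N(w := s)) v) ^ \<beta> v))"
      proof (intro sum.cong refl)
        fix \<beta>
        have "(\<Prod>v\<in>V. of_nat ((N(w := s)) v) ^ \<beta> v :: complex) = (\<Prod>v\<in>V. of_nat (N v) ^ \<beta> v)"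
          using insert.hyps by (intro prod.cong) auto
        then show "c \<beta> * (\<Prod>v\<in>V. of_nat (N v) ^ \<beta> v) * of_nat s ^ \<beta> w =
            c \<beta> * (\<Prod>v\<in>insert w V. of_nat ((N(w := s)) v) ^ \<beta> v)"
          using insert.hyps by (simp add: mult_ac)
      qed
      also have "\<dots> = 0"
        using insert.prems(3)[of "N(w := s)"] N that by auto
      finally show ?thesis .
    qed
    have "e k = 0" if "k \<le> K" for k
    proof (rule ccontr)
      assume "e k \<noteq> 0"
      then have "finite {z. (\<Sum>i\<le>K. e i * z ^ i) = 0}"
        using Transcendental.polyfun_rootbound[of e k K] that by blast
      moreover have "of_nat ` {1..} \<subseteq> {z. (\<Sum>i\<le>K. e i * z ^ i) = 0}"
        using sum by auto
      moreover have "infinite ((of_nat :: nat \<Rightarrow> complex) ` {1..})"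
        by (simp add: finite_image_iff inj_on_def infinite_Ici)
      ultimately show False
        using finite_subset by blast
    qed
    then have "e (\<alpha> w) = 0" using K insert.prems(4) by simp
    moreover have "(\<Sum>\<beta>\<in>?z ` ?B (\<alpha> w). d (\<alpha> w) \<beta> * (\<Prod>v\<in>V. of_nat (N v) ^ \<beta> v)) = e (\<alpha> w)"
      unfolding e_def sum.reindex[OF inj] o_def d_def
      using insert.hyps by (intro sum.cong refl) (auto simp: fun_upd_idem intro!: arg_cong2[of _ _ _ _ times] prod.cong)
    ultimately show ?thesis by simp
  qed
  note vanish = this
  have "d (\<alpha> w) (?z \<alpha>) = 0"
  proof (rule insert.IH)
    show "?z \<alpha> \<in> ?z ` ?B (\<alpha> w)"
      using insert.prems(4) by (intro imageI) simp
    show "finite (?z ` ?B (\<alpha> w))"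
      using insert.prems(1) by simp
    show "\<beta> v = 0" if "\<beta> \<in> ?z ` ?B (\<alpha> w)" "v \<notin> V" for \<beta> v
      using that insert.prems(2) by auto
  qed (use vanish in blast)
  then show ?case by (simp add: d_def)
qed

lemma powser_eq_0:
  fixes a :: "nat \<Rightarrow> complex"
  assumes "0 < r" and "\<And>x. norm x < r \<Longrightarrow> summable (\<lambda>k. a k * x ^ k)"
    and "\<And>s::real. 0 < s \<Longrightarrow> s < r \<Longrightarrow> (\<lambda>k. a k * of_real s ^ k) sums 0"
  shows "a k = 0"
proof (induction k rule: less_induct)
  case (less k)
  let ?b = "\<lambda>i. a (i + k)"
  have shift: "x ^ k * (suminf (\<lambda>i. ?b i * x ^ i)) = (suminf (\<lambda>i. a i * x ^ i))" "summable (\<lambda>i. ?b i * x ^ i)"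
    if x: "norm x < r" "x \<noteq> 0" for x
  proof -
    have *: "summable (\<lambda>i. a (i + k) * x ^ (i + k))"
      using assms(2)[OF x(1)] by (subst summable_iff_shift)
    have "summable (\<lambda>i. inverse (x ^ k) * (a (i + k) * x ^ (i + k)))"
      using * by (rule summable_mult)
    also have "(\<lambda>i. inverse (x ^ k) * (a (i + k) * x ^ (i + k))) = (\<lambda>i. ?b i * x ^ i)"
      using x by (auto simp: power_add field_simps)
    finally show sum: "summable (\<lambda>i. ?b i * x ^ i)" .
    have "(suminf (\<lambda>i. a i * x ^ i)) = (suminf (\<lambda>i. a (i + k) * x ^ (i + k))) + (\<Sum>i<k. a i * x ^ i)"
      by (rule suminf_split_initial_segment[OF assms(2)[OF x(1)]])
    also have "(\<Sum>i<k. a i * x ^ i) = 0"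
      using less by (intro sum.neutral) auto
    also have "(suminf (\<lambda>i. a (i + k) * x ^ (i + k))) = (suminf (\<lambda>i. x ^ k * (?b i * x ^ i)))"
      by (simp add: power_add mult_ac)
    also have "\<dots> = x ^ k * (suminf (\<lambda>i. ?b i * x ^ i))"
      by (rule suminf_mult[OF sum])
    finally show "x ^ k * (suminf (\<lambda>i. ?b i * x ^ i)) = (suminf (\<lambda>i. a i * x ^ i))" by simp
  qed
  have "(\<lambda>i. ?b i * x ^ i) sums (suminf (\<lambda>i. ?b i * x ^ i))" if "norm x < r" for x
  proof (cases "x = 0")
    case True
    then show ?thesis using powser_sums_zero[of ?b] by (simp add: sums_iff)
  next
    case False
    then show ?thesis using shift(2)[OF that] by (simp add: summable_sums)
  qed
  then have "((\<lambda>x. suminf (\<lambda>i. ?b i * x ^ i)) \<longlongrightarrow> ?b 0) (at 0)"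
    by (rule powser_limit_0[OF assms(1)])
  then have "((\<lambda>s::real. suminf (\<lambda>i. ?b i * of_real s ^ i)) \<longlongrightarrow> ?b 0) (at_right 0)"
    by (rule filterlim_compose[where g = "\<lambda>x. suminf (\<lambda>i. ?b i * x ^ i)"])
      (auto simp: filterlim_at intro!: tendsto_eq_intros eventually_mono[OF eventually_at_right_less])
  moreover have "\<forall>\<^sub>F s in at_right (0::real). (suminf (\<lambda>i. ?b i * of_real s ^ i)) = 0"
    using eventually_at_right_less[of 0] eventually_at_right_real[OF assms(1)]
  proof eventually_elim
    case (elim s)
    have "of_real s ^ k * (suminf (\<lambda>i. ?b i * of_real s ^ i)) = 0"
      using shift(1)[of "of_real s"] elim assms(3)[of s] by (simp add: sums_iff)
    then show ?case using elim by simp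
  qed
  ultimately have "((\<lambda>s::real. 0::complex) \<longlongrightarrow> ?b 0) (at_right 0)"
    by (rule Lim_transform_eventually)
  then have "?b 0 = 0"
    by (simp add: tendsto_const_iff)
  then show ?case by simp
qed

lemma finite_bounded_degree:
  assumes "finite V"
  shows "finite {\<kappa>. keys \<kappa> \<subseteq> V \<and> wdeg (\<lambda>_. 1) \<kappa> \<le> d}"
proof -
  have sub: "lookup ` {\<kappa>. keys \<kappa> \<subseteq> V \<and> wdeg (\<lambda>_. 1) \<kappa> \<le> d} \<subseteq>
      (\<lambda>g v. if v \<in> V then g v else 0) ` (V \<rightarrow>\<^sub>E {..d})"
  proof clarify
    fix \<kappa> :: mindex assume k: "keys \<kappa> \<subseteq> V" "wdeg (\<lambda>_. 1) \<kappa> \<le> d"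
    have "lookup \<kappa> v \<le> d" if "v \<in> V" for v
    proof -
      have "lookup \<kappa> v \<le> (\<Sum>v\<in>V. lookup \<kappa> v)"
        using that assms by (intro member_le_sum) auto
      then show ?thesis using k wdeg_superset[OF assms k(1), of "\<lambda>_. 1"] by simp
    qed
    then have "restrict (lookup \<kappa>) V \<in> V \<rightarrow>\<^sub>E {..d}" by auto
    moreover have "lookup \<kappa> = (\<lambda>v. if v \<in> V then restrict (lookup \<kappa>) V v else 0)"
      using k by (auto simp: fun_eq_iff in_keys_iff)
    ultimately show "lookup \<kappa> \<in> (\<lambda>g v. if v \<in> V then g v else 0) ` (V \<rightarrow>\<^sub>E {..d})"
      by blast
  qed
  have "finite ((\<lambda>g v. if v \<in> V then g v else (0::nat)) ` (V \<rightarrow>\<^sub>E {..d}))"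
    using assms by (intro finite_imageI finite_PiE) auto
  then have "finite (lookup ` {\<kappa>. keys \<kappa> \<subseteq> V \<and> wdeg (\<lambda>_. 1) \<kappa> \<le> d})"
    by (rule finite_subset[OF sub])
  then show ?thesis
    by (rule finite_imageD) (auto simp: inj_on_def poly_mapping_eq_iff[symmetric])
qed

lemma hs_eq_0_imp_eq_0:
  assumes V: "finite V" "\<And>\<kappa>. cf f \<kappa> \<noteq> 0 \<Longrightarrow> keys \<kappa> \<subseteq> V" and "0 < r"
    and zero: "\<And>s. (\<And>v. v \<in> V \<Longrightarrow> 0 < s v) \<Longrightarrow> (\<And>v. v \<in> V \<Longrightarrow> s v < r) \<Longrightarrow> (\<And>v. v \<notin> V \<Longrightarrow> s v = 0) \<Longrightarrow>
      hs f (\<lambda>v. of_real (s v)) 0"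
  shows "f = 0"
proof -
  let ?deg = "wdeg (\<lambda>_. 1)"
  let ?A = "\<lambda>d. {\<kappa>. keys \<kappa> \<subseteq> V \<and> ?deg \<kappa> = d}"
  have finA: "finite (?A d)" for d
    by (rule finite_subset[OF _ finite_bounded_degree[OF V(1), of d]]) auto
  have hom: "(\<Sum>\<kappa>\<in>?A d. cf f \<kappa> * mon \<kappa> (\<lambda>v. of_nat (N v))) = 0" if N: "\<And>v. 1 \<le> N v" for N :: "var \<Rightarrow> nat" and d
  proof -
    define K where "K = Suc (Max (insert 0 (N ` V)))"
    have K: "N v < K" if "v \<in> V" for v
      using V(1) that by (auto simp: K_def less_Suc_eq_le)
    define R where "R = r / K"
    have R: "0 < R" using \<open>0 < r\<close> by (simp add: R_def K_def)
    let ?s = "\<lambda>s v. if v \<in> V then s * of_nat (N v) else 0"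
    define a where "a d = (\<Sum>\<kappa>\<in>?A d. cf f \<kappa> * mon \<kappa> (\<lambda>v. of_nat (N v)))" for d
    have mon_eq: "mon \<kappa> (?s s) = s ^ ?deg \<kappa> * mon \<kappa> (\<lambda>v. of_nat (N v))"
      if "keys \<kappa> \<subseteq> V" for \<kappa> and s :: complex
    proof -
      have "mon \<kappa> (?s s) = (\<Prod>v\<in>keys \<kappa>. (s * of_nat (N v)) ^ lookup \<kappa> v)"
        unfolding mon_def using that by (intro prod.cong) auto
      also have "\<dots> = s ^ ?deg \<kappa> * mon \<kappa> (\<lambda>v. of_nat (N v))"
        by (simp add: mon_def wdeg_def power_mult_distrib prod.distrib power_sum)
      finally show ?thesis .
    qed
    have hs0: "hs f (?s (of_real s)) 0" if "0 < s" "s < R" for s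
    proof -
      have "s * of_nat (N v) < r" if v: "v \<in> V" for v
      proof -
        have "s * of_nat (N v) \<le> s * K"
          using K[OF v] \<open>0 < s\<close> by (intro mult_left_mono) auto
        also have "\<dots> < r" using \<open>s < R\<close> by (simp add: R_def K_def field_simps)
        finally show ?thesis .
      qed
      moreover have "0 < s * of_nat (N v)" for v
        using \<open>0 < s\<close> N[of v] by simp
      ultimately have "hs f (\<lambda>v. of_real (if v \<in> V then s * of_nat (N v) else 0)) 0"
        by (intro zero) auto
      also have "(\<lambda>v. of_real (if v \<in> V then s * of_nat (N v) else 0)) = ?s (complex_of_real s)"
        by auto
      finally show ?thesis .
    qed
    have group: "((\<lambda>d. a d * x ^ d) has_sum y) UNIV" if "hs f (?s x) y" for x y
    proof -
      have "((\<lambda>\<kappa>. cf f \<kappa> * mon \<kappa> (?s x)) has_sum y) {\<kappa>. keys \<kappa> \<subseteq> V}"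
        using that V(2) unfolding hs_def by (subst has_sum_cong_neutral[where T = UNIV]) auto
      also have "?this \<longleftrightarrow> ((\<lambda>(d, \<kappa>). cf f \<kappa> * mon \<kappa> (?s x)) has_sum y) (SIGMA d:UNIV. ?A d)"
        by (rule has_sum_reindex_bij_witness[of _ snd "\<lambda>\<kappa>. (?deg \<kappa>, \<kappa>)"]) auto
      finally show ?thesis
      proof (rule has_sum_SigmaD)
        fix d
        show "((\<lambda>\<kappa>. case (d, \<kappa>) of (d, \<kappa>) \<Rightarrow> cf f \<kappa> * mon \<kappa> (?s x)) has_sum a d * x ^ d) (?A d)"
          unfolding a_def sum_distrib_right
          by (rule has_sum_finiteI[OF finA]) (auto intro!: sum.cong simp: mon_eq)
      qed
    qed
    have "a d = 0"
    proof (rule powser_eq_0[OF R])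
      show "(\<lambda>k. a k * of_real s ^ k) sums 0" if "0 < s" "s < R" for s
        using group[OF hs0[OF that]] by (rule has_sum_imp_sums)
      show "summable (\<lambda>k. a k * x ^ k)" if x: "norm x < R" for x
      proof -
        obtain s where s: "norm x < s" "s < R" using x dense by blast
        then have "0 < s" using norm_ge_zero[of x] by linarith
        then have "(\<lambda>k. a k * of_real s ^ k) sums 0"
          using s group[OF hs0] has_sum_imp_sums by blast
        then show ?thesis
          using s \<open>0 < s\<close> by (intro powser_inside[of a "of_real s" x]) (auto simp: sums_iff)
      qed
    qed
    then show ?thesis by (simp add: a_def)
  qed
  show "f = 0"
  proof (rule mps_eqI)
    fix \<mu>
    show "cf f \<mu> = cf 0 \<mu>"
    proof (cases "keys \<mu> \<subseteq> V")
      case True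
      have "cf f (Abs_poly_mapping (lookup \<mu>)) = 0"
      proof (rule finite_polynomial_eq_0[where V = V and A = "lookup ` ?A (?deg \<mu>)"
            and c = "\<lambda>\<alpha>. cf f (Abs_poly_mapping \<alpha>)" and \<alpha> = "lookup \<mu>"])
        fix N :: "var \<Rightarrow> nat" assume N: "\<And>v. 1 \<le> N v"
        have inj: "inj_on lookup (?A (?deg \<mu>))"
          by (auto simp: inj_on_def poly_mapping_eq_iff[symmetric])
        have "(\<Sum>\<kappa>\<in>?A (?deg \<mu>). cf f (Abs_poly_mapping (lookup \<kappa>)) * (\<Prod>v\<in>V. of_nat (N v) ^ lookup \<kappa> v)) =
            (\<Sum>\<kappa>\<in>?A (?deg \<mu>). cf f \<kappa> * mon \<kappa> (\<lambda>v. of_nat (N v)))"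
          by (intro sum.cong refl) (simp add: lookup_inverse mon_superset[OF V(1)])
        then show "(\<Sum>\<alpha>\<in>lookup ` ?A (?deg \<mu>). cf f (Abs_poly_mapping \<alpha>) * (\<Prod>v\<in>V. of_nat (N v) ^ \<alpha> v)) = 0"
          unfolding sum.reindex[OF inj] o_def using hom[OF N] by simp
      next
        show "lookup \<mu> \<in> lookup ` ?A (?deg \<mu>)"
          using True by (intro imageI) simp
        show "finite (lookup ` ?A (?deg \<mu>))"
          using finA by (rule finite_imageI)
        show "\<alpha> v = 0" if "\<alpha> \<in> lookup ` ?A (?deg \<mu>)" "v \<notin> V" for \<alpha> v
          using that by (auto simp: in_keys_iff)
      qed (rule V(1))
      then show ?thesis by (simp add: lookup_inverse)
    qed (use V(2) in auto)
  qed
qed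

subsection \<open>Coordinates and neighbourhoods\<close>

fun emb :: "pt \<Rightarrow> var \<Rightarrow> complex" where
  "emb (t, x, z) (Tv i) = of_real (t i)"
| "emb (t, x, z) (Xv j) = of_real (x j)"
| "emb (t, x, z) (Zv k) = z k"

definition emb_diff :: "pt \<Rightarrow> pt \<Rightarrow> var \<Rightarrow> complex" where
  "emb_diff p q v = emb q v - emb p v"

definition padd :: "pt \<Rightarrow> (var \<Rightarrow> real) \<Rightarrow> pt" where
  "padd p s = (case p of (t, x, z) \<Rightarrow>
     (\<lambda>i. t i + s (Tv i), \<lambda>j. x j + s (Xv j), \<lambda>k. z k + of_real (s (Zv k))))"

lemma emb_padd: "emb (padd p s) v = emb p v + of_real (s v)"
  by (cases p; cases v) (auto simp: padd_def)

lemma emb_diff_padd: "emb_diff p (padd p s) = (\<lambda>v. of_real (s v))"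
  by (auto simp: emb_diff_def emb_padd)

fun tweight :: "var \<Rightarrow> nat" where
  "tweight (Tv i) = 1" | "tweight (Xv j) = 0" | "tweight (Zv k) = 0"

fun yweight :: "var \<Rightarrow> nat" where
  "yweight (Tv i) = 0" | "yweight (Xv j) = 1" | "yweight (Zv k) = 1"

abbreviation tdeg :: "mindex \<Rightarrow> nat" where
  "tdeg \<equiv> wdeg tweight"

abbreviation ydeg :: "mindex \<Rightarrow> nat" where
  "ydeg \<equiv> wdeg yweight"

abbreviation deg :: "mindex \<Rightarrow> nat" where
  "deg \<equiv> wdeg (\<lambda>_. 1)"

lemma deg_eq: "deg \<kappa> = tdeg \<kappa> + ydeg \<kappa>"
proof -
  have "tweight v + yweight v = 1" for v by (cases v) auto
  then show ?thesis
    unfolding wdeg_def by (simp flip: sum.distrib distrib_right)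
qed

lemma tdeg_eq_0_iff: "tdeg \<kappa> = 0 \<longleftrightarrow> (\<forall>i. lookup \<kappa> (Tv i) = 0)"
proof
  assume *: "tdeg \<kappa> = 0"
  show "\<forall>i. lookup \<kappa> (Tv i) = 0"
  proof
    fix i
    have "Tv i \<notin> keys \<kappa>"
    proof
      assume i: "Tv i \<in> keys \<kappa>"
      then have "tweight (Tv i) * lookup \<kappa> (Tv i) = 0"
        using * unfolding wdeg_def by (simp only: sum_eq_0_iff finite_keys)
      then show False using i by (simp add: in_keys_iff)
    qed
    then show "lookup \<kappa> (Tv i) = 0" by (simp add: in_keys_iff)
  qed
next
  assume *: "\<forall>i. lookup \<kappa> (Tv i) = 0"
  then have "tweight v * lookup \<kappa> v = 0" for v by (cases v) auto
  then show "tdeg \<kappa> = 0" by (simp add: wdeg_def)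
qed

definition t0 :: "mps \<Rightarrow> mps" where
  "t0 f = Mps (\<lambda>\<kappa>. if tdeg \<kappa> = 0 then cf f \<kappa> else 0)"

lemma cf_t0: "cf (t0 f) \<kappa> = (if tdeg \<kappa> = 0 then cf f \<kappa> else 0)"
  by (simp add: t0_def)

definition pos :: "nat \<Rightarrow> pt \<Rightarrow> bool" where
  "pos n q \<longleftrightarrow> (\<forall>i<n. fst q i > 0)"

definition bpt :: "(nat \<Rightarrow> real) \<Rightarrow> (nat \<Rightarrow> complex) \<Rightarrow> pt" where
  "bpt x z = (\<lambda>_. 0, x, z)"

locale coords =
  fixes n n' l :: nat
begin

definition V :: "var set" where
  "V = Tv ` {..<n} \<union> (Xv ` {..<n'} \<union> Zv ` {..<l})"

definition TS :: "pt set" where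
  "TS = topspace (txz_space n n' l)"

definition pd :: "pt \<Rightarrow> real \<Rightarrow> pt set" where
  "pd p r = {q \<in> TS. \<forall>v\<in>V. cmod (emb_diff p q v) < r}"

definition pf :: "pt \<Rightarrow> pt filter" where
  "pf p = (INF r\<in>{0<..}. principal (pd p r))"

definition Vsup :: "mps \<Rightarrow> bool" where
  "Vsup c \<longleftrightarrow> (\<forall>\<kappa>. cf c \<kappa> \<noteq> 0 \<longrightarrow> keys \<kappa> \<subseteq> V)"

definition expands :: "mps \<Rightarrow> (pt \<Rightarrow> complex) \<Rightarrow> pt \<Rightarrow> bool" where
  "expands c f p \<longleftrightarrow> Vsup c \<and> p \<in> TS \<and> (\<forall>\<^sub>F q in pf p. hs c (emb_diff p q) (f q))"

lemma finite_V [simp]: "finite V"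
  by (simp add: V_def)

lemma V_simps [simp]: "Tv i \<in> V \<longleftrightarrow> i < n" "Xv j \<in> V \<longleftrightarrow> j < n'" "Zv k \<in> V \<longleftrightarrow> k < l"
  by (auto simp: V_def)

lemma TS_iff: "(t, x, z) \<in> TS \<longleftrightarrow> (\<forall>i\<ge>n. t i = 0) \<and> (\<forall>j\<ge>n'. x j = 0) \<and> (\<forall>k\<ge>l. z k = 0)"
  by (simp add: TS_def txz_space_def topspace_Euclidean_space Complex_space_def)

lemma emb_outside: "q \<in> TS \<Longrightarrow> v \<notin> V \<Longrightarrow> emb q v = 0"
  by (cases q; cases v) (auto simp: TS_iff)

lemma emb_diff_outside: "p \<in> TS \<Longrightarrow> q \<in> TS \<Longrightarrow> v \<notin> V \<Longrightarrow> emb_diff p q v = 0"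
  by (simp add: emb_diff_def emb_outside)

lemma padd_in_TS: "p \<in> TS \<Longrightarrow> (\<And>v. v \<notin> V \<Longrightarrow> s v = 0) \<Longrightarrow> padd p s \<in> TS"
  by (cases p) (auto simp: TS_iff padd_def)

lemma pd_self: "p \<in> TS \<Longrightarrow> 0 < r \<Longrightarrow> p \<in> pd p r"
  by (simp add: pd_def emb_diff_def)

lemma padd_in_pd:
  "p \<in> TS \<Longrightarrow> (\<And>v. v \<notin> V \<Longrightarrow> s v = 0) \<Longrightarrow> (\<And>v. v \<in> V \<Longrightarrow> \<bar>s v\<bar> < r) \<Longrightarrow> padd p s \<in> pd p r"
  by (simp add: pd_def padd_in_TS emb_diff_padd)

lemma pd_mono: "r \<le> r' \<Longrightarrow> pd p r \<subseteq> pd p r'"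
  by (force simp: pd_def)

lemma pd_subset:
  assumes d: "\<And>v. v \<in> V \<Longrightarrow> cmod (emb_diff p q v) \<le> d" "d + r' \<le> r"
  shows "pd q r' \<subseteq> pd p r"
proof
  fix y assume y: "y \<in> pd q r'"
  have "cmod (emb_diff p y v) < r" if "v \<in> V" for v
  proof -
    have "emb_diff p y v = emb_diff p q v + emb_diff q y v" by (simp add: emb_diff_def)
    then have "cmod (emb_diff p y v) \<le> cmod (emb_diff p q v) + cmod (emb_diff q y v)"
      by (simp add: norm_triangle_ineq)
    also have "\<dots> < d + r'" using d(1)[OF that] y that by (intro add_le_less_mono) (auto simp: pd_def)
    finally show ?thesis using d(2) by simp
  qed
  then show "y \<in> pd p r" using y by (simp add: pd_def)
qed

lemma pd_margin:
  assumes "q \<in> pd p r" "0 < r"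
  shows "\<exists>d. 0 \<le> d \<and> d < r \<and> (\<forall>v\<in>V. cmod (emb_diff p q v) \<le> d)"
proof -
  let ?d = "Max (insert 0 ((\<lambda>v. cmod (emb_diff p q v)) ` V))"
  have "?d < r" using assms by (subst Max_less_iff) (auto simp: pd_def)
  moreover have "0 \<le> ?d" by (rule Max_ge) auto
  moreover have "cmod (emb_diff p q v) \<le> ?d" if "v \<in> V" for v
    using that by (intro Max_ge) auto
  ultimately show ?thesis by blast
qed

lemma eventually_pf: "eventually Q (pf p) \<longleftrightarrow> (\<exists>r>0. \<forall>q\<in>pd p r. Q q)"
  unfolding pf_def
proof (subst eventually_INF_base)
  fix a b :: real assume "a \<in> {0<..}" "b \<in> {0<..}"
  then show "\<exists>x\<in>{0<..}. principal (pd p x) \<le> inf (principal (pd p a)) (principal (pd p b))"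
    by (intro bexI[of _ "min a b"]) (use pd_mono[of "min a b" a p] pd_mono[of "min a b" b p] in auto)
qed (auto simp: eventually_principal)

lemma eventually_pf_self: "eventually Q (pf p) \<Longrightarrow> p \<in> TS \<Longrightarrow> Q p"
  unfolding eventually_pf using pd_self by blast

lemma eventually_pf_TS: "\<forall>\<^sub>F q in pf p. q \<in> TS"
  unfolding eventually_pf by (intro exI[of _ 1]) (auto simp: pd_def)

lemma eventually_pf_pf:
  assumes "eventually Q (pf p)"
  shows "\<forall>\<^sub>F q in pf p. eventually Q (pf q)"
proof -
  obtain r where r: "0 < r" "\<forall>q\<in>pd p r. Q q"
    using assms unfolding eventually_pf by blast
  show ?thesis
    unfolding eventually_pf
  proof (rule exI[of _ r], intro conjI ballI r(1))
    fix q assume q: "q \<in> pd p r"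
    obtain d where d: "0 \<le> d" "d < r" "\<And>v. v \<in> V \<Longrightarrow> cmod (emb_diff p q v) \<le> d"
      using pd_margin[OF q r(1)] by blast
    have "pd q (r - d) \<subseteq> pd p r" by (rule pd_subset[of p q d]) (use d in auto)
    then show "\<exists>r>0. \<forall>q\<in>pd q r. Q q"
      using d r(2) by (intro exI[of _ "r - d"]) auto
  qed
qed

lemma bpt_near:
  assumes "(t, x', z') \<in> pd (bpt x z) r"
  shows "bpt x' z' \<in> pd (bpt x z) r"
proof -
  have "cmod (emb_diff (bpt x z) (bpt x' z') v) < r" if "v \<in> V" for v
  proof -
    have "cmod (emb_diff (bpt x z) (bpt x' z') v) \<le> cmod (emb_diff (bpt x z) (t, x', z') v)"
      by (cases v) (auto simp: emb_diff_def bpt_def)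
    then show ?thesis using assms that by (force simp: pd_def)
  qed
  then show ?thesis
    using assms by (auto simp: pd_def bpt_def TS_iff)
qed

lemma eventually_pf_bpt:
  assumes "eventually Q (pf (bpt x z))"
  shows "\<forall>\<^sub>F q in pf (bpt x z). Q (bpt (fst (snd q)) (snd (snd q)))"
  using assms bpt_near unfolding eventually_pf by fastforce

subsection \<open>Expansions\<close>

lemma Vsup_simps [simp]: "Vsup 0" "Vsup (cst a)"
  by (auto simp: Vsup_def cf_cst)

lemma Vsup_mvar [simp]: "v \<in> V \<Longrightarrow> Vsup (mvar v)"
  by (auto simp: Vsup_def cf_mvar)

lemma Vsup_add: "Vsup f \<Longrightarrow> Vsup g \<Longrightarrow> Vsup (f + g)"
  by (auto simp: Vsup_def) (metis add_0 subsetD)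

lemma Vsup_uminus: "Vsup f \<Longrightarrow> Vsup (- f)"
  by (auto simp: Vsup_def)

lemma Vsup_diff: "Vsup f \<Longrightarrow> Vsup g \<Longrightarrow> Vsup (f - g)"
  using Vsup_add[of f "- g"] by (simp add: Vsup_uminus)

lemma Vsup_sum: "(\<And>i. i \<in> I \<Longrightarrow> Vsup (f i)) \<Longrightarrow> Vsup (sum f I)"
  by (induction I rule: infinite_finite_induct) (auto intro: Vsup_add)

lemma keys_mindex_add: "keys (a + b :: mindex) = keys a \<union> keys b"
  by (auto simp: in_keys_iff lookup_add)

lemma Vsup_mult: "Vsup f \<Longrightarrow> Vsup g \<Longrightarrow> Vsup (f * g)"
  unfolding Vsup_def
proof (intro allI impI)
  fix \<kappa> assume fg: "\<forall>\<kappa>. cf f \<kappa> \<noteq> 0 \<longrightarrow> keys \<kappa> \<subseteq> V" "\<forall>\<kappa>. cf g \<kappa> \<noteq> 0 \<longrightarrow> keys \<kappa> \<subseteq> V" "cf (f * g) \<kappa> \<noteq> 0"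
  then obtain p where p: "p \<in> splits \<kappa>" "(case p of (a, b) \<Rightarrow> cf f a * cf g b) \<noteq> 0"
    unfolding cf_mult by (metis (no_types, lifting) sum.neutral)
  obtain a b where ab: "p = (a, b)" by (cases p)
  have \<kappa>: "\<kappa> = a + b" and nz: "cf f a \<noteq> 0" "cf g b \<noteq> 0"
    using p unfolding ab splits_def by simp_all
  have "keys a \<subseteq> V" "keys b \<subseteq> V"
    using fg(1,2) nz by simp_all
  then show "keys \<kappa> \<subseteq> V"
    by (simp add: \<kappa> keys_mindex_add)
qed

lemma Vsup_prod: "(\<And>i. i \<in> I \<Longrightarrow> Vsup (f i)) \<Longrightarrow> Vsup (prod f I)"
  using Vsup_simps(2)[of 1] by (induction I rule: infinite_finite_induct) (auto intro: Vsup_mult)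

lemma Vsup_power: "Vsup f \<Longrightarrow> Vsup (f ^ k)"
  using Vsup_simps(2)[of 1] by (induction k) (auto intro: Vsup_mult)

lemma Vsup_eul: "Vsup f \<Longrightarrow> Vsup (eul v f)"
  by (auto simp: Vsup_def)

lemma Vsup_D: "Vsup f \<Longrightarrow> Vsup (D v f)"
  unfolding Vsup_def cf_D by (metis keys_mindex_add le_sup_iff mult_zero_right)

lemma Vsup_t0: "Vsup f \<Longrightarrow> Vsup (t0 f)"
  by (auto simp: Vsup_def cf_t0)

lemma Vsup_recenter:
  assumes "Vsup f"
  shows "Vsup (recenter \<eta> f)"
  unfolding Vsup_def
proof (intro allI impI)
  fix \<mu> assume *: "cf (recenter \<eta> f) \<mu> \<noteq> 0"
  have "\<exists>\<kappa>. cf f \<kappa> * cf (shifted_mon \<eta> \<kappa>) \<mu> \<noteq> 0"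
  proof (rule ccontr)
    assume "\<nexists>\<kappa>. cf f \<kappa> * cf (shifted_mon \<eta> \<kappa>) \<mu> \<noteq> 0"
    then have "(\<lambda>\<kappa>. cf f \<kappa> * cf (shifted_mon \<eta> \<kappa>) \<mu>) = (\<lambda>_. 0)" by auto
    then show False using * by (simp add: recenter_def)
  qed
  then obtain \<kappa> where "cf f \<kappa> \<noteq> 0" "cf (shifted_mon \<eta> \<kappa>) \<mu> \<noteq> 0" by auto
  then show "keys \<mu> \<subseteq> V"
    using assms cf_shifted_mon_eq_0[of \<kappa> _ \<mu> \<eta>] by (auto simp: Vsup_def in_keys_iff) (metis in_keys_iff subsetD)
qed

lemma hs_cong_Vsup:
  assumes "Vsup c" "\<And>v. v \<in> V \<Longrightarrow> \<zeta> v = \<zeta>' v"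
  shows "hs c \<zeta> y \<longleftrightarrow> hs c \<zeta>' y"
  unfolding hs_def
proof (rule has_sum_cong)
  fix \<kappa>
  have "mon \<kappa> \<zeta> = mon \<kappa> \<zeta>'" if "keys \<kappa> \<subseteq> V"
    unfolding mon_def using assms(2) that by (intro prod.cong) auto
  then show "cf c \<kappa> * mon \<kappa> \<zeta> = cf c \<kappa> * mon \<kappa> \<zeta>'"
    using assms(1) by (cases "cf c \<kappa> = 0") (auto simp: Vsup_def)
qed

lemma expandsI: "Vsup c \<Longrightarrow> p \<in> TS \<Longrightarrow> (\<forall>\<^sub>F q in pf p. hs c (emb_diff p q) (f q)) \<Longrightarrow> expands c f p"
  by (simp add: expands_def)

lemma expandsD: "expands c f p \<Longrightarrow> \<forall>\<^sub>F q in pf p. hs c (emb_diff p q) (f q)"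
  by (simp add: expands_def)

lemma expands_cong:
  assumes "expands c f p" "\<forall>\<^sub>F q in pf p. f q = g q"
  shows "expands c g p"
proof -
  have "\<forall>\<^sub>F q in pf p. hs c (emb_diff p q) (g q)"
    using expandsD[OF assms(1)] assms(2) by eventually_elim simp
  then show ?thesis using assms(1) by (simp add: expands_def)
qed

lemma expands_binary:
  assumes "expands c f p" "expands d g p" "Vsup e"
    and "\<And>\<zeta> a b. hs c \<zeta> a \<Longrightarrow> hs d \<zeta> b \<Longrightarrow> hs e \<zeta> (F a b)"
  shows "expands e (\<lambda>q. F (f q) (g q)) p"
proof -
  have "\<forall>\<^sub>F q in pf p. hs e (emb_diff p q) (F (f q) (g q))"
    using expandsD[OF assms(1)] expandsD[OF assms(2)] by eventually_elim (rule assms(4))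
  then show ?thesis using assms by (simp add: expands_def)
qed

lemma expands_Vsup: "expands c f p \<Longrightarrow> Vsup c" and expands_TS: "expands c f p \<Longrightarrow> p \<in> TS"
  by (simp_all add: expands_def)

lemma expands_add: "expands c f p \<Longrightarrow> expands d g p \<Longrightarrow> expands (c + d) (\<lambda>q. f q + g q) p"
  by (rule expands_binary[where F = "(+)"]) (auto intro: Vsup_add expands_Vsup hs_add)

lemma expands_diff: "expands c f p \<Longrightarrow> expands d g p \<Longrightarrow> expands (c - d) (\<lambda>q. f q - g q) p"
  by (rule expands_binary[where F = "(-)"]) (auto intro: Vsup_diff expands_Vsup hs_diff)

lemma expands_mult: "expands c f p \<Longrightarrow> expands d g p \<Longrightarrow> expands (c * d) (\<lambda>q. f q * g q) p"
  by (rule expands_binary[where F = "(*)"]) (auto intro: Vsup_mult expands_Vsup hs_mult)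

lemma expands_cst: "p \<in> TS \<Longrightarrow> expands (cst a) (\<lambda>_. a) p"
  by (simp add: expands_def hs_cst)

lemma expands_0: "p \<in> TS \<Longrightarrow> expands 0 (\<lambda>_. 0) p"
  using expands_cst[of p 0] by simp

lemma expands_sum:
  "(\<And>i. i \<in> I \<Longrightarrow> expands (c i) (f i) p) \<Longrightarrow> p \<in> TS \<Longrightarrow> expands (sum c I) (\<lambda>q. \<Sum>i\<in>I. f i q) p"
  by (induction I rule: infinite_finite_induct) (auto intro: expands_add expands_0)

lemma expands_eqD:
  assumes "expands c f p" "expands c g p"
  shows "\<forall>\<^sub>F q in pf p. f q = g q"
  using expandsD[OF assms(1)] expandsD[OF assms(2)] by eventually_elim (rule hs_unique)

lemma expands_at:
  assumes "expands c f p"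
  shows "f p = cf c 0"
proof -
  have "hs c (emb_diff p p) (f p)"
    using eventually_pf_self[OF expandsD[OF assms] expands_TS[OF assms]] .
  moreover have "emb_diff p p = (\<lambda>_. 0)" by (simp add: emb_diff_def fun_eq_iff)
  ultimately show ?thesis
    using hs_at_0 hs_unique by fastforce
qed

lemma expands_unique_positive:
  assumes "expands c f p"
    and "\<forall>\<^sub>F q in pf p. (\<forall>v\<in>V. 0 < Re (emb_diff p q v)) \<longrightarrow> f q = 0"
  shows "c = 0"
proof -
  have "\<forall>\<^sub>F q in pf p. (\<forall>v\<in>V. 0 < Re (emb_diff p q v)) \<longrightarrow> hs c (emb_diff p q) 0"
    using expandsD[OF assms(1)] assms(2) by eventually_elim auto
  then obtain r where r: "0 < r" "\<And>q. q \<in> pd p r \<Longrightarrow> (\<forall>v\<in>V. 0 < Re (emb_diff p q v)) \<Longrightarrow> hs c (emb_diff p q) 0"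
    unfolding eventually_pf by auto
  have p: "p \<in> TS" "Vsup c" using assms(1) by (auto simp: expands_def)
  show ?thesis
  proof (rule hs_eq_0_imp_eq_0[OF finite_V _ r(1)])
    show "keys \<kappa> \<subseteq> V" if "cf c \<kappa> \<noteq> 0" for \<kappa>
      using that p by (auto simp: Vsup_def)
    fix s :: "var \<Rightarrow> real"
    assume s: "\<And>v. v \<in> V \<Longrightarrow> 0 < s v" "\<And>v. v \<in> V \<Longrightarrow> s v < r" "\<And>v. v \<notin> V \<Longrightarrow> s v = 0"
    have "padd p s \<in> pd p r"
      by (rule padd_in_pd) (use s p in \<open>auto simp: abs_of_pos\<close>)
    then show "hs c (\<lambda>v. of_real (s v)) 0"
      using r(2)[of "padd p s"] s(1) by (simp add: emb_diff_padd)
  qed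
qed

lemma expands_zero: "expands c f p \<Longrightarrow> \<forall>\<^sub>F q in pf p. f q = 0 \<Longrightarrow> c = 0"
  by (rule expands_unique_positive) (auto elim: eventually_mono)

lemma expands_zero_pos:
  assumes "expands c f (bpt x z)" "\<forall>\<^sub>F q in pf (bpt x z). pos n q \<longrightarrow> f q = 0"
  shows "c = 0"
  using assms(1)
proof (rule expands_unique_positive)
  show "\<forall>\<^sub>F q in pf (bpt x z). (\<forall>v\<in>V. 0 < Re (emb_diff (bpt x z) q v)) \<longrightarrow> f q = 0"
    using assms(2)
  proof eventually_elim
    case (elim q)
    show ?case
    proof
      assume *: "\<forall>v\<in>V. 0 < Re (emb_diff (bpt x z) q v)"
      have "pos n q"
        unfolding pos_def
      proof (intro allI impI)
        fix i assume "i < n"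
        then show "0 < fst q i" using *[rule_format, of "Tv i"] by (cases q) (simp add: emb_diff_def bpt_def)
      qed
      then show "f q = 0" using elim by simp
    qed
  qed
qed

lemma bd_of_hs_pd:
  assumes "Vsup c" "p \<in> TS" "0 < r" "\<And>q. q \<in> pd p r \<Longrightarrow> hs c (emb_diff p q) (f q)"
    and s: "\<And>v. v \<in> V \<Longrightarrow> 0 \<le> s v \<and> s v < r"
  shows "\<exists>B. bd (\<lambda>\<kappa>. mon \<kappa> s) c B"
proof -
  let ?s = "\<lambda>v. if v \<in> V then s v else 0"
  have "padd p ?s \<in> pd p r" by (rule padd_in_pd) (use s assms(2) in auto)
  then have "hs c (\<lambda>v. of_real (?s v)) (f (padd p ?s))"
    using assms(4)[of "padd p ?s"] by (simp add: emb_diff_padd)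
  then obtain B where B: "bd (mon_abs (\<lambda>v. of_real (?s v))) c B"
    using hs_imp_bd by blast
  have "bd (\<lambda>\<kappa>. mon \<kappa> s) c B"
  proof (rule bd_mono[OF B])
    fix \<kappa> assume "cf c \<kappa> \<noteq> 0"
    then have "keys \<kappa> \<subseteq> V" using assms(1) by (auto simp: Vsup_def)
    then have "mon \<kappa> s = mon \<kappa> (\<lambda>v. cmod (of_real (?s v)))"
      unfolding mon_def using s by (intro prod.cong) auto
    then show "cmod (cf c \<kappa>) * mon \<kappa> s \<le> cmod (cf c \<kappa>) * mon_abs (\<lambda>v. of_real (?s v)) \<kappa>" by simp
  qed (auto intro: mon_nonneg)
  then show ?thesis by blast
qed

definition conv :: "mps \<Rightarrow> bool" where
  "conv c \<longleftrightarrow> (\<exists>s>0. \<exists>B. bd (\<lambda>\<kappa>. s ^ deg \<kappa>) c B)"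

lemma expands_conv:
  assumes "expands c f p"
  shows "conv c"
proof -
  obtain r where r: "0 < r" "\<And>q. q \<in> pd p r \<Longrightarrow> hs c (emb_diff p q) (f q)"
    using expandsD[OF assms] by (auto simp: eventually_pf)
  have "\<exists>B. bd (\<lambda>\<kappa>. mon \<kappa> (\<lambda>_. r / 2)) c B"
    using assms r by (intro bd_of_hs_pd[of c p r f]) (auto simp: expands_def)
  then show ?thesis
    unfolding conv_def using r(1) by (intro exI[of _ "r / 2"]) (simp add: mon_const)
qed

definition psum :: "mps \<Rightarrow> pt \<Rightarrow> pt \<Rightarrow> complex" where
  "psum c p q = infsum (\<lambda>\<kappa>. cf c \<kappa> * mon \<kappa> (emb_diff p q)) UNIV"

lemma hs_psum:
  assumes "Vsup c" "p \<in> TS" "bd (\<lambda>\<kappa>. s ^ deg \<kappa>) c B" "0 < s" "q \<in> pd p s"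
  shows "hs c (emb_diff p q) (psum c p q)"
  unfolding psum_def
proof (rule bd_imp_hs, rule bd_mono[OF assms(3)])
  fix \<kappa> assume "cf c \<kappa> \<noteq> 0"
  then have "keys \<kappa> \<subseteq> V" using assms(1) by (auto simp: Vsup_def)
  then have "mon_abs (emb_diff p q) \<kappa> \<le> mon \<kappa> (\<lambda>_. s)"
    unfolding mon_def using assms(5) by (intro prod_mono conjI power_mono) (auto simp: pd_def intro: less_imp_le)
  then show "cmod (cf c \<kappa>) * mon_abs (emb_diff p q) \<kappa> \<le> cmod (cf c \<kappa>) * s ^ deg \<kappa>"
    by (intro mult_left_mono) (auto simp: mon_const)
qed (use assms(4) in auto)

lemma conv_expands:
  assumes "Vsup c" "p \<in> TS" "conv c"
  shows "expands c (psum c p) p"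
proof -
  obtain s B where "0 < s" "bd (\<lambda>\<kappa>. s ^ deg \<kappa>) c B" using assms(3) by (auto simp: conv_def)
  then have "\<forall>q\<in>pd p s. hs c (emb_diff p q) (psum c p q)"
    using hs_psum[OF assms(1,2)] by blast
  then show ?thesis
    using assms \<open>0 < s\<close> unfolding expands_def eventually_pf by blast
qed

lemma psum_eq: "hs c (emb_diff p q) y \<Longrightarrow> psum c p q = y"
  by (auto simp: hs_def psum_def intro: infsumI)

lemma hs_recenter_pd:
  assumes "Vsup c" "p \<in> TS" "0 < r" "\<And>q. q \<in> pd p r \<Longrightarrow> hs c (emb_diff p q) (f q)"
    and q0: "q0 \<in> pd p r" "\<And>v. v \<in> V \<Longrightarrow> cmod (emb_diff p q0 v) \<le> d" and q: "q \<in> pd q0 (r - d)"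
  shows "hs (recenter (emb_diff p q0) c) (emb_diff q0 q) (f q)"
    and "mon \<mu> (emb_diff q0 q) \<noteq> 0 \<Longrightarrow>
      (\<lambda>\<kappa>. cf c \<kappa> * cf (shifted_mon (emb_diff p q0) \<kappa>) \<mu>) summable_on UNIV"
proof -
  have "\<exists>B. bd (\<lambda>\<kappa>. mon \<kappa> (\<lambda>v. cmod (emb_diff p q0 v) + cmod (emb_diff q0 q v))) c B"
  proof (rule bd_of_hs_pd[OF assms(1-4)])
    fix v assume "v \<in> V"
    then show "0 \<le> cmod (emb_diff p q0 v) + cmod (emb_diff q0 q v) \<and>
        cmod (emb_diff p q0 v) + cmod (emb_diff q0 q v) < r"
      using q0(2)[of v] q by (fastforce simp: pd_def)
  qed
  then obtain B where B: "bd (\<lambda>\<kappa>. mon \<kappa> (\<lambda>v. cmod (emb_diff p q0 v) + cmod (emb_diff q0 q v))) c B" by blast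
  have "q \<in> pd p r" using pd_subset[of p q0 d "r - d" r] q0 q by auto
  then have "hs c (emb_diff p q) (f q)" using assms(4) by blast
  moreover have "emb_diff p q = (\<lambda>v. emb_diff p q0 v + emb_diff q0 q v)"
    by (auto simp: emb_diff_def)
  ultimately show "hs (recenter (emb_diff p q0) c) (emb_diff q0 q) (f q)"
    using hs_recenter(1)[OF B] by simp
  show "(\<lambda>\<kappa>. cf c \<kappa> * cf (shifted_mon (emb_diff p q0) \<kappa>) \<mu>) summable_on UNIV" if "mon \<mu> (emb_diff q0 q) \<noteq> 0"
    using hs_recenter(2)[OF B] that by simp
qed

lemma expands_recenter:
  assumes "Vsup c" "p \<in> TS" "0 < r" "\<And>q. q \<in> pd p r \<Longrightarrow> hs c (emb_diff p q) (f q)" "q0 \<in> pd p r"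
  shows "expands (recenter (emb_diff p q0) c) f q0"
proof -
  obtain d where d: "0 \<le> d" "d < r" "\<And>v. v \<in> V \<Longrightarrow> cmod (emb_diff p q0 v) \<le> d"
    using pd_margin[OF assms(5,3)] by blast
  have "\<forall>\<^sub>F q in pf q0. hs (recenter (emb_diff p q0) c) (emb_diff q0 q) (f q)"
    unfolding eventually_pf
    using d hs_recenter_pd(1)[OF assms(1-4) assms(5) d(3)] by (intro exI[of _ "r - d"]) auto
  then show ?thesis
    using assms Vsup_recenter by (auto simp: expands_def pd_def)
qed

lemma expands_eventually_expands:
  assumes "expands c f p"
  shows "\<forall>\<^sub>F q in pf p. \<exists>d. expands d f q"
proof -
  obtain r where r: "0 < r" "\<And>q. q \<in> pd p r \<Longrightarrow> hs c (emb_diff p q) (f q)"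
    using expandsD[OF assms] by (auto simp: eventually_pf)
  then show ?thesis
    using assms expands_recenter[of c p r f] unfolding eventually_pf expands_def[of c] by blast
qed

subsection \<open>Differentiation of expansions\<close>

lemma hs_derivative:
  assumes c: "Vsup c" "p \<in> TS" "0 < r" "\<And>q. q \<in> pd p r \<Longrightarrow> hs c (emb_diff p q) (f q)"
    and q0: "q0 \<in> pd p r" and v: "v \<in> V"
  shows "\<exists>y. hs (D v c) (emb_diff p q0) y \<and>
    ((\<lambda>s. f (padd q0 (\<lambda>u. if u = v then s else 0))) has_vector_derivative y) (at 0)"
proof -
  obtain d where d: "0 \<le> d" "d < r" "\<And>v. v \<in> V \<Longrightarrow> cmod (emb_diff p q0 v) \<le> d"
    using pd_margin[OF q0 c(3)] by blast
  let ?c = "recenter (emb_diff p q0) c"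
  let ?e = "\<lambda>s u. if u = v then s else (0::real)"
  define b where "b k = cf ?c (Poly_Mapping.single v k)" for k
  define y where "y = cf ?c (unit_index v)"
  have q0_TS: "q0 \<in> TS" using q0 by (simp add: pd_def)
  have line: "hs ?c (\<lambda>u. of_real (?e s u)) (f (padd q0 (?e s)))"
    and summ: "s \<noteq> 0 \<Longrightarrow> (\<lambda>\<kappa>. cf c \<kappa> * cf (shifted_mon (emb_diff p q0) \<kappa>) (unit_index v)) summable_on UNIV"
    if "\<bar>s\<bar> < r - d" for s
  proof -
    have "padd q0 (?e s) \<in> pd q0 (r - d)"
      by (rule padd_in_pd) (use q0_TS that v d in auto)
    then show "hs ?c (\<lambda>u. of_real (?e s u)) (f (padd q0 (?e s)))"
      "s \<noteq> 0 \<Longrightarrow> (\<lambda>\<kappa>. cf c \<kappa> * cf (shifted_mon (emb_diff p q0) \<kappa>) (unit_index v)) summable_on UNIV"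
      using hs_recenter_pd[OF c q0 d(3), of "padd q0 (?e s)"] by (auto simp: emb_diff_padd)
  qed
  have 1: "hs (D v c) (emb_diff p q0) y"
    unfolding y_def by (rule hs_D) (use summ[of "(r - d) / 2"] d in auto)
  have sums: "(\<lambda>k. b k * of_real s ^ k) sums f (padd q0 (?e s))" if "\<bar>s\<bar> < r - d" for s
  proof -
    have inj: "inj_on (Poly_Mapping.single v :: nat \<Rightarrow> mindex) UNIV"
      by (rule injI) (metis lookup_single_eq)
    have "((\<lambda>\<kappa>. cf ?c \<kappa> * mon \<kappa> (\<lambda>u. of_real (?e s u))) has_sum f (padd q0 (?e s))) UNIV"
      using line[OF that] by (simp add: hs_def)
    also have "?this \<longleftrightarrow> ((\<lambda>\<kappa>. cf ?c \<kappa> * mon \<kappa> (\<lambda>u. of_real (?e s u))) has_sum f (padd q0 (?e s))) (range (Poly_Mapping.single v))"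
    proof (rule has_sum_cong_neutral)
      fix \<kappa> :: mindex assume \<kappa>: "\<kappa> \<in> UNIV - range (Poly_Mapping.single v)"
      have "\<exists>u. u \<noteq> v \<and> lookup \<kappa> u \<noteq> 0"
      proof (rule ccontr)
        assume "\<nexists>u. u \<noteq> v \<and> lookup \<kappa> u \<noteq> 0"
        then have "\<kappa> = Poly_Mapping.single v (lookup \<kappa> v)"
          by (auto simp: poly_mapping_eq_iff fun_eq_iff lookup_single when_def)
        then show False using \<kappa> by blast
      qed
      then obtain u where u: "u \<noteq> v" "lookup \<kappa> u \<noteq> 0" by blast
      then have "mon \<kappa> (\<lambda>u. complex_of_real (?e s u)) = 0"
        unfolding mon_def by (intro prod_zero) (auto simp: in_keys_iff zero_power intro!: bexI[of _ u])
      then show "cf ?c \<kappa> * mon \<kappa> (\<lambda>u. of_real (?e s u)) = 0" by simp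
    qed auto
    also have "\<dots> \<longleftrightarrow> (((\<lambda>\<kappa>. cf ?c \<kappa> * mon \<kappa> (\<lambda>u. of_real (?e s u))) \<circ> Poly_Mapping.single v) has_sum f (padd q0 (?e s))) UNIV"
      by (rule has_sum_reindex[OF inj])
    also have "(\<lambda>\<kappa>. cf ?c \<kappa> * mon \<kappa> (\<lambda>u. of_real (?e s u))) \<circ> Poly_Mapping.single v = (\<lambda>k. b k * of_real s ^ k)"
    proof
      fix k show "((\<lambda>\<kappa>. cf ?c \<kappa> * mon \<kappa> (\<lambda>u. of_real (?e s u))) \<circ> Poly_Mapping.single v) k = b k * of_real s ^ k"
        by (cases "k = 0") (auto simp: b_def mon_def)
    qed
    finally show ?thesis by (rule has_sum_imp_sums)
  qed
  define K where "K = (r - d) / 2"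
  have K: "0 < K" "K < r - d" using d by (auto simp: K_def)
  have "summable (\<lambda>k. b k * of_real K ^ k)"
    using sums[of K] K by (auto simp: sums_iff)
  then have "((\<lambda>x. suminf (\<lambda>k. b k * x ^ k)) has_field_derivative suminf (\<lambda>k. diffs b k * 0 ^ k)) (at (of_real 0))"
    unfolding of_real_0 by (rule termdiffs_strong) (use K in auto)
  also have "suminf (\<lambda>k. diffs b k * 0 ^ k) = y"
    by (simp only: powser_zero) (simp add: diffs_def b_def y_def unit_index_def)
  finally have "((\<lambda>s::real. suminf (\<lambda>k. b k * of_real s ^ k)) has_vector_derivative y) (at 0)"
    by (rule has_vector_derivative_real_field)
  then have "((\<lambda>s. f (padd q0 (?e s))) has_vector_derivative y) (at 0)"
  proof (rule has_vector_derivative_transform_within_open[where S = "{-K<..<K}"])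
    show "suminf (\<lambda>k. b k * of_real s ^ k) = f (padd q0 (?e s))" if "s \<in> {-K<..<K}" for s
      using sums[of s] that K by (auto simp: sums_iff)
  qed (use K in auto)
  then show ?thesis using 1 by blast
qed

end

lemma has_vector_derivative_vec:
  fixes f :: "real \<Rightarrow> 'b::real_normed_vector ^ 'm"
  assumes "\<And>i. ((\<lambda>s. f s $ i) has_vector_derivative (y $ i)) (at a)"
  shows "(f has_vector_derivative y) (at a)"
  unfolding has_vector_derivative_def has_derivative_within
proof (intro conjI vec_tendstoI)
  show "bounded_linear (\<lambda>x. x *\<^sub>R y)" by (rule bounded_linear_scaleR_left)
  fix i
  have "((\<lambda>x. (1 / norm (x - a)) *\<^sub>R (f x $ i - (f a $ i + (x - a) *\<^sub>R y $ i))) \<longlongrightarrow> 0) (at a)"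
    using assms[of i] by (simp add: has_vector_derivative_def has_derivative_within)
  then show "((\<lambda>x. ((1 / norm (x - a)) *\<^sub>R (f x - (f a + (x - a) *\<^sub>R y))) $ i) \<longlongrightarrow> 0 $ i) (at a)"
    by simp
qed

context coords
begin

subsection \<open>Neighbourhoods of the boundary\<close>

lemma txz_space_eq: "txz_space n n' l = top_of_set TS"
proof -
  have "txz_space n n' l = subtopology (prod_topology euclidean (prod_topology euclidean euclidean))
      ({t. \<forall>i\<ge>n. t i = 0} \<times> {x. \<forall>i\<ge>n'. x i = 0} \<times> {z. \<forall>i\<ge>l. z i = 0})"
    unfolding txz_space_def Euclidean_space_def Complex_space_def euclidean_product_topology
    by (simp add: prod_topology_subtopology subtopology_subtopology)
       (simp add: Times_Int_Times)
  also have "prod_topology euclidean (prod_topology euclidean euclidean) =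
      (euclidean :: pt topology)"
    by simp
  also have "{t. \<forall>i\<ge>n. t i = 0} \<times> {x. \<forall>i\<ge>n'. x i = 0} \<times> {z. \<forall>i\<ge>l. z i = 0} = TS"
    by (auto simp: TS_iff)
  finally show ?thesis .
qed

lemma continuous_on_emb: "continuous_on S (\<lambda>q. emb q v)"
proof (cases v)
  case (Tv i)
  have "continuous_on S (\<lambda>q. complex_of_real (fst q i))"
    by (intro continuous_intros continuous_on_product_then_coordinatewise)
  moreover have "emb q (Tv i) = complex_of_real (fst q i)" for q by (cases q) simp
  ultimately show ?thesis by (simp add: Tv)
next
  case (Xv j)
  have "continuous_on S (\<lambda>q. complex_of_real (fst (snd q) j))"
    by (intro continuous_intros continuous_on_product_then_coordinatewise)
  moreover have "emb q (Xv j) = complex_of_real (fst (snd q) j)" for q by (cases q) simp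
  ultimately show ?thesis by (simp add: Xv)
next
  case (Zv k)
  have "continuous_on S (\<lambda>q. snd (snd q) k)"
    by (intro continuous_intros continuous_on_product_then_coordinatewise)
  moreover have "emb q (Zv k) = snd (snd q) k" for q by (cases q) simp
  ultimately show ?thesis by (simp add: Zv)
qed

lemma openin_pd: "openin (top_of_set TS) (pd p r)"
proof -
  have "open {q. \<forall>v\<in>V. cmod (emb_diff p q v) < r}"
  proof -
    have "open {q. cmod (emb_diff p q v) < r}" for v
      unfolding emb_diff_def
      by (intro open_Collect_less continuous_intros continuous_on_emb)
    then have "open (\<Inter>v\<in>V. {q. cmod (emb_diff p q v) < r})"
      by (intro open_INT) auto
    also have "(\<Inter>v\<in>V. {q. cmod (emb_diff p q v) < r}) = {q. \<forall>v\<in>V. cmod (emb_diff p q v) < r}"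
      by auto
    finally show ?thesis .
  qed
  then show ?thesis
    unfolding openin_open pd_def by (intro exI[of _ "{q. \<forall>v\<in>V. cmod (emb_diff p q v) < r}"]) auto
qed

lemma open_fun_ball:
  fixes S :: "(nat \<Rightarrow> 'a::metric_space) set"
  assumes "open S" "a \<in> S"
  obtains r where "0 < r" "\<And>b. (\<And>i. dist (a i) (b i) < r) \<Longrightarrow> b \<in> S"
proof -
  have "openin (product_topology (\<lambda>_. euclidean) UNIV) S"
    using assms(1) by (simp add: euclidean_product_topology)
  then obtain X where X: "a \<in> PiE UNIV X" "\<And>i. open (X i)" "finite {i. X i \<noteq> UNIV}" "PiE UNIV X \<subseteq> S"
    using product_topology_open_contains_basis[of "\<lambda>_. euclidean" UNIV S a] assms(2) by auto
  have "\<exists>r>0. ball (a i) r \<subseteq> X i" for i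
    using X(1,2) by (meson PiE_mem UNIV_I open_contains_ball)
  then obtain \<rho> where \<rho>: "\<And>i. 0 < \<rho> i" "\<And>i. ball (a i) (\<rho> i) \<subseteq> X i" by metis
  let ?r = "Min (insert 1 (\<rho> ` {i. X i \<noteq> UNIV}))"
  have "0 < ?r" using X(3) \<rho>(1) by (subst Min_gr_iff) auto
  moreover have "b \<in> S" if b: "\<And>i. dist (a i) (b i) < ?r" for b
  proof -
    have "b i \<in> X i" for i
    proof (cases "X i = UNIV")
      case False
      then have "?r \<le> \<rho> i" using X(3) by (intro Min_le) auto
      then show ?thesis using b[of i] \<rho>(2)[of i] by (meson less_le_trans mem_ball subsetD)
    qed auto
    then show ?thesis using X(4) by auto
  qed
  ultimately show thesis using that by blast
qed

lemma openin_contains_pd: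
  assumes "openin (top_of_set TS) W" "p \<in> W"
  shows "\<exists>r>0. pd p r \<subseteq> W"
proof -
  obtain G where G: "open G" "W = TS \<inter> G" using assms(1) by (auto simp: openin_open)
  obtain t x z where p: "p = (t, x, z)" by (cases p)
  have "p \<in> G" using assms(2) G(2) by blast
  then obtain A B' where AB': "open A" "open B'" "(t, x, z) \<in> A \<times> B'" "A \<times> B' \<subseteq> G"
    using open_prod_elim[OF G(1)] unfolding p by blast
  then have AB: "open A" "open B'" "t \<in> A" "(x, z) \<in> B'" "A \<times> B' \<subseteq> G" by blast+
  obtain B C where BC': "open B" "open C" "(x, z) \<in> B \<times> C" "B \<times> C \<subseteq> B'"
    using open_prod_elim[OF AB(2,4)] by blast
  then have BC: "open B" "open C" "x \<in> B" "z \<in> C" "B \<times> C \<subseteq> B'" by blast+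
  obtain r1 where r1: "0 < r1" "\<And>b. (\<And>i. dist (t i) (b i) < r1) \<Longrightarrow> b \<in> A"
    using AB(1,3) by (rule open_fun_ball) blast
  obtain r2 where r2: "0 < r2" "\<And>b. (\<And>i. dist (x i) (b i) < r2) \<Longrightarrow> b \<in> B"
    using BC(1,3) by (rule open_fun_ball) blast
  obtain r3 where r3: "0 < r3" "\<And>b. (\<And>i. dist (z i) (b i) < r3) \<Longrightarrow> b \<in> C"
    using BC(2,4) by (rule open_fun_ball) blast
  let ?r = "min r1 (min r2 r3)"
  have pTS: "p \<in> TS" using assms(2) G(2) by blast
  have "pd p ?r \<subseteq> W"
  proof
    fix q assume q: "q \<in> pd p ?r"
    obtain t' x' z' where q': "q = (t', x', z')" by (cases q)
    have close: "cmod (emb_diff p q v) < ?r" for v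
    proof (cases "v \<in> V")
      case False
      then show ?thesis
        using emb_diff_outside[OF pTS _ False, of q] q r1 r2 r3 by (simp add: pd_def)
    qed (use q in \<open>simp add: pd_def\<close>)
    have "t' \<in> A"
    proof (rule r1(2))
      show "dist (t i) (t' i) < r1" for i
        using close[of "Tv i"] by (simp add: p q' emb_diff_def dist_real_def abs_minus_commute flip: of_real_diff)
    qed
    moreover have "x' \<in> B"
    proof (rule r2(2))
      show "dist (x i) (x' i) < r2" for i
        using close[of "Xv i"] by (simp add: p q' emb_diff_def dist_real_def abs_minus_commute flip: of_real_diff)
    qed
    moreover have "z' \<in> C"
    proof (rule r3(2))
      show "dist (z i) (z' i) < r3" for i
        using close[of "Zv i"] by (simp add: p q' emb_diff_def dist_norm norm_minus_commute)
    qed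
    ultimately have "q \<in> G" using AB(5) BC(5) q' by blast
    then show "q \<in> W" using G(2) q by (simp add: pd_def)
  qed
  then show ?thesis using r1 r2 r3 by (intro exI[of _ ?r]) auto
qed

definition MU :: "((nat \<Rightarrow> real) \<times> (nat \<Rightarrow> real)) set \<Rightarrow> (nat \<Rightarrow> complex) set \<Rightarrow> pt set" where
  "MU M U = {(t, x, z). (t, x) \<in> M \<and> z \<in> U}"

lemma openin_MU:
  assumes "openin (prod_topology (Euclidean_space n) (Euclidean_space n')) M" "openin (Complex_space l) U"
  shows "openin (top_of_set TS) (MU M U)"
proof -
  let ?X = "prod_topology (Euclidean_space n) (prod_topology (Euclidean_space n') (Complex_space l))"
  have 1: "continuous_map ?X (prod_topology (Euclidean_space n) (Euclidean_space n')) (\<lambda>q. (fst q, fst (snd q)))"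
    by (intro continuous_map_pairedI continuous_map_fst continuous_map_fst_of[OF continuous_map_snd, unfolded o_def])
  have 2: "continuous_map ?X (Complex_space l) (\<lambda>q. snd (snd q))"
    by (intro continuous_map_snd_of[OF continuous_map_snd, unfolded o_def])
  have "openin ?X ({q \<in> topspace ?X. (fst q, fst (snd q)) \<in> M} \<inter> {q \<in> topspace ?X. snd (snd q) \<in> U})"
    using openin_continuous_map_preimage[OF 1 assms(1)] openin_continuous_map_preimage[OF 2 assms(2)]
    by (rule openin_Int)
  also have "{q \<in> topspace ?X. (fst q, fst (snd q)) \<in> M} \<inter> {q \<in> topspace ?X. snd (snd q) \<in> U} = MU M U"
    using openin_subset[OF assms(1)] openin_subset[OF assms(2)] by (auto simp: MU_def)
  finally show ?thesis by (simp flip: txz_space_eq txz_space_def)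
qed

lemma near_iff:
  assumes "openin (prod_topology (Euclidean_space n) (Euclidean_space n')) M" "openin (Complex_space l) U"
  shows "near n n' l M U Q \<longleftrightarrow> (\<forall>x\<in>locus M. \<forall>z\<in>U. eventually Q (pf (bpt x z)))"
proof
  assume "near n n' l M U Q"
  then obtain W where W: "openin (top_of_set TS) W" "\<And>x z. x \<in> locus M \<Longrightarrow> z \<in> U \<Longrightarrow> bpt x z \<in> W" "\<And>q. q \<in> W \<Longrightarrow> Q q"
    by (auto simp: near_def txz_space_eq bpt_def)
  show "\<forall>x\<in>locus M. \<forall>z\<in>U. eventually Q (pf (bpt x z))"
  proof (intro ballI)
    fix x z assume "x \<in> locus M" "z \<in> U"
    then have "\<exists>r>0. pd (bpt x z) r \<subseteq> W"
      using openin_contains_pd[OF W(1) W(2)] by blast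
    then show "eventually Q (pf (bpt x z))"
      using W(3) unfolding eventually_pf by blast
  qed
next
  assume *: "\<forall>x\<in>locus M. \<forall>z\<in>U. eventually Q (pf (bpt x z))"
  then obtain r where r: "\<And>x z. x \<in> locus M \<Longrightarrow> z \<in> U \<Longrightarrow> 0 < r x z"
      "\<And>x z q. x \<in> locus M \<Longrightarrow> z \<in> U \<Longrightarrow> q \<in> pd (bpt x z) (r x z) \<Longrightarrow> Q q"
    unfolding eventually_pf by metis
  let ?W = "(\<Union>x\<in>locus M. \<Union>z\<in>U. pd (bpt x z) (r x z)) \<inter> MU M U"
  have W1: "openin (top_of_set TS) ?W"
    by (intro openin_Int openin_MU[OF assms] openin_Union) (auto intro!: openin_Union openin_pd)
  have W2: "?W \<subseteq> {(t, x, z). (t, x) \<in> M \<and> z \<in> U}"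
    by (auto simp: MU_def)
  have W3: "(\<lambda>_. 0, x, z) \<in> ?W" if "x \<in> locus M" "z \<in> U" for x z
  proof -
    have MU: "bpt x z \<in> MU M U" using that by (auto simp: MU_def bpt_def locus_def)
    then have "bpt x z \<in> TS" using openin_MU[OF assms] openin_subset by fastforce
    then have "bpt x z \<in> pd (bpt x z) (r x z)" using r(1)[OF that] by (intro pd_self)
    then show ?thesis using that MU by (auto simp: bpt_def)
  qed
  have W4: "Q q" if "q \<in> ?W" for q using that r(2) by blast
  show "near n n' l M U Q"
    unfolding near_def txz_space_eq
    by (intro exI[of _ ?W] conjI ballI W1 W2 W3 W4)
qed

lemma bpt_in_TS:
  assumes "openin (prod_topology (Euclidean_space n) (Euclidean_space n')) M" "openin (Complex_space l) U"
    "x \<in> locus M" "z \<in> U"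
  shows "bpt x z \<in> TS"
proof -
  have "bpt x z \<in> MU M U" using assms(3,4) by (auto simp: MU_def bpt_def locus_def)
  then show ?thesis using openin_MU[OF assms(1,2)] openin_subset by fastforce
qed

lemma eventually_MU:
  assumes "openin (prod_topology (Euclidean_space n) (Euclidean_space n')) M" "openin (Complex_space l) U"
    "x \<in> locus M" "z \<in> U"
  shows "\<forall>\<^sub>F q in pf (bpt x z). q \<in> MU M U"
proof -
  have "bpt x z \<in> MU M U" using assms(3,4) by (auto simp: MU_def bpt_def locus_def)
  then show ?thesis
    using openin_contains_pd[OF openin_MU[OF assms(1,2)]] unfolding eventually_pf by blast
qed

lemma near_pos_iff:
  assumes "openin (prod_topology (Euclidean_space n) (Euclidean_space n')) M" "openin (Complex_space l) U"
  shows "near_pos n n' l M U Q \<longleftrightarrow> (\<forall>x\<in>locus M. \<forall>z\<in>U. \<forall>\<^sub>F q in pf (bpt x z). pos n q \<longrightarrow> Q q)"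
  unfolding near_pos_def near_iff[OF assms] by (simp add: pos_def case_prod_unfold)

subsection \<open>Analyticity and expansions\<close>

definition indices_of :: "mindex \<Rightarrow> (nat \<Rightarrow> nat) \<times> (nat \<Rightarrow> nat) \<times> (nat \<Rightarrow> nat)" where
  "indices_of \<kappa> = (\<lambda>i. lookup \<kappa> (Tv i), \<lambda>j. lookup \<kappa> (Xv j), \<lambda>k. lookup \<kappa> (Zv k))"

definition index_of :: "(nat \<Rightarrow> nat) \<times> (nat \<Rightarrow> nat) \<times> (nat \<Rightarrow> nat) \<Rightarrow> mindex" where
  "index_of = (\<lambda>(\<alpha>, \<beta>, \<delta>). Abs_poly_mapping (\<lambda>v. case v of Tv i \<Rightarrow> \<alpha> i | Xv j \<Rightarrow> \<beta> j | Zv k \<Rightarrow> \<delta> k))"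

lemma lookup_index_of:
  assumes "(\<alpha>, \<beta>, \<delta>) \<in> multi_indices n \<times> multi_indices n' \<times> multi_indices l"
  shows "lookup (index_of (\<alpha>, \<beta>, \<delta>)) v = (case v of Tv i \<Rightarrow> \<alpha> i | Xv j \<Rightarrow> \<beta> j | Zv k \<Rightarrow> \<delta> k)"
proof -
  have "{v. (case v of Tv i \<Rightarrow> \<alpha> i | Xv j \<Rightarrow> \<beta> j | Zv k \<Rightarrow> \<delta> k) \<noteq> 0} \<subseteq> V"
  proof (rule subsetI, rule ccontr)
    fix v assume "v \<in> {v. (case v of Tv i \<Rightarrow> \<alpha> i | Xv j \<Rightarrow> \<beta> j | Zv k \<Rightarrow> \<delta> k) \<noteq> 0}" "v \<notin> V"
    then show False using assms by (cases v) (auto simp: multi_indices_def)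
  qed
  then have "finite {v. (case v of Tv i \<Rightarrow> \<alpha> i | Xv j \<Rightarrow> \<beta> j | Zv k \<Rightarrow> \<delta> k) \<noteq> 0}"
    using finite_V finite_subset by blast
  then show ?thesis
    by (simp add: index_of_def)
qed

lemma index_of_bij:
  "a \<in> multi_indices n \<times> multi_indices n' \<times> multi_indices l \<Longrightarrow> indices_of (index_of a) = a"
  "a \<in> multi_indices n \<times> multi_indices n' \<times> multi_indices l \<Longrightarrow> keys (index_of a) \<subseteq> V"
  "keys \<kappa> \<subseteq> V \<Longrightarrow> index_of (indices_of \<kappa>) = \<kappa>"
  "keys \<kappa> \<subseteq> V \<Longrightarrow> indices_of \<kappa> \<in> multi_indices n \<times> multi_indices n' \<times> multi_indices l"
proof -
  show 4: "indices_of \<kappa> \<in> multi_indices n \<times> multi_indices n' \<times> multi_indices l" if "keys \<kappa> \<subseteq> V" for \<kappa>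
  proof -
    have "lookup \<kappa> v = 0" if "v \<notin> V" for v
      using that \<open>keys \<kappa> \<subseteq> V\<close> by (auto simp: in_keys_iff)
    then show ?thesis by (auto simp: indices_of_def multi_indices_def)
  qed
  show "indices_of (index_of a) = a" if "a \<in> multi_indices n \<times> multi_indices n' \<times> multi_indices l"
  proof -
    obtain \<alpha> \<beta> \<delta> where a: "a = (\<alpha>, \<beta>, \<delta>)" by (cases a)
    show ?thesis using lookup_index_of[OF that[unfolded a]] by (simp add: a indices_of_def)
  qed
  show "keys (index_of a) \<subseteq> V" if "a \<in> multi_indices n \<times> multi_indices n' \<times> multi_indices l"
  proof
    obtain \<alpha> \<beta> \<delta> where a: "a = (\<alpha>, \<beta>, \<delta>)" by (cases a)
    fix v assume v: "v \<in> keys (index_of a)"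
    show "v \<in> V"
    proof (rule ccontr)
      assume "v \<notin> V"
      then show False
        using v lookup_index_of[OF that[unfolded a], of v] that
        by (cases v) (auto simp: a in_keys_iff multi_indices_def)
    qed
  qed
  show "index_of (indices_of \<kappa>) = \<kappa>" if "keys \<kappa> \<subseteq> V"
  proof (rule poly_mapping_eqI)
    fix v show "lookup (index_of (indices_of \<kappa>)) v = lookup \<kappa> v"
      using lookup_index_of[OF 4[OF that, unfolded indices_of_def]]
      by (cases v) (auto simp: indices_of_def)
  qed
qed

lemma mon_indices:
  assumes "keys \<kappa> \<subseteq> V"
  shows "mon \<kappa> \<zeta> = mpow n (\<lambda>i. \<zeta> (Tv i)) (fst (indices_of \<kappa>)) *
    mpow n' (\<lambda>j. \<zeta> (Xv j)) (fst (snd (indices_of \<kappa>))) * mpow l (\<lambda>k. \<zeta> (Zv k)) (snd (snd (indices_of \<kappa>)))"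
proof -
  have inj: "inj_on Tv A" "inj_on Xv A" "inj_on Zv A" for A by (auto simp: inj_on_def)
  have "mon \<kappa> \<zeta> = (\<Prod>v\<in>V. \<zeta> v ^ lookup \<kappa> v)"
    using assms by (rule mon_superset[OF finite_V])
  also have "\<dots> = (\<Prod>v\<in>Tv ` {..<n}. \<zeta> v ^ lookup \<kappa> v) *
      ((\<Prod>v\<in>Xv ` {..<n'}. \<zeta> v ^ lookup \<kappa> v) * (\<Prod>v\<in>Zv ` {..<l}. \<zeta> v ^ lookup \<kappa> v))"
    unfolding V_def
    by (subst prod.union_disjoint, simp, simp, blast, subst prod.union_disjoint, simp, simp, blast, rule refl)
  finally show ?thesis
    by (simp add: prod.reindex[OF inj(1)] prod.reindex[OF inj(2)] prod.reindex[OF inj(3)]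
        mpow_def indices_of_def mult.assoc)
qed

lemma hs_indices:
  fixes t x t' x' :: "nat \<Rightarrow> real"
  assumes "\<And>\<kappa>. keys \<kappa> \<subseteq> V \<Longrightarrow> cf c \<kappa> = (case indices_of \<kappa> of (\<alpha>, \<beta>, \<delta>) \<Rightarrow> a \<alpha> \<beta> \<delta>)"
    and "Vsup c"
  shows "hs c (emb_diff (t, x, z) (t', x', z')) y \<longleftrightarrow>
    ((\<lambda>(\<alpha>, \<beta>, \<delta>). a \<alpha> \<beta> \<delta> * of_real (mpow n (\<lambda>i. t' i - t i) \<alpha>)
            * of_real (mpow n' (\<lambda>j. x' j - x j) \<beta>) * mpow l (\<lambda>k. z' k - z k) \<delta>)
         has_sum y) (multi_indices n \<times> multi_indices n' \<times> multi_indices l)"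
proof -
  let ?\<zeta> = "emb_diff (t, x, z) (t', x', z')"
  let ?f = "\<lambda>(\<alpha>, \<beta>, \<delta>). a \<alpha> \<beta> \<delta> * of_real (mpow n (\<lambda>i. t' i - t i) \<alpha>)
            * of_real (mpow n' (\<lambda>j. x' j - x j) \<beta>) * mpow l (\<lambda>k. z' k - z k) \<delta>"
  have "hs c ?\<zeta> y \<longleftrightarrow> ((\<lambda>\<kappa>. cf c \<kappa> * mon \<kappa> ?\<zeta>) has_sum y) {\<kappa>. keys \<kappa> \<subseteq> V}"
    unfolding hs_def by (rule has_sum_cong_neutral) (use assms(2) in \<open>auto simp: Vsup_def\<close>)
  also have "\<dots> \<longleftrightarrow> (?f has_sum y) (multi_indices n \<times> multi_indices n' \<times> multi_indices l)"
  proof (rule has_sum_reindex_bij_witness[of _ index_of indices_of])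
    fix \<kappa> assume "\<kappa> \<in> {\<kappa>. keys \<kappa> \<subseteq> V}"
    then have k: "keys \<kappa> \<subseteq> V" by simp
    show "?f (indices_of \<kappa>) = cf c \<kappa> * mon \<kappa> ?\<zeta>"
      unfolding assms(1)[OF k] mon_indices[OF k]
      by (simp add: emb_diff_def case_prod_unfold mpow_def mult.assoc)
  qed (use index_of_bij in auto)
  finally show ?thesis .
qed

lemma pd_iff:
  "(t', x', z') \<in> pd (t, x, z) r \<longleftrightarrow> (t', x', z') \<in> topspace (txz_space n n' l) \<and>
    (\<forall>i<n. \<bar>t' i - t i\<bar> < r) \<and> (\<forall>j<n'. \<bar>x' j - x j\<bar> < r) \<and> (\<forall>k<l. cmod (z' k - z k) < r)"
proof -
  have "(\<forall>v\<in>V. Q v) \<longleftrightarrow> (\<forall>i<n. Q (Tv i)) \<and> (\<forall>j<n'. Q (Xv j)) \<and> (\<forall>k<l. Q (Zv k))" for Q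
    by (auto simp: V_def)
  then show ?thesis
    unfolding pd_def TS_def by (simp add: emb_diff_def flip: of_real_diff)
qed

lemma analytic_iff_expands:
  assumes "p \<in> TS"
  shows "analytic_at_pt n n' l f p \<longleftrightarrow> (\<exists>c. expands c f p)"
proof -
  obtain t x z where p: "p = (t, x, z)" by (cases p)
  show ?thesis
  proof
    assume "analytic_at_pt n n' l f p"
    then obtain r a where r: "r > 0" and a0: "\<forall>(t', x', z') \<in> topspace (txz_space n n' l).
       (\<forall>i<n. \<bar>t' i - t i\<bar> < r) \<and> (\<forall>j<n'. \<bar>x' j - x j\<bar> < r) \<and> (\<forall>k<l. cmod (z' k - z k) < r) \<longrightarrow>
       ((\<lambda>(\<alpha>, \<beta>, \<delta>). a \<alpha> \<beta> \<delta> * of_real (mpow n (\<lambda>i. t' i - t i) \<alpha>)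
            * of_real (mpow n' (\<lambda>j. x' j - x j) \<beta>) * mpow l (\<lambda>k. z' k - z k) \<delta>)
         has_sum f (t', x', z')) (multi_indices n \<times> multi_indices n' \<times> multi_indices l)"
      unfolding analytic_at_pt_def p prod.case by (elim exE conjE)
    have a: "((\<lambda>(\<alpha>, \<beta>, \<delta>). a \<alpha> \<beta> \<delta> * of_real (mpow n (\<lambda>i. t' i - t i) \<alpha>)
            * of_real (mpow n' (\<lambda>j. x' j - x j) \<beta>) * mpow l (\<lambda>k. z' k - z k) \<delta>)
         has_sum f (t', x', z')) (multi_indices n \<times> multi_indices n' \<times> multi_indices l)"
      if "(t', x', z') \<in> pd p r" for t' x' z'
    proof -
      note 1 = that[unfolded p pd_iff]
      show ?thesis
        using bspec[OF a0 conjunct1[OF 1], unfolded prod.case] conjunct2[OF 1] by (rule mp)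
    qed
    define c where "c = Mps (\<lambda>\<kappa>. if keys \<kappa> \<subseteq> V then (case indices_of \<kappa> of (\<alpha>, \<beta>, \<delta>) \<Rightarrow> a \<alpha> \<beta> \<delta>) else 0)"
    have c: "Vsup c" by (auto simp: Vsup_def c_def split: if_splits)
    have "hs c (emb_diff p q) (f q)" if "q \<in> pd p r" for q
    proof -
      obtain t' x' z' where q: "q = (t', x', z')" by (cases q)
      show ?thesis
        unfolding p q by (subst hs_indices[OF _ c, where a = a]) (use a that q in \<open>auto simp: c_def\<close>)
    qed
    then show "\<exists>c. expands c f p"
      using r c assms unfolding expands_def eventually_pf by blast
  next
    assume "\<exists>c. expands c f p"
    then obtain c r where c: "Vsup c" and r: "r > 0" "\<And>q. q \<in> pd p r \<Longrightarrow> hs c (emb_diff p q) (f q)"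
      unfolding expands_def eventually_pf by blast
    define a where "a \<alpha> \<beta> \<delta> = cf c (index_of (\<alpha>, \<beta>, \<delta>))" for \<alpha> \<beta> \<delta>
    have coef: "cf c \<kappa> = (case indices_of \<kappa> of (\<alpha>, \<beta>, \<delta>) \<Rightarrow> a \<alpha> \<beta> \<delta>)" if "keys \<kappa> \<subseteq> V" for \<kappa>
      using index_of_bij(3)[OF that] by (simp add: a_def case_prod_unfold)
    show "analytic_at_pt n n' l f p"
      unfolding analytic_at_pt_def p prod.case
    proof (rule exI[of _ r], intro conjI r(1) exI[of _ a] ballI, clarify)
      fix t' x' z'
      assume "(t', x', z') \<in> topspace (txz_space n n' l)"
        "\<forall>i<n. \<bar>t' i - t i\<bar> < r" "\<forall>j<n'. \<bar>x' j - x j\<bar> < r" "\<forall>k<l. cmod (z' k - z k) < r"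
      then have "(t', x', z') \<in> pd p r" by (simp add: p pd_iff)
      then have "hs c (emb_diff (t, x, z) (t', x', z')) (f (t', x', z'))"
        using r(2)[of "(t', x', z')"] by (simp add: p)
      then show "((\<lambda>(\<alpha>, \<beta>, \<delta>). a \<alpha> \<beta> \<delta> * of_real (mpow n (\<lambda>i. t' i - t i) \<alpha>)
            * of_real (mpow n' (\<lambda>j. x' j - x j) \<beta>) * mpow l (\<lambda>k. z' k - z k) \<delta>)
         has_sum f (t', x', z')) (multi_indices n \<times> multi_indices n' \<times> multi_indices l)"
        by (subst (asm) hs_indices[of c a]) (use coef c in simp_all)
    qed
  qed
qed

end

lemma has_vector_derivative_shift:
  "(g has_vector_derivative y) (at (0::real)) \<Longrightarrow> ((\<lambda>s. g (s - a)) has_vector_derivative y) (at a)"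
  using vector_diff_chain_at[of "\<lambda>s. s - a" 1 a g y]
  by (simp add: o_def has_vector_derivative_diff_const)

definition twist :: "nat \<Rightarrow> ((nat \<Rightarrow> complex) \<Rightarrow> nat \<Rightarrow> complex) \<Rightarrow> pt \<Rightarrow> complex" where
  "twist n lam q = tpow n (fst q) (lam (snd (snd q)))"

definition theta_tw :: "((nat \<Rightarrow> complex) \<Rightarrow> nat \<Rightarrow> complex) \<Rightarrow> nat \<Rightarrow> (pt \<Rightarrow> complex ^ 'm) \<Rightarrow> pt \<Rightarrow> complex ^ 'm" where
  "theta_tw lam i g q = theta i g q + lam (snd (snd q)) i *s g q"

definition op_tw :: "nat \<Rightarrow> nat \<Rightarrow> 'm::finite oper \<Rightarrow> ((nat \<Rightarrow> complex) \<Rightarrow> nat \<Rightarrow> complex) \<Rightarrow> (pt \<Rightarrow> complex ^ 'm) \<Rightarrow> pt \<Rightarrow> complex ^ 'm" where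
  \<comment> \<open>the operator \<open>t^(-\<lambda>) A t^\<lambda>\<close>\<close>
  "op_tw n n' A lam w q =
     (\<Sum>(\<alpha>, \<beta>)\<in>supp A. A \<alpha> \<beta> q *v multi_iter (theta_tw lam) n \<alpha> (multi_iter dx n' \<beta> w) q)"

lemma op_tw_0:
  fixes A :: "'m::finite oper"
  shows "op_tw n n' A (\<lambda>_ _. 0) w = op_apply n n' A w"
proof -
  have eq: "theta_tw (\<lambda>_ _. 0) = (theta :: nat \<Rightarrow> (pt \<Rightarrow> complex ^ 'm) \<Rightarrow> pt \<Rightarrow> complex ^ 'm)"
    by (auto simp: theta_tw_def fun_eq_iff vec_eq_iff)
  show ?thesis by (rule ext) (simp only: op_tw_def op_apply_def eq)
qed

definition th :: "(nat \<Rightarrow> mps) \<Rightarrow> nat \<Rightarrow> mps \<Rightarrow> mps" where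
  "th L i f = eul (Tv i) f + L i * f"

abbreviation dX :: "nat \<Rightarrow> mps \<Rightarrow> mps" where
  "dX j \<equiv> D (Xv j)"

context coords
begin

definition mit :: "(nat \<Rightarrow> mps) \<Rightarrow> (nat \<Rightarrow> nat) \<Rightarrow> (nat \<Rightarrow> nat) \<Rightarrow> mps \<Rightarrow> mps" where
  "mit L \<alpha> \<beta> f = multi_iter (th L) n \<alpha> (multi_iter dX n' \<beta> f)"

definition fop :: "((nat \<Rightarrow> nat) \<times> (nat \<Rightarrow> nat)) set \<Rightarrow> ((nat \<Rightarrow> nat) \<Rightarrow> (nat \<Rightarrow> nat) \<Rightarrow> mps ^ 'm ^ 'm) \<Rightarrow>
    (nat \<Rightarrow> mps) \<Rightarrow> mps ^ 'm \<Rightarrow> mps ^ 'm" where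
  "fop S a L w = (\<chi> i. \<Sum>(\<alpha>, \<beta>)\<in>S. \<Sum>j\<in>UNIV. a \<alpha> \<beta> $ i $ j * mit L \<alpha> \<beta> (w $ j))"

definition expV :: "mps ^ 'm \<Rightarrow> (pt \<Rightarrow> complex ^ 'm) \<Rightarrow> pt \<Rightarrow> bool" where
  "expV c w p \<longleftrightarrow> (\<forall>k. expands (c $ k) (\<lambda>q. w q $ k) p)"

lemma expV_cong:
  assumes "expV c f p" "\<forall>\<^sub>F q in pf p. f q = g q"
  shows "expV c g p"
  unfolding expV_def
proof
  fix k
  show "expands (c $ k) (\<lambda>q. g q $ k) p"
    by (rule expands_cong[of _ "\<lambda>q. f q $ k"]) (use assms in \<open>auto simp: expV_def elim: eventually_mono\<close>)
qed

lemma expV_zero_pos: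
  fixes c :: "mps ^ 'm::finite"
  assumes "expV c f (bpt x z)" "\<forall>\<^sub>F q in pf (bpt x z). pos n q \<longrightarrow> f q = 0"
  shows "c = 0"
proof -
  have "c $ k = 0" for k
    by (rule expands_zero_pos[of _ "\<lambda>q. f q $ k"]) (use assms in \<open>auto simp: expV_def elim: eventually_mono\<close>)
  then show ?thesis by (simp add: vec_eq_iff)
qed

lemma expV_unique_pos:
  fixes c :: "mps ^ 'm::finite"
  assumes "expV c f (bpt x z)" "expV d g (bpt x z)" "\<forall>\<^sub>F q in pf (bpt x z). pos n q \<longrightarrow> f q = g q"
  shows "c = d"
proof -
  have "expV (c - d) (\<lambda>q. f q - g q) (bpt x z)"
    using assms(1,2) by (auto simp: expV_def intro: expands_diff)
  then have "c - d = 0"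
    by (rule expV_zero_pos) (use assms(3) in \<open>auto elim: eventually_mono\<close>)
  then show ?thesis by simp
qed

lemma expV_eqD:
  fixes c :: "mps ^ 'm::finite"
  assumes "expV c f p" "expV c g p"
  shows "\<forall>\<^sub>F q in pf p. f q = g q"
proof -
  have "\<forall>\<^sub>F q in pf p. \<forall>k. f q $ k = g q $ k"
  proof (rule eventually_all_finite)
    fix k
    show "\<forall>\<^sub>F q in pf p. f q $ k = g q $ k"
      using assms unfolding expV_def by (intro expands_eqD[of "c $ k" "\<lambda>q. f q $ k" p "\<lambda>q. g q $ k"]) blast+
  qed
  then show ?thesis by (simp add: vec_eq_iff)
qed

lemma expV_TS: "expV c f p \<Longrightarrow> p \<in> TS"
  by (auto simp: expV_def expands_def)

lemma expV_derivative:
  fixes c :: "mps ^ 'm::finite"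
  assumes "expV c w p" "v \<in> V"
  shows "\<forall>\<^sub>F q in pf p. \<exists>y. (\<forall>k. hs (D v (c $ k)) (emb_diff p q) (y $ k)) \<and>
    ((\<lambda>s. w (padd q (\<lambda>u. if u = v then s else 0))) has_vector_derivative y) (at 0)"
proof -
  have "\<forall>\<^sub>F q in pf p. \<forall>k. \<exists>y. hs (D v (c $ k)) (emb_diff p q) y \<and>
    ((\<lambda>s. w (padd q (\<lambda>u. if u = v then s else 0)) $ k) has_vector_derivative y) (at 0)"
  proof (rule eventually_all_finite)
    fix k
    have e: "expands (c $ k) (\<lambda>q. w q $ k) p" using assms(1) by (simp add: expV_def)
    then obtain r where r: "0 < r" "\<And>q. q \<in> pd p r \<Longrightarrow> hs (c $ k) (emb_diff p q) (w q $ k)"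
      unfolding expands_def eventually_pf by blast
    show "\<forall>\<^sub>F q in pf p. \<exists>y. hs (D v (c $ k)) (emb_diff p q) y \<and>
      ((\<lambda>s. w (padd q (\<lambda>u. if u = v then s else 0)) $ k) has_vector_derivative y) (at 0)"
      unfolding eventually_pf
      by (rule exI[of _ r], intro conjI ballI r(1))
        (rule hs_derivative[OF expands_Vsup[OF e] expands_TS[OF e] r _ assms(2)])
  qed
  then show ?thesis
  proof eventually_elim
    case (elim q)
    then obtain y where y: "\<And>k. hs (D v (c $ k)) (emb_diff p q) (y k)"
      "\<And>k. ((\<lambda>s. w (padd q (\<lambda>u. if u = v then s else 0)) $ k) has_vector_derivative y k) (at 0)" by metis
    show ?case
      by (rule exI[of _ "\<chi> k. y k"], intro conjI has_vector_derivative_vec) (use y in auto)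
  qed
qed

lemma line_X: "(\<lambda>s. w (t, x(j := s), z)) = (\<lambda>s. w (padd (t, x, z) (\<lambda>u. if u = Xv j then s - x j else 0)))"
  and line_T: "(\<lambda>s. w (t(i := s), x, z)) = (\<lambda>s. w (padd (t, x, z) (\<lambda>u. if u = Tv i then s - t i else 0)))"
  by (auto simp: padd_def fun_eq_iff intro!: arg_cong[of _ _ w])

lemma expV_dx:
  fixes c :: "mps ^ 'm::finite"
  assumes "expV c w p" "j < n'"
  shows "expV (\<chi> k. dX j (c $ k)) (dx j w) p"
    and "\<forall>\<^sub>F (t, x, z) in pf p. ((\<lambda>s. w (t, x(j := s), z)) has_vector_derivative dx j w (t, x, z)) (at (x j))"
proof -
  have v: "Xv j \<in> V" using assms(2) by simp
  have *: "\<forall>\<^sub>F q in pf p. (\<forall>k. hs (dX j (c $ k)) (emb_diff p q) (dx j w q $ k)) \<and>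
      (case q of (t, x, z) \<Rightarrow> ((\<lambda>s. w (t, x(j := s), z)) has_vector_derivative dx j w (t, x, z)) (at (x j)))"
    using expV_derivative[OF assms(1) v]
  proof eventually_elim
    case (elim q)
    obtain t x z where q: "q = (t, x, z)" by (cases q)
    from elim obtain y where y: "\<forall>k. hs (dX j (c $ k)) (emb_diff p q) (y $ k)"
      and d: "((\<lambda>s. w (padd q (\<lambda>u. if u = Xv j then s else 0))) has_vector_derivative y) (at 0)" by blast
    have "((\<lambda>s. w (t, x(j := s), z)) has_vector_derivative y) (at (x j))"
      unfolding line_X using has_vector_derivative_shift[OF d, of "x j"] by (simp add: q)
    moreover from this have "dx j w q = y"
      by (simp add: dx_def q vector_derivative_at)
    ultimately show ?case using y by (simp add: q)
  qed
  show "expV (\<chi> k. dX j (c $ k)) (dx j w) p"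
    unfolding expV_def expands_def
  proof (intro allI conjI)
    show "Vsup ((\<chi> k. dX j (c $ k)) $ k)" for k
      using assms(1) by (simp add: expV_def expands_def Vsup_D)
    show "p \<in> TS" using assms(1) by (rule expV_TS)
    show "\<forall>\<^sub>F q in pf p. hs ((\<chi> k. dX j (c $ k)) $ k) (emb_diff p q) (dx j w q $ k)" for k
      using * by eventually_elim simp
  qed
  show "\<forall>\<^sub>F (t, x, z) in pf p. ((\<lambda>s. w (t, x(j := s), z)) has_vector_derivative dx j w (t, x, z)) (at (x j))"
    using * by eventually_elim simp
qed

lemma expV_theta:
  fixes c :: "mps ^ 'm::finite"
  assumes "expV c w (bpt x0 z0)" "i < n"
  shows "expV (\<chi> k. eul (Tv i) (c $ k)) (theta i w) (bpt x0 z0)"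
    and "\<forall>\<^sub>F (t, x, z) in pf (bpt x0 z0). \<exists>y. ((\<lambda>s. w (t(i := s), x, z)) has_vector_derivative y) (at (t i))"
proof -
  let ?p = "bpt x0 z0"
  have v: "Tv i \<in> V" using assms(2) by simp
  have *: "\<forall>\<^sub>F q in pf ?p. (\<forall>k. hs (eul (Tv i) (c $ k)) (emb_diff ?p q) (theta i w q $ k)) \<and>
      (case q of (t, x, z) \<Rightarrow> \<exists>y. ((\<lambda>s. w (t(i := s), x, z)) has_vector_derivative y) (at (t i)))"
    using expV_derivative[OF assms(1) v]
  proof eventually_elim
    case (elim q)
    obtain t x z where q: "q = (t, x, z)" by (cases q)
    from elim obtain y where y: "\<forall>k. hs (D (Tv i) (c $ k)) (emb_diff ?p q) (y $ k)"
      and d: "((\<lambda>s. w (padd q (\<lambda>u. if u = Tv i then s else 0))) has_vector_derivative y) (at 0)" by blast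
    have d': "((\<lambda>s. w (t(i := s), x, z)) has_vector_derivative y) (at (t i))"
      unfolding line_T using has_vector_derivative_shift[OF d, of "t i"] by (simp add: q)
    then have th: "theta i w q = t i *\<^sub>R y"
      by (simp add: theta_def q vector_derivative_at)
    have "hs (eul (Tv i) (c $ k)) (emb_diff ?p q) (theta i w q $ k)" for k
    proof -
      have "hs (mvar (Tv i) * D (Tv i) (c $ k)) (emb_diff ?p q) (emb_diff ?p q (Tv i) * y $ k)"
        using y by (intro hs_mult hs_mvar) simp
      then show ?thesis
        unfolding mvar_mult_D th by (simp add: q emb_diff_def bpt_def scaleR_conv_of_real[where 'a = complex])
    qed
    then show ?case using d' by (auto simp: q)
  qed
  show "expV (\<chi> k. eul (Tv i) (c $ k)) (theta i w) ?p"
    unfolding expV_def expands_def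
  proof (intro allI conjI)
    show "Vsup ((\<chi> k. eul (Tv i) (c $ k)) $ k)" for k
      using assms(1) by (simp add: expV_def expands_def Vsup_eul)
    show "?p \<in> TS" using assms(1) by (rule expV_TS)
    show "\<forall>\<^sub>F q in pf ?p. hs ((\<chi> k. eul (Tv i) (c $ k)) $ k) (emb_diff ?p q) (theta i w q $ k)" for k
      using * by eventually_elim simp
  qed
  show "\<forall>\<^sub>F (t, x, z) in pf (bpt x0 z0). \<exists>y. ((\<lambda>s. w (t(i := s), x, z)) has_vector_derivative y) (at (t i))"
    using * by eventually_elim auto
qed

definition expL :: "(nat \<Rightarrow> mps) \<Rightarrow> ((nat \<Rightarrow> complex) \<Rightarrow> nat \<Rightarrow> complex) \<Rightarrow> pt \<Rightarrow> bool" where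
  "expL L lam p \<longleftrightarrow> (\<forall>i<n. expands (L i) (\<lambda>q. lam (snd (snd q)) i) p)"

definition expO :: "((nat \<Rightarrow> nat) \<Rightarrow> (nat \<Rightarrow> nat) \<Rightarrow> mps ^ 'm ^ 'm) \<Rightarrow> 'm::finite oper \<Rightarrow> pt \<Rightarrow> bool" where
  "expO a A p \<longleftrightarrow> (\<forall>\<alpha> \<beta> i j. expands (a \<alpha> \<beta> $ i $ j) (\<lambda>q. A \<alpha> \<beta> q $ i $ j) p)"

lemma expV_theta_tw:
  fixes c :: "mps ^ 'm::finite"
  assumes "expV c w (bpt x0 z0)" "i < n" "expL L lam (bpt x0 z0)"
  shows "expV (\<chi> k. th L i (c $ k)) (theta_tw lam i w) (bpt x0 z0)"
  using expV_theta(1)[OF assms(1,2)] assms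
  by (auto simp: expV_def th_def theta_tw_def expL_def intro!: expands_add expands_mult)

lemma expV_multi_iter:
  fixes c :: "mps ^ 'm::finite"
  assumes "\<And>k c w. k < N \<Longrightarrow> expV c w p \<Longrightarrow> expV (\<chi> i. F k (c $ i)) (G k w) p" "expV c w p"
  shows "expV (\<chi> i. multi_iter F N \<alpha> (c $ i)) (multi_iter G N \<alpha> w) p"
  using assms(1)
proof (induction N)
  case 0
  then show ?case using assms(2) by simp
next
  case (Suc N)
  note step = Suc.prems[of N, OF lessI]
  have *: "expV (\<chi> i. multi_iter F N \<alpha> (c $ i)) (multi_iter G N \<alpha> w) p"
    by (rule Suc.IH) (use Suc.prems in auto)
  have "expV (\<chi> i. (F N ^^ k) (multi_iter F N \<alpha> (c $ i))) ((G N ^^ k) (multi_iter G N \<alpha> w)) p" for k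
  proof (induction k)
    case (Suc k)
    then show ?case using step[OF Suc.IH] by simp
  qed (use * in simp)
  then show ?case by simp
qed

lemma expV_mit:
  fixes c :: "mps ^ 'm::finite"
  assumes "expV c w (bpt x0 z0)" "expL L lam (bpt x0 z0)"
  shows "expV (\<chi> k. mit L \<alpha> \<beta> (c $ k)) (multi_iter (theta_tw lam) n \<alpha> (multi_iter dx n' \<beta> w)) (bpt x0 z0)"
proof -
  have X: "expV (\<chi> k. multi_iter dX n' \<beta> (c $ k)) (multi_iter dx n' \<beta> w) (bpt x0 z0)"
    by (rule expV_multi_iter[OF _ assms(1)]) (rule expV_dx(1))
  have "expV (\<chi> k. multi_iter (th L) n \<alpha> ((\<chi> k. multi_iter dX n' \<beta> (c $ k)) $ k))
      (multi_iter (theta_tw lam) n \<alpha> (multi_iter dx n' \<beta> w)) (bpt x0 z0)"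
    by (rule expV_multi_iter[OF _ X]) (rule expV_theta_tw[OF _ _ assms(2)])
  then show ?thesis by (simp add: mit_def)
qed

lemma expV_op_tw:
  fixes c :: "mps ^ 'm::finite"
  assumes "expV c w (bpt x0 z0)" "expL L lam (bpt x0 z0)" "expO a A (bpt x0 z0)"
  shows "expV (fop (supp A) a L c) (op_tw n n' A lam w) (bpt x0 z0)"
proof -
  have TS: "bpt x0 z0 \<in> TS" by (rule expV_TS[OF assms(1)])
  have mit: "expands (mit L \<alpha> \<beta> (c $ k)) (\<lambda>q. multi_iter (theta_tw lam) n \<alpha> (multi_iter dx n' \<beta> w) q $ k) (bpt x0 z0)" for \<alpha> \<beta> k
    using expV_mit[OF assms(1,2), of \<alpha> \<beta>] by (simp add: expV_def)
  have a: "expands (a \<alpha> \<beta> $ i $ j) (\<lambda>q. A \<alpha> \<beta> q $ i $ j) (bpt x0 z0)" for \<alpha> \<beta> i j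
    using assms(3) by (simp add: expO_def)
  show ?thesis
    unfolding expV_def
  proof
    fix i
    have "expands (\<Sum>s\<in>supp A. \<Sum>j\<in>UNIV. a (fst s) (snd s) $ i $ j * mit L (fst s) (snd s) (c $ j))
      (\<lambda>q. \<Sum>s\<in>supp A. \<Sum>j\<in>UNIV. A (fst s) (snd s) q $ i $ j *
        multi_iter (theta_tw lam) n (fst s) (multi_iter dx n' (snd s) w) q $ j) (bpt x0 z0)"
      by (intro expands_sum expands_mult mit a TS)
    then show "expands (fop (supp A) a L c $ i) (\<lambda>q. op_tw n n' A lam w q $ i) (bpt x0 z0)"
      by (simp add: fop_def op_tw_def case_prod_unfold matrix_vector_mult_def sum_component)
  qed
qed

subsection \<open>Conjugation by powers of t\<close>

lemma eventually_pf_line: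
  assumes "eventually Q (pf q)" "q \<in> TS" "v \<in> V"
  shows "\<exists>r>0. \<forall>s. \<bar>s\<bar> < r \<longrightarrow> Q (padd q (\<lambda>u. if u = v then s else 0))"
proof -
  obtain r where r: "0 < r" "\<And>y. y \<in> pd q r \<Longrightarrow> Q y" using assms(1) unfolding eventually_pf by blast
  have "padd q (\<lambda>u. if u = v then s else 0) \<in> pd q r" if "\<bar>s\<bar> < r" for s
    by (rule padd_in_pd) (use assms that r in auto)
  then show ?thesis using r by blast
qed

lemma eventually_pos:
  assumes "pos n q" "q \<in> TS"
  shows "eventually (pos n) (pf q)"
proof -
  define r where "r = Min (insert 1 (fst q ` {..<n}))"
  have "0 < r" using assms(1) unfolding r_def by (subst Min_gr_iff) (auto simp: pos_def)
  moreover have "pos n y" if y: "y \<in> pd q r" for y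
    unfolding pos_def
  proof (intro allI impI)
    fix i assume i: "i < n"
    obtain t x z where q: "q = (t, x, z)" by (cases q)
    obtain t' x' z' where y': "y = (t', x', z')" by (cases y)
    have "\<bar>t' i - t i\<bar> < r"
      using y i unfolding q y' pd_iff by simp
    moreover have "r \<le> t i" using i unfolding r_def by (intro Min_le) (auto simp: q)
    ultimately show "0 < fst y i" by (simp add: y')
  qed
  ultimately show ?thesis unfolding eventually_pf by blast
qed

lemma twist_nonzero: "pos n q \<Longrightarrow> twist n lam q \<noteq> 0"
  by (auto simp: twist_def tpow_def pos_def)

lemma twist_derivative:
  assumes "i < n" "0 < t i"
  shows "((\<lambda>s. twist n lam (t(i := s), x, z)) has_vector_derivative
    (lam z i / of_real (t i)) * twist n lam (t, x, z)) (at (t i))"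
proof -
  let ?c = "\<Prod>k\<in>{..<n} - {i}. of_real (t k) powr lam z k"
  have eq: "twist n lam (t(i := s), x, z) = (of_real s powr lam z i) * ?c" for s
  proof -
    have "twist n lam (t(i := s), x, z) = (of_real s powr lam z i) *
        (\<Prod>k\<in>{..<n} - {i}. of_real ((t(i := s)) k) powr lam z k)"
      unfolding twist_def tpow_def using assms(1) by (subst prod.remove[of _ i]) auto
    also have "(\<Prod>k\<in>{..<n} - {i}. of_real ((t(i := s)) k) powr lam z k) = ?c"
      by (intro prod.cong) auto
    finally show ?thesis .
  qed
  have "((\<lambda>w. w powr lam z i) has_field_derivative lam z i * of_real (t i) powr (lam z i - 1)) (at (of_real (t i)))"
    using assms(2) by (intro has_field_derivative_powr) (auto simp: complex_nonpos_Reals_iff)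
  then have "((\<lambda>s. of_real s powr lam z i) has_vector_derivative lam z i * of_real (t i) powr (lam z i - 1)) (at (t i))"
    by (rule has_vector_derivative_real_field)
  then have "((\<lambda>s. of_real s powr lam z i * ?c) has_vector_derivative
      lam z i * of_real (t i) powr (lam z i - 1) * ?c) (at (t i))"
    by (rule has_vector_derivative_mult_left)
  also have "lam z i * of_real (t i) powr (lam z i - 1) * ?c = (lam z i / of_real (t i)) * twist n lam (t(i := t i), x, z)"
    unfolding eq using assms(2) by (simp add: powr_diff)
  finally show ?thesis by (simp add: eq)
qed

definition twisted :: "((nat \<Rightarrow> complex) \<Rightarrow> nat \<Rightarrow> complex) \<Rightarrow> pt \<Rightarrow> (pt \<Rightarrow> complex ^ 'm) \<Rightarrow> (pt \<Rightarrow> complex ^ 'm) \<Rightarrow> bool" where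
  "twisted lam p u w \<longleftrightarrow> (\<forall>\<^sub>F q in pf p. pos n q \<longrightarrow> u q = twist n lam q *s w q)"

lemma twisted_dx:
  fixes c :: "mps ^ 'm::finite"
  assumes "twisted lam p u w" "expV c w p" "j < n'"
  shows "twisted lam p (dx j u) (dx j w)"
  unfolding twisted_def
  using eventually_pf_pf[OF assms(1)[unfolded twisted_def]] expV_dx(2)[OF assms(2,3)] eventually_pf_TS
proof eventually_elim
  case (elim q)
  obtain t x z where q: "q = (t, x, z)" by (cases q)
  show ?case
  proof
    assume p: "pos n q"
    have ev: "\<forall>\<^sub>F y in pf q. u y = twist n lam y *s w y"
      using elim(1) eventually_pos[OF p elim(3)] by eventually_elim simp
    have v: "Xv j \<in> V" using assms(3) by simp
    obtain r where "0 < r" and r: "\<forall>s. \<bar>s\<bar> < r \<longrightarrow> u (padd q (\<lambda>u. if u = Xv j then s else 0)) =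
        twist n lam (padd q (\<lambda>u. if u = Xv j then s else 0)) *s w (padd q (\<lambda>u. if u = Xv j then s else 0))"
      using eventually_pf_line[OF ev elim(3) v] by blast
    have "((\<lambda>s. w (t, x(j := s), z)) has_vector_derivative dx j w q) (at (x j))"
      using elim(2) by (simp add: q)
    then have "((\<lambda>s. twist n lam q *s w (t, x(j := s), z)) has_vector_derivative twist n lam q *s dx j w q) (at (x j))"
      by (intro has_vector_derivative_vec)
        (auto intro!: has_vector_derivative_mult_right bounded_linear.has_vector_derivative[OF bounded_linear_vec_nth])
    then have "((\<lambda>s. u (t, x(j := s), z)) has_vector_derivative twist n lam q *s dx j w q) (at (x j))"
    proof (rule has_vector_derivative_transform_within_open[where S = "ball (x j) r"])
      fix s assume s: "s \<in> ball (x j) r"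
      have "padd q (\<lambda>u. if u = Xv j then s - x j else 0) = (t, x(j := s), z)"
        by (auto simp: padd_def q fun_eq_iff)
      then show "twist n lam q *s w (t, x(j := s), z) = u (t, x(j := s), z)"
        using r[rule_format, of "s - x j"] s by (auto simp: dist_real_def abs_minus_commute twist_def q)
    qed (use \<open>0 < r\<close> in auto)
    then show "dx j u q = twist n lam q *s dx j w q"
      by (simp add: dx_def q vector_derivative_at)
  qed
qed

lemma twisted_theta:
  fixes c :: "mps ^ 'm::finite"
  assumes "twisted lam (bpt x0 z0) u w" "expV c w (bpt x0 z0)" "i < n"
  shows "twisted lam (bpt x0 z0) (theta i u) (theta_tw lam i w)"
  unfolding twisted_def
  using eventually_pf_pf[OF assms(1)[unfolded twisted_def]] expV_theta(2)[OF assms(2,3)] eventually_pf_TS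
proof eventually_elim
  case (elim q)
  obtain t x z where q: "q = (t, x, z)" by (cases q)
  show ?case
  proof
    assume p: "pos n q"
    then have ti: "0 < t i" using assms(3) by (simp add: pos_def q)
    have ev: "\<forall>\<^sub>F y in pf q. u y = twist n lam y *s w y"
      using elim(1) eventually_pos[OF p elim(3)] by eventually_elim simp
    have v: "Tv i \<in> V" using assms(3) by simp
    obtain r where "0 < r" and r: "\<forall>s. \<bar>s\<bar> < r \<longrightarrow> u (padd q (\<lambda>u. if u = Tv i then s else 0)) =
        twist n lam (padd q (\<lambda>u. if u = Tv i then s else 0)) *s w (padd q (\<lambda>u. if u = Tv i then s else 0))"
      using eventually_pf_line[OF ev elim(3) v] by blast
    obtain y where y: "((\<lambda>s. w (t(i := s), x, z)) has_vector_derivative y) (at (t i))"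
      using elim(2) by (auto simp: q)
    have th: "theta i w q = t i *\<^sub>R y" using y by (simp add: theta_def q vector_derivative_at)
    let ?d = "twist n lam q *s y + ((lam z i / of_real (t i)) * twist n lam q) *s w q"
    have "((\<lambda>s. twist n lam (t(i := s), x, z) *s w (t(i := s), x, z)) has_vector_derivative ?d) (at (t i))"
    proof (intro has_vector_derivative_vec)
      fix k
      have "((\<lambda>s. w (t(i := s), x, z) $ k) has_vector_derivative y $ k) (at (t i))"
        by (rule bounded_linear.has_vector_derivative[OF bounded_linear_vec_nth y])
      then have "((\<lambda>s. twist n lam (t(i := s), x, z) * w (t(i := s), x, z) $ k) has_vector_derivative
        twist n lam (t(i := t i), x, z) * y $ k + (lam z i / of_real (t i)) * twist n lam (t, x, z) * w (t(i := t i), x, z) $ k) (at (t i))"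
        by (rule has_vector_derivative_mult[OF twist_derivative[where t = t and x = x and z = z, OF assms(3) ti]])
      then show "((\<lambda>s. (twist n lam (t(i := s), x, z) *s w (t(i := s), x, z)) $ k) has_vector_derivative ?d $ k) (at (t i))"
        by (simp add: q)
    qed
    then have "((\<lambda>s. u (t(i := s), x, z)) has_vector_derivative ?d) (at (t i))"
    proof (rule has_vector_derivative_transform_within_open[where S = "ball (t i) r"])
      fix s assume s: "s \<in> ball (t i) r"
      have "padd q (\<lambda>u. if u = Tv i then s - t i else 0) = (t(i := s), x, z)"
        by (auto simp: padd_def q fun_eq_iff)
      then show "twist n lam (t(i := s), x, z) *s w (t(i := s), x, z) = u (t(i := s), x, z)"
        using r[rule_format, of "s - t i"] s by (auto simp: dist_real_def abs_minus_commute)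
    qed (use \<open>0 < r\<close> in auto)
    then have "theta i u q = t i *\<^sub>R ?d"
      by (simp add: theta_def q vector_derivative_at)
    also have "\<dots> = twist n lam q *s theta_tw lam i w q"
      unfolding theta_tw_def th using ti
      by (simp add: vec_eq_iff q scaleR_conv_of_real[where 'a = complex] field_simps)
    finally show "theta i u q = twist n lam q *s theta_tw lam i w q" .
  qed
qed

lemma twisted_multi_iter:
  fixes c :: "mps ^ 'm::finite"
  assumes "\<And>k c w. k < N \<Longrightarrow> expV c w p \<Longrightarrow> expV (\<chi> i. F k (c $ i)) (G k w) p"
    "\<And>k (c :: mps ^ 'm) u w. k < N \<Longrightarrow> twisted lam p u w \<Longrightarrow> expV c w p \<Longrightarrow> twisted lam p (H k u) (G k w)"
    "expV c w p" "twisted lam p u w"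
  shows "twisted lam p (multi_iter H N \<alpha> u) (multi_iter G N \<alpha> w)"
proof -
  have "(\<exists>c :: mps ^ 'm. expV c (multi_iter G N' \<alpha> w) p) \<and> twisted lam p (multi_iter H N' \<alpha> u) (multi_iter G N' \<alpha> w)"
    if "N' \<le> N" for N'
    using that
  proof (induction N')
    case 0
    then show ?case using assms(3,4) by auto
  next
    case (Suc N')
    have "(\<exists>c :: mps ^ 'm. expV c ((G N' ^^ k) (multi_iter G N' \<alpha> w)) p) \<and>
        twisted lam p ((H N' ^^ k) (multi_iter H N' \<alpha> u)) ((G N' ^^ k) (multi_iter G N' \<alpha> w))" for k
    proof (induction k)
      case 0
      then show ?case using Suc by simp
    next
      case (Suc k)
      then obtain d :: "mps ^ 'm" where d: "expV d ((G N' ^^ k) (multi_iter G N' \<alpha> w)) p" by blast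
      have "N' < N" using \<open>Suc N' \<le> N\<close> by simp
      from assms(1)[OF this d] assms(2)[OF this _ d] Suc.IH show ?case by auto
    qed
    then show ?case by simp
  qed
  then show ?thesis by blast
qed

lemma op_apply_twisted:
  fixes c :: "mps ^ 'm::finite"
  assumes "twisted lam (bpt x0 z0) u w" "expV c w (bpt x0 z0)" "expL L lam (bpt x0 z0)" "finite (supp A)"
  shows "\<forall>\<^sub>F q in pf (bpt x0 z0). pos n q \<longrightarrow> op_apply n n' A u q = twist n lam q *s op_tw n n' A lam w q"
proof -
  let ?p = "bpt x0 z0"
  have "twisted lam ?p (multi_iter theta n \<alpha> (multi_iter dx n' \<beta> u)) (multi_iter (theta_tw lam) n \<alpha> (multi_iter dx n' \<beta> w))" for \<alpha> \<beta>
  proof -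
    have 1: "expV (\<chi> k. multi_iter dX n' \<beta> (c $ k)) (multi_iter dx n' \<beta> w) ?p"
      by (rule expV_multi_iter[OF _ assms(2)]) (rule expV_dx(1))
    have 2: "twisted lam ?p (multi_iter dx n' \<beta> u) (multi_iter dx n' \<beta> w)"
      by (rule twisted_multi_iter[OF _ _ assms(2,1)]) (rule expV_dx(1) twisted_dx; assumption)+
    show ?thesis
      by (rule twisted_multi_iter[OF _ _ 1 2]) (rule expV_theta_tw[OF _ _ assms(3)] twisted_theta; assumption)+
  qed
  then have "\<forall>\<^sub>F q in pf ?p. \<forall>s\<in>supp A. pos n q \<longrightarrow>
      multi_iter theta n (fst s) (multi_iter dx n' (snd s) u) q =
      twist n lam q *s multi_iter (theta_tw lam) n (fst s) (multi_iter dx n' (snd s) w) q"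
    using assms(4) by (intro eventually_ball_finite) (auto simp: twisted_def)
  then show ?thesis
    by eventually_elim
      (auto simp: op_apply_def op_tw_def case_prod_unfold vec.scale_sum_right matrix_vector_mult_scaleR
        vector_scalar_commute intro!: sum.cong)
qed

end

subsection \<open>Filtrations of the ring of formal power series\<close>

fun wt :: "nat \<Rightarrow> var \<Rightarrow> nat" where
  "wt s (Tv i) = s" | "wt s (Xv j) = 1" | "wt s (Zv k) = 1"

abbreviation W :: "nat \<Rightarrow> mindex \<Rightarrow> nat" where
  "W s \<equiv> wdeg (wt s)"

lemma W_eq: "W s \<kappa> = s * tdeg \<kappa> + ydeg \<kappa>"
proof -
  have "wt s v = s * tweight v + yweight v" for v by (cases v) auto
  then show ?thesis
    by (simp add: wdeg_def sum_distrib_left sum.distrib distrib_right mult.assoc)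
qed

lemma W_eq_0_iff: "0 < s \<Longrightarrow> W s \<kappa> = 0 \<longleftrightarrow> \<kappa> = 0"
proof
  assume s: "0 < s" and *: "W s \<kappa> = 0"
  have "v \<notin> keys \<kappa>" for v
  proof
    assume v: "v \<in> keys \<kappa>"
    then have "wt s v * lookup \<kappa> v = 0"
      using * unfolding wdeg_def by (simp only: sum_eq_0_iff finite_keys)
    moreover have "0 < wt s v" using s by (cases v) auto
    ultimately show False using v by (simp add: in_keys_iff)
  qed
  then have "keys \<kappa> = {}" by blast
  then show "\<kappa> = 0" by simp
qed auto

definition low :: "nat \<Rightarrow> nat \<Rightarrow> mps \<Rightarrow> bool" where
  "low s d f \<longleftrightarrow> (\<forall>\<kappa>. W s \<kappa> < d \<longrightarrow> cf f \<kappa> = 0)"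

lemma low_0 [simp]: "low s 0 f" and low_zero [simp]: "low s d 0"
  by (simp_all add: low_def)

lemma low_mono: "low s d f \<Longrightarrow> e \<le> d \<Longrightarrow> low s e f"
  by (simp add: low_def)

lemma low_add: "low s d f \<Longrightarrow> low s d g \<Longrightarrow> low s d (f + g)"
  and low_diff: "low s d f \<Longrightarrow> low s d g \<Longrightarrow> low s d (f - g)"
  by (simp_all add: low_def)

lemma low_sum: "(\<And>i. i \<in> I \<Longrightarrow> low s d (f i)) \<Longrightarrow> low s d (sum f I)"
  by (simp add: low_def)

lemma low_mult:
  assumes "low s d f" "low s e g"
  shows "low s (d + e) (f * g)"
  unfolding low_def
proof (intro allI impI)
  fix \<kappa> assume \<kappa>: "W s \<kappa> < d + e"
  show "cf (f * g) \<kappa> = 0"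
    unfolding cf_mult
  proof (intro sum.neutral ballI)
    fix p assume p: "p \<in> splits \<kappa>"
    obtain a b where ab: "p = (a, b)" by (cases p)
    then have "W s a + W s b < d + e" using p \<kappa> by (auto simp: splits_def)
    then have "W s a < d \<or> W s b < e" by linarith
    then show "(case p of (a, b) \<Rightarrow> cf f a * cf g b) = 0"
      using assms by (auto simp: ab low_def)
  qed
qed

lemma low_mult_right: "low s d g \<Longrightarrow> low s d (f * g)"
  using low_mult[of s 0 f d g] by simp

lemma low_eul: "low s d f \<Longrightarrow> low s d (eul v f)"
  by (simp add: low_def)

lemma low_th: "low s d f \<Longrightarrow> low s d (th L i f)"
  unfolding th_def by (intro low_add low_eul low_mult_right)

lemma low_dX: "low s d f \<Longrightarrow> low s (d - 1) (dX j f)"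
  by (auto simp: low_def cf_D)

lemma low_all_imp_0: "(\<And>d. low s d f) \<Longrightarrow> f = 0"
  by (rule mps_eqI) (metis low_def cf_0 lessI)

lemma cf_mult_low:
  assumes "low s d g" "W s \<kappa> = d" "0 < s"
  shows "cf (f * g) \<kappa> = cf f 0 * cf g \<kappa>"
proof -
  have "cf (f * g) \<kappa> = (\<Sum>(a, b)\<in>splits (0 + \<kappa>). if a = 0 then cf f 0 * cf g b else 0)"
    unfolding cf_mult add_0
  proof (intro sum.cong refl)
    fix p assume p: "p \<in> splits \<kappa>"
    obtain a b where ab: "p = (a, b)" by (cases p)
    have "cf g b = 0" if "a \<noteq> 0"
    proof -
      have "W s a + W s b = d" using p assms(2) by (auto simp: ab splits_def)
      moreover have "W s a \<noteq> 0" using that assms(3) by (simp add: W_eq_0_iff)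
      ultimately have "W s b < d" by linarith
      then show ?thesis using assms(1) by (simp add: low_def)
    qed
    then show "(case p of (a, b) \<Rightarrow> cf f a * cf g b) = (case p of (a, b) \<Rightarrow> if a = 0 then cf f 0 * cf g b else 0)"
      by (auto simp: ab)
  qed
  then show ?thesis by (simp only: sum_splits_left)
qed

lemma th_linear: "th L i (f + g) = th L i f + th L i g" "th L i (f - g) = th L i f - th L i g" "th L i 0 = 0"
  by (simp_all add: th_def eul_linear algebra_simps)

lemma multi_iter_additive:
  fixes F :: "nat \<Rightarrow> mps \<Rightarrow> mps"
  assumes "\<And>i f g. F i (f - g) = F i f - F i g"
  shows "multi_iter F N \<alpha> (f - g) = multi_iter F N \<alpha> f - multi_iter F N \<alpha> g"
proof (induction N)
  case (Suc N)
  have "(F N ^^ k) (f - g) = (F N ^^ k) f - (F N ^^ k) g" for k f g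
    by (induction k) (simp_all add: assms)
  then show ?case by (simp add: Suc)
qed simp

lemma multi_iter_invariant:
  assumes "\<And>i f. i < N \<Longrightarrow> Q f \<Longrightarrow> Q (F i f)" "Q f"
  shows "Q (multi_iter F N \<alpha> f)"
  using assms(1)
proof (induction N)
  case (Suc N)
  note step = Suc.prems[OF lessI]
  have "Q ((F N ^^ k) (multi_iter F N \<alpha> f))" for k
    by (induction k) (use Suc step in auto)
  then show ?case by simp
qed (use assms(2) in simp)

lemma multi_iter_zero [simp]: "multi_iter F N (\<lambda>_. 0) f = f"
  by (induction N) auto

context coords
begin

abbreviation bsum :: "(nat \<Rightarrow> nat) \<Rightarrow> nat" where
  "bsum \<beta> \<equiv> \<Sum>j<n'. \<beta> j"

lemma low_multi_iter_dX: "low s d f \<Longrightarrow> low s (d - (\<Sum>j<N. \<beta> j)) (multi_iter dX N \<beta> f)"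
proof (induction N)
  case (Suc N)
  have "low s (e - k) ((dX N ^^ k) g)" if "low s e g" for k e g
  proof (induction k)
    case (Suc k)
    from low_dX[OF this, of N] show ?case by simp
  qed (use that in simp)
  from this[OF Suc.IH[OF Suc.prems], of "\<beta> N"] show ?case
    by (simp add: diff_diff_eq)
qed simp

lemma low_mit: "low s d f \<Longrightarrow> low s (d - bsum \<beta>) (mit L \<alpha> \<beta> f)"
  unfolding mit_def
  by (rule multi_iter_invariant[where Q = "low s (d - bsum \<beta>)"]) (auto intro: low_th low_multi_iter_dX)

lemma mit_diff: "mit L \<alpha> \<beta> (f - g) = mit L \<alpha> \<beta> f - mit L \<alpha> \<beta> g"
  unfolding mit_def by (simp add: multi_iter_additive th_linear D_linear)

lemma fop_diff: "fop S a L (u - w) = fop S a L u - fop S a L w"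
  by (simp add: fop_def vec_eq_iff mit_diff algebra_simps sum_subtractf case_prod_unfold)

lemma fop_0: "fop S a L 0 = 0"
  using fop_diff[of S a L 0 0] by simp

lemma Vsup_mit: "Vsup f \<Longrightarrow> (\<And>i. i < n \<Longrightarrow> Vsup (L i)) \<Longrightarrow> Vsup (mit L \<alpha> \<beta> f)"
  unfolding mit_def th_def
  by (intro multi_iter_invariant[where Q = Vsup] Vsup_add Vsup_mult Vsup_eul Vsup_D) auto

text \<open>The leading matrix: how an operator of \<open>_U D_*\<close> acts on \<open>t^\<gamma>\<close> up to terms of higher order.\<close>

definition lead :: "((nat \<Rightarrow> nat) \<times> (nat \<Rightarrow> nat)) set \<Rightarrow> ((nat \<Rightarrow> nat) \<Rightarrow> (nat \<Rightarrow> nat) \<Rightarrow> mps ^ 'm ^ 'm) \<Rightarrow>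
    (nat \<Rightarrow> mps) \<Rightarrow> (nat \<Rightarrow> nat) \<Rightarrow> complex ^ 'm ^ 'm" where
  "lead S a L \<gamma> = (\<chi> i j. \<Sum>\<alpha> | (\<alpha>, \<lambda>_. 0) \<in> S.
     cf (a \<alpha> (\<lambda>_. 0) $ i $ j) 0 * mpow n (\<lambda>k. cf (L k) 0 + of_nat (\<gamma> k)) \<alpha>)"

definition UD_data :: "nat \<Rightarrow> ((nat \<Rightarrow> nat) \<times> (nat \<Rightarrow> nat)) set \<Rightarrow> ((nat \<Rightarrow> nat) \<Rightarrow> (nat \<Rightarrow> nat) \<Rightarrow> mps ^ 'm ^ 'm) \<Rightarrow> bool" where
  "UD_data s S a \<longleftrightarrow> finite S \<and> (\<forall>(\<alpha>, \<beta>)\<in>S. bsum \<beta> < s \<and>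
     (\<beta> \<noteq> (\<lambda>_. 0) \<longrightarrow> (\<forall>i j. t0 (a \<alpha> \<beta> $ i $ j) = 0)))"

lemma low_t0: "t0 f = 0 \<Longrightarrow> low s s f"
  unfolding low_def
proof (intro allI impI)
  fix \<kappa> assume f: "t0 f = 0" and W: "W s \<kappa> < s"
  have "tdeg \<kappa> = 0"
  proof (rule ccontr)
    assume "tdeg \<kappa> \<noteq> 0"
    then have "s \<le> s * tdeg \<kappa>" by simp
    then show False using W unfolding W_eq by linarith
  qed
  then show "cf f \<kappa> = 0" using f by (metis cf_0 cf_t0)
qed

lemma cf_th_low:
  assumes "low s d f" "W s \<kappa> = d" "0 < s"
  shows "cf (th L i f) \<kappa> = (cf (L i) 0 + of_nat (lookup \<kappa> (Tv i))) * cf f \<kappa>"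
  unfolding th_def cf_add cf_eul cf_mult_low[OF assms] by (simp add: algebra_simps)

lemma cf_mit_low:
  assumes "low s d f" "W s \<kappa> = d" "0 < s"
  shows "cf (mit L \<alpha> (\<lambda>_. 0) f) \<kappa> = mpow n (\<lambda>k. cf (L k) 0 + of_nat (lookup \<kappa> (Tv k))) \<alpha> * cf f \<kappa>"
proof -
  let ?m = "\<lambda>k. cf (L k) 0 + of_nat (lookup \<kappa> (Tv k))"
  have "low s d (multi_iter (th L) N \<alpha> f) \<and> cf (multi_iter (th L) N \<alpha> f) \<kappa> = mpow N ?m \<alpha> * cf f \<kappa>" for N
  proof (induction N)
    case 0
    then show ?case using assms(1) by (simp add: mpow_def)
  next
    case (Suc N)
    have "low s d ((th L N ^^ k) g) \<and> cf ((th L N ^^ k) g) \<kappa> = ?m N ^ k * cf g \<kappa>" if "low s d g" for k g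
    proof (induction k)
      case (Suc k)
      then show ?case using cf_th_low[OF _ assms(2,3), of "(th L N ^^ k) g" L N] by (simp add: low_th)
    qed (use that in simp)
    from this[of "multi_iter (th L) N \<alpha> f" "\<alpha> N"] Suc show ?case
      by (simp add: mpow_def mult_ac)
  qed
  then show ?thesis by (simp add: mit_def)
qed

lemma cf_fop_low:
  assumes "UD_data s S a" "\<And>j. low s d (w $ j)" "W s \<kappa> = d" "0 < s"
  shows "cf (fop S a L w $ i) \<kappa> = (lead S a L (\<lambda>k. lookup \<kappa> (Tv k)) *v (\<chi> j. cf (w $ j) \<kappa>)) $ i"
proof -
  let ?c = "\<lambda>\<alpha>. \<Sum>j\<in>UNIV. cf (a \<alpha> (\<lambda>_. 0) $ i $ j) 0 *
     (mpow n (\<lambda>k. cf (L k) 0 + of_nat (lookup \<kappa> (Tv k))) \<alpha> * cf (w $ j) \<kappa>)"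
  have S: "finite S" using assms(1) by (simp add: UD_data_def)
  have "cf (fop S a L w $ i) \<kappa> = (\<Sum>(\<alpha>, \<beta>)\<in>S. \<Sum>j\<in>UNIV. cf (a \<alpha> \<beta> $ i $ j * mit L \<alpha> \<beta> (w $ j)) \<kappa>)"
    by (simp add: fop_def case_prod_unfold)
  also have "\<dots> = (\<Sum>(\<alpha>, \<beta>)\<in>S. if \<beta> = (\<lambda>_. 0) then ?c \<alpha> else 0)"
  proof (intro sum.cong refl, clarify)
    fix \<alpha> \<beta> assume ab: "(\<alpha>, \<beta>) \<in> S"
    show "(\<Sum>j\<in>UNIV. cf (a \<alpha> \<beta> $ i $ j * mit L \<alpha> \<beta> (w $ j)) \<kappa>) = (if \<beta> = (\<lambda>_. 0) then ?c \<alpha> else 0)"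
    proof (cases "\<beta> = (\<lambda>_. 0)")
      case True
      have "low s d (mit L \<alpha> (\<lambda>_. 0) (w $ j))" for j
        using low_mit[OF assms(2), of "\<lambda>_. 0" L \<alpha> j] by simp
      from cf_mult_low[OF this assms(3,4)] cf_mit_low[OF assms(2,3,4)]
      show ?thesis by (simp add: True)
    next
      case False
      have b: "bsum \<beta> < s" and t: "t0 (a \<alpha> \<beta> $ i $ j) = 0" for j
        using assms(1) ab False by (auto simp: UD_data_def)
      have "low s (s + (d - bsum \<beta>)) (a \<alpha> \<beta> $ i $ j * mit L \<alpha> \<beta> (w $ j))" for j
        by (intro low_mult low_t0 t low_mit assms(2))
      then have "cf (a \<alpha> \<beta> $ i $ j * mit L \<alpha> \<beta> (w $ j)) \<kappa> = 0" for j
        using b assms(3) by (simp add: low_def)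
      then show ?thesis using False by simp
    qed
  qed
  also have "\<dots> = (\<Sum>(\<alpha>, \<beta>)\<in>S \<inter> {(\<alpha>, \<beta>). \<beta> = (\<lambda>_. 0)}. ?c \<alpha>)"
    using S by (simp add: sum.inter_restrict case_prod_unfold)
  also have "\<dots> = (\<Sum>\<alpha> | (\<alpha>, \<lambda>_. 0) \<in> S. ?c \<alpha>)"
    by (rule sum.reindex_bij_witness[of _ "\<lambda>\<alpha>. (\<alpha>, \<lambda>_. 0)" fst]) auto
  also have "\<dots> = (\<Sum>j\<in>UNIV. \<Sum>\<alpha> | (\<alpha>, \<lambda>_. 0) \<in> S. cf (a \<alpha> (\<lambda>_. 0) $ i $ j) 0 *
     (mpow n (\<lambda>k. cf (L k) 0 + of_nat (lookup \<kappa> (Tv k))) \<alpha> * cf (w $ j) \<kappa>))"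
    by (rule sum.swap)
  also have "\<dots> = (lead S a L (\<lambda>k. lookup \<kappa> (Tv k)) *v (\<chi> j. cf (w $ j) \<kappa>)) $ i"
    by (simp add: lead_def matrix_vector_mult_def sum_distrib_right mult.assoc)
  finally show ?thesis .
qed

lemma formal_uniqueness:
  fixes w :: "nat \<Rightarrow> mps ^ 'm::finite"
  assumes "0 < s" and P: "UD_data s S a" and T: "\<And>i j. i < p \<Longrightarrow> j < p \<Longrightarrow> UD_data s (S' i j) (a' i j)"
    and leadT: "\<And>i j \<gamma>. i < p \<Longrightarrow> j < p \<Longrightarrow> lead (S' i j) (a' i j) L \<gamma> = 0"
    and leadP: "\<And>\<kappa> y. keys \<kappa> \<subseteq> V \<Longrightarrow> tdeg \<kappa> \<noteq> 0 \<Longrightarrow> lead S a L (\<lambda>k. lookup \<kappa> (Tv k)) *v y = 0 \<Longrightarrow> y = 0"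
    and eq: "\<And>i. i < p \<Longrightarrow> fop S a L (w i) = (\<Sum>j<p. fop (S' i j) (a' i j) L (w j))"
    and w0: "\<And>i k. i < p \<Longrightarrow> t0 (w i $ k) = 0" and Vs: "\<And>i k. i < p \<Longrightarrow> Vsup (w i $ k)"
    and "i < p"
  shows "w i = 0"
proof -
  have "\<forall>i<p. \<forall>k. low s d (w i $ k)" for d
  proof (induction d)
    case (Suc d)
    show ?case
      unfolding low_def
    proof (intro allI impI)
      fix i k \<kappa> assume i: "i < p" and \<kappa>: "W s \<kappa> < Suc d"
      show "cf (w i $ k) \<kappa> = 0"
      proof (cases "W s \<kappa> < d \<or> tdeg \<kappa> = 0 \<or> \<not> keys \<kappa> \<subseteq> V")
        case True
        have "low s d (w i $ k)" using Suc i by blast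
        moreover have "cf (t0 (w i $ k)) \<kappa> = 0" using w0[OF i] by simp
        ultimately show ?thesis
          using True Vs[OF i, of k] by (auto simp: low_def Vsup_def cf_t0 split: if_splits)
      next
        case False
        then have W: "W s \<kappa> = d" using \<kappa> by auto
        have "lead S a L (\<lambda>k. lookup \<kappa> (Tv k)) *v (\<chi> j. cf (w i $ j) \<kappa>) = 0"
        proof (subst vec_eq_iff, rule allI)
          fix r
          have lj: "low s d (w j $ k)" if "j < p" for j k using Suc that by blast
          have "(lead S a L (\<lambda>k. lookup \<kappa> (Tv k)) *v (\<chi> j. cf (w i $ j) \<kappa>)) $ r = cf (fop S a L (w i) $ r) \<kappa>"
            using cf_fop_low[OF P lj[OF i] W assms(1)] by simp
          also have "\<dots> = (\<Sum>j<p. cf (fop (S' i j) (a' i j) L (w j) $ r) \<kappa>)"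
            by (simp add: eq[OF i] sum_component)
          also have "\<dots> = 0"
            using cf_fop_low[OF T[OF i] lj W assms(1)] leadT[OF i] by (intro sum.neutral) auto
          finally show "(lead S a L (\<lambda>k. lookup \<kappa> (Tv k)) *v (\<chi> j. cf (w i $ j) \<kappa>)) $ r = 0 $ r" by simp
        qed
        then have "(\<chi> j. cf (w i $ j) \<kappa>) = 0"
          using leadP False by blast
        then show ?thesis by (simp add: vec_eq_iff)
      qed
    qed
  qed simp
  then have "w i $ k = 0" for k
    using low_all_imp_0 assms(9) by blast
  then show ?thesis by (simp add: vec_eq_iff)
qed

subsection \<open>The commutator relation for twisted operators\<close>

definition Zonly :: "mps \<Rightarrow> bool" where
  "Zonly f \<longleftrightarrow> (\<forall>\<kappa>. cf f \<kappa> \<noteq> 0 \<longrightarrow> keys \<kappa> \<subseteq> range Zv)"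

lemma Zonly_cst [simp]: "Zonly (cst a)"
  by (simp add: Zonly_def cf_cst)

lemma Zonly_eul: "Zonly f \<Longrightarrow> eul (Tv i) f = 0"
proof (rule mps_eqI)
  fix \<kappa> assume f: "Zonly f"
  show "cf (eul (Tv i) f) \<kappa> = cf 0 \<kappa>"
  proof (cases "cf f \<kappa> = 0")
    case False
    then have "Tv i \<notin> keys \<kappa>" using f by (auto simp: Zonly_def)
    then show ?thesis by (simp add: in_keys_iff)
  qed simp
qed

lemma Zonly_dX: "Zonly f \<Longrightarrow> dX j f = 0"
proof (rule mps_eqI)
  fix \<kappa> assume f: "Zonly f"
  have "Xv j \<in> keys (\<kappa> + unit_index (Xv j))" by (simp add: in_keys_iff lookup_add)
  then have "cf f (\<kappa> + unit_index (Xv j)) = 0" using f by (force simp: Zonly_def)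
  then show "cf (dX j f) \<kappa> = cf 0 \<kappa>" by (simp add: cf_D)
qed

lemma eul_power: "eul v f = c * f \<Longrightarrow> eul v (f ^ k) = of_nat k * c * f ^ k"
  using eul_cst[of v 1] by (induction k) (simp_all add: eul_mult algebra_simps)

lemma D_power: "D v f = 0 \<Longrightarrow> D v (f ^ k) = 0"
  using D_cst[of v 1] by (induction k) (simp_all add: D_mult)

lemma D_prod: "(\<And>i. i \<in> I \<Longrightarrow> D v (f i) = 0) \<Longrightarrow> D v (prod f I) = 0"
  using D_cst[of v 1] by (induction I rule: infinite_finite_induct) (simp_all add: D_mult)

lemma eul_prod: "(\<And>i. i \<in> I \<Longrightarrow> eul v (f i) = c i * f i) \<Longrightarrow> eul v (prod f I) = sum c I * prod f I"
  using eul_cst[of v 1] by (induction I rule: infinite_finite_induct) (simp_all add: eul_mult algebra_simps)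

definition PF_rep :: "((nat \<Rightarrow> mps) \<Rightarrow> mps) \<Rightarrow> (nat \<Rightarrow> nat) set \<Rightarrow> ((nat \<Rightarrow> nat) \<Rightarrow> mps) \<Rightarrow> bool" where
  "PF_rep F A g \<longleftrightarrow> finite A \<and> A \<subseteq> multi_indices n \<and>
     (\<forall>L. (\<forall>i. Zonly (L i)) \<longrightarrow> F L = (\<Sum>\<alpha>\<in>A. mpow n L \<alpha> * g \<alpha>))"

definition PF :: "((nat \<Rightarrow> mps) \<Rightarrow> mps) \<Rightarrow> bool" where
  \<comment> \<open>\<open>F L\<close> is a polynomial in \<open>L\<close>, as long as the entries of \<open>L\<close> only involve the parameters\<close>
  "PF F \<longleftrightarrow> (\<exists>A g. PF_rep F A g)"

lemma PF_repD:
  assumes "PF_rep F A g"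
  shows "finite A" "A \<subseteq> multi_indices n" "\<forall>i. Zonly (L i) \<Longrightarrow> F L = (\<Sum>\<alpha>\<in>A. mpow n L \<alpha> * g \<alpha>)"
  using assms unfolding PF_rep_def by simp_all

lemma PFI:
  "finite A \<Longrightarrow> A \<subseteq> multi_indices n \<Longrightarrow> (\<And>L. \<forall>i. Zonly (L i) \<Longrightarrow> F L = (\<Sum>\<alpha>\<in>A. mpow n L \<alpha> * g \<alpha>)) \<Longrightarrow> PF F"
  unfolding PF_def PF_rep_def by blast

lemma PF_const: "PF (\<lambda>_. f)"
  by (rule PFI[of "{\<lambda>_. 0}" _ "\<lambda>_. f"]) (auto simp: multi_indices_def mpow_def)

lemma PF_add:
  assumes "PF F" "PF G"
  shows "PF (\<lambda>L. F L + G L)"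
proof -
  obtain A f where "PF_rep F A f" using assms(1) unfolding PF_def by blast
  note A = PF_repD[OF this]
  obtain B g where "PF_rep G B g" using assms(2) unfolding PF_def by blast
  note B = PF_repD[OF this]
  let ?h = "\<lambda>\<alpha>. (if \<alpha> \<in> A then f \<alpha> else 0) + (if \<alpha> \<in> B then g \<alpha> else 0)"
  have "F L + G L = (\<Sum>\<alpha>\<in>A \<union> B. mpow n L \<alpha> * ?h \<alpha>)" if "\<forall>i. Zonly (L i)" for L
  proof -
    have "F L = (\<Sum>\<alpha>\<in>A \<union> B. mpow n L \<alpha> * (if \<alpha> \<in> A then f \<alpha> else 0))"
      unfolding A(3)[OF that] using A B by (intro sum.mono_neutral_cong_left) auto
    moreover have "G L = (\<Sum>\<alpha>\<in>A \<union> B. mpow n L \<alpha> * (if \<alpha> \<in> B then g \<alpha> else 0))"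
      unfolding B(3)[OF that] using A B by (intro sum.mono_neutral_cong_left) auto
    ultimately show ?thesis by (simp only: sum.distrib distrib_left)
  qed
  then show ?thesis
    using A(1,2) B(1,2) by (intro PFI[of "A \<union> B" _ ?h]) auto
qed

lemma PF_map:
  assumes "PF F" "\<And>f g. \<phi> (f + g) = \<phi> f + \<phi> g"
    "\<And>L \<alpha> f. \<forall>i. Zonly (L i) \<Longrightarrow> \<phi> (mpow n L \<alpha> * f) = mpow n L \<alpha> * \<phi> f"
  shows "PF (\<lambda>L. \<phi> (F L))"
proof -
  obtain A f where "PF_rep F A f" using assms(1) unfolding PF_def by blast
  note A = PF_repD[OF this]
  have "\<phi> 0 = 0" using assms(2)[of 0 0] by simp
  then have "\<phi> (sum h I) = (\<Sum>i\<in>I. \<phi> (h i))" for h :: "(nat \<Rightarrow> nat) \<Rightarrow> mps" and I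
    by (induction I rule: infinite_finite_induct) (auto simp: assms(2))
  then have "\<phi> (F L) = (\<Sum>\<alpha>\<in>A. mpow n L \<alpha> * \<phi> (f \<alpha>))" if "\<forall>i. Zonly (L i)" for L
    using A(3)[OF that] assms(3)[OF that] by simp
  then show ?thesis
    using A(1,2) by (intro PFI[of A _ "\<lambda>\<alpha>. \<phi> (f \<alpha>)"]) auto
qed

lemma PF_mult_const: "PF F \<Longrightarrow> PF (\<lambda>L. a * F L)"
  by (rule PF_map[where \<phi> = "(*) a"]) (auto simp: algebra_simps)

lemma PF_diff: "PF F \<Longrightarrow> PF G \<Longrightarrow> PF (\<lambda>L. F L - G L)"
  using PF_add[of F "\<lambda>L. - 1 * G L"] PF_mult_const[of G "- 1"] by simp

lemma PF_sum: "(\<And>i. i \<in> I \<Longrightarrow> PF (F i)) \<Longrightarrow> PF (\<lambda>L. \<Sum>i\<in>I. F i L)"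
  by (induction I rule: infinite_finite_induct) (auto intro: PF_add PF_const)

lemma PF_eul: "PF F \<Longrightarrow> PF (\<lambda>L. eul (Tv i) (F L))"
proof (rule PF_map[where \<phi> = "eul (Tv i)"])
  fix L :: "nat \<Rightarrow> mps" and \<alpha> f assume L: "\<forall>i. Zonly (L i)"
  have "eul (Tv i) (mpow n L \<alpha>) = 0"
    unfolding mpow_def using Zonly_eul L eul_prod[of "{..<n}" "Tv i" "\<lambda>k. L k ^ \<alpha> k" "\<lambda>_. 0"] eul_power[of "Tv i" _ 0]
    by simp
  then show "eul (Tv i) (mpow n L \<alpha> * f) = mpow n L \<alpha> * eul (Tv i) f" by (simp add: eul_mult)
qed (simp_all add: eul_linear)

lemma PF_dX: "PF F \<Longrightarrow> PF (\<lambda>L. dX j (F L))"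
proof (rule PF_map[where \<phi> = "dX j"])
  fix L :: "nat \<Rightarrow> mps" and \<alpha> f assume L: "\<forall>i. Zonly (L i)"
  have "dX j (mpow n L \<alpha>) = 0"
    unfolding mpow_def using L by (intro D_prod D_power Zonly_dX) auto
  then show "dX j (mpow n L \<alpha> * f) = mpow n L \<alpha> * dX j f" by (simp add: D_mult)
qed (simp_all add: D_linear)

lemma PF_param:
  assumes "PF F" "i < n"
  shows "PF (\<lambda>L. L i * F L)"
proof -
  obtain A f where "PF_rep F A f" using assms(1) unfolding PF_def by blast
  note A = PF_repD[OF this]
  let ?s = "\<lambda>\<alpha>. \<alpha>(i := Suc (\<alpha> i))" and ?r = "\<lambda>\<alpha>. \<alpha>(i := \<alpha> i - 1)"
  have rs: "?r (?s \<alpha>) = \<alpha>" for \<alpha> :: "nat \<Rightarrow> nat" by auto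
  have inj: "inj_on ?s A" by (rule inj_on_inverseI[of _ ?r]) (simp add: rs)
  have "mpow n L (?s \<alpha>) = L i * mpow n L \<alpha>" for L :: "nat \<Rightarrow> mps" and \<alpha>
  proof -
    have "mpow n L (?s \<alpha>) = L i ^ Suc (\<alpha> i) * (\<Prod>k\<in>{..<n} - {i}. L k ^ ?s \<alpha> k)"
      unfolding mpow_def using assms(2) by (subst prod.remove[of _ i]) auto
    also have "(\<Prod>k\<in>{..<n} - {i}. L k ^ ?s \<alpha> k) = (\<Prod>k\<in>{..<n} - {i}. L k ^ \<alpha> k)"
      by (intro prod.cong) auto
    also have "L i ^ Suc (\<alpha> i) * \<dots> = L i * mpow n L \<alpha>"
      unfolding mpow_def using assms(2) by (subst (2) prod.remove[of _ i]) (auto simp: mult_ac)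
    finally show ?thesis .
  qed
  then have "L i * F L = (\<Sum>\<alpha>\<in>?s ` A. mpow n L \<alpha> * f (?r \<alpha>))" if "\<forall>i. Zonly (L i)" for L
    unfolding A(3)[OF that] sum.reindex[OF inj] o_def rs by (simp add: sum_distrib_left mult.assoc)
  moreover have "?s ` A \<subseteq> multi_indices n" using A(2) assms(2) by (auto simp: multi_indices_def)
  ultimately show ?thesis
    using A(1) by (intro PFI[of "?s ` A" _ "\<lambda>\<alpha>. f (?r \<alpha>)"]) auto
qed

lemma PF_th: "PF F \<Longrightarrow> i < n \<Longrightarrow> PF (\<lambda>L. th L i (F L))"
  unfolding th_def by (intro PF_add PF_eul PF_param)

lemma PF_multi_iter:
  assumes "\<And>i F. i < N \<Longrightarrow> PF F \<Longrightarrow> PF (\<lambda>L. G L i (F L))" "PF F"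
  shows "PF (\<lambda>L. multi_iter (G L) N \<alpha> (F L))"
  using assms(1)
proof (induction N)
  case (Suc N)
  note step = Suc.prems[OF lessI]
  have "PF (\<lambda>L. (G L N ^^ k) (multi_iter (G L) N \<alpha> (F L)))" for k
  proof (induction k)
    case 0
    then show ?case using Suc by simp
  next
    case (Suc k)
    from step[OF this] show ?case by simp
  qed
  then show ?case by simp
qed (use assms(2) in simp)

lemma PF_fop:
  assumes "\<And>j. PF (\<lambda>L. w L $ j)"
  shows "PF (\<lambda>L. fop S a L (w L) $ i)"
proof -
  have "PF (\<lambda>L. mit L \<alpha> \<beta> (w L $ j))" for \<alpha> \<beta> j
    unfolding mit_def
    by (intro PF_multi_iter PF_th PF_multi_iter[where G = "\<lambda>_. dX"] PF_dX assms)
  then show ?thesis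
    unfolding fop_def case_prod_unfold by (simp add: PF_sum PF_mult_const)
qed

lemma PF_zero:
  assumes "PF F" "\<And>N. F (\<lambda>i. of_nat (N i)) = 0" "\<And>i. Zonly (L i)"
  shows "F L = 0"
proof -
  obtain A g where "PF_rep F A g" using assms(1) unfolding PF_def by blast
  note A = PF_repD[OF this]
  have "cf (g \<alpha>) \<kappa> = 0" if "\<alpha> \<in> A" for \<alpha> \<kappa>
  proof (rule finite_polynomial_eq_0[where V = "{..<n}" and A = A and c = "\<lambda>\<alpha>. cf (g \<alpha>) \<kappa>"])
    fix N :: "nat \<Rightarrow> nat"
    have "mpow n (\<lambda>i. of_nat (N i)) \<alpha> = cst (\<Prod>i<n. of_nat (N i) ^ \<alpha> i)" for \<alpha>
      by (simp add: mpow_def flip: of_nat_power of_nat_prod of_nat_mps)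
    then have "(\<Sum>\<alpha>\<in>A. (\<Prod>i<n. of_nat (N i) ^ \<alpha> i) * cf (g \<alpha>) \<kappa>) = cf (F (\<lambda>i. of_nat (N i))) \<kappa>"
      using A(3)[of "\<lambda>i. of_nat (N i)"] by (simp add: of_nat_mps)
    then show "(\<Sum>\<alpha>\<in>A. cf (g \<alpha>) \<kappa> * (\<Prod>i<n. of_nat (N i) ^ \<alpha> i)) = 0"
      by (simp add: assms(2) mult.commute)
  qed (use A that in \<open>auto simp: multi_indices_def\<close>)
  then have "g \<alpha> = 0" if "\<alpha> \<in> A" for \<alpha> using that by (intro mps_eqI) simp
  then show ?thesis using A(3)[of L] assms(3) by simp
qed

definition tN :: "(nat \<Rightarrow> nat) \<Rightarrow> mps" where
  "tN N = mpow n (\<lambda>i. mvar (Tv i)) N"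

lemma tN_cancel: "tN N * f = 0 \<Longrightarrow> f = 0"
proof -
  have "(\<Prod>i<m. mvar (Tv i) ^ N i) * f = 0 \<Longrightarrow> f = 0" for m
  proof (induction m arbitrary: f)
    case (Suc m)
    then have "(\<Prod>i<m. mvar (Tv i) ^ N i) * (mvar (Tv m) ^ N m * f) = 0" by (simp add: mult.assoc)
    from Suc.IH[OF this] show ?case by (rule mvar_power_mult_cancel)
  qed simp
  then show "tN N * f = 0 \<Longrightarrow> f = 0" by (simp add: tN_def mpow_def)
qed

lemma th_tN:
  assumes "i < n"
  shows "th (\<lambda>_. 0) i (tN N * f) = tN N * th (\<lambda>i. of_nat (N i)) i f"
proof -
  have "eul (Tv i) (mvar (Tv k) ^ N k) = (if k = i then of_nat (N i) else 0) * mvar (Tv k) ^ N k" for k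
    using eul_power[of "Tv i" "mvar (Tv k)" "if k = i then 1 else 0" "N k"] by (auto simp: eul_mvar)
  then have "eul (Tv i) (tN N) = (\<Sum>k<n. if k = i then of_nat (N i) else 0) * tN N"
    unfolding tN_def mpow_def by (intro eul_prod) auto
  also have "(\<Sum>k<n. if k = i then of_nat (N i) else 0) = (of_nat (N i) :: mps)"
    using assms by simp
  finally show ?thesis by (simp add: th_def eul_mult algebra_simps)
qed

lemma dX_tN: "dX j (tN N * f) = tN N * dX j f"
proof -
  have "dX j (tN N) = 0"
    unfolding tN_def mpow_def by (intro D_prod D_power) (simp add: D_mvar)
  then show ?thesis by (simp add: D_mult)
qed

lemma multi_iter_commute:
  fixes G H :: "nat \<Rightarrow> mps \<Rightarrow> mps"
  assumes "\<And>i f. i < N \<Longrightarrow> G i (c * f) = c * H i f"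
  shows "multi_iter G N \<alpha> (c * f) = c * multi_iter H N \<alpha> f"
  using assms
proof (induction N)
  case (Suc N)
  note step = Suc.prems[OF lessI]
  have "(G N ^^ k) (c * g) = c * (H N ^^ k) g" for k g
    by (induction k) (simp_all add: step)
  then show ?case using Suc by simp
qed simp

lemma fop_tN: "fop S a (\<lambda>_. 0) (\<chi> j. tN N * w $ j) = (\<chi> i. tN N * fop S a (\<lambda>i. of_nat (N i)) w $ i)"
proof -
  have "mit (\<lambda>_. 0) \<alpha> \<beta> (tN N * f) = tN N * mit (\<lambda>i. of_nat (N i)) \<alpha> \<beta> f" for \<alpha> \<beta> f
    unfolding mit_def 
    by (subst multi_iter_commute[where H = dX], rule dX_tN, rule multi_iter_commute) (rule th_tN)
  then show ?thesis
    by (simp add: fop_def vec_eq_iff case_prod_unfold sum_distrib_left mult_ac)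
qed

type_synonym 'm fdata = "((nat \<Rightarrow> nat) \<times> (nat \<Rightarrow> nat)) set \<times> ((nat \<Rightarrow> nat) \<Rightarrow> (nat \<Rightarrow> nat) \<Rightarrow> mps ^ 'm ^ 'm)"

definition com :: "'m fdata \<Rightarrow> 'm fdata \<Rightarrow> 'm fdata \<Rightarrow> nat \<Rightarrow> (nat \<Rightarrow> 'm fdata) \<Rightarrow> (nat \<Rightarrow> 'm fdata) \<Rightarrow>
    (nat \<Rightarrow> mps) \<Rightarrow> mps ^ 'm::finite \<Rightarrow> mps ^ 'm" where
  "com P Q R p T Qs L w =
     case_prod fop P L (case_prod fop Q L w) - case_prod fop Q L (case_prod fop P L w)
     - case_prod fop R L (case_prod fop P L w)
     - (\<Sum>j<p. case_prod fop (T j) L (case_prod fop (Qs j) L w))"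

lemma com_diff: "com P Q R p T Qs L (u - w) = com P Q R p T Qs L u - com P Q R p T Qs L w"
  by (simp add: com_def fop_diff case_prod_unfold sum_subtractf)

lemma com_low:
  fixes P :: "'m::finite fdata"
  assumes "finite (fst P)" "finite (fst Q)" "finite (fst R)" "\<forall>j<p. finite (fst (T j))" "\<forall>j<p. finite (fst (Qs j))"
  shows "\<exists>K. \<forall>w d. (\<forall>k. low 1 d (w $ k)) \<longrightarrow> (\<forall>k. low 1 (d - K) (com P Q R p T Qs L w $ k))"
proof -
  define U where "U = fst P \<union> fst Q \<union> fst R \<union> (\<Union>j<p. fst (T j)) \<union> (\<Union>j<p. fst (Qs j))"
  have U: "finite U" using assms by (auto simp: U_def)
  define K where "K = Max (insert 0 ((\<lambda>(\<alpha>, \<beta>). bsum \<beta>) ` U))"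
  have K: "bsum \<beta> \<le> K" if "(\<alpha>, \<beta>) \<in> U" for \<alpha> \<beta>
    unfolding K_def using U that by (intro Max_ge) (auto intro!: rev_image_eqI)
  have fop_low: "low 1 (d - K) (case_prod fop X L w $ k)" if "fst X \<subseteq> U" "\<And>k. low 1 d (w $ k)" for X :: "'m fdata" and d w k
  proof -
    have "low 1 (d - K) (a * mit L \<alpha> \<beta> (w $ j))" if "(\<alpha>, \<beta>) \<in> fst X" for \<alpha> \<beta> j a
      using low_mit[OF \<open>\<And>k. low 1 d (w $ k)\<close>, of \<beta> L \<alpha> j] K[of \<alpha> \<beta>] that \<open>fst X \<subseteq> U\<close>
      by (intro low_mult_right) (meson diff_le_mono2 low_mono subsetD)
    then show ?thesis
      by (auto simp: fop_def case_prod_unfold intro!: low_sum)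
  qed
  have "low 1 (d - (K + K)) (com P Q R p T Qs L w $ k)" if w: "\<And>k. low 1 d (w $ k)" for w d k
  proof -
    have two: "low 1 (d - (K + K)) (case_prod fop X L (case_prod fop Y L w) $ k)" if "fst X \<subseteq> U" "fst Y \<subseteq> U" for X Y :: "'m fdata"
      using fop_low[OF that(1) fop_low[OF that(2) w]] by (simp add: diff_diff_eq)
    have sub: "fst P \<subseteq> U" "fst Q \<subseteq> U" "fst R \<subseteq> U" "j < p \<Longrightarrow> fst (T j) \<subseteq> U" "j < p \<Longrightarrow> fst (Qs j) \<subseteq> U" for j
      by (auto simp: U_def)
    have "low 1 (d - (K + K)) (\<Sum>j<p. case_prod fop (T j) L (case_prod fop (Qs j) L w) $ k)"
      by (intro low_sum two sub) auto
    then show ?thesis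
      unfolding com_def vector_minus_component sum_component by (intro low_diff two sub)
  qed
  then show ?thesis by blast
qed

lemma com_twisted:
  fixes P :: "'m::finite fdata" and w :: "mps ^ 'm"
  assumes fin: "finite (fst P)" "finite (fst Q)" "finite (fst R)" "\<forall>j<p. finite (fst (T j))" "\<forall>j<p. finite (fst (Qs j))"
    and poly: "\<And>w. (\<And>k. Vsup (w $ k)) \<Longrightarrow> (\<And>k. finite {\<kappa>. cf (w $ k) \<kappa> \<noteq> 0}) \<Longrightarrow> com P Q R p T Qs (\<lambda>_. 0) w = 0"
    and w: "\<And>k. Vsup (w $ k)" and L: "\<And>i. Zonly (L i)"
  shows "com P Q R p T Qs L w = 0"
proof -
  obtain K where K0: "\<forall>w d. (\<forall>k. low 1 d (w $ k)) \<longrightarrow> (\<forall>k. low 1 (d - K) (com P Q R p T Qs (\<lambda>_. 0) w $ k))"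
    using com_low[of P Q R p T Qs "\<lambda>_. 0", OF fin] by (elim exE)
  have K: "low 1 (d - K) (com P Q R p T Qs (\<lambda>_. 0) w $ k)" if "\<And>k. low 1 d (w $ k)" for w d k
    using K0 that by blast
  have series: "com P Q R p T Qs (\<lambda>_. 0) w = 0" if w: "\<And>k. Vsup (w $ k)" for w
  proof (subst vec_eq_iff, rule allI, rule mps_eqI)
    fix k \<kappa>
    let ?d = "Suc (W 1 \<kappa>) + K"
    define w' where "w' = (\<chi> k. Mps (\<lambda>\<mu>. if W 1 \<mu> < ?d then cf (w $ k) \<mu> else 0))"
    have "wt 1 v = 1" for v by (cases v) auto
    then have "wt 1 = (\<lambda>_. 1)" by (rule ext)
    then have W1: "W (Suc 0) = wdeg (\<lambda>_. Suc 0)" by simp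
    have "Vsup (w' $ k)" for k
      using w[of k] by (auto simp: Vsup_def w'_def split: if_splits)
    moreover have "finite {\<mu>. cf (w' $ k) \<mu> \<noteq> 0}" for k
      by (rule finite_subset[OF _ finite_bounded_degree[OF finite_V, of ?d]])
        (use w[of k] in \<open>auto simp: Vsup_def w'_def W1 split: if_splits\<close>)
    ultimately have "com P Q R p T Qs (\<lambda>_. 0) w' = 0" by (rule poly)
    moreover have "low 1 (?d - K) (com P Q R p T Qs (\<lambda>_. 0) (w - w') $ k)"
      by (rule K) (simp add: low_def w'_def)
    ultimately show "cf (com P Q R p T Qs (\<lambda>_. 0) w $ k) \<kappa> = cf (0 $ k) \<kappa>"
      by (simp add: com_diff low_def)
  qed
  have "com P Q R p T Qs L w $ k = 0" for k
  proof (rule PF_zero[where F = "\<lambda>L. com P Q R p T Qs L w $ k"])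
    have one: "PF (\<lambda>L. case_prod fop X L w $ k)" and two: "PF (\<lambda>L. case_prod fop X L (case_prod fop Y L w) $ k)" for X Y :: "'m fdata" and k
      unfolding case_prod_unfold by (intro PF_fop PF_const)+
    show "PF (\<lambda>L. com P Q R p T Qs L w $ k)"
      unfolding com_def vector_minus_component sum_component by (intro PF_diff PF_sum two)
    fix N
    have "com P Q R p T Qs (\<lambda>_. 0) (\<chi> j. tN N * w $ j) $ k = tN N * com P Q R p T Qs (\<lambda>i. of_nat (N i)) w $ k"
      by (simp add: com_def case_prod_unfold fop_tN sum_component sum_distrib_left right_diff_distrib)
    moreover have "com P Q R p T Qs (\<lambda>_. 0) (\<chi> j. tN N * w $ j) = 0"
      by (rule series) (auto simp: tN_def mpow_def intro!: Vsup_mult Vsup_prod Vsup_power w)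
    ultimately have "tN N * com P Q R p T Qs (\<lambda>i. of_nat (N i)) w $ k = 0" by simp
    then show "com P Q R p T Qs (\<lambda>i. of_nat (N i)) w $ k = 0" by (rule tN_cancel)
  qed (rule L)
  then show ?thesis by (simp add: vec_eq_iff)
qed

end

subsection \<open>Weights\<close>

definition phi :: "nat \<Rightarrow> nat \<Rightarrow> real" where
  "phi N m = fact m * fact N / fact (m + N)"

lemma phi_pos: "0 < phi N m"
  by (simp add: phi_def)

lemma phi_0 [simp]: "phi 0 m = 1"
  by (simp add: phi_def)

lemma phi_Suc: "phi N (Suc m) \<le> phi N m"
proof -
  have "phi N (Suc m) = phi N m * (real (Suc m) / real (Suc (m + N)))"
    by (simp add: phi_def mult_ac)
  also have "\<dots> \<le> phi N m * 1"
    by (intro mult_left_mono) (auto simp: phi_pos less_imp_le divide_le_eq)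
  finally show ?thesis by simp
qed

lemma phi_antimono: "phi N (m + e) \<le> phi N m"
  by (induction e) (auto intro: order_trans[OF phi_Suc])

lemma phi_shift:
  assumes "N + b \<le> N'"
  shows "phi N' m \<le> phi N (m + b) * (fact m / fact (m + b)) * real N' ^ b"
proof -
  have 1: "(fact (N + b) :: real) \<le> fact N * real N' ^ b"
    using assms
  proof (induction b)
    case (Suc b)
    have "(fact (N + Suc b) :: real) = real (N + Suc b) * fact (N + b)" by simp
    also have "\<dots> \<le> real N' * (fact N * real N' ^ b)"
      using Suc by (intro mult_mono) auto
    finally show ?case by (simp add: mult_ac)
  qed simp
  have 2: "(fact (N + b + e) :: real) * fact (m + (N + b)) \<le> fact (N + b) * fact (m + (N + b + e))" for e
  proof (induction e)
    case (Suc e)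
    have "(fact (N + b + Suc e) :: real) * fact (m + (N + b)) = real (N + b + Suc e) * (fact (N + b + e) * fact (m + (N + b)))"
      by (simp add: mult_ac)
    also have "\<dots> \<le> real (m + (N + b + Suc e)) * (fact (N + b) * fact (m + (N + b + e)))"
      using Suc by (rule_tac mult_mono) auto
    also have "\<dots> = fact (N + b) * fact (m + (N + b + Suc e))" by (simp add: mult_ac)
    finally show ?case .
  qed simp
  obtain e where e: "N' = N + b + e" using assms le_Suc_ex by blast
  have "(fact N' :: real) * fact (m + (N + b)) \<le> fact (N + b) * fact (m + N')"
    using 2[of e] by (simp add: e)
  also have "\<dots> \<le> (fact N * real N' ^ b) * fact (m + N')"
    using 1 by (intro mult_right_mono) auto
  finally have "(fact N' :: real) * fact (m + (N + b)) \<le> fact N * real N' ^ b * fact (m + N')" .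
  then show ?thesis
    unfolding phi_def by (simp add: field_simps)
qed

lemma phi_ge: "(1 / 2) ^ (m + N) \<le> phi N m"
proof -
  have "(m + N) choose m \<le> (\<Sum>k\<le>m + N. (m + N) choose k)"
    by (rule member_le_sum) auto
  then have "real ((m + N) choose m) \<le> 2 ^ (m + N)"
    by (simp only: choose_row_sum) (metis of_nat_le_iff of_nat_numeral of_nat_power)
  then have "1 / 2 ^ (m + N) \<le> 1 / real ((m + N) choose m)"
    by (intro divide_left_mono) auto
  also have "\<dots> = phi N m"
    by (simp add: binomial_fact phi_def)
  finally show ?thesis by (simp add: power_one_over)
qed

definition bw :: "(nat \<Rightarrow> nat \<Rightarrow> real) \<Rightarrow> mps \<Rightarrow> real \<Rightarrow> bool" where
  "bw \<omega> f B \<longleftrightarrow> bd (\<lambda>\<kappa>. \<omega> (tdeg \<kappa>) (ydeg \<kappa>)) f B"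

definition yw :: "real \<Rightarrow> (nat \<Rightarrow> nat \<Rightarrow> real) \<Rightarrow> bool" where
  "yw \<rho> \<omega> \<longleftrightarrow> 0 \<le> \<rho> \<and> (\<forall>k m. 0 \<le> \<omega> k m \<and> \<omega> k (Suc m) \<le> \<rho> * \<omega> k m)"

lemma yw_power: "yw \<rho> \<omega> \<Longrightarrow> \<omega> k (m + e) \<le> \<rho> ^ e * \<omega> k m"
proof (induction e)
  case (Suc e)
  have "\<omega> k (m + Suc e) \<le> \<rho> * \<omega> k (m + e)" using Suc.prems by (simp add: yw_def)
  also have "\<dots> \<le> \<rho> * (\<rho> ^ e * \<omega> k m)" using Suc by (intro mult_left_mono) (auto simp: yw_def)
  finally show ?case by (simp add: mult_ac)
qed simp

lemma yw_divide: "yw \<rho> \<omega> \<Longrightarrow> (\<And>k. 0 \<le> q k) \<Longrightarrow> yw \<rho> (\<lambda>k m. \<omega> k m / q k)"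
  by (auto simp: yw_def intro!: divide_right_mono)

lemma bw_le:
  assumes "bw \<omega> f B" "\<And>k m. 0 \<le> \<omega> k m" "\<And>k m. \<omega>' k m \<le> \<omega> k m"
  shows "bw \<omega>' f B"
  unfolding bw_def by (rule bd_mono[OF assms(1)[unfolded bw_def]]) (auto intro!: mult_left_mono assms)

lemma bw_scale: "bw \<omega> f B \<Longrightarrow> 0 \<le> c \<Longrightarrow> bw (\<lambda>k m. c * \<omega> k m) f (c * B)"
proof -
  assume f: "bw \<omega> f B" and c: "0 \<le> c"
  show ?thesis
    unfolding bw_def
  proof (rule bdI)
    fix F :: "mindex set" assume "finite F"
    then have "(\<Sum>\<kappa>\<in>F. cmod (cf f \<kappa>) * \<omega> (tdeg \<kappa>) (ydeg \<kappa>)) \<le> B"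
      using f by (auto simp: bw_def dest: bdD)
    then have "c * (\<Sum>\<kappa>\<in>F. cmod (cf f \<kappa>) * \<omega> (tdeg \<kappa>) (ydeg \<kappa>)) \<le> c * B"
      using c by (rule mult_left_mono)
    then show "(\<Sum>\<kappa>\<in>F. cmod (cf f \<kappa>) * (c * \<omega> (tdeg \<kappa>) (ydeg \<kappa>))) \<le> c * B"
      by (simp add: sum_distrib_left mult_ac)
  qed
qed

lemma lookup_Xv_le_ydeg: "lookup \<kappa> (Xv j) \<le> ydeg \<kappa>"
proof (cases "Xv j \<in> keys \<kappa>")
  case True
  then have "yweight (Xv j) * lookup \<kappa> (Xv j) \<le> ydeg \<kappa>"
    unfolding wdeg_def by (intro member_le_sum) auto
  then show ?thesis by simp
qed (simp add: in_keys_iff)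

lemma lookup_Tv_le_tdeg: "lookup \<kappa> (Tv j) \<le> tdeg \<kappa>"
proof (cases "Tv j \<in> keys \<kappa>")
  case True
  then have "tweight (Tv j) * lookup \<kappa> (Tv j) \<le> tdeg \<kappa>"
    unfolding wdeg_def by (intro member_le_sum) auto
  then show ?thesis by simp
qed (simp add: in_keys_iff)

lemma bw_dX:
  assumes "bw \<omega> f B" "\<And>k m. 0 \<le> \<omega> k m"
  shows "bw (\<lambda>k m. \<omega> k (Suc m) / real (Suc m)) (dX j f) B"
  unfolding bw_def
proof (rule bdI)
  fix F :: "mindex set" assume F: "finite F"
  let ?e = "unit_index (Xv j)"
  have inj: "inj_on (\<lambda>\<kappa>. \<kappa> + ?e) F" by (simp add: inj_on_def)
  have "(\<Sum>\<kappa>\<in>F. cmod (cf (dX j f) \<kappa>) * (\<omega> (tdeg \<kappa>) (Suc (ydeg \<kappa>)) / real (Suc (ydeg \<kappa>)))) \<le>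
      (\<Sum>\<kappa>\<in>F. cmod (cf f (\<kappa> + ?e)) * \<omega> (tdeg (\<kappa> + ?e)) (ydeg (\<kappa> + ?e)))"
  proof (intro sum_mono)
    fix \<kappa>
    have "real (lookup \<kappa> (Xv j) + 1) / real (Suc (ydeg \<kappa>)) \<le> 1"
      using lookup_Xv_le_ydeg[of \<kappa> j] by simp
    then have "(real (lookup \<kappa> (Xv j) + 1) / real (Suc (ydeg \<kappa>))) * (cmod (cf f (\<kappa> + ?e)) * \<omega> (tdeg \<kappa>) (Suc (ydeg \<kappa>)))
        \<le> 1 * (cmod (cf f (\<kappa> + ?e)) * \<omega> (tdeg \<kappa>) (Suc (ydeg \<kappa>)))"
      by (intro mult_right_mono) (auto simp: assms(2))
    moreover have "cmod (cf (dX j f) \<kappa>) = real (lookup \<kappa> (Xv j) + 1) * cmod (cf f (\<kappa> + ?e))"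
      by (simp only: cf_D norm_mult norm_of_nat)
    ultimately show "cmod (cf (dX j f) \<kappa>) * (\<omega> (tdeg \<kappa>) (Suc (ydeg \<kappa>)) / real (Suc (ydeg \<kappa>))) \<le>
        cmod (cf f (\<kappa> + ?e)) * \<omega> (tdeg (\<kappa> + ?e)) (ydeg (\<kappa> + ?e))"
      by (simp add: mult_ac)
  qed
  also have "\<dots> = (\<Sum>\<kappa>\<in>(\<lambda>\<kappa>. \<kappa> + ?e) ` F. cmod (cf f \<kappa>) * \<omega> (tdeg \<kappa>) (ydeg \<kappa>))"
    by (simp add: sum.reindex[OF inj])
  also have "\<dots> \<le> B"
    using assms(1) F by (auto simp: bw_def dest: bdD)
  finally show "(\<Sum>\<kappa>\<in>F. cmod (cf (dX j f) \<kappa>) * (\<omega> (tdeg \<kappa>) (Suc (ydeg \<kappa>)) / real (Suc (ydeg \<kappa>)))) \<le> B" .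
qed

lemma multi_iter_count:
  assumes "\<And>i a x. i < N \<Longrightarrow> Q a x \<Longrightarrow> Q (Suc a) (F i x)" "Q 0 x"
  shows "Q (\<Sum>i<N. \<alpha> i) (multi_iter F N \<alpha> x)"
  using assms(1)
proof (induction N)
  case (Suc N)
  note step = Suc.prems[OF lessI]
  have "Q (a + k) ((F N ^^ k) y)" if "Q a y" for a k y
    by (induction k) (use that step in auto)
  from this[OF Suc.IH[OF Suc.prems]] show ?case by simp
qed (use assms(2) in simp)

lemma multi_iter_pair:
  "multi_iter (\<lambda>i (u, v). (F i u, G i v)) N \<alpha> (f, g) = (multi_iter F N \<alpha> f, multi_iter G N \<alpha> g)"
proof (induction N)
  case (Suc N)
  have "((\<lambda>(u, v). (F N u, G N v)) ^^ k) (f, g) = ((F N ^^ k) f, (G N ^^ k) g)" for k f g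
    by (induction k) auto
  then show ?case using Suc by simp
qed simp

definition dw :: "nat \<Rightarrow> (nat \<Rightarrow> nat \<Rightarrow> real) \<Rightarrow> nat \<Rightarrow> nat \<Rightarrow> real" where
  "dw b \<omega> k m = \<omega> k (m + b) * (fact m / fact (m + b))"

lemma bw_multi_dX:
  assumes "bw \<omega> f B" "\<And>k m. 0 \<le> \<omega> k m"
  shows "bw (dw (\<Sum>j<N. \<beta> j) \<omega>) (multi_iter dX N \<beta> f) B"
proof (rule multi_iter_count[where Q = "\<lambda>b g. bw (dw b \<omega>) g B"])
  fix i b g assume "bw (dw b \<omega>) g B"
  moreover have "0 \<le> dw b \<omega> k m" for k m using assms(2) by (simp add: dw_def)
  ultimately have "bw (\<lambda>k m. dw b \<omega> k (Suc m) / real (Suc m)) (dX i g) B" by (rule bw_dX)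
  also have "(\<lambda>k m. dw b \<omega> k (Suc m) / real (Suc m)) = dw (Suc b) \<omega>"
    by (auto simp: dw_def fun_eq_iff)
  finally show "bw (dw (Suc b) \<omega>) (dX i g) B" .
next
  have "dw 0 \<omega> = \<omega>" by (auto simp: dw_def fun_eq_iff)
  then show "bw (dw 0 \<omega>) f B" using assms(1) by simp
qed

lemma yw_dw:
  assumes "yw \<rho> \<omega>"
  shows "yw \<rho> (dw b \<omega>)"
  unfolding yw_def
proof (intro conjI allI)
  show "0 \<le> \<rho>" using assms by (simp add: yw_def)
  fix k m
  show "0 \<le> dw b \<omega> k m" using assms by (simp add: yw_def dw_def)
  have "dw b \<omega> k (Suc m) = \<omega> k (Suc (m + b)) * (fact m / fact (m + b) * (real (Suc m) / real (Suc (m + b))))"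
    by (simp add: dw_def mult_ac)
  also have "\<dots> \<le> (\<rho> * \<omega> k (m + b)) * (fact m / fact (m + b) * 1)"
    using assms by (intro mult_mono) (auto simp: yw_def divide_le_eq)
  finally show "dw b \<omega> k (Suc m) \<le> \<rho> * dw b \<omega> k m" by (simp add: dw_def)
qed

lemma bw_nonneg: "bw \<omega> f B \<Longrightarrow> 0 \<le> B"
  unfolding bw_def by (rule bd_nonneg)

lemma bw_mult_tdeg_0:
  assumes "\<And>\<kappa>. cf c \<kappa> \<noteq> 0 \<Longrightarrow> tdeg \<kappa> = 0" "bd (\<lambda>\<kappa>. \<rho> ^ deg \<kappa>) c A" "yw \<rho> \<omega>" "bw \<omega> f B"
  shows "bw \<omega> (c * f) (A * B)"
  unfolding bw_def
proof (rule bd_mult[OF assms(2) assms(4)[unfolded bw_def]])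
  fix a b assume "cf c a \<noteq> 0"
  then have "tdeg a = 0" by (rule assms(1))
  then show "\<omega> (tdeg (a + b)) (ydeg (a + b)) \<le> \<rho> ^ deg a * \<omega> (tdeg b) (ydeg b)"
    using yw_power[OF assms(3), of "tdeg b" "ydeg b" "ydeg a"] unfolding deg_eq by (simp add: add.commute)
qed (use assms(3) in \<open>auto simp: yw_def\<close>)

lemma bw_th:
  assumes L: "\<And>\<kappa>. cf (L i) \<kappa> \<noteq> 0 \<Longrightarrow> tdeg \<kappa> = 0" "bd (\<lambda>\<kappa>. \<rho> ^ deg \<kappa>) (L i) A"
    and \<omega>: "yw \<rho> \<omega>" and f: "bw \<omega> f B"
  shows "bw (\<lambda>k m. \<omega> k m / ((1 + A) * (1 + real k))) (th L i f) B"
proof -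
  have A: "0 \<le> A" using L(2) by (rule bd_nonneg)
  have B: "0 \<le> B" using f by (rule bw_nonneg)
  have nonneg: "0 \<le> \<omega> k m" for k m using \<omega> by (simp add: yw_def)
  have 1: "bw (\<lambda>k m. \<omega> k m / (1 + real k)) (eul (Tv i) f) B"
    unfolding bw_def
  proof (rule bd_mono[OF f[unfolded bw_def]])
    fix \<kappa>
    have "real (lookup \<kappa> (Tv i)) / (1 + real (tdeg \<kappa>)) \<le> 1"
      using lookup_Tv_le_tdeg[of \<kappa> i] by (simp add: divide_le_eq)
    then have "(real (lookup \<kappa> (Tv i)) / (1 + real (tdeg \<kappa>))) * (cmod (cf f \<kappa>) * \<omega> (tdeg \<kappa>) (ydeg \<kappa>)) \<le>
        1 * (cmod (cf f \<kappa>) * \<omega> (tdeg \<kappa>) (ydeg \<kappa>))"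
      by (intro mult_right_mono) (auto simp: nonneg)
    then show "cmod (cf (eul (Tv i) f) \<kappa>) * (\<omega> (tdeg \<kappa>) (ydeg \<kappa>) / (1 + real (tdeg \<kappa>))) \<le>
        cmod (cf f \<kappa>) * \<omega> (tdeg \<kappa>) (ydeg \<kappa>)"
      by (simp add: norm_mult mult_ac)
  qed (rule nonneg)
  have "bw \<omega> (L i * f) (A * B)" by (rule bw_mult_tdeg_0[OF L \<omega> f])
  moreover have "\<omega> k m / (1 + real k) \<le> \<omega> k m" for k m
    using divide_left_mono[of 1 "1 + real k" "\<omega> k m"] nonneg by simp
  ultimately have 2: "bw (\<lambda>k m. \<omega> k m / (1 + real k)) (L i * f) (A * B)"
    by (rule bw_le[OF _ nonneg])
  have "bw (\<lambda>k m. \<omega> k m / (1 + real k)) (th L i f) (B + A * B)"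
    using 1 2 unfolding bw_def th_def by (rule bd_add) (simp add: nonneg)
  from bw_scale[OF this, of "1 / (1 + A)"] have "bw (\<lambda>k m. 1 / (1 + A) * (\<omega> k m / (1 + real k))) (th L i f) (1 / (1 + A) * (B + A * B))"
    using A by simp
  moreover have "1 / (1 + A) * (B + A * B) = B" using A by (simp add: field_simps)
  ultimately show ?thesis by simp
qed

lemma bw_multi_th_diff:
  assumes L: "\<And>i \<kappa>. i < N \<Longrightarrow> cf (L i) \<kappa> \<noteq> 0 \<Longrightarrow> tdeg \<kappa> = 0" "\<And>i. i < N \<Longrightarrow> bd (\<lambda>\<kappa>. \<rho> ^ deg \<kappa>) (L i) A"
    and L': "\<And>i \<kappa>. i < N \<Longrightarrow> cf (L' i) \<kappa> \<noteq> 0 \<Longrightarrow> tdeg \<kappa> = 0" "\<And>i. i < N \<Longrightarrow> bd (\<lambda>\<kappa>. \<rho> ^ deg \<kappa>) (L' i) A"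
    and d: "\<And>i. i < N \<Longrightarrow> bd (\<lambda>\<kappa>. \<rho> ^ deg \<kappa>) (L i - L' i) \<epsilon>"
    and \<omega>: "yw \<rho> \<omega>" and f: "bw \<omega> f B" and A: "0 \<le> A" and "0 \<le> \<epsilon>"
  defines "w a \<equiv> \<lambda>k m. \<omega> k m / ((1 + A) * (1 + real k)) ^ a"
  shows "bw (w (\<Sum>i<N. \<alpha> i)) (multi_iter (th L) N \<alpha> f) B"
    and "bw (w (\<Sum>i<N. \<alpha> i)) (multi_iter (th L) N \<alpha> f - multi_iter (th L') N \<alpha> f) (real (\<Sum>i<N. \<alpha> i) * \<epsilon> * B)"
proof -
  have yww: "yw \<rho> (w a)" for a
    unfolding w_def using \<omega> A by (intro yw_divide) auto
  have step: "(\<lambda>k m. w a k m / ((1 + A) * (1 + real k))) = w (Suc a)" for a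
    by (simp add: w_def mult_ac)
  have wnn: "0 \<le> w a k m" for a k m using yww by (simp add: yw_def)
  have wle: "w (Suc a) k m \<le> w a k m" for a k m
  proof -
    have "1 * 1 \<le> (1 + A) * (1 + real k)" using A by (intro mult_mono) auto
    then have "w a k m / ((1 + A) * (1 + real k)) \<le> w a k m / 1"
      using wnn by (intro divide_left_mono) auto
    then show ?thesis using step[of a] by (metis div_by_1)
  qed
  let ?Q = "\<lambda>a (u, u'). bw (w a) u B \<and> bw (w a) (u - u') (real a * \<epsilon> * B)"
  have "?Q (\<Sum>i<N. \<alpha> i) (multi_iter (\<lambda>i (u, v). (th L i u, th L' i v)) N \<alpha> (f, f))"
  proof (rule multi_iter_count[where Q = ?Q])
    show "?Q 0 (f, f)" using f by (simp add: w_def bw_def)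
    fix i a x assume i: "i < N" and Q: "?Q a x"
    obtain u u' where x: "x = (u, u')" by (cases x)
    have u: "bw (w a) u B" and du: "bw (w a) (u - u') (real a * \<epsilon> * B)" using Q by (auto simp: x)
    have 1: "bw (w (Suc a)) (th L i u) B"
      unfolding step[symmetric] by (rule bw_th[of L i \<rho> A "w a", OF L(1)[OF i] L(2)[OF i] yww u])
    have 2: "bw (w (Suc a)) (th L' i (u - u')) (real a * \<epsilon> * B)"
      unfolding step[symmetric] by (rule bw_th[of L' i \<rho> A "w a", OF L'(1)[OF i] L'(2)[OF i] yww du])
    have "cf (L i - L' i) \<kappa> \<noteq> 0 \<Longrightarrow> tdeg \<kappa> = 0" for \<kappa>
      using L(1)[OF i, of \<kappa>] L'(1)[OF i, of \<kappa>] by (cases "cf (L i) \<kappa> = 0") auto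
    then have "bw (w a) ((L i - L' i) * u) (\<epsilon> * B)"
      by (rule bw_mult_tdeg_0[OF _ d[OF i] yww u])
    then have 3: "bw (w (Suc a)) ((L i - L' i) * u) (\<epsilon> * B)"
      by (rule bw_le) (auto simp: wnn wle)
    have "bw (w (Suc a)) ((L i - L' i) * u + th L' i (u - u')) (\<epsilon> * B + real a * \<epsilon> * B)"
      using 3 2 unfolding bw_def by (rule bd_add) (rule wnn)
    also have "(L i - L' i) * u + th L' i (u - u') = th L i u - th L' i u'"
      by (simp add: th_def eul_linear algebra_simps)
    finally show "?Q (Suc a) (case x of (u, v) \<Rightarrow> (th L i u, th L' i v))"
      using 1 by (simp add: x algebra_simps)
  qed
  then show "bw (w (\<Sum>i<N. \<alpha> i)) (multi_iter (th L) N \<alpha> f) B"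
    and "bw (w (\<Sum>i<N. \<alpha> i)) (multi_iter (th L) N \<alpha> f - multi_iter (th L') N \<alpha> f) (real (\<Sum>i<N. \<alpha> i) * \<epsilon> * B)"
    by (simp_all add: multi_iter_pair)
qed

text \<open>
  The weight of \<open>t^\<gamma> y^\<mu>\<close>, where \<open>k = |\<gamma>|\<close> and \<open>m = |\<mu>|\<close>. The factor \<open>phi\<close> compensates for the loss of
  up to \<open>r\<close> derivatives in the step from \<open>k\<close> to \<open>k + 1\<close>.
\<close>

definition om :: "nat \<Rightarrow> real \<Rightarrow> real \<Rightarrow> nat \<Rightarrow> nat \<Rightarrow> real" where
  "om r h \<rho> k m = h ^ k * \<rho> ^ m * phi (r * k) m"

lemma yw_om: "0 \<le> h \<Longrightarrow> 0 \<le> \<rho> \<Longrightarrow> yw \<rho> (om r h \<rho>)"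
  unfolding yw_def om_def
proof (intro conjI allI)
  fix k m assume h: "0 \<le> h" "0 \<le> \<rho>"
  show "0 \<le> h ^ k * \<rho> ^ m * phi (r * k) m" using h by (simp add: phi_pos less_imp_le)
  have "h ^ k * \<rho> ^ Suc m * phi (r * k) (Suc m) \<le> h ^ k * \<rho> ^ Suc m * phi (r * k) m"
    using h by (intro mult_left_mono phi_Suc) auto
  then show "h ^ k * \<rho> ^ Suc m * phi (r * k) (Suc m) \<le> \<rho> * (h ^ k * \<rho> ^ m * phi (r * k) m)"
    by (simp add: mult_ac)
qed

lemma om_shift:
  assumes h: "0 < h" "h \<le> s" and \<rho>: "0 < \<rho>" "\<rho> \<le> s" "\<rho> \<le> 1" and d: "1 \<le> d" and ab: "a + b \<le> r" and A: "0 \<le> A"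
  shows "om r h \<rho> (k + d) (m + e) / (1 + real (k + d)) ^ r \<le>
    (h / s * (1 / \<rho>) ^ r * (1 + real r) ^ r * (1 + A) ^ r * s ^ (d + e)) *
      (dw b (om r h \<rho>) k m / ((1 + A) * (1 + real k)) ^ a)"
proof -
  define X where "X = h ^ k * \<rho> ^ (m + b) * phi (r * k) (m + b) * (fact m / fact (m + b))"
  have X: "0 \<le> X" using h \<rho> by (simp add: X_def phi_pos less_imp_le)
  have s: "0 < s" using h by simp
  have hd: "h ^ d * \<rho> ^ e \<le> h / s * s ^ (d + e)"
  proof -
    obtain d' where d': "d = Suc d'" using d by (cases d) auto
    have "h ^ d * \<rho> ^ e = h * (h ^ d' * \<rho> ^ e)" by (simp add: d')
    also have "\<dots> \<le> h * (s ^ d' * s ^ e)"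
      using h \<rho> by (intro mult_left_mono mult_mono power_mono) auto
    also have "\<dots> = h / s * s ^ (d + e)" using s by (simp add: d' power_add)
    finally show ?thesis .
  qed
  have kd: "real (r * (k + d)) ^ b * (1 + real k) ^ a \<le> (1 + real r) ^ r * (1 + real (k + d)) ^ r"
  proof -
    have "real (r * (k + d)) ^ b * (1 + real k) ^ a \<le> ((1 + real r) * (1 + real (k + d))) ^ b * (1 + real (k + d)) ^ a"
      by (intro mult_mono power_mono) (auto simp: algebra_simps)
    also have "\<dots> = (1 + real r) ^ b * (1 + real (k + d)) ^ (a + b)"
      by (simp add: power_mult_distrib power_add mult_ac)
    also have "\<dots> \<le> (1 + real r) ^ r * (1 + real (k + d)) ^ r"
      using ab by (intro mult_mono power_increasing) auto
    finally show ?thesis .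
  qed
  have \<rho>b: "(1 :: real) \<le> (1 / \<rho>) ^ r * \<rho> ^ b"
  proof -
    have "(1 / \<rho>) ^ r * \<rho> ^ b \<ge> (1 / \<rho>) ^ r * \<rho> ^ r"
      using \<rho> ab by (intro mult_left_mono power_decreasing) auto
    then show ?thesis using \<rho> by (simp flip: power_mult_distrib)
  qed
  have "r * k + b \<le> r * (k + d)"
  proof -
    have "r \<le> r * d" using d by (cases d) auto
    then show ?thesis using ab unfolding distrib_left by linarith
  qed
  from phi_shift[OF this, of m] have phi: "phi (r * (k + d)) (m + e) \<le>
      phi (r * k) (m + b) * (fact m / fact (m + b)) * real (r * (k + d)) ^ b"
    using phi_antimono[of "r * (k + d)" m e] by linarith
  have "om r h \<rho> (k + d) (m + e) = (h ^ k * \<rho> ^ m) * (h ^ d * \<rho> ^ e) * phi (r * (k + d)) (m + e)"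
    by (simp add: om_def power_add mult_ac)
  also have "\<dots> \<le> (h ^ k * \<rho> ^ m * ((1 / \<rho>) ^ r * \<rho> ^ b)) * (h / s * s ^ (d + e)) *
      (phi (r * k) (m + b) * (fact m / fact (m + b)) * real (r * (k + d)) ^ b)"
  proof -
    have hk: "0 \<le> h ^ k * \<rho> ^ m" using h \<rho> by simp
    have A1: "h ^ k * \<rho> ^ m \<le> h ^ k * \<rho> ^ m * ((1 / \<rho>) ^ r * \<rho> ^ b)"
      using mult_left_mono[OF \<rho>b hk] by simp
    have A2: "(h ^ k * \<rho> ^ m) * (h ^ d * \<rho> ^ e) \<le> (h ^ k * \<rho> ^ m * ((1 / \<rho>) ^ r * \<rho> ^ b)) * (h / s * s ^ (d + e))"
      by (rule mult_mono[OF A1 hd]) (use h \<rho> in simp_all)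
    show ?thesis
      by (rule mult_mono[OF A2 phi]) (use h \<rho> s in \<open>simp_all add: phi_pos less_imp_le\<close>)
  qed
  also have "\<dots> = (h / s * (1 / \<rho>) ^ r * s ^ (d + e)) * X * real (r * (k + d)) ^ b"
    by (simp add: X_def power_add mult_ac)
  finally have 1: "om r h \<rho> (k + d) (m + e) \<le> (h / s * (1 / \<rho>) ^ r * s ^ (d + e)) * X * real (r * (k + d)) ^ b" .
  let ?Y = "(h / s * (1 / \<rho>) ^ r * s ^ (d + e)) * X"
  have Y: "0 \<le> ?Y" using h \<rho> s X by simp
  have pos: "0 < (1 + real (k + d)) ^ r" "0 < (1 + real k) ^ a" "0 < (1 + A) ^ a" using A by auto
  have "om r h \<rho> (k + d) (m + e) / (1 + real (k + d)) ^ r \<le> ?Y * real (r * (k + d)) ^ b / (1 + real (k + d)) ^ r"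
    using 1 by (intro divide_right_mono) auto
  also have "\<dots> = ?Y * (real (r * (k + d)) ^ b * (1 + real k) ^ a) / (1 + real (k + d)) ^ r / (1 + real k) ^ a"
    using pos by simp
  also have "\<dots> \<le> ?Y * ((1 + real r) ^ r * (1 + real (k + d)) ^ r) / (1 + real (k + d)) ^ r / (1 + real k) ^ a"
    using kd Y by (intro divide_right_mono mult_left_mono) auto
  also have "\<dots> = ?Y * (1 + real r) ^ r / (1 + real k) ^ a"
    using pos by simp
  also have "\<dots> = (?Y * (1 + real r) ^ r * (1 + A) ^ a) / ((1 + A) * (1 + real k)) ^ a"
    using pos A by (auto simp: power_mult_distrib)
  also have "\<dots> \<le> (?Y * (1 + real r) ^ r * (1 + A) ^ r) / ((1 + A) * (1 + real k)) ^ a"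
    using ab A h \<rho> s X by (intro divide_right_mono mult_left_mono power_increasing) auto
  also have "\<dots> = (h / s * (1 / \<rho>) ^ r * (1 + real r) ^ r * (1 + A) ^ r * s ^ (d + e)) *
      (dw b (om r h \<rho>) k m / ((1 + A) * (1 + real k)) ^ a)"
    by (simp add: dw_def om_def X_def mult_ac)
  finally show ?thesis .
qed

lemma matrix_left_inverse_bound:
  fixes B :: "complex ^ 'm::finite ^ 'm"
  assumes "0 < c" "\<And>y. c * norm y \<le> norm (B *v y)"
  shows "B ** matrix_inv B = mat 1" and "norm (matrix_inv B *v z) \<le> norm z / c"
proof -
  have "inj ((*v) B)"
  proof (rule injI)
    fix x y assume "B *v x = B *v y"
    then have "c * norm (x - y) \<le> 0" using assms(2)[of "x - y"] by (simp add: matrix_vector_mult_diff_distrib)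
    then show "x = y" using assms(1) by (simp add: mult_le_0_iff)
  qed
  then have "invertible B"
    by (simp add: invertible_left_inverse matrix_left_invertible_injective)
  then show inv: "B ** matrix_inv B = mat 1"
    unfolding matrix_inv_def invertible_def by (rule someI2_ex) blast
  have "c * norm (matrix_inv B *v z) \<le> norm (B *v (matrix_inv B *v z))" by (rule assms(2))
  also have "\<dots> = norm z" by (simp add: matrix_vector_mul_assoc inv)
  finally show "norm (matrix_inv B *v z) \<le> norm z / c"
    using assms(1) by (simp add: field_simps)
qed

lemma matrix_vector_mult_diff_lambda:
  "(M :: complex ^ 'n ^ 'm) *v (\<chi> j. x j - y j) = M *v (\<chi> j. x j) - M *v (\<chi> j. y j)"
  by (simp add: vec_eq_iff matrix_vector_mult_def algebra_simps sum_subtractf)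

lemma matrix_vector_mult_uminus: "(M :: complex ^ 'n ^ 'm) *v (- x) = - (M *v x)"
  by (simp add: vec_eq_iff matrix_vector_mult_def sum_negf)

lemma bd_scale:
  assumes "bd \<omega> c A" "0 \<le> C" "\<And>\<kappa>. 0 \<le> \<omega> \<kappa>" "\<And>\<kappa>. cmod (cf g \<kappa>) \<le> cmod (cf c \<kappa>)"
  shows "bd (\<lambda>\<kappa>. C * \<omega> \<kappa>) g (A * C)"
proof (rule bdI)
  fix F :: "mindex set" assume F: "finite F"
  have "(\<Sum>\<kappa>\<in>F. cmod (cf g \<kappa>) * (C * \<omega> \<kappa>)) \<le> (\<Sum>\<kappa>\<in>F. cmod (cf c \<kappa>) * (C * \<omega> \<kappa>))"
    by (intro sum_mono mult_right_mono assms(4) mult_nonneg_nonneg assms(2,3))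
  also have "\<dots> = C * (\<Sum>\<kappa>\<in>F. cmod (cf c \<kappa>) * \<omega> \<kappa>)" by (simp add: sum_distrib_left mult_ac)
  also have "\<dots> \<le> C * A" using bdD[OF assms(1) F] assms(2) by (rule mult_left_mono)
  finally show "(\<Sum>\<kappa>\<in>F. cmod (cf g \<kappa>) * (C * \<omega> \<kappa>)) \<le> A * C" by (simp add: mult.commute)
qed

context coords
begin

lemma t0_add: "t0 (f + g) = t0 f + t0 g" and t0_diff: "t0 (f - g) = t0 f - t0 g" and t0_0: "t0 0 = 0"
  by (auto intro!: mps_eqI simp: cf_t0)

lemma t0_sum: "t0 (sum f I) = (\<Sum>i\<in>I. t0 (f i))"
  by (induction I rule: infinite_finite_induct) (auto simp: t0_add t0_0)

lemma t0_eq_0_iff: "t0 f = 0 \<longleftrightarrow> (\<forall>\<kappa>. tdeg \<kappa> = 0 \<longrightarrow> cf f \<kappa> = 0)"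
proof
  assume "t0 f = 0"
  then show "\<forall>\<kappa>. tdeg \<kappa> = 0 \<longrightarrow> cf f \<kappa> = 0" by (metis cf_0 cf_t0)
qed (auto intro!: mps_eqI simp: cf_t0)

lemma t0_mult_eq_0: "t0 f = 0 \<Longrightarrow> t0 (c * f) = 0"
  unfolding t0_eq_0_iff cf_mult
proof (intro allI impI sum.neutral ballI)
  fix \<kappa> p assume f: "\<forall>\<kappa>. tdeg \<kappa> = 0 \<longrightarrow> cf f \<kappa> = 0" and k: "tdeg \<kappa> = 0" and p: "p \<in> splits \<kappa>"
  obtain a b where ab: "p = (a, b)" by (cases p)
  then have "tdeg b = 0" using p k by (auto simp: splits_def)
  then show "(case p of (a, b) \<Rightarrow> cf c a * cf f b) = 0" using f by (simp add: ab)
qed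

lemma t0_mit_eq_0: "t0 f = 0 \<Longrightarrow> t0 (mit L \<alpha> \<beta> f) = 0"
proof -
  assume f: "t0 f = 0"
  have X: "t0 (dX j g) = 0" if "t0 g = 0" for j g
    using that by (simp add: t0_eq_0_iff cf_D)
  have T: "t0 (th L i g) = 0" if "t0 g = 0" for i g
    using that t0_mult_eq_0[OF that, of "L i"] by (simp add: th_def t0_eq_0_iff)
  have "t0 (multi_iter dX n' \<beta> f) = 0"
    by (rule multi_iter_invariant[where Q = "\<lambda>f. t0 f = 0"]) (rule X f, assumption?)+
  then show ?thesis
    unfolding mit_def by (rule multi_iter_invariant[where Q = "\<lambda>f. t0 f = 0", rotated]) (rule T)
qed

lemma t0_fop_eq_0: "(\<And>j. t0 (w $ j) = 0) \<Longrightarrow> t0 (fop S a L w $ i) = 0"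
  by (simp add: fop_def t0_sum case_prod_unfold t0_mult_eq_0 t0_mit_eq_0)

lemma t0_fop_cong:
  assumes "\<And>j. t0 (u $ j) = t0 (w $ j)"
  shows "t0 (fop S a L u $ i) = t0 (fop S a L w $ i)"
proof -
  have "t0 (fop S a L (u - w) $ i) = 0"
    by (rule t0_fop_eq_0) (simp add: t0_diff assms)
  then show ?thesis by (simp add: fop_diff t0_diff)
qed

lemma Vsup_fop:
  assumes "\<And>\<alpha> \<beta> i j. Vsup (a \<alpha> \<beta> $ i $ j)" "\<And>i. i < n \<Longrightarrow> Vsup (L i)" "\<And>j. Vsup (w $ j)"
  shows "Vsup (fop S a L w $ i)"
  unfolding fop_def using assms
  by (auto simp: case_prod_unfold intro!: Vsup_sum Vsup_mult Vsup_mit)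

lemma conv_uniform:
  assumes "finite I" "\<And>i. i \<in> I \<Longrightarrow> conv (f i)"
  shows "\<exists>s>0. s \<le> 1 \<and> (\<exists>A\<ge>0. \<forall>i\<in>I. bd (\<lambda>\<kappa>. s ^ deg \<kappa>) (f i) A)"
  using assms
proof (induction I rule: finite_induct)
  case empty
  then show ?case by (intro exI[of _ 1]) auto
next
  case (insert i I)
  then obtain s A where s: "0 < s" "s \<le> 1" "0 \<le> A" "\<And>i. i \<in> I \<Longrightarrow> bd (\<lambda>\<kappa>. s ^ deg \<kappa>) (f i) A" by auto
  have "conv (f i)" using insert.prems by blast
  then obtain s' A' where s': "0 < s'" "bd (\<lambda>\<kappa>. s' ^ deg \<kappa>) (f i) A'" unfolding conv_def by blast
  let ?s = "min s s'" and ?A = "max A A'"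
  have mono: "bd (\<lambda>\<kappa>. ?s ^ deg \<kappa>) g ?A" if "bd (\<lambda>\<kappa>. u ^ deg \<kappa>) g C" "?s \<le> u" "C \<le> ?A" "0 < u" for g u C
    by (rule bd_le[OF bd_mono[OF that(1)]]) (use that s s' in \<open>auto intro!: mult_left_mono power_mono\<close>)
  have all: "bd (\<lambda>\<kappa>. ?s ^ deg \<kappa>) (f j) ?A" if "j \<in> insert i I" for j
  proof (cases "j = i")
    case True
    show ?thesis unfolding True by (rule mono[OF s'(2)]) (use s' in auto)
  next
    case False
    show ?thesis by (rule mono[OF s(4)]) (use that False s in auto)
  qed
  have "0 < ?s" "?s \<le> 1" "0 \<le> ?A" using s s' by auto
  then show ?case using all by blast
qed

definition rem_op :: "((nat \<Rightarrow> nat) \<times> (nat \<Rightarrow> nat)) set \<Rightarrow> ((nat \<Rightarrow> nat) \<Rightarrow> (nat \<Rightarrow> nat) \<Rightarrow> mps ^ 'm ^ 'm) \<Rightarrow>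
    (nat \<Rightarrow> mps) \<Rightarrow> mps ^ 'm::finite \<Rightarrow> mps ^ 'm" where
  "rem_op S a L w = (\<chi> i. Mps (\<lambda>\<kappa>. cf (fop S a L w $ i) \<kappa> -
     (lead S a L (\<lambda>k. lookup \<kappa> (Tv k)) *v (\<chi> j. cf (w $ j) \<kappa>)) $ i))"

lemma cf_mit_const:
  "cf (mit (\<lambda>i. cst (lz i)) \<alpha> (\<lambda>_. 0) f) \<kappa> = mpow n (\<lambda>k. lz k + of_nat (lookup \<kappa> (Tv k))) \<alpha> * cf f \<kappa>"
proof -
  let ?m = "\<lambda>k. lz k + of_nat (lookup \<kappa> (Tv k))"
  have "cf (multi_iter (th (\<lambda>i. cst (lz i))) N \<alpha> f) \<kappa> = mpow N ?m \<alpha> * cf f \<kappa>" for N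
  proof (induction N)
    case (Suc N)
    have "cf ((th (\<lambda>i. cst (lz i)) N ^^ k) g) \<kappa> = ?m N ^ k * cf g \<kappa>" for k g
      by (induction k) (simp_all add: th_def algebra_simps)
    then show ?case using Suc by (simp add: mpow_def mult_ac)
  qed (simp add: mpow_def)
  then show ?thesis by (simp add: mit_def)
qed

lemma rem_op_eq:
  assumes "finite S"
  shows "rem_op S a L w $ i = (\<Sum>(\<alpha>, \<beta>)\<in>S. \<Sum>j\<in>UNIV. a \<alpha> \<beta> $ i $ j * mit L \<alpha> \<beta> (w $ j) -
    (if \<beta> = (\<lambda>_. 0) then cst (cf (a \<alpha> \<beta> $ i $ j) 0) * mit (\<lambda>k. cst (cf (L k) 0)) \<alpha> (\<lambda>_. 0) (w $ j) else 0))"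
proof (rule mps_eqI)
  fix \<kappa>
  let ?c = "\<lambda>\<alpha>. \<Sum>j\<in>UNIV. cf (a \<alpha> (\<lambda>_. 0) $ i $ j) 0 *
     (mpow n (\<lambda>k. cf (L k) 0 + of_nat (lookup \<kappa> (Tv k))) \<alpha> * cf (w $ j) \<kappa>)"
  have "(lead S a L (\<lambda>k. lookup \<kappa> (Tv k)) *v (\<chi> j. cf (w $ j) \<kappa>)) $ i = (\<Sum>\<alpha> | (\<alpha>, \<lambda>_. 0) \<in> S. ?c \<alpha>)"
    by (simp add: lead_def matrix_vector_mult_def sum_distrib_right mult.assoc) (rule sum.swap)
  also have "\<dots> = (\<Sum>(\<alpha>, \<beta>)\<in>S \<inter> {(\<alpha>, \<beta>). \<beta> = (\<lambda>_. 0)}. ?c \<alpha>)"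
    by (rule sum.reindex_bij_witness[of _ fst "\<lambda>\<alpha>. (\<alpha>, \<lambda>_. 0)"]) auto
  also have "\<dots> = (\<Sum>(\<alpha>, \<beta>)\<in>S. if \<beta> = (\<lambda>_. 0) then ?c \<alpha> else 0)"
    using assms by (simp add: sum.inter_restrict case_prod_unfold)
  also have "\<dots> = (\<Sum>(\<alpha>, \<beta>)\<in>S. \<Sum>j\<in>UNIV. cf (if \<beta> = (\<lambda>_. 0) then cst (cf (a \<alpha> \<beta> $ i $ j) 0) *
      mit (\<lambda>k. cst (cf (L k) 0)) \<alpha> (\<lambda>_. 0) (w $ j) else 0) \<kappa>)"
    by (intro sum.cong refl) (auto simp: cf_mit_const)
  finally show "cf (rem_op S a L w $ i) \<kappa> = cf (\<Sum>(\<alpha>, \<beta>)\<in>S. \<Sum>j\<in>UNIV. a \<alpha> \<beta> $ i $ j * mit L \<alpha> \<beta> (w $ j) -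
    (if \<beta> = (\<lambda>_. 0) then cst (cf (a \<alpha> \<beta> $ i $ j) 0) * mit (\<lambda>k. cst (cf (L k) 0)) \<alpha> (\<lambda>_. 0) (w $ j) else 0)) \<kappa>"
    by (simp add: rem_op_def fop_def case_prod_unfold sum_subtractf)
qed

lemma rem_op_diff: "rem_op S a L (u - w) = rem_op S a L u - rem_op S a L w"
  by (auto simp: rem_op_def fop_diff vec_eq_iff matrix_vector_mult_diff_lambda intro!: mps_eqI)

lemma rem_op_low:
  assumes "UD_data s S a" "0 < s" "\<And>j. low s d (w $ j)"
  shows "low s (Suc d) (rem_op S a L w $ i)"
  unfolding low_def
proof (intro allI impI)
  fix \<kappa> assume "W s \<kappa> < Suc d"
  then have "low s (W s \<kappa>) (w $ j)" for j by (intro low_mono[OF assms(3)]) simp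
  from cf_fop_low[OF assms(1) this refl assms(2)] show "cf (rem_op S a L w $ i) \<kappa> = 0"
    by (simp add: rem_op_def)
qed

definition K1 :: "nat \<Rightarrow> real \<Rightarrow> real \<Rightarrow> real" where
  "K1 r s A = A * (1 + real r) ^ r * (1 + A) ^ r / s + A * (1 + A) ^ r / s + A * real r * A * (1 + A) ^ r / s"

lemma rem_op_term_bound:
  assumes s: "0 < s" "s \<le> 1" and h: "0 < h" "h \<le> s" and \<rho>: "0 < \<rho>" "\<rho> \<le> s" and A: "0 \<le> A"
    and c: "bd (\<lambda>\<kappa>. s ^ deg \<kappa>) c A"
    and L: "\<And>i. i < n \<Longrightarrow> bd (\<lambda>\<kappa>. s ^ deg \<kappa>) (L i) A" "\<And>i \<kappa>. i < n \<Longrightarrow> cf (L i) \<kappa> \<noteq> 0 \<Longrightarrow> tdeg \<kappa> = 0"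
    and ord: "c \<noteq> 0 \<Longrightarrow> (\<Sum>i<n. \<alpha> i) + bsum \<beta> \<le> r" and UD: "\<beta> \<noteq> (\<lambda>_. 0) \<Longrightarrow> t0 c = 0"
    and f: "bw (om r h \<rho>) f B"
  shows "bw (\<lambda>k m. om r h \<rho> k m / (1 + real k) ^ r) (c * mit L \<alpha> \<beta> f -
    (if \<beta> = (\<lambda>_. 0) then cst (cf c 0) * mit (\<lambda>k. cst (cf (L k) 0)) \<alpha> (\<lambda>_. 0) f else 0))
    (K1 r s A * (\<rho> + h * (1 / \<rho>) ^ r) * B)" (is "bw ?\<omega>' ?R ?bound")
proof (cases "c = 0")
  case True
  have "0 \<le> K1 r s A" using s A by (simp add: K1_def)
  moreover have "0 \<le> B" using f by (rule bw_nonneg)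
  ultimately show ?thesis using True h \<rho> by (simp add: bw_def)
next
  case False
  have B: "0 \<le> B" using f by (rule bw_nonneg)
  define a b where "a = (\<Sum>i<n. \<alpha> i)" and "b = bsum \<beta>"
  have ab: "a + b \<le> r" using ord[OF False] by (simp add: a_def b_def)
  let ?\<omega> = "om r h \<rho>"
  let ?L0 = "\<lambda>k. cst (cf (L k) 0)"
  have yw: "yw \<rho> ?\<omega>" using h \<rho> by (intro yw_om) auto
  have \<omega>nn: "0 \<le> ?\<omega> k m" for k m using yw by (simp add: yw_def)
  have \<omega>'nn: "0 \<le> ?\<omega>' k m" for k m using \<omega>nn by simp
  define \<omega>2 where "\<omega>2 = (\<lambda>k m. dw b ?\<omega> k m / ((1 + A) * (1 + real k)) ^ a)"
  have \<omega>2nn: "0 \<le> \<omega>2 k m" for k m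
    using \<omega>nn A by (simp add: \<omega>2_def dw_def)
  have bd_\<rho>: "bd (\<lambda>\<kappa>. \<rho> ^ deg \<kappa>) g C" if "bd (\<lambda>\<kappa>. s ^ deg \<kappa>) g C" for g C
    by (rule bd_mono[OF that]) (use s \<rho> in \<open>auto intro!: mult_left_mono power_mono\<close>)
  have split: "cf (g - cst (cf g 0)) \<kappa> = (if \<kappa> = 0 then 0 else cf g \<kappa>)" for g \<kappa>
    by (simp add: cf_cst)
  have L0: "bd (\<lambda>\<kappa>. \<rho> ^ deg \<kappa>) (?L0 i) A" if "i < n" for i
    by (rule bd_mono[OF L(1)[OF that]]) (use s in \<open>auto simp: cf_cst\<close>)
  have dL: "bd (\<lambda>\<kappa>. \<rho> ^ deg \<kappa>) (L i - ?L0 i) (\<rho> / s * A)" if i: "i < n" for i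
  proof (rule bdI)
    fix F :: "mindex set" assume F: "finite F"
    have "(\<Sum>\<kappa>\<in>F. cmod (cf (L i - ?L0 i) \<kappa>) * \<rho> ^ deg \<kappa>) \<le> (\<Sum>\<kappa>\<in>F. \<rho> / s * (cmod (cf (L i) \<kappa>) * s ^ deg \<kappa>))"
    proof (intro sum_mono)
      fix \<kappa>
      show "cmod (cf (L i - ?L0 i) \<kappa>) * \<rho> ^ deg \<kappa> \<le> \<rho> / s * (cmod (cf (L i) \<kappa>) * s ^ deg \<kappa>)"
      proof (cases "\<kappa> = 0")
        case True
        then show ?thesis using s \<rho> by (simp add: cf_cst)
      next
        case False
        then have "deg \<kappa> \<noteq> 0" using W_eq_0_iff[of 1 \<kappa>] unfolding W_eq deg_eq by simp
        then obtain e where e: "deg \<kappa> = Suc e" by (cases "deg \<kappa>") auto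
        have "\<rho> ^ deg \<kappa> = \<rho> / s * (s * \<rho> ^ e)" unfolding e using s by simp
        also have "\<dots> \<le> \<rho> / s * (s * s ^ e)"
          using s \<rho> by (intro mult_left_mono power_mono) auto
        finally have "\<rho> ^ deg \<kappa> \<le> \<rho> / s * s ^ deg \<kappa>" by (simp only: e power_Suc)
        then have "cmod (cf (L i) \<kappa>) * \<rho> ^ deg \<kappa> \<le> cmod (cf (L i) \<kappa>) * (\<rho> / s * s ^ deg \<kappa>)"
          by (intro mult_left_mono) auto
        then show ?thesis using False by (simp only: split if_False mult.left_commute)
      qed
    qed
    also have "\<dots> = \<rho> / s * (\<Sum>\<kappa>\<in>F. cmod (cf (L i) \<kappa>) * s ^ deg \<kappa>)" by (simp add: sum_distrib_left)
    also have "\<dots> \<le> \<rho> / s * A" using bdD[OF L(1)[OF i] F] s \<rho> by (intro mult_left_mono) auto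
    finally show "(\<Sum>\<kappa>\<in>F. cmod (cf (L i - ?L0 i) \<kappa>) * \<rho> ^ deg \<kappa>) \<le> \<rho> / s * A" .
  qed
  have L0t: "cf (?L0 i) \<kappa> \<noteq> 0 \<Longrightarrow> tdeg \<kappa> = 0" for i \<kappa> by (auto simp: cf_cst split: if_splits)
  have \<epsilon>: "0 \<le> \<rho> / s * A" using s \<rho> A by simp
  have X: "bw (dw b ?\<omega>) (multi_iter dX n' \<beta> f) B"
    unfolding b_def by (rule bw_multi_dX[OF f \<omega>nn])
  have M: "bw \<omega>2 (multi_iter (th L) n \<alpha> (multi_iter dX n' \<beta> f)) B"
    "bw \<omega>2 (multi_iter (th L) n \<alpha> (multi_iter dX n' \<beta> f) - multi_iter (th ?L0) n \<alpha> (multi_iter dX n' \<beta> f))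
      (real a * (\<rho> / s * A) * B)"
    unfolding \<omega>2_def a_def
    by (rule bw_multi_th_diff[where \<epsilon> = "\<rho> / s * A" and L = L and L' = ?L0 and \<rho> = \<rho> and \<omega> = "dw b ?\<omega>"],
      (rule L(2) bd_\<rho>[OF L(1)] L0t L0 dL yw_dw[OF yw] X A \<epsilon>; assumption)+)+
  have g: "bw \<omega>2 (mit L \<alpha> \<beta> f) B" using M(1) by (simp add: mit_def)
  have part1: "bw ?\<omega>' ((c - t0 c) * mit L \<alpha> \<beta> f) (A * (h / s * (1 / \<rho>) ^ r * (1 + real r) ^ r * (1 + A) ^ r) * B)"
    (is "bw _ _ (A * ?C * B)")
    unfolding bw_def
  proof (rule bd_mult[OF _ g[unfolded bw_def]])
    show "bd (\<lambda>\<kappa>. ?C * s ^ deg \<kappa>) (c - t0 c) (A * ?C)"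
      by (rule bd_scale[OF c]) (use h \<rho> A s in \<open>auto simp: cf_t0\<close>)
    fix \<nu> \<kappa> assume "cf (c - t0 c) \<nu> \<noteq> 0"
    then have "1 \<le> tdeg \<nu>" by (cases "tdeg \<nu> = 0") (auto simp: cf_t0)
    from om_shift[OF h \<rho> order_trans[OF \<rho>(2) s(2)] this ab A, of "tdeg \<kappa>" "ydeg \<kappa>" "ydeg \<nu>"]
    show "?\<omega>' (tdeg (\<nu> + \<kappa>)) (ydeg (\<nu> + \<kappa>)) \<le> ?C * s ^ deg \<nu> * \<omega>2 (tdeg \<kappa>) (ydeg \<kappa>)"
      unfolding deg_eq \<omega>2_def by (simp only: wdeg_add add.commute[of "tdeg \<nu>" "tdeg \<kappa>"] add.commute[of "ydeg \<nu>" "ydeg \<kappa>"])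
  qed (use h \<rho> s A \<omega>nn \<omega>2nn in auto)
  show ?thesis
  proof (cases "\<beta> = (\<lambda>_. 0)")
    case False
    have "bw ?\<omega>' (c * mit L \<alpha> \<beta> f) (A * ?C * B)" using part1 UD[OF False] by simp
    moreover have "A * ?C * B \<le> ?bound"
    proof -
      have "A * ?C = (A * (1 + real r) ^ r * (1 + A) ^ r / s) * (h * (1 / \<rho>) ^ r)" by simp
      also have "\<dots> \<le> K1 r s A * (\<rho> + h * (1 / \<rho>) ^ r)"
        unfolding K1_def using s h \<rho> A by (intro mult_mono) auto
      finally show ?thesis using B by (rule mult_right_mono)
    qed
    ultimately show ?thesis using False by (auto simp: bw_def intro: bd_le)
  next
    case True
    have b0: "b = 0" by (simp add: b_def True)
    have dw0: "dw 0 ?\<omega> = ?\<omega>" by (auto simp: dw_def fun_eq_iff)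
    let ?g = "mit L \<alpha> (\<lambda>_. 0) f" and ?gc = "mit ?L0 \<alpha> (\<lambda>_. 0) f"
    have \<omega>'2: "?\<omega>' k m \<le> (1 + A) ^ r * \<omega>2 k m" for k m
    proof -
      have "(1 + A) ^ a * (1 + real k) ^ a \<le> (1 + A) ^ r * (1 + real k) ^ r"
        using ab A by (intro mult_mono power_increasing) auto
      then have "?\<omega> k m * ((1 + A) ^ a * (1 + real k) ^ a) \<le> ?\<omega> k m * ((1 + A) ^ r * (1 + real k) ^ r)"
        using \<omega>nn by (rule mult_left_mono)
      moreover have "0 < (1 + A) ^ a * (1 + real k) ^ a" using A by simp
      ultimately show ?thesis
        unfolding \<omega>2_def b0 dw0 power_mult_distrib by (simp add: field_simps)
    qed
    have part2: "bw ?\<omega>' ((t0 c - cst (cf c 0)) * ?g) (A * (\<rho> / s * (1 + A) ^ r) * B)"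
      unfolding bw_def
    proof (rule bd_mult[OF _ g[unfolded bw_def True]])
      let ?D = "\<rho> / s * (1 + A) ^ r"
      have D: "0 \<le> ?D" using \<rho> A s by simp
      show "bd (\<lambda>\<kappa>. ?D * s ^ deg \<kappa>) (t0 c - cst (cf c 0)) (A * ?D)"
        by (rule bd_scale[OF c D]) (use s in \<open>auto simp: cf_t0 cf_cst\<close>)
      fix \<nu> \<kappa> assume \<nu>: "cf (t0 c - cst (cf c 0)) \<nu> \<noteq> 0"
      then have t: "tdeg \<nu> = 0" by (cases "tdeg \<nu> = 0") (auto simp: cf_t0 cf_cst split: if_splits)
      have "\<nu> \<noteq> 0" using \<nu> by (auto simp: cf_t0 cf_cst)
      then have "ydeg \<nu> \<noteq> 0" using W_eq_0_iff[of 1 \<nu>] t by (simp add: W_eq)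
      then obtain e where e: "ydeg \<nu> = Suc e" by (cases "ydeg \<nu>") auto
      have "\<rho> ^ ydeg \<nu> = \<rho> / s * (s * \<rho> ^ e)" unfolding e using s by simp
      also have "\<dots> \<le> \<rho> / s * (s * s ^ e)"
        using s \<rho> by (intro mult_left_mono power_mono) auto
      finally have \<rho>e: "\<rho> ^ ydeg \<nu> \<le> \<rho> / s * s ^ deg \<nu>" using t by (simp only: e power_Suc deg_eq add_0)
      have yw': "yw \<rho> ?\<omega>'" by (rule yw_divide[OF yw]) simp
      have "?\<omega>' (tdeg (\<nu> + \<kappa>)) (ydeg (\<nu> + \<kappa>)) \<le> \<rho> ^ ydeg \<nu> * ?\<omega>' (tdeg \<kappa>) (ydeg \<kappa>)"
        using yw_power[OF yw', of "tdeg \<kappa>" "ydeg \<kappa>" "ydeg \<nu>"] t by (simp add: add.commute)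
      also have "\<dots> \<le> (\<rho> / s * s ^ deg \<nu>) * ((1 + A) ^ r * \<omega>2 (tdeg \<kappa>) (ydeg \<kappa>))"
        using s \<rho> \<omega>'nn by (intro mult_mono \<rho>e \<omega>'2) auto
      finally show "?\<omega>' (tdeg (\<nu> + \<kappa>)) (ydeg (\<nu> + \<kappa>)) \<le> ?D * s ^ deg \<nu> * \<omega>2 (tdeg \<kappa>) (ydeg \<kappa>)"
        by (simp only: mult_ac)
    qed (use h \<rho> s A \<omega>nn \<omega>2nn in auto)
    have c0: "cmod (cf c 0) \<le> A" using bd_coeff[OF c, of 0] by simp
    have dg: "bw \<omega>2 (?g - ?gc) (real a * (\<rho> / s * A) * B)" using M(2) by (simp add: mit_def True)
    have part3: "bw ?\<omega>' (cst (cf c 0) * (?g - ?gc)) (A * (1 + A) ^ r * (real a * (\<rho> / s * A) * B))"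
      unfolding bw_def
    proof (rule bdI)
      fix F :: "mindex set" assume F: "finite F"
      have "(\<Sum>\<kappa>\<in>F. cmod (cf (cst (cf c 0) * (?g - ?gc)) \<kappa>) * ?\<omega>' (tdeg \<kappa>) (ydeg \<kappa>)) \<le>
        (\<Sum>\<kappa>\<in>F. A * (1 + A) ^ r * (cmod (cf (?g - ?gc) \<kappa>) * \<omega>2 (tdeg \<kappa>) (ydeg \<kappa>)))"
      proof (intro sum_mono)
        fix \<kappa>
        have "cmod (cf c 0) * cmod (cf (?g - ?gc) \<kappa>) * ?\<omega>' (tdeg \<kappa>) (ydeg \<kappa>) \<le>
            A * cmod (cf (?g - ?gc) \<kappa>) * ((1 + A) ^ r * \<omega>2 (tdeg \<kappa>) (ydeg \<kappa>))"
          using A c0 \<omega>'nn by (intro mult_mono \<omega>'2) auto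
        then show "cmod (cf (cst (cf c 0) * (?g - ?gc)) \<kappa>) * ?\<omega>' (tdeg \<kappa>) (ydeg \<kappa>) \<le>
            A * (1 + A) ^ r * (cmod (cf (?g - ?gc) \<kappa>) * \<omega>2 (tdeg \<kappa>) (ydeg \<kappa>))"
          by (simp only: cf_cst_mult norm_mult mult_ac)
      qed
      also have "\<dots> = A * (1 + A) ^ r * (\<Sum>\<kappa>\<in>F. cmod (cf (?g - ?gc) \<kappa>) * \<omega>2 (tdeg \<kappa>) (ydeg \<kappa>))"
        by (simp only: sum_distrib_left)
      also have "\<dots> \<le> A * (1 + A) ^ r * (real a * (\<rho> / s * A) * B)"
        using dg F A by (intro mult_left_mono) (auto simp: bw_def dest: bdD)
      finally show "(\<Sum>\<kappa>\<in>F. cmod (cf (cst (cf c 0) * (?g - ?gc)) \<kappa>) * ?\<omega>' (tdeg \<kappa>) (ydeg \<kappa>)) \<le>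
        A * (1 + A) ^ r * (real a * (\<rho> / s * A) * B)" .
    qed
    have sum: "bw ?\<omega>' ((c - t0 c) * ?g + (t0 c - cst (cf c 0)) * ?g + cst (cf c 0) * (?g - ?gc))
      (A * ?C * B + A * (\<rho> / s * (1 + A) ^ r) * B + A * (1 + A) ^ r * (real a * (\<rho> / s * A) * B))"
      using part1[unfolded True] part2 part3 unfolding bw_def by (intro bd_add) (auto simp: \<omega>nn)
    have eq: "(c - t0 c) * ?g + (t0 c - cst (cf c 0)) * ?g + cst (cf c 0) * (?g - ?gc) = ?R"
      by (simp add: True algebra_simps)
    have "A * ?C * B + A * (\<rho> / s * (1 + A) ^ r) * B + A * (1 + A) ^ r * (real a * (\<rho> / s * A) * B) \<le> ?bound"
    proof -
      have 1: "A * ?C = (A * (1 + real r) ^ r * (1 + A) ^ r / s) * (h * (1 / \<rho>) ^ r)" by simp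
      have "A * (1 + A) ^ r * (real a * (\<rho> / s * A)) \<le> A * (1 + A) ^ r * (real r * (\<rho> / s * A))"
        using ab A s \<rho> by (intro mult_left_mono mult_right_mono) auto
      then have 2: "A * (1 + A) ^ r * (real a * (\<rho> / s * A)) \<le> (A * real r * A * (1 + A) ^ r / s) * \<rho>" by (simp add: mult_ac)
      have 3: "A * (\<rho> / s * (1 + A) ^ r) = (A * (1 + A) ^ r / s) * \<rho>" by simp
      define h' where "h' = h * (1 / \<rho>) ^ r"
      have h': "0 \<le> h'" using h \<rho> by (simp add: h'_def)
      define p q u where "p = A * (1 + real r) ^ r * (1 + A) ^ r / s" and "q = A * (1 + A) ^ r / s"
        and "u = A * real r * A * (1 + A) ^ r / s"
      have nn: "0 \<le> p" "0 \<le> q" "0 \<le> u" using A s by (auto simp: p_def q_def u_def)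
      have "p * h' + q * \<rho> + u * \<rho> \<le> (p + q + u) * (\<rho> + h')"
        using nn h' \<rho> by (simp add: algebra_simps)
      then have "A * ?C + A * (\<rho> / s * (1 + A) ^ r) + A * (1 + A) ^ r * (real a * (\<rho> / s * A)) \<le> K1 r s A * (\<rho> + h * (1 / \<rho>) ^ r)"
        using 2 unfolding 1 3 K1_def p_def q_def u_def h'_def by linarith
      from mult_right_mono[OF this B] show ?thesis by (simp only: distrib_right mult.assoc)
    qed
    with sum show ?thesis unfolding eq bw_def by (rule bd_le)
  qed
qed

lemma formal_existence:
  fixes v :: "mps ^ 'm::finite"
  assumes UD: "UD_data s0 S a" "0 < s0"
    and conv: "\<And>\<alpha> \<beta> i j. (\<alpha>, \<beta>) \<in> S \<Longrightarrow> conv (a \<alpha> \<beta> $ i $ j)" "\<And>i. i < n \<Longrightarrow> conv (L i)" "\<And>i. conv (v $ i)"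
    and Vs: "\<And>\<alpha> \<beta> i j. Vsup (a \<alpha> \<beta> $ i $ j)" "\<And>i. i < n \<Longrightarrow> Vsup (L i)" "\<And>i. Vsup (v $ i)"
    and L: "\<And>i \<kappa>. i < n \<Longrightarrow> cf (L i) \<kappa> \<noteq> 0 \<Longrightarrow> tdeg \<kappa> = 0"
    and ord: "\<And>\<alpha> \<beta> i j. (\<alpha>, \<beta>) \<in> S \<Longrightarrow> a \<alpha> \<beta> $ i $ j \<noteq> 0 \<Longrightarrow> (\<Sum>i<n. \<alpha> i) + bsum \<beta> \<le> r"
    and c: "0 < c" "\<And>\<kappa> y. keys \<kappa> \<subseteq> V \<Longrightarrow> tdeg \<kappa> \<noteq> 0 \<Longrightarrow>
      c * (1 + real (tdeg \<kappa>)) ^ r * norm y \<le> norm (lead S a L (\<lambda>k. lookup \<kappa> (Tv k)) *v y)"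
    and v: "\<And>i. t0 (v $ i) = v $ i" "\<And>i. t0 (fop S a L v $ i) = 0"
  shows "\<exists>w. fop S a L w = 0 \<and> (\<forall>i. t0 (w $ i) = v $ i) \<and> (\<forall>i. Vsup (w $ i)) \<and> (\<forall>i. conv (w $ i))"
proof -
  have S: "finite S" using UD by (simp add: UD_data_def)
  define I where "I = (\<lambda>((\<alpha>, \<beta>), i, j). a \<alpha> \<beta> $ i $ j) ` (S \<times> UNIV \<times> UNIV) \<union> L ` {..<n} \<union> range (($) v)"
  have "\<exists>s>0. s \<le> 1 \<and> (\<exists>A\<ge>0. \<forall>f\<in>I. bd (\<lambda>\<kappa>. s ^ deg \<kappa>) (id f) A)"
    by (rule conv_uniform) (use S conv in \<open>auto simp: I_def\<close>)
  then obtain s A where s: "0 < s" "s \<le> 1" and A: "0 \<le> A" and bdin: "\<And>f. f \<in> I \<Longrightarrow> bd (\<lambda>\<kappa>. s ^ deg \<kappa>) f A"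
    by auto
  have bda: "bd (\<lambda>\<kappa>. s ^ deg \<kappa>) (a \<alpha> \<beta> $ i $ j) A" if "(\<alpha>, \<beta>) \<in> S" for \<alpha> \<beta> i j
  proof (rule bdin)
    have "a \<alpha> \<beta> $ i $ j \<in> (\<lambda>((\<alpha>, \<beta>), i, j). a \<alpha> \<beta> $ i $ j) ` (S \<times> UNIV \<times> UNIV)"
      by (rule image_eqI[of _ _ "((\<alpha>, \<beta>), i, j)"]) (use that in auto)
    then show "a \<alpha> \<beta> $ i $ j \<in> I" by (simp add: I_def)
  qed
  have bdL: "bd (\<lambda>\<kappa>. s ^ deg \<kappa>) (L i) A" if "i < n" for i
    by (rule bdin) (use that in \<open>simp add: I_def\<close>)
  have bdv: "bd (\<lambda>\<kappa>. s ^ deg \<kappa>) (v $ i) A" for i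
    by (rule bdin) (simp add: I_def)
  define q where "q = real (CARD('m)) / c"
  define Q where "Q = q * (real (card S) * real (CARD('m)) * K1 r s A) + 1"
  have q: "0 \<le> q" using c by (simp add: q_def)
  have K1: "0 \<le> K1 r s A" using s A by (simp add: K1_def)
  have Q: "0 < Q" using q K1 by (simp add: Q_def add_nonneg_pos)
  define \<rho> where "\<rho> = min s (1 / (4 * Q))"
  define h where "h = min s (\<rho> ^ r / (4 * Q))"
  have \<rho>: "0 < \<rho>" "\<rho> \<le> s" using s Q by (auto simp: \<rho>_def)
  have h: "0 < h" "h \<le> s" using s Q \<rho> by (auto simp: h_def)
  define E where "E = \<rho> + h * (1 / \<rho>) ^ r"
  have E: "0 \<le> E" using h \<rho> by (simp add: E_def)
  have QE: "Q * E \<le> 1 / 2"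
  proof -
    have "Q * \<rho> \<le> Q * (1 / (4 * Q))" using Q by (intro mult_left_mono) (auto simp: \<rho>_def)
    moreover have "Q * (h * (1 / \<rho>) ^ r) \<le> Q * ((\<rho> ^ r / (4 * Q)) * (1 / \<rho>) ^ r)"
      using Q \<rho> by (intro mult_left_mono mult_right_mono) (auto simp: h_def)
    moreover have "Q * ((\<rho> ^ r / (4 * Q)) * (1 / \<rho>) ^ r) = 1 / 4"
      using Q \<rho> by (simp add: power_one_over field_simps)
    ultimately show ?thesis using Q by (simp add: E_def distrib_left)
  qed
  let ?\<omega> = "om r h \<rho>"
  have \<omega>nn: "0 \<le> ?\<omega> k m" for k m using yw_om[of h \<rho> r] h \<rho> by (simp add: yw_def)
  let ?\<omega>' = "\<lambda>k m. ?\<omega> k m / (1 + real k) ^ r"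
  let ?lead = "\<lambda>\<kappa>. lead S a L (\<lambda>k. lookup \<kappa> (Tv k))"
  have rem_bd: "bw ?\<omega>' (rem_op S a L w $ i) (real (card S) * real (CARD('m)) * K1 r s A * E * B)"
    if w: "\<And>j. bw ?\<omega> (w $ j) B" for w i B
  proof -
    have "bw ?\<omega>' (rem_op S a L w $ i) (\<Sum>s'\<in>S. \<Sum>j\<in>(UNIV :: 'm set). K1 r s A * E * B)"
      unfolding rem_op_eq[OF S] bw_def case_prod_unfold
    proof (intro bd_sum)
      fix s' j assume "s' \<in> S"
      then have "(fst s', snd s') \<in> S" by simp
      then have "bw ?\<omega>' (a (fst s') (snd s') $ i $ j * mit L (fst s') (snd s') (w $ j) -
         (if snd s' = (\<lambda>_. 0) then cst (cf (a (fst s') (snd s') $ i $ j) 0) * mit (\<lambda>k. cst (cf (L k) 0)) (fst s') (\<lambda>_. 0) (w $ j) else 0))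
         (K1 r s A * E * B)"
        unfolding E_def
        by (intro rem_op_term_bound s h \<rho> A bda bdL L w ord) (use UD in \<open>auto simp: UD_data_def\<close>)
      then show "bd (\<lambda>\<kappa>. ?\<omega>' (tdeg \<kappa>) (ydeg \<kappa>)) (a (fst s') (snd s') $ i $ j * mit L (fst s') (snd s') (w $ j) -
         (if snd s' = (\<lambda>_. 0) then cst (cf (a (fst s') (snd s') $ i $ j) 0) * mit (\<lambda>k. cst (cf (L k) 0)) (fst s') (\<lambda>_. 0) (w $ j) else 0))
         (K1 r s A * E * B)"
        unfolding bw_def .
    qed (auto simp: \<omega>nn)
    then show ?thesis by (simp add: mult.assoc)
  qed
  define Lop where "Lop w = (\<chi> i. Mps (\<lambda>\<kappa>. if tdeg \<kappa> \<noteq> 0 \<and> keys \<kappa> \<subseteq> V then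
      - (matrix_inv (?lead \<kappa>) *v (\<chi> j. cf (rem_op S a L w $ j) \<kappa>)) $ i else 0))" for w
  have inv: "?lead \<kappa> ** matrix_inv (?lead \<kappa>) = mat 1"
    and inv_norm: "norm (matrix_inv (?lead \<kappa>) *v z) \<le> norm z / (c * (1 + real (tdeg \<kappa>)) ^ r)"
    if "tdeg \<kappa> \<noteq> 0" "keys \<kappa> \<subseteq> V" for \<kappa> z
  proof -
    have "0 < c * (1 + real (tdeg \<kappa>)) ^ r" using c(1) by simp
    note * = matrix_left_inverse_bound[OF this c(2)[OF that(2,1)]]
    show "?lead \<kappa> ** matrix_inv (?lead \<kappa>) = mat 1" "norm (matrix_inv (?lead \<kappa>) *v z) \<le> norm z / (c * (1 + real (tdeg \<kappa>)) ^ r)"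
      by (rule *)+
  qed
  have Lop_bd: "bw ?\<omega> (Lop w $ i) (B / 2)" if w: "\<And>j. bw ?\<omega> (w $ j) B" for w i B
    unfolding bw_def
  proof (rule bdI)
    fix F :: "mindex set" assume F: "finite F"
    have B: "0 \<le> B" using w by (rule bw_nonneg)
    let ?rem = "\<lambda>j \<kappa>. cmod (cf (rem_op S a L w $ j) \<kappa>)"
    have "(\<Sum>\<kappa>\<in>F. cmod (cf (Lop w $ i) \<kappa>) * ?\<omega> (tdeg \<kappa>) (ydeg \<kappa>)) \<le>
        (\<Sum>\<kappa>\<in>F. \<Sum>j\<in>UNIV. (1 / c) * (?rem j \<kappa> * ?\<omega>' (tdeg \<kappa>) (ydeg \<kappa>)))"
    proof (intro sum_mono)
      fix \<kappa>
      have nn: "0 \<le> (\<Sum>j\<in>UNIV. (1 / c) * (?rem j \<kappa> * ?\<omega>' (tdeg \<kappa>) (ydeg \<kappa>)))"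
        using c(1) \<omega>nn by (intro sum_nonneg) auto
      show "cmod (cf (Lop w $ i) \<kappa>) * ?\<omega> (tdeg \<kappa>) (ydeg \<kappa>) \<le>
          (\<Sum>j\<in>UNIV. (1 / c) * (?rem j \<kappa> * ?\<omega>' (tdeg \<kappa>) (ydeg \<kappa>)))"
      proof (cases "tdeg \<kappa> \<noteq> 0 \<and> keys \<kappa> \<subseteq> V")
        case True
        let ?z = "\<chi> j. cf (rem_op S a L w $ j) \<kappa>"
        have "cmod (cf (Lop w $ i) \<kappa>) = cmod ((matrix_inv (?lead \<kappa>) *v ?z) $ i)"
          using True by (simp add: Lop_def)
        also have "\<dots> \<le> norm (matrix_inv (?lead \<kappa>) *v ?z)" by (rule Finite_Cartesian_Product.norm_nth_le)
        also have "\<dots> \<le> norm ?z / (c * (1 + real (tdeg \<kappa>)) ^ r)" using inv_norm True by blast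
        also have "\<dots> \<le> (\<Sum>j\<in>UNIV. ?rem j \<kappa>) / (c * (1 + real (tdeg \<kappa>)) ^ r)"
          using c(1) L2_set_le_sum[of UNIV "\<lambda>j. ?rem j \<kappa>"] by (intro divide_right_mono) (auto simp: norm_vec_def)
        finally have "cmod (cf (Lop w $ i) \<kappa>) * ?\<omega> (tdeg \<kappa>) (ydeg \<kappa>) \<le>
            (\<Sum>j\<in>UNIV. ?rem j \<kappa>) / (c * (1 + real (tdeg \<kappa>)) ^ r) * ?\<omega> (tdeg \<kappa>) (ydeg \<kappa>)"
          using \<omega>nn by (rule mult_right_mono)
        also have "\<dots> = (\<Sum>j\<in>UNIV. (1 / c) * (?rem j \<kappa> * ?\<omega>' (tdeg \<kappa>) (ydeg \<kappa>)))"
          by (simp add: sum_distrib_left sum_divide_distrib mult_ac)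
        finally show ?thesis .
      next
        case False
        then show ?thesis using nn by (auto simp: Lop_def)
      qed
    qed
    also have "\<dots> = (1 / c) * (\<Sum>j\<in>UNIV. \<Sum>\<kappa>\<in>F. ?rem j \<kappa> * ?\<omega>' (tdeg \<kappa>) (ydeg \<kappa>))"
      by (subst sum.swap) (simp only: sum_distrib_left)
    also have "\<dots> \<le> (1 / c) * (\<Sum>j\<in>(UNIV :: 'm set). real (card S) * real (CARD('m)) * K1 r s A * E * B)"
    proof (intro mult_left_mono sum_mono)
      show "(\<Sum>\<kappa>\<in>F. ?rem j \<kappa> * ?\<omega>' (tdeg \<kappa>) (ydeg \<kappa>)) \<le> real (card S) * real (CARD('m)) * K1 r s A * E * B" for j
        by (rule bdD[OF rem_bd[of w B, OF w, unfolded bw_def] F])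
    qed (use c(1) in simp)
    also have "\<dots> = q * (real (card S) * real (CARD('m)) * K1 r s A) * E * B"
      by (simp add: q_def)
    also have "\<dots> \<le> Q * E * B"
      using E B by (intro mult_right_mono) (auto simp: Q_def)
    also have "\<dots> \<le> 1 / 2 * B" using QE B by (rule mult_right_mono)
    finally show "(\<Sum>\<kappa>\<in>F. cmod (cf (Lop w $ i) \<kappa>) * ?\<omega> (tdeg \<kappa>) (ydeg \<kappa>)) \<le> B / 2" by simp
  qed
  have Lop_diff: "Lop (u - w) = Lop u - Lop w" for u w
    by (auto simp: Lop_def vec_eq_iff rem_op_diff matrix_vector_mult_diff_lambda intro!: mps_eqI)
  have Lop_low: "low s0 (Suc d) (Lop w $ i)" if w: "\<And>j. low s0 d (w $ j)" for w d i
    unfolding low_def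
  proof (intro allI impI)
    fix \<kappa> assume "W s0 \<kappa> < Suc d"
    then have "cf (rem_op S a L w $ j) \<kappa> = 0" for j
      using rem_op_low[OF UD w] by (auto simp: low_def)
    then have "(\<chi> j. cf (rem_op S a L w $ j) \<kappa>) = 0" by (simp add: vec_eq_iff)
    then show "cf (Lop w $ i) \<kappa> = 0" by (simp add: Lop_def)
  qed
  define it where "it = rec_nat v (\<lambda>_ w. v + Lop w)"
  have it: "it 0 = v" "it (Suc k) = v + Lop (it k)" for k by (simp_all add: it_def)
  have v_bd: "bw ?\<omega> (v $ i) A" for i
    unfolding bw_def
  proof (rule bd_mono[OF bdv[of i]])
    fix \<kappa> assume "cf (v $ i) \<kappa> \<noteq> 0"
    then have "tdeg \<kappa> = 0" using arg_cong[OF v(1)[of i], of "\<lambda>f. cf f \<kappa>"] by (auto simp: cf_t0 split: if_splits)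
    then have "?\<omega> (tdeg \<kappa>) (ydeg \<kappa>) \<le> s ^ deg \<kappa>"
      using \<rho> unfolding deg_eq by (simp add: om_def power_mono)
    then show "cmod (cf (v $ i) \<kappa>) * ?\<omega> (tdeg \<kappa>) (ydeg \<kappa>) \<le> cmod (cf (v $ i) \<kappa>) * s ^ deg \<kappa>"
      by (rule mult_left_mono) simp
  qed (use s in simp)
  have it_bd: "bw ?\<omega> (it k $ i) (2 * A)" for k i
  proof (induction k arbitrary: i)
    case 0
    show ?case using v_bd[of i] A unfolding it bw_def by (rule_tac bd_le) auto
  next
    case (Suc k)
    have "bw ?\<omega> (v $ i + Lop (it k) $ i) (A + 2 * A / 2)"
      using v_bd[of i] Lop_bd[OF Suc.IH, of i] unfolding bw_def by (rule bd_add) (rule \<omega>nn)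
    then show ?case by (simp add: it)
  qed
  have it_low: "low s0 k ((it (Suc k) - it k) $ i)" for k i
  proof (induction k arbitrary: i)
    case (Suc k)
    have "it (Suc (Suc k)) - it (Suc k) = Lop (it (Suc k) - it k)"
      unfolding Lop_diff by (simp add: it)
    then show ?case using Lop_low[OF Suc.IH] by simp
  qed simp
  have stable: "cf (it j $ i) \<kappa> = cf (it (Suc (W s0 \<kappa>)) $ i) \<kappa>" if "Suc (W s0 \<kappa>) \<le> j" for i j \<kappa>
    using that
  proof (induction j rule: dec_induct)
    case (step j)
    then have "cf ((it (Suc j) - it j) $ i) \<kappa> = 0" using it_low[of j i] by (simp add: low_def)
    then show ?case using step.IH by simp
  qed simp
  define w where "w = (\<chi> i. Mps (\<lambda>\<kappa>. cf (it (Suc (W s0 \<kappa>)) $ i) \<kappa>))"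
  have w_low: "low s0 j ((w - it j) $ i)" for j i
    unfolding low_def
  proof (intro allI impI)
    fix \<kappa> assume "W s0 \<kappa> < j"
    then show "cf ((w - it j) $ i) \<kappa> = 0"
      using stable[of \<kappa> j i] by (simp only: vector_minus_component cf_diff w_def vec_lambda_beta cf_Mps) simp
  qed
  have fix_w: "w = v + Lop w"
  proof (subst vec_eq_iff, rule allI, rule mps_eqI)
    fix i \<kappa>
    let ?j = "Suc (W s0 \<kappa>)"
    have "cf (Lop (w - it ?j) $ i) \<kappa> = 0"
      using Lop_low[OF w_low[of ?j], of i] by (simp add: low_def)
    then have "cf ((v + Lop w) $ i) \<kappa> = cf (it (Suc ?j) $ i) \<kappa>"
      unfolding Lop_diff by (simp add: it)
    also have "\<dots> = cf (w $ i) \<kappa>"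
      using stable[of \<kappa> "Suc ?j" i] by (simp add: w_def)
    finally show "cf (w $ i) \<kappa> = cf ((v + Lop w) $ i) \<kappa>" by simp
  qed
  have Vw: "Vsup (w $ i)" for i
  proof -
    have "Vsup (Lop w $ i)" by (auto simp: Vsup_def Lop_def split: if_splits)
    then show ?thesis using Vs(3)[of i] by (subst fix_w) (simp add: Vsup_add)
  qed
  have t0w: "t0 (w $ i) = v $ i" for i
  proof -
    have "t0 (Lop w $ i) = 0" by (simp add: t0_eq_0_iff Lop_def)
    then show ?thesis using v(1)[of i] by (subst fix_w) (simp add: t0_add)
  qed
  have "fop S a L w $ i = 0" for i
  proof (rule mps_eqI)
    fix \<kappa>
    show "cf (fop S a L w $ i) \<kappa> = cf 0 \<kappa>"
    proof (cases "tdeg \<kappa> \<noteq> 0 \<and> keys \<kappa> \<subseteq> V")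
      case True
      let ?z = "\<chi> j. cf (rem_op S a L w $ j) \<kappa>"
      have "cf (v $ j) \<kappa> = 0" for j
        using True arg_cong[OF v(1)[of j], of "\<lambda>f. cf f \<kappa>"] by (simp add: cf_t0)
      then have "(\<chi> j. cf (w $ j) \<kappa>) = - (matrix_inv (?lead \<kappa>) *v ?z)"
        using True by (subst fix_w) (simp add: vec_eq_iff Lop_def)
      then have "?lead \<kappa> *v (\<chi> j. cf (w $ j) \<kappa>) = - ?z"
        using inv[of \<kappa>] True by (simp add: matrix_vector_mul_assoc matrix_vector_mult_uminus)
      then have "(?lead \<kappa> *v (\<chi> j. cf (w $ j) \<kappa>)) $ i = - cf (rem_op S a L w $ i) \<kappa>"
        by simp
      then show ?thesis by (simp add: rem_op_def)
    next
      case False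
      have "t0 (fop S a L w $ i) = 0"
        using t0_fop_cong[of w v S a L i] v t0w by simp
      moreover have "Vsup (fop S a L w $ i)" by (rule Vsup_fop[OF Vs(1,2) Vw])
      ultimately show ?thesis using False by (auto simp: t0_eq_0_iff Vsup_def)
    qed
  qed
  then have "fop S a L w = 0" by (simp add: vec_eq_iff)
  moreover have "conv (w $ i)" for i
  proof -
    have wbd: "bw ?\<omega> (w $ i) (2 * A)"
      unfolding bw_def
    proof (rule bdI)
      fix F :: "mindex set" assume F: "finite F"
      define J where "J = Suc (Max (insert 0 (W s0 ` F)))"
      have WJ: "Suc (W s0 \<kappa>) \<le> J" if "\<kappa> \<in> F" for \<kappa>
        using F that by (auto simp: J_def)
      have "(\<Sum>\<kappa>\<in>F. cmod (cf (w $ i) \<kappa>) * ?\<omega> (tdeg \<kappa>) (ydeg \<kappa>)) =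
          (\<Sum>\<kappa>\<in>F. cmod (cf (it J $ i) \<kappa>) * ?\<omega> (tdeg \<kappa>) (ydeg \<kappa>))"
      proof (intro sum.cong refl)
        fix \<kappa> assume "\<kappa> \<in> F"
        then have "cf (it J $ i) \<kappa> = cf (w $ i) \<kappa>"
          using stable[OF WJ] by (simp only: w_def vec_lambda_beta cf_Mps)
        then show "cmod (cf (w $ i) \<kappa>) * ?\<omega> (tdeg \<kappa>) (ydeg \<kappa>) = cmod (cf (it J $ i) \<kappa>) * ?\<omega> (tdeg \<kappa>) (ydeg \<kappa>)"
          by simp
      qed
      also have "\<dots> \<le> 2 * A" using it_bd[of J i] F by (auto simp: bw_def dest: bdD)
      finally show "(\<Sum>\<kappa>\<in>F. cmod (cf (w $ i) \<kappa>) * ?\<omega> (tdeg \<kappa>) (ydeg \<kappa>)) \<le> 2 * A" .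
    qed
    define u where "u = min (h / 2 ^ r) (\<rho> / 2)"
    have u: "0 < u" using h \<rho> by (simp add: u_def)
    have ule: "u \<le> h / 2 ^ r" "u \<le> \<rho> / 2" unfolding u_def by (rule min.cobounded1, rule min.cobounded2)
    have "u ^ deg \<kappa> \<le> ?\<omega> (tdeg \<kappa>) (ydeg \<kappa>)" for \<kappa>
    proof -
      have "u ^ deg \<kappa> = u ^ tdeg \<kappa> * u ^ ydeg \<kappa>" unfolding deg_eq by (rule power_add)
      also have "\<dots> \<le> (h / 2 ^ r) ^ tdeg \<kappa> * (\<rho> / 2) ^ ydeg \<kappa>"
        using u h \<rho> by (intro mult_mono power_mono ule) auto
      also have "\<dots> = h ^ tdeg \<kappa> * \<rho> ^ ydeg \<kappa> * (1 / 2) ^ (ydeg \<kappa> + r * tdeg \<kappa>)"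
        by (simp add: power_divide power_add power_mult)
      also have "\<dots> \<le> ?\<omega> (tdeg \<kappa>) (ydeg \<kappa>)"
        unfolding om_def using h \<rho> by (intro mult_left_mono phi_ge) auto
      finally show ?thesis .
    qed
    then have "bd (\<lambda>\<kappa>. u ^ deg \<kappa>) (w $ i) (2 * A)"
      by (intro bd_mono[OF wbd[unfolded bw_def]] mult_left_mono \<omega>nn) auto
    then show ?thesis using u unfolding conv_def by blast
  qed
  ultimately show ?thesis using t0w Vw by blast
qed

end

subsection \<open>Lower bounds for the symbol\<close>

definition symb :: "nat \<Rightarrow> (nat \<Rightarrow> nat) set \<Rightarrow> ((nat \<Rightarrow> nat) \<Rightarrow> complex ^ 'm ^ 'm) \<Rightarrow> (nat \<Rightarrow> complex) \<Rightarrow> complex ^ 'm ^ 'm" where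
  "symb n A C \<xi> = (\<chi> i j. \<Sum>\<alpha>\<in>A. C \<alpha> $ i $ j * mpow n \<xi> \<alpha>)"

abbreviation order :: "nat \<Rightarrow> (nat \<Rightarrow> nat) \<Rightarrow> nat" where
  "order n \<alpha> \<equiv> \<Sum>i<n. \<alpha> i"

lemma norm_mpow_le:
  assumes "\<And>i. i < n \<Longrightarrow> cmod (a i) \<le> K"
  shows "cmod (mpow n a \<alpha>) \<le> K ^ order n \<alpha>"
proof -
  have "cmod (mpow n a \<alpha>) = (\<Prod>i<n. cmod (a i) ^ \<alpha> i)"
    by (simp add: mpow_def prod_norm norm_power[symmetric])
  also have "\<dots> \<le> (\<Prod>i<n. K ^ \<alpha> i)"
    using assms by (intro prod_mono conjI power_mono) auto
  finally show ?thesis by (simp add: power_sum)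
qed

lemma mpow_scale: "mpow n (\<lambda>i. s * \<xi> i) \<alpha> = (s :: complex) ^ order n \<alpha> * mpow n \<xi> \<alpha>"
  by (simp add: mpow_def power_mult_distrib prod.distrib power_sum)

lemma norm_mpow_diff_le:
  assumes "0 < K" "\<And>i. i < n \<Longrightarrow> cmod (a i) \<le> K" "\<And>i. i < n \<Longrightarrow> cmod (b i) \<le> K"
    "\<And>i. i < n \<Longrightarrow> cmod (a i - b i) \<le> \<delta>" "0 \<le> \<delta>"
  shows "cmod (mpow n a \<alpha> - mpow n b \<alpha>) \<le> K ^ order n \<alpha> * (real (order n \<alpha>) * (\<delta> / K))"
proof -
  let ?a = "\<lambda>i. a i / of_real K" and ?b = "\<lambda>i. b i / of_real K"
  have na: "cmod (?a i) \<le> 1" "cmod (?b i) \<le> 1" if "i < n" for i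
    using assms that by (auto simp: norm_divide)
  have "cmod (mpow n ?a \<alpha> - mpow n ?b \<alpha>) \<le> (\<Sum>i<n. cmod (?a i ^ \<alpha> i - ?b i ^ \<alpha> i))"
    unfolding mpow_def by (rule norm_prod_diff) (use na in \<open>auto simp: norm_power intro!: power_le_one\<close>)
  also have "\<dots> \<le> (\<Sum>i<n. real (\<alpha> i) * (\<delta> / K))"
  proof (rule sum_mono)
    fix i assume "i \<in> {..<n}"
    then have i: "i < n" by simp
    have "cmod (?a i ^ \<alpha> i - ?b i ^ \<alpha> i) \<le> real (\<alpha> i) * cmod (?a i - ?b i)"
      by (rule norm_power_diff) (use na[OF i] in auto)
    also have "cmod (?a i - ?b i) = cmod (a i - b i) / K"
      using assms(1) by (simp add: norm_divide flip: diff_divide_distrib)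
    also have "real (\<alpha> i) * (cmod (a i - b i) / K) \<le> real (\<alpha> i) * (\<delta> / K)"
      using assms(1,4) i by (intro mult_left_mono divide_right_mono) auto
    finally show "cmod (?a i ^ \<alpha> i - ?b i ^ \<alpha> i) \<le> real (\<alpha> i) * (\<delta> / K)" by simp
  qed
  also have "\<dots> = real (order n \<alpha>) * (\<delta> / K)" by (simp only: of_nat_sum sum_distrib_right)
  finally have *: "cmod (mpow n ?a \<alpha> - mpow n ?b \<alpha>) \<le> real (order n \<alpha>) * (\<delta> / K)" .
  have "mpow n a \<alpha> - mpow n b \<alpha> = of_real K ^ order n \<alpha> * (mpow n ?a \<alpha> - mpow n ?b \<alpha>)"
    using assms(1) mpow_scale[of n "of_real K" ?a \<alpha>] mpow_scale[of n "of_real K" ?b \<alpha>]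
    by (simp add: right_diff_distrib)
  then have "cmod (mpow n a \<alpha> - mpow n b \<alpha>) = K ^ order n \<alpha> * cmod (mpow n ?a \<alpha> - mpow n ?b \<alpha>)"
    using assms(1) by (simp add: norm_mult norm_power)
  also have "\<dots> \<le> K ^ order n \<alpha> * (real (order n \<alpha>) * (\<delta> / K))"
    using * assms(1) by (intro mult_left_mono) auto
  finally show ?thesis .
qed

lemma norm_vec_le_sum: "norm (y :: complex ^ 'm::finite) \<le> (\<Sum>i\<in>UNIV. cmod (y $ i))"
  unfolding norm_vec_def by (rule L2_set_le_sum) simp

lemma norm_matrix_vector_le:
  fixes M :: "complex ^ 'm::finite ^ 'm"
  assumes "\<And>i j. cmod (M $ i $ j) \<le> e"
  shows "norm (M *v y) \<le> real (CARD('m)) * real (CARD('m)) * e * norm y"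
proof -
  have e: "0 \<le> e" using assms norm_ge_zero order_trans by blast
  have "cmod ((M *v y) $ i) \<le> real (CARD('m)) * (e * norm y)" for i
  proof -
    have "cmod ((M *v y) $ i) \<le> (\<Sum>j\<in>UNIV. cmod (M $ i $ j * y $ j))"
      unfolding matrix_vector_mult_def by (simp add: norm_sum)
    also have "\<dots> \<le> (\<Sum>j\<in>(UNIV :: 'm set). e * norm y)"
      unfolding norm_mult using e by (intro sum_mono mult_mono assms Finite_Cartesian_Product.norm_nth_le) auto
    finally show ?thesis by simp
  qed
  then have "(\<Sum>i\<in>UNIV. cmod ((M *v y) $ i)) \<le> (\<Sum>i\<in>(UNIV :: 'm set). real (CARD('m)) * (e * norm y))"
    by (rule sum_mono)
  then show ?thesis using norm_vec_le_sum[of "M *v y"] by (simp add: mult_ac)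
qed

lemma invertible_lower_bound:
  fixes M :: "complex ^ 'm::finite ^ 'm"
  assumes "det M \<noteq> 0"
  shows "\<exists>c>0. \<forall>y. c * norm y \<le> norm (M *v y)"
proof -
  obtain B where B: "B ** M = mat 1" using assms invertible_det_nz invertible_def by blast
  define e where "e = Max (range (\<lambda>(i, j). cmod (B $ i $ j)))"
  have e: "cmod (B $ i $ j) \<le> e" for i j
    unfolding e_def by (intro Max_ge) (auto intro!: rev_image_eqI[of "(i, j)"])
  have e0: "0 \<le> e" using e norm_ge_zero order_trans by blast
  define k where "k = real (CARD('m)) * real (CARD('m)) * e + 1"
  have k: "0 < k" using e0 by (simp add: k_def add_nonneg_pos)
  have "1 / k * norm y \<le> norm (M *v y)" for y
  proof -
    have "norm y = norm (B *v (M *v y))" by (simp add: matrix_vector_mul_assoc B)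
    also have "\<dots> \<le> real (CARD('m)) * real (CARD('m)) * e * norm (M *v y)"
      by (rule norm_matrix_vector_le) (rule e)
    also have "\<dots> \<le> k * norm (M *v y)" by (intro mult_right_mono) (auto simp: k_def)
    finally show ?thesis using k by (simp add: field_simps)
  qed
  then show ?thesis using k by (intro exI[of _ "1 / k"]) auto
qed

lemma det_nonzero_of_lower_bound:
  fixes M :: "complex ^ 'm::finite ^ 'm"
  assumes "0 < c" "\<And>y. c * norm y \<le> norm (M *v y)"
  shows "det M \<noteq> 0"
  using matrix_left_inverse_bound(1)[OF assms] det_mul[of M "matrix_inv M"] by auto

lemma compact_simplex: "compact {\<xi> :: nat \<Rightarrow> real. (\<forall>i<n. 0 \<le> \<xi> i) \<and> (\<forall>i\<ge>n. \<xi> i = 0) \<and> (\<Sum>i<n. \<xi> i) = 1}"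
proof -
  let ?S = "\<lambda>i. if i < n then {0..1::real} else {0}"
  have "compactin (product_topology (\<lambda>_. euclidean) UNIV) (PiE UNIV ?S)"
    by (subst compactin_PiE) auto
  then have 1: "compact (PiE UNIV ?S)" by (simp add: euclidean_product_topology)
  have 2: "closed {\<xi> :: nat \<Rightarrow> real. (\<Sum>i<n. \<xi> i) = 1}"
    by (intro closed_Collect_eq continuous_intros continuous_on_product_then_coordinatewise)
  have "compact (PiE UNIV ?S \<inter> {\<xi>. (\<Sum>i<n. \<xi> i) = 1})"
    using 1 2 by (rule compact_Int_closed)
  also have "PiE UNIV ?S \<inter> {\<xi>. (\<Sum>i<n. \<xi> i) = 1} =
      {\<xi> :: nat \<Rightarrow> real. (\<forall>i<n. 0 \<le> \<xi> i) \<and> (\<forall>i\<ge>n. \<xi> i = 0) \<and> (\<Sum>i<n. \<xi> i) = 1}"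
  proof (intro set_eqI iffI)
    fix \<xi> :: "nat \<Rightarrow> real" assume *: "\<xi> \<in> {\<xi>. (\<forall>i<n. 0 \<le> \<xi> i) \<and> (\<forall>i\<ge>n. \<xi> i = 0) \<and> (\<Sum>i<n. \<xi> i) = 1}"
    have "\<xi> i \<le> 1" if "i < n" for i
      using * that member_le_sum[of i "{..<n}" \<xi>] by auto
    then show "\<xi> \<in> PiE UNIV ?S \<inter> {\<xi>. (\<Sum>i<n. \<xi> i) = 1}" using * by auto
  next
    fix \<xi> :: "nat \<Rightarrow> real" assume *: "\<xi> \<in> PiE UNIV ?S \<inter> {\<xi>. (\<Sum>i<n. \<xi> i) = 1}"
    then have "\<xi> i \<in> ?S i" for i unfolding PiE_def Pi_def by blast
    then have "(i < n \<longrightarrow> 0 \<le> \<xi> i) \<and> (\<not> i < n \<longrightarrow> \<xi> i = 0)" for i by (metis atLeastAtMost_iff singletonD)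
    then show "\<xi> \<in> {\<xi>. (\<forall>i<n. 0 \<le> \<xi> i) \<and> (\<forall>i\<ge>n. \<xi> i = 0) \<and> (\<Sum>i<n. \<xi> i) = 1}" using * by auto
  qed
  finally show ?thesis .
qed

lemma continuous_on_symb: "continuous_on S (\<lambda>p. symb n A C (\<lambda>i. of_real (fst p i)) *v snd p)"
proof -
  have "continuous_on S (\<lambda>p. of_real (fst p i) :: complex)" for i
    by (intro continuous_intros continuous_on_product_then_coordinatewise)
  then show ?thesis
    unfolding symb_def matrix_vector_mult_def mpow_def
    by (intro continuous_on_vec_lambda continuous_on_sum continuous_on_mult continuous_on_prod continuous_on_power
        continuous_on_const continuous_on_snd continuous_on_id continuous_on_component) auto?
qed

lemma principal_symbol_bound:
  fixes C :: "(nat \<Rightarrow> nat) \<Rightarrow> complex ^ 'm::finite ^ 'm"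
  assumes hom: "\<And>\<alpha>. \<alpha> \<in> A \<Longrightarrow> order n \<alpha> = r"
    and nz: "\<And>\<xi>. (\<forall>i<n. 0 \<le> \<xi> i) \<Longrightarrow> (\<forall>i\<ge>n. \<xi> i = 0) \<Longrightarrow> \<xi> \<noteq> (\<lambda>_. 0) \<Longrightarrow> det (symb n A C (\<lambda>i. of_real (\<xi> i))) \<noteq> 0"
  shows "\<exists>c>0. \<forall>\<gamma>\<in>multi_indices n. \<gamma> \<noteq> (\<lambda>_. 0) \<longrightarrow>
    (\<forall>y. c * real (order n \<gamma>) ^ r * norm y \<le> norm (symb n A C (\<lambda>i. of_nat (\<gamma> i)) *v y))"
proof (cases "n = 0")
  case True
  then show ?thesis by (intro exI[of _ 1]) (auto simp: multi_indices_def)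
next
  case False
  let ?K = "{\<xi> :: nat \<Rightarrow> real. (\<forall>i<n. 0 \<le> \<xi> i) \<and> (\<forall>i\<ge>n. \<xi> i = 0) \<and> (\<Sum>i<n. \<xi> i) = 1}"
  let ?f = "\<lambda>p. norm (symb n A C (\<lambda>i. of_real (fst p i)) *v snd p)"
  have comp: "compact (?K \<times> sphere (0 :: complex ^ 'm) 1)"
    by (intro compact_Times compact_simplex compact_sphere)
  have k0: "(\<lambda>i. if i = 0 then 1 else 0) \<in> ?K" using False by simp
  have s0: "(1 / norm (vec 1 :: complex ^ 'm)) *\<^sub>R vec 1 \<in> sphere (0 :: complex ^ 'm) 1"
    by (simp add: vec_eq_iff)
  have "?K \<times> sphere (0 :: complex ^ 'm) 1 \<noteq> {}"
  proof
    assume "?K \<times> sphere (0 :: complex ^ 'm) 1 = {}"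
    with SigmaI[OF k0 s0] show False by (simp only: empty_iff)
  qed
  from continuous_attains_inf[OF comp this continuous_on_norm[OF continuous_on_symb]]
  obtain p where p: "p \<in> ?K \<times> sphere (0 :: complex ^ 'm) 1" "\<forall>q \<in> ?K \<times> sphere 0 1. ?f p \<le> ?f q"
    by (rule bexE)
  obtain \<xi> y where xy: "p = (\<xi>, y)" by (cases p)
  have "\<xi> \<noteq> (\<lambda>_. 0)" using p(1) by (auto simp: xy)
  then have "det (symb n A C (\<lambda>i. of_real (\<xi> i))) \<noteq> 0" using p(1) by (intro nz) (auto simp: xy)
  then obtain c where c: "0 < c" "\<And>y. c * norm y \<le> norm (symb n A C (\<lambda>i. of_real (\<xi> i)) *v y)"
    using invertible_lower_bound by blast
  have "norm y = 1" using p(1) by (simp add: xy)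
  then have "0 < ?f p" using c(1) c(2)[of y] unfolding xy fst_conv snd_conv by (simp only: mult_1_right less_le_trans)
  moreover have "?f p * real (order n \<gamma>) ^ r * norm y \<le> norm (symb n A C (\<lambda>i. of_nat (\<gamma> i)) *v y)"
    if \<gamma>: "\<gamma> \<in> multi_indices n" "\<gamma> \<noteq> (\<lambda>_. 0)" for \<gamma> y
  proof (cases "y = 0")
    case False
    define k where "k = order n \<gamma>"
    have "k \<noteq> 0"
    proof
      assume "k = 0"
      then have "\<gamma> i = 0" for i using \<gamma>(1) by (cases "i < n") (auto simp: k_def multi_indices_def)
      with \<gamma>(2) show False by (simp add: fun_eq_iff)
    qed
    then have k: "0 < real k" by simp
    let ?\<xi> = "\<lambda>i. real (\<gamma> i) / real k" and ?y = "(1 / norm y) *\<^sub>R y"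
    have "(\<Sum>i<n. ?\<xi> i) = real k / real k" by (simp only: k_def of_nat_sum sum_divide_distrib)
    then have "(\<Sum>i<n. ?\<xi> i) = 1" using k by simp
    then have "(?\<xi>, ?y) \<in> ?K \<times> sphere 0 1"
      using \<gamma>(1) False by (auto simp: multi_indices_def)
    then have 1: "?f p \<le> norm (symb n A C (\<lambda>i. of_real (?\<xi> i)) *v ?y)" using p(2)[rule_format, of "(?\<xi>, ?y)"] by simp
    have "symb n A C (\<lambda>i. of_nat (\<gamma> i)) = (real k ^ r) *\<^sub>R symb n A C (\<lambda>i. of_real (?\<xi> i))"
    proof -
      have "mpow n (\<lambda>i. complex_of_nat (\<gamma> i)) \<alpha> = of_real (real k ^ r) * mpow n (\<lambda>i. of_real (?\<xi> i)) \<alpha>" if "\<alpha> \<in> A" for \<alpha>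
        using mpow_scale[of n "of_real (real k)" "\<lambda>i. of_real (?\<xi> i)" \<alpha>] k hom[OF that] by simp
      then show ?thesis by (simp add: symb_def vec_eq_iff sum_distrib_left mult_ac scaleR_conv_of_real[where 'a = complex] cong: sum.cong)
    qed
    then have "norm (symb n A C (\<lambda>i. of_nat (\<gamma> i)) *v y) = real k ^ r * norm (symb n A C (\<lambda>i. of_real (?\<xi> i)) *v y)"
    proof -
      assume s: "symb n A C (\<lambda>i. of_nat (\<gamma> i)) = (real k ^ r) *\<^sub>R symb n A C (\<lambda>i. of_real (?\<xi> i))"
      have "symb n A C (\<lambda>i. of_nat (\<gamma> i)) *v y = (real k ^ r) *\<^sub>R (symb n A C (\<lambda>i. of_real (?\<xi> i)) *v y)"
        unfolding s by (simp add: vec_eq_iff matrix_vector_mult_def scaleR_conv_of_real[where 'a = complex] sum_distrib_left mult.assoc)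
      then show ?thesis by simp
    qed
    moreover have "norm (symb n A C (\<lambda>i. of_real (?\<xi> i)) *v ?y) = norm (symb n A C (\<lambda>i. of_real (?\<xi> i)) *v y) / norm y"
    proof -
      have "symb n A C (\<lambda>i. of_real (?\<xi> i)) *v ?y = (1 / norm y) *\<^sub>R (symb n A C (\<lambda>i. of_real (?\<xi> i)) *v y)"
        by (simp add: vec_eq_iff matrix_vector_mult_def scaleR_conv_of_real[where 'a = complex] sum_distrib_left mult_ac)
      then show ?thesis by simp
    qed
    moreover have "F * R * Y \<le> N" if "F \<le> Z" "N = R * W" "Z = W / Y" "0 < Y" "0 \<le> R" for F N Z R W Y :: real
    proof -
      have "R * (F * Y) \<le> R * (Z * Y)" using that by (intro mult_left_mono mult_right_mono) auto
      then show ?thesis using that by (simp add: mult_ac)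
    qed
    ultimately show ?thesis
      unfolding k_def[symmetric] using 1 False k zero_le_power[of "real k" r] zero_less_norm_iff[of y] less_imp_le[OF k] by blast
  qed simp
  ultimately show ?thesis by (intro exI[of _ "?f p"]) blast
qed

lemma finite_multi_indices_bounded: "finite {\<gamma> \<in> multi_indices n. order n \<gamma> \<le> G}"
proof (rule finite_subset)
  show "{\<gamma> \<in> multi_indices n. order n \<gamma> \<le> G} \<subseteq> (\<lambda>g i. if i < n then g i else 0) ` ({..<n} \<rightarrow>\<^sub>E {..G})"
  proof
    fix \<gamma> assume *: "\<gamma> \<in> {\<gamma> \<in> multi_indices n. order n \<gamma> \<le> G}"
    have "\<gamma> i \<le> G" if "i < n" for i
      using * that member_le_sum[of i "{..<n}" \<gamma>] by auto
    then have "restrict \<gamma> {..<n} \<in> {..<n} \<rightarrow>\<^sub>E {..G}" by auto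
    moreover have "\<gamma> = (\<lambda>i. if i < n then restrict \<gamma> {..<n} i else 0)"
      using * by (auto simp: multi_indices_def fun_eq_iff)
    ultimately show "\<gamma> \<in> (\<lambda>g i. if i < n then g i else 0) ` ({..<n} \<rightarrow>\<^sub>E {..G})" by blast
  qed
qed (intro finite_imageI finite_PiE, auto)

lemma symbol_lower_bound:
  fixes C :: "(nat \<Rightarrow> nat) \<Rightarrow> complex ^ 'm::finite ^ 'm"
  assumes A: "finite A" and ord: "\<And>\<alpha>. \<alpha> \<in> A \<Longrightarrow> r < order n \<alpha> \<Longrightarrow> C \<alpha> = 0"
    and nz: "\<And>\<xi>. (\<forall>i<n. 0 \<le> \<xi> i) \<Longrightarrow> (\<forall>i\<ge>n. \<xi> i = 0) \<Longrightarrow> \<xi> \<noteq> (\<lambda>_. 0) \<Longrightarrow>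
      det (symb n {\<alpha> \<in> A. order n \<alpha> = r} C (\<lambda>i. of_real (\<xi> i))) \<noteq> 0"
    and nz': "\<And>\<gamma>. \<gamma> \<in> multi_indices n \<Longrightarrow> \<gamma> \<noteq> (\<lambda>_. 0) \<Longrightarrow> det (symb n A C (\<lambda>i. \<mu> i + of_nat (\<gamma> i))) \<noteq> 0"
  shows "\<exists>c>0. \<forall>\<gamma>\<in>multi_indices n. \<gamma> \<noteq> (\<lambda>_. 0) \<longrightarrow>
    (\<forall>y. c * (1 + real (order n \<gamma>)) ^ r * norm y \<le> norm (symb n A C (\<lambda>i. \<mu> i + of_nat (\<gamma> i)) *v y))"
proof -
  let ?A' = "{\<alpha> \<in> A. order n \<alpha> = r}"
  obtain c1 where c1: "0 < c1" "\<And>\<gamma> y. \<gamma> \<in> multi_indices n \<Longrightarrow> \<gamma> \<noteq> (\<lambda>_. 0) \<Longrightarrow>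
      c1 * real (order n \<gamma>) ^ r * norm y \<le> norm (symb n ?A' C (\<lambda>i. of_nat (\<gamma> i)) *v y)"
    using principal_symbol_bound[of ?A' n r C] nz by auto
  define \<Lambda> where "\<Lambda> = 1 + (\<Sum>i<n. cmod (\<mu> i))"
  have \<Lambda>1: "1 \<le> \<Lambda>" by (simp add: \<Lambda>_def sum_nonneg)
  have \<Lambda>: "cmod (\<mu> i) \<le> \<Lambda>" if "i < n" for i
    using that member_le_sum[of i "{..<n}" "\<lambda>i. cmod (\<mu> i)"] by (simp add: \<Lambda>_def)
  define E where "E = (\<Sum>\<alpha>\<in>A. \<Sum>i\<in>UNIV. \<Sum>j\<in>UNIV. cmod (C \<alpha> $ i $ j))"
  have Eij: "(\<Sum>\<alpha>\<in>A. cmod (C \<alpha> $ i $ j)) \<le> E" for i j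
    unfolding E_def
  proof (rule sum_mono)
    fix \<alpha>
    have "cmod (C \<alpha> $ i $ j) \<le> (\<Sum>j\<in>UNIV. cmod (C \<alpha> $ i $ j))" by (rule member_le_sum) auto
    also have "\<dots> \<le> (\<Sum>i\<in>UNIV. \<Sum>j\<in>UNIV. cmod (C \<alpha> $ i $ j))"
      by (rule member_le_sum[of i UNIV "\<lambda>i. \<Sum>j\<in>UNIV. cmod (C \<alpha> $ i $ j)"]) (auto intro: sum_nonneg)
    finally show "cmod (C \<alpha> $ i $ j) \<le> (\<Sum>i\<in>UNIV. \<Sum>j\<in>UNIV. cmod (C \<alpha> $ i $ j))" .
  qed
  have E: "0 \<le> E" by (simp add: E_def sum_nonneg)
  define m where "m = real (CARD('m))"
  define F where "F = m * m * (E * (real r * \<Lambda> + 1) * \<Lambda> ^ r)"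
  have F: "0 \<le> F" using E \<Lambda>1 by (simp add: F_def m_def)
  have large: "norm (symb n A C (\<lambda>i. \<mu> i + of_nat (\<gamma> i)) *v y - symb n ?A' C (\<lambda>i. of_nat (\<gamma> i)) *v y)
      \<le> F * (1 + real (order n \<gamma>)) ^ r / (1 + real (order n \<gamma>)) * norm y" for \<gamma> y
  proof -
    define k where "k = 1 + real (order n \<gamma>)"
    have k: "1 \<le> k" by (simp only: k_def of_nat_0_le_iff le_add_same_cancel1)
    define K where "K = \<Lambda> * k"
    have Kk: "k \<le> K" "\<Lambda> \<le> K" using k \<Lambda>1 mult_right_mono[of 1 \<Lambda> k] mult_left_mono[of 1 k \<Lambda>] by (auto simp: K_def)
    have K: "1 \<le> K" using k Kk by linarith
    have g: "cmod (of_nat (\<gamma> i)) \<le> K" "cmod (\<mu> i + of_nat (\<gamma> i)) \<le> K" if "i < n" for i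
    proof -
      have gi: "real (\<gamma> i) \<le> real (order n \<gamma>)" using that member_le_sum[of i "{..<n}" \<gamma>] by (simp del: of_nat_sum)
      then show "cmod (of_nat (\<gamma> i)) \<le> K" using Kk by (simp add: k_def)
      have "cmod (\<mu> i + of_nat (\<gamma> i)) \<le> \<Lambda> + real (order n \<gamma>)"
        using norm_triangle_ineq[of "\<mu> i" "of_nat (\<gamma> i)"] \<Lambda>[OF that] gi by simp
      also have "\<dots> \<le> \<Lambda> + \<Lambda> * real (order n \<gamma>)" using mult_right_mono[OF \<Lambda>1 of_nat_0_le_iff, of "order n \<gamma>"] by (simp only: mult_1_left add_le_cancel_left)
      finally show "cmod (\<mu> i + of_nat (\<gamma> i)) \<le> K" by (simp add: K_def k_def algebra_simps)
    qed
    let ?d = "\<lambda>\<alpha>. mpow n (\<lambda>i. \<mu> i + of_nat (\<gamma> i)) \<alpha> - (if order n \<alpha> = r then mpow n (\<lambda>i. of_nat (\<gamma> i)) \<alpha> else 0)"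
    have d: "cmod (C \<alpha> $ i $ j * ?d \<alpha>) \<le> cmod (C \<alpha> $ i $ j) * ((real r * \<Lambda> + 1) * (K ^ r / K))" if "\<alpha> \<in> A" for \<alpha> i j
    proof (cases "order n \<alpha> \<le> r")
      case True
      have "cmod (?d \<alpha>) \<le> (real r * \<Lambda> + 1) * (K ^ r / K)"
      proof (cases "order n \<alpha> = r")
        case True
        have "cmod (?d \<alpha>) \<le> K ^ order n \<alpha> * (real (order n \<alpha>) * (\<Lambda> / K))"
          using True norm_mpow_diff_le[of K n "\<lambda>i. \<mu> i + of_nat (\<gamma> i)" "\<lambda>i. of_nat (\<gamma> i)" \<Lambda> \<alpha>] K g \<Lambda> \<Lambda>1 by simp
        also have "\<dots> = real r * \<Lambda> * (K ^ r / K)" using True by simp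
        also have "\<dots> \<le> (real r * \<Lambda> + 1) * (K ^ r / K)" using K by (intro mult_right_mono) auto
        finally show ?thesis .
      next
        case False
        then have "cmod (?d \<alpha>) \<le> K ^ order n \<alpha>" using norm_mpow_le[of n "\<lambda>i. \<mu> i + of_nat (\<gamma> i)" K \<alpha>] g by simp
        also have "\<dots> \<le> K ^ (r - 1)" using False \<open>order n \<alpha> \<le> r\<close> K by (intro power_increasing) auto
        also have "\<dots> = K ^ r / K" using False \<open>order n \<alpha> \<le> r\<close> K by (cases r) auto
        also have "\<dots> = 1 * (K ^ r / K)" by simp
        also have "\<dots> \<le> (real r * \<Lambda> + 1) * (K ^ r / K)" using K \<Lambda>1 by (intro mult_right_mono) auto
        finally show ?thesis .
      qed
      then show ?thesis unfolding norm_mult by (rule mult_left_mono) simp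
    next
      case False
      then show ?thesis using ord[OF that] by simp
    qed
    have entry: "cmod ((symb n A C (\<lambda>i. \<mu> i + of_nat (\<gamma> i)) - symb n ?A' C (\<lambda>i. of_nat (\<gamma> i))) $ i $ j)
        \<le> E * ((real r * \<Lambda> + 1) * (K ^ r / K))" for i j
    proof -
      have "(symb n ?A' C (\<lambda>i. of_nat (\<gamma> i))) $ i $ j = (\<Sum>\<alpha>\<in>A. C \<alpha> $ i $ j * (if order n \<alpha> = r then mpow n (\<lambda>i. of_nat (\<gamma> i)) \<alpha> else 0))"
        unfolding symb_def using A by (simp add: if_distrib sum.inter_filter cong: if_cong)
      then have "(symb n A C (\<lambda>i. \<mu> i + of_nat (\<gamma> i)) - symb n ?A' C (\<lambda>i. of_nat (\<gamma> i))) $ i $ j = (\<Sum>\<alpha>\<in>A. C \<alpha> $ i $ j * ?d \<alpha>)"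
        by (simp add: symb_def right_diff_distrib sum_subtractf)
      also have "cmod \<dots> \<le> (\<Sum>\<alpha>\<in>A. cmod (C \<alpha> $ i $ j) * ((real r * \<Lambda> + 1) * (K ^ r / K)))"
        using d by (rule sum_norm_le)
      also have "\<dots> = (\<Sum>\<alpha>\<in>A. cmod (C \<alpha> $ i $ j)) * ((real r * \<Lambda> + 1) * (K ^ r / K))"
        by (simp only: sum_distrib_right)
      also have "\<dots> \<le> E * ((real r * \<Lambda> + 1) * (K ^ r / K))"
        using Eij K \<Lambda>1 by (intro mult_right_mono) auto
      finally show ?thesis .
    qed
    have "norm ((symb n A C (\<lambda>i. \<mu> i + of_nat (\<gamma> i)) - symb n ?A' C (\<lambda>i. of_nat (\<gamma> i))) *v y)
        \<le> m * m * (E * ((real r * \<Lambda> + 1) * (K ^ r / K))) * norm y"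
      unfolding m_def by (rule norm_matrix_vector_le) (rule entry)
    also have "\<dots> \<le> F * k ^ r / k * norm y"
    proof -
      have "K ^ r / K \<le> \<Lambda> ^ r * k ^ r / k"
        unfolding K_def power_mult_distrib using k \<Lambda>1 mult_right_mono[of 1 \<Lambda> k]
        by (intro divide_left_mono) auto
      then have "m * m * (E * ((real r * \<Lambda> + 1) * (K ^ r / K))) \<le> m * m * (E * ((real r * \<Lambda> + 1) * (\<Lambda> ^ r * k ^ r / k)))"
        using E \<Lambda>1 by (intro mult_left_mono) (auto simp: m_def)
      also have "\<dots> = F * k ^ r / k" by (simp add: F_def)
      finally show ?thesis by (rule mult_right_mono) simp
    qed
    finally show ?thesis unfolding k_def by (simp add: matrix_vector_mult_diff_rdistrib)
  qed
  define c2 where "c2 = c1 / 2 ^ r"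
  have c2: "0 < c2" using c1 by (simp add: c2_def)
  obtain G :: nat where G: "2 * F / c2 \<le> real G" using real_arch_simple by blast
  have big: "c2 / 2 * (1 + real (order n \<gamma>)) ^ r * norm y \<le> norm (symb n A C (\<lambda>i. \<mu> i + of_nat (\<gamma> i)) *v y)"
    if \<gamma>: "\<gamma> \<in> multi_indices n" "\<gamma> \<noteq> (\<lambda>_. 0)" "G < order n \<gamma>" for \<gamma> y
  proof -
    define k where "k = 1 + real (order n \<gamma>)"
    have k: "1 \<le> k" by (simp only: k_def of_nat_0_le_iff le_add_same_cancel1)
    have "(k / 2) ^ r \<le> real (order n \<gamma>) ^ r" using \<gamma>(3) by (intro power_mono) (simp_all add: k_def del: of_nat_sum)
    then have "c1 * (k / 2) ^ r * norm y \<le> c1 * real (order n \<gamma>) ^ r * norm y"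
      using c1(1) by (intro mult_right_mono mult_left_mono) auto
    also have "\<dots> \<le> norm (symb n ?A' C (\<lambda>i. of_nat (\<gamma> i)) *v y)" by (rule c1(2)[OF \<gamma>(1,2)])
    finally have 1: "c2 * k ^ r * norm y \<le> norm (symb n ?A' C (\<lambda>i. of_nat (\<gamma> i)) *v y)"
      by (simp add: c2_def power_divide)
    have "real G \<le> k" using \<gamma>(3) unfolding k_def by linarith
    then have "2 * F / c2 \<le> k" using G by linarith
    then have "2 * F \<le> c2 * k" using c2 by (simp add: field_simps)
    then have "F / k \<le> c2 / 2" using k by (simp add: field_simps)
    then have "F / k * (k ^ r * norm y) \<le> c2 / 2 * (k ^ r * norm y)" using k by (intro mult_right_mono) auto
    then have 2: "F * k ^ r / k * norm y \<le> c2 / 2 * k ^ r * norm y" by (simp add: mult_ac)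
    have "norm (symb n ?A' C (\<lambda>i. of_nat (\<gamma> i)) *v y) \<le> norm (symb n A C (\<lambda>i. \<mu> i + of_nat (\<gamma> i)) *v y) +
      norm (symb n A C (\<lambda>i. \<mu> i + of_nat (\<gamma> i)) *v y - symb n ?A' C (\<lambda>i. of_nat (\<gamma> i)) *v y)"
      by (subst norm_minus_commute) (rule norm_triangle_sub)
    with 1 2 large[of \<gamma> y] have "c2 * k ^ r * norm y - c2 / 2 * k ^ r * norm y \<le> norm (symb n A C (\<lambda>i. \<mu> i + of_nat (\<gamma> i)) *v y)"
      unfolding k_def[symmetric] by linarith
    then show ?thesis unfolding k_def[symmetric] by (simp add: mult_ac)
  qed
  let ?S = "{\<gamma> \<in> multi_indices n. order n \<gamma> \<le> G} - {\<lambda>_. 0}"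
  have "\<forall>\<gamma>\<in>?S. \<exists>c>0. \<forall>y. c * norm y \<le> norm (symb n A C (\<lambda>i. \<mu> i + of_nat (\<gamma> i)) *v y)"
    using nz' invertible_lower_bound by auto
  from bchoice[OF this] obtain d where
    "\<forall>\<gamma>\<in>?S. 0 < d \<gamma> \<and> (\<forall>y. d \<gamma> * norm y \<le> norm (symb n A C (\<lambda>i. \<mu> i + of_nat (\<gamma> i)) *v y))" by (rule exE)
  then have d: "0 < d \<gamma>" "d \<gamma> * norm y \<le> norm (symb n A C (\<lambda>i. \<mu> i + of_nat (\<gamma> i)) *v y)" if "\<gamma> \<in> ?S" for \<gamma> y
    using that by blast+
  have finS: "finite ?S" using finite_multi_indices_bounded by auto
  define c where "c = Min (insert (c2 / 2) ((\<lambda>\<gamma>. d \<gamma> / (1 + real (order n \<gamma>)) ^ r) ` ?S))"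
  have pos: "0 < (1 + real (order n \<gamma>)) ^ r" for \<gamma>
    by (intro zero_less_power add_pos_nonneg zero_less_one of_nat_0_le_iff)
  have c: "0 < c" unfolding c_def using finS c2 divide_pos_pos[OF d(1) pos] by (subst Min_gr_iff) (auto simp del: of_nat_sum)
  have "c * (1 + real (order n \<gamma>)) ^ r * norm y \<le> norm (symb n A C (\<lambda>i. \<mu> i + of_nat (\<gamma> i)) *v y)"
    if \<gamma>: "\<gamma> \<in> multi_indices n" "\<gamma> \<noteq> (\<lambda>_. 0)" for \<gamma> y
  proof (cases "order n \<gamma> \<le> G")
    case True
    then have "c \<le> d \<gamma> / (1 + real (order n \<gamma>)) ^ r" unfolding c_def using finS \<gamma> by (intro Min_le) auto
    then have "c * (1 + real (order n \<gamma>)) ^ r \<le> d \<gamma>" by (subst (asm) pos_le_divide_eq[OF pos])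
    then have "c * (1 + real (order n \<gamma>)) ^ r * norm y \<le> d \<gamma> * norm y" by (rule mult_right_mono) simp
    also have "\<dots> \<le> norm (symb n A C (\<lambda>i. \<mu> i + of_nat (\<gamma> i)) *v y)" using True \<gamma> by (intro d(2)) auto
    finally show ?thesis .
  next
    case False
    have "c \<le> c2 / 2" unfolding c_def using finS by (intro Min_le) auto
    then have "c * (1 + real (order n \<gamma>)) ^ r * norm y \<le> c2 / 2 * (1 + real (order n \<gamma>)) ^ r * norm y"
      by (intro mult_right_mono less_imp_le[OF pos]) auto
    also have "\<dots> \<le> norm (symb n A C (\<lambda>i. \<mu> i + of_nat (\<gamma> i)) *v y)" using False \<gamma> by (intro big) auto
    finally show ?thesis .
  qed
  then show ?thesis using c by blast
qed

lemma symbol_perturbation: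
  fixes C :: "(nat \<Rightarrow> nat) \<Rightarrow> complex ^ 'm::finite ^ 'm"
  assumes A: "finite A" and ord: "\<And>\<alpha>. \<alpha> \<in> A \<Longrightarrow> r < order n \<alpha> \<Longrightarrow> C \<alpha> = 0"
    and c: "0 < c" "\<And>\<gamma> y. \<gamma> \<in> multi_indices n \<Longrightarrow> \<gamma> \<noteq> (\<lambda>_. 0) \<Longrightarrow>
      c * (1 + real (order n \<gamma>)) ^ r * norm y \<le> norm (symb n A C (\<lambda>i. \<mu> i + of_nat (\<gamma> i)) *v y)"
  shows "\<exists>\<delta>>0. \<forall>C' \<mu>'. (\<forall>\<alpha>\<in>A. r < order n \<alpha> \<longrightarrow> C' \<alpha> = 0) \<longrightarrow>
    (\<forall>\<alpha>\<in>A. \<forall>i j. cmod (C' \<alpha> $ i $ j - C \<alpha> $ i $ j) \<le> \<delta>) \<longrightarrow> (\<forall>i<n. cmod (\<mu>' i - \<mu> i) \<le> \<delta>) \<longrightarrow>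
    (\<forall>\<gamma>\<in>multi_indices n. \<gamma> \<noteq> (\<lambda>_. 0) \<longrightarrow> det (symb n A C' (\<lambda>i. \<mu>' i + of_nat (\<gamma> i))) \<noteq> 0)"
proof -
  define \<Lambda> where "\<Lambda> = 2 + (\<Sum>i<n. cmod (\<mu> i))"
  have \<Lambda>1: "1 \<le> \<Lambda>" by (simp add: \<Lambda>_def sum_nonneg add_increasing2)
  have \<Lambda>: "1 + cmod (\<mu> i) \<le> \<Lambda>" if "i < n" for i
    using that member_le_sum[of i "{..<n}" "\<lambda>i. cmod (\<mu> i)"] by (simp add: \<Lambda>_def)
  define E where "E = (\<Sum>\<alpha>\<in>A. \<Sum>i\<in>UNIV. \<Sum>j\<in>UNIV. cmod (C \<alpha> $ i $ j))"
  have Eij: "cmod (C \<alpha> $ i $ j) \<le> E" if "\<alpha> \<in> A" for \<alpha> i j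
  proof -
    have "cmod (C \<alpha> $ i $ j) \<le> (\<Sum>j\<in>UNIV. cmod (C \<alpha> $ i $ j))" by (rule member_le_sum) auto
    also have "\<dots> \<le> (\<Sum>i\<in>UNIV. \<Sum>j\<in>UNIV. cmod (C \<alpha> $ i $ j))"
      by (rule member_le_sum[of i UNIV "\<lambda>i. \<Sum>j\<in>UNIV. cmod (C \<alpha> $ i $ j)"]) (auto intro: sum_nonneg)
    also have "\<dots> \<le> E"
      unfolding E_def by (rule member_le_sum[of \<alpha> A "\<lambda>\<alpha>. \<Sum>i\<in>UNIV. \<Sum>j\<in>UNIV. cmod (C \<alpha> $ i $ j)"])
        (use A that in \<open>auto intro!: sum_nonneg\<close>)
    finally show ?thesis .
  qed
  have E: "0 \<le> E" by (simp add: E_def sum_nonneg)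
  define m where "m = real (CARD('m))"
  define Q where "Q = m * m * (real (card A) * (1 + E * real r) * \<Lambda> ^ r) + 1"
  have Q: "0 < Q" using E \<Lambda>1 by (simp add: Q_def m_def add_nonneg_pos)
  define \<delta> where "\<delta> = min 1 (c / (2 * Q))"
  have \<delta>: "0 < \<delta>" "\<delta> \<le> 1" using c Q by (auto simp: \<delta>_def)
  have Q\<delta>: "Q * \<delta> \<le> c / 2"
  proof -
    have "Q * \<delta> \<le> Q * (c / (2 * Q))" using Q by (intro mult_left_mono) (auto simp: \<delta>_def)
    then show ?thesis using Q by simp
  qed
  have "det (symb n A C' (\<lambda>i. \<mu>' i + of_nat (\<gamma> i))) \<noteq> 0"
    if ord': "\<forall>\<alpha>\<in>A. r < order n \<alpha> \<longrightarrow> C' \<alpha> = 0"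
      and C': "\<forall>\<alpha>\<in>A. \<forall>i j. cmod (C' \<alpha> $ i $ j - C \<alpha> $ i $ j) \<le> \<delta>" and \<mu>': "\<forall>i<n. cmod (\<mu>' i - \<mu> i) \<le> \<delta>"
      and \<gamma>: "\<gamma> \<in> multi_indices n" "\<gamma> \<noteq> (\<lambda>_. 0)" for C' :: "(nat \<Rightarrow> nat) \<Rightarrow> complex ^ 'm ^ 'm" and \<mu>' \<gamma>
  proof -
    define k where "k = 1 + real (order n \<gamma>)"
    have k: "1 \<le> k" by (simp only: k_def of_nat_0_le_iff le_add_same_cancel1)
    define K where "K = \<Lambda> * k"
    have K: "1 \<le> K" using k \<Lambda>1 mult_mono[of 1 \<Lambda> 1 k] by (simp add: K_def)
    have g: "cmod (\<mu>' i + of_nat (\<gamma> i)) \<le> K" "cmod (\<mu> i + of_nat (\<gamma> i)) \<le> K" if "i < n" for i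
    proof -
      have gi: "real (\<gamma> i) \<le> real (order n \<gamma>)" using that member_le_sum[of i "{..<n}" \<gamma>] by (simp del: of_nat_sum)
      have le: "\<Lambda> + real (order n \<gamma>) \<le> K"
        using mult_right_mono[OF \<Lambda>1 of_nat_0_le_iff, of "order n \<gamma>"] unfolding K_def k_def by (simp only: distrib_left mult_1_left mult_1_right add_le_cancel_left)
      have "cmod (\<mu> i + of_nat (\<gamma> i)) \<le> \<Lambda> + real (order n \<gamma>)"
        using norm_triangle_ineq[of "\<mu> i" "of_nat (\<gamma> i)"] \<Lambda>[OF that] gi by simp
      then show "cmod (\<mu> i + of_nat (\<gamma> i)) \<le> K" using le by linarith
      have "cmod (\<mu>' i) \<le> \<Lambda>"
        using norm_triangle_sub[of "\<mu>' i" "\<mu> i"] \<mu>' \<delta> \<Lambda>[OF that] that by force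
      then have "cmod (\<mu>' i + of_nat (\<gamma> i)) \<le> \<Lambda> + real (order n \<gamma>)"
        using norm_triangle_ineq[of "\<mu>' i" "of_nat (\<gamma> i)"] gi by simp
      then show "cmod (\<mu>' i + of_nat (\<gamma> i)) \<le> K" using le by linarith
    qed
    let ?a = "mpow n (\<lambda>i. \<mu>' i + of_nat (\<gamma> i))" and ?b = "mpow n (\<lambda>i. \<mu> i + of_nat (\<gamma> i))"
    have d: "cmod (C' \<alpha> $ i $ j * ?a \<alpha> - C \<alpha> $ i $ j * ?b \<alpha>) \<le> \<delta> * (1 + E * real r) * K ^ r" if \<alpha>: "\<alpha> \<in> A" for \<alpha> i j
    proof (cases "order n \<alpha> \<le> r")
      case True
      have Kr: "K ^ order n \<alpha> \<le> K ^ r" using True K by (intro power_increasing)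
      have "cmod (?a \<alpha> - ?b \<alpha>) \<le> K ^ order n \<alpha> * (real (order n \<alpha>) * (\<delta> / K))"
        using norm_mpow_diff_le[of K n "\<lambda>i. \<mu>' i + of_nat (\<gamma> i)" "\<lambda>i. \<mu> i + of_nat (\<gamma> i)" \<delta> \<alpha>] K g \<mu>' \<delta> by simp
      also have "\<dots> \<le> K ^ r * (real r * (\<delta> / 1))"
        using Kr True K \<delta> by (intro mult_mono divide_left_mono) (auto simp del: of_nat_sum)
      finally have 1: "cmod (?a \<alpha> - ?b \<alpha>) \<le> K ^ r * (real r * \<delta>)" by simp
      have 2: "cmod (?a \<alpha>) \<le> K ^ r" using norm_mpow_le[of n "\<lambda>i. \<mu>' i + of_nat (\<gamma> i)" K \<alpha>] g Kr by force
      have "C' \<alpha> $ i $ j * ?a \<alpha> - C \<alpha> $ i $ j * ?b \<alpha> =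
          (C' \<alpha> $ i $ j - C \<alpha> $ i $ j) * ?a \<alpha> + C \<alpha> $ i $ j * (?a \<alpha> - ?b \<alpha>)"
        by (simp add: algebra_simps)
      then have "cmod (C' \<alpha> $ i $ j * ?a \<alpha> - C \<alpha> $ i $ j * ?b \<alpha>) \<le>
          cmod (C' \<alpha> $ i $ j - C \<alpha> $ i $ j) * cmod (?a \<alpha>) + cmod (C \<alpha> $ i $ j) * cmod (?a \<alpha> - ?b \<alpha>)"
        by (simp only: norm_mult[symmetric] norm_triangle_ineq)
      also have "\<dots> \<le> \<delta> * K ^ r + E * (K ^ r * (real r * \<delta>))"
        using C' \<alpha> 1 2 Eij[OF \<alpha>] E \<delta> by (intro add_mono mult_mono) auto
      also have "\<dots> = \<delta> * (1 + E * real r) * K ^ r" by (simp add: algebra_simps)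
      finally show ?thesis .
    next
      case False
      then show ?thesis using ord[OF \<alpha>] ord' \<alpha> \<delta> E K by simp
    qed
    have entry: "cmod ((symb n A C' (\<lambda>i. \<mu>' i + of_nat (\<gamma> i)) - symb n A C (\<lambda>i. \<mu> i + of_nat (\<gamma> i))) $ i $ j)
        \<le> real (card A) * (\<delta> * (1 + E * real r) * K ^ r)" for i j
    proof -
      have "(symb n A C' (\<lambda>i. \<mu>' i + of_nat (\<gamma> i)) - symb n A C (\<lambda>i. \<mu> i + of_nat (\<gamma> i))) $ i $ j =
          (\<Sum>\<alpha>\<in>A. C' \<alpha> $ i $ j * ?a \<alpha> - C \<alpha> $ i $ j * ?b \<alpha>)"
        by (simp add: symb_def sum_subtractf)
      also have "cmod \<dots> \<le> (\<Sum>\<alpha>\<in>A. \<delta> * (1 + E * real r) * K ^ r)" using d by (rule sum_norm_le)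
      finally show ?thesis by simp
    qed
    have diff: "norm (symb n A C' (\<lambda>i. \<mu>' i + of_nat (\<gamma> i)) *v y - symb n A C (\<lambda>i. \<mu> i + of_nat (\<gamma> i)) *v y) \<le>
        c / 2 * k ^ r * norm y" for y
    proof -
      have "norm ((symb n A C' (\<lambda>i. \<mu>' i + of_nat (\<gamma> i)) - symb n A C (\<lambda>i. \<mu> i + of_nat (\<gamma> i))) *v y) \<le>
          m * m * (real (card A) * (\<delta> * (1 + E * real r) * K ^ r)) * norm y"
        unfolding m_def by (rule norm_matrix_vector_le) (rule entry)
      also have "\<dots> = (m * m * (real (card A) * (1 + E * real r) * \<Lambda> ^ r)) * \<delta> * k ^ r * norm y"
        by (simp add: K_def power_mult_distrib)
      also have "\<dots> \<le> Q * \<delta> * k ^ r * norm y"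
        using \<delta> k by (intro mult_right_mono) (auto simp: Q_def)
      also have "\<dots> \<le> c / 2 * k ^ r * norm y" using Q\<delta> k by (intro mult_right_mono) auto
      finally show ?thesis by (simp add: matrix_vector_mult_diff_rdistrib)
    qed
    have "c / 2 * k ^ r * norm y \<le> norm (symb n A C' (\<lambda>i. \<mu>' i + of_nat (\<gamma> i)) *v y)" for y
    proof -
      have "norm (symb n A C (\<lambda>i. \<mu> i + of_nat (\<gamma> i)) *v y) \<le> norm (symb n A C' (\<lambda>i. \<mu>' i + of_nat (\<gamma> i)) *v y) +
        norm (symb n A C' (\<lambda>i. \<mu>' i + of_nat (\<gamma> i)) *v y - symb n A C (\<lambda>i. \<mu> i + of_nat (\<gamma> i)) *v y)"
        by (subst norm_minus_commute) (rule norm_triangle_sub)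
      with diff[of y] c(2)[OF \<gamma>, of y]
      have "c * k ^ r * norm y - c / 2 * k ^ r * norm y \<le> norm (symb n A C' (\<lambda>i. \<mu>' i + of_nat (\<gamma> i)) *v y)"
        unfolding k_def[symmetric] by linarith
      then show ?thesis by (simp add: mult_ac)
    qed
    then show ?thesis
      using c(1) k by (intro det_nonzero_of_lower_bound[of "c / 2 * k ^ r"]) auto
  qed
  then show ?thesis using \<delta>(1) by (intro exI[of _ \<delta>] conjI allI impI ballI)
qed

subsection \<open>Restriction to the boundary and change of dimension\<close>

lemma hs_t0:
  assumes "hs c \<zeta>' y" "\<And>i. \<zeta>' (Tv i) = 0" "\<And>j. \<zeta>' (Xv j) = \<zeta> (Xv j)" "\<And>k. \<zeta>' (Zv k) = \<zeta> (Zv k)"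
  shows "hs (t0 c) \<zeta> y"
proof -
  have "cf (t0 c) \<kappa> * mon \<kappa> \<zeta> = cf c \<kappa> * mon \<kappa> \<zeta>'" for \<kappa>
  proof (cases "tdeg \<kappa> = 0")
    case True
    then have "lookup \<kappa> (Tv i) = 0" for i by (simp add: tdeg_eq_0_iff)
    then have "\<zeta> v ^ lookup \<kappa> v = \<zeta>' v ^ lookup \<kappa> v" for v using assms(3,4) by (cases v) simp_all
    then show ?thesis using True by (simp add: cf_t0 mon_def)
  next
    case False
    then obtain i where "lookup \<kappa> (Tv i) \<noteq> 0" by (auto simp: tdeg_eq_0_iff)
    then have "mon \<kappa> \<zeta>' = 0"
      unfolding mon_def using assms(2)[of i] by (intro prod_zero bexI[of _ "Tv i"]) (simp_all add: in_keys_iff)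
    then show ?thesis using False by (simp add: cf_t0)
  qed
  then show ?thesis using assms(1) by (simp add: hs_def)
qed

context coords
begin

lemma expands_proj:
  assumes "expands c f (bpt x z)"
  shows "expands (t0 c) (\<lambda>q. f (bpt (fst (snd q)) (snd (snd q)))) (bpt x z)"
proof (rule expandsI)
  show "Vsup (t0 c)" by (rule Vsup_t0[OF expands_Vsup[OF assms]])
  show "bpt x z \<in> TS" by (rule expands_TS[OF assms])
  show "\<forall>\<^sub>F q in pf (bpt x z). hs (t0 c) (emb_diff (bpt x z) q) (f (bpt (fst (snd q)) (snd (snd q))))"
    using eventually_pf_bpt[OF expandsD[OF assms]]
  proof (rule eventually_mono)
    fix q :: pt
    assume h: "hs c (emb_diff (bpt x z) (bpt (fst (snd q)) (snd (snd q)))) (f (bpt (fst (snd q)) (snd (snd q))))"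
    obtain t' x' z' where q: "q = (t', x', z')" by (rule prod_cases3)
    show "hs (t0 c) (emb_diff (bpt x z) q) (f (bpt (fst (snd q)) (snd (snd q))))"
      by (rule hs_t0[OF h]) (simp_all add: q emb_diff_def bpt_def)
  qed
qed

lemma expands_lift:
  assumes e: "coords.expands n1 n2 l c f p'" and p: "p \<in> TS" and sub: "coords.V n1 n2 l \<subseteq> V"
    and \<pi>: "\<And>q. q \<in> TS \<Longrightarrow> \<pi> q \<in> coords.TS n1 n2 l"
      "\<And>q v. q \<in> TS \<Longrightarrow> v \<in> coords.V n1 n2 l \<Longrightarrow> emb_diff p' (\<pi> q) v = emb_diff p q v"
  shows "expands c (\<lambda>q. f (\<pi> q)) p"
proof (rule expandsI)
  have Vs: "coords.Vsup n1 n2 l c" by (rule coords.expands_Vsup[OF e])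
  show "Vsup c" using Vs sub unfolding coords.Vsup_def by blast
  show "p \<in> TS" by (rule p)
  obtain r where r: "0 < r" "\<forall>q\<in>coords.pd n1 n2 l p' r. hs c (emb_diff p' q) (f q)"
    using coords.expandsD[OF e] unfolding coords.eventually_pf by blast
  have "hs c (emb_diff p q) (f (\<pi> q))" if q: "q \<in> pd p r" for q
  proof -
    have q': "q \<in> TS" "\<forall>v\<in>V. cmod (emb_diff p q v) < r" using q unfolding pd_def by blast+
    have "\<pi> q \<in> coords.pd n1 n2 l p' r"
      unfolding coords.pd_def mem_Collect_eq
    proof (intro conjI ballI)
      show "\<pi> q \<in> coords.TS n1 n2 l" by (rule \<pi>(1)[OF q'(1)])
      fix v assume v: "v \<in> coords.V n1 n2 l"
      then have "v \<in> V" using sub by blast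
      then have "cmod (emb_diff p q v) < r" using q'(2) by blast
      then show "cmod (emb_diff p' (\<pi> q) v) < r" by (simp only: \<pi>(2)[OF q'(1) v])
    qed
    then have "hs c (emb_diff p' (\<pi> q)) (f (\<pi> q))" using r(2) by blast
    moreover have "hs c (emb_diff p' (\<pi> q)) (f (\<pi> q)) \<longleftrightarrow> hs c (emb_diff p q) (f (\<pi> q))"
      by (rule coords.hs_cong_Vsup[OF Vs \<pi>(2)[OF q'(1)]])
    ultimately show ?thesis by blast
  qed
  then show "\<forall>\<^sub>F q in pf p. hs c (emb_diff p q) (f (\<pi> q))" unfolding eventually_pf using r(1) by blast
qed

lemma analytic_boundary_lift:
  assumes an: "analytic_at_pt 0 n' l (\<lambda>(t, x, z). g x z) (bpt x z)" and TS: "bpt x z \<in> TS"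
  shows "\<exists>c. expands c (\<lambda>q. g (fst (snd q)) (snd (snd q))) (bpt x z) \<and> t0 c = c"
proof -
  let ?V = "coords.V 0 n' l"
  have TS': "bpt x z \<in> coords.TS 0 n' l" using TS by (simp add: bpt_def coords.TS_iff)
  obtain c where c: "coords.expands 0 n' l c (\<lambda>(t, x, z). g x z) (bpt x z)"
    using an unfolding coords.analytic_iff_expands[OF TS'] by blast
  have "expands c (\<lambda>q. (\<lambda>(t, x, z). g x z) (bpt (fst (snd q)) (snd (snd q)))) (bpt x z)"
  proof (rule expands_lift[OF c TS])
    show "?V \<subseteq> V" unfolding coords.V_def by auto
    fix q :: pt assume q: "q \<in> TS"
    obtain t' x' z' where q': "q = (t', x', z')" by (rule prod_cases3)
    show "bpt (fst (snd q)) (snd (snd q)) \<in> coords.TS 0 n' l"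
      using q unfolding q' by (simp add: bpt_def coords.TS_iff)
    fix v assume "v \<in> ?V"
    then show "emb_diff (bpt x z) (bpt (fst (snd q)) (snd (snd q))) v = emb_diff (bpt x z) q v"
      unfolding q' by (cases v) (auto simp: coords.V_def emb_diff_def bpt_def)
  qed
  then have "expands c (\<lambda>q. g (fst (snd q)) (snd (snd q))) (bpt x z)" by (simp add: bpt_def case_prod_beta)
  moreover have "t0 c = c"
  proof (rule mps_eqI)
    fix \<kappa>
    have "tdeg \<kappa> = 0" if "cf c \<kappa> \<noteq> 0"
    proof -
      have "keys \<kappa> \<subseteq> ?V" using that coords.expands_Vsup[OF c] unfolding coords.Vsup_def by blast
      then have "Tv i \<notin> keys \<kappa>" for i by (auto simp: coords.V_def)
      then show ?thesis by (simp add: tdeg_eq_0_iff in_keys_iff)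
    qed
    then show "cf (t0 c) \<kappa> = cf c \<kappa>" by (cases "cf c \<kappa> = 0") (simp_all add: cf_t0)
  qed
  ultimately show ?thesis by blast
qed

lemma analytic_boundary_drop:
  assumes c: "expands c f (bpt x z)"
    and g: "\<forall>\<^sub>F q in pf (bpt x z). g (fst (snd q)) (snd (snd q)) = f (bpt (fst (snd q)) (snd (snd q)))"
  shows "analytic_at_pt 0 n' l (\<lambda>(t, x, z). g x z) (bpt x z)"
proof -
  have TS: "bpt x z \<in> TS" by (rule expands_TS[OF c])
  then have TS': "bpt x z \<in> coords.TS 0 n' l" by (simp add: bpt_def coords.TS_iff)
  have "\<forall>\<^sub>F q in pf (bpt x z). hs (t0 c) (emb_diff (bpt x z) q) (f (bpt (fst (snd q)) (snd (snd q)))) \<and>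
      g (fst (snd q)) (snd (snd q)) = f (bpt (fst (snd q)) (snd (snd q)))"
    by (rule eventually_conj[OF expandsD[OF expands_proj[OF c]] g])
  then obtain r where r: "0 < r" "\<forall>q\<in>pd (bpt x z) r. hs (t0 c) (emb_diff (bpt x z) q) (f (bpt (fst (snd q)) (snd (snd q)))) \<and>
      g (fst (snd q)) (snd (snd q)) = f (bpt (fst (snd q)) (snd (snd q)))"
    unfolding eventually_pf by blast
  have "coords.expands 0 n' l (t0 c) (\<lambda>(t, x, z). g x z) (bpt x z)"
  proof (rule coords.expandsI)
    show "coords.Vsup 0 n' l (t0 c)"
      unfolding coords.Vsup_def
    proof (intro allI impI subsetI)
      fix \<kappa> v assume \<kappa>: "cf (t0 c) \<kappa> \<noteq> 0" and v: "v \<in> keys \<kappa>"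
      then have *: "tdeg \<kappa> = 0" "cf c \<kappa> \<noteq> 0" by (auto simp: cf_t0 split: if_splits)
      then have "keys \<kappa> \<subseteq> V" using expands_Vsup[OF c] unfolding Vsup_def by blast
      then have "v \<in> V" using v by blast
      moreover have "lookup \<kappa> v \<noteq> 0" using v by (simp add: in_keys_iff)
      ultimately show "v \<in> coords.V 0 n' l"
        using *(1) by (cases v) (auto simp: coords.V_def tdeg_eq_0_iff)
    qed
    show "bpt x z \<in> coords.TS 0 n' l" by (rule TS')
    have "hs (t0 c) (emb_diff (bpt x z) q) ((\<lambda>(t, x, z). g x z) q)" if q: "q \<in> coords.pd 0 n' l (bpt x z) r" for q
    proof -
      obtain t' x' z' where q': "q = (t', x', z')" by (rule prod_cases3)
      have "q \<in> coords.TS 0 n' l" "\<forall>v\<in>coords.V 0 n' l. cmod (emb_diff (bpt x z) q v) < r"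
        using q unfolding coords.pd_def by blast+
      then have t': "t' = (\<lambda>_. 0)" and "q \<in> TS" and v: "\<forall>v\<in>coords.V 0 n' l. cmod (emb_diff (bpt x z) q v) < r"
        unfolding q' by (auto simp: coords.TS_iff fun_eq_iff)
      moreover have "cmod (emb_diff (bpt x z) q v) < r" if "v \<in> V" for v
      proof (cases v)
        case (Tv i)
        then show ?thesis using r(1) by (simp add: q' t' emb_diff_def bpt_def)
      next
        case (Xv j)
        then show ?thesis using v that by (simp add: coords.V_simps)
      next
        case (Zv k)
        then show ?thesis using v that by (simp add: coords.V_simps)
      qed
      ultimately have "q \<in> pd (bpt x z) r" unfolding pd_def by blast
      then have "hs (t0 c) (emb_diff (bpt x z) q) (g (fst (snd q)) (snd (snd q)))" using r(2) by force
      then show ?thesis by (simp add: q')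
    qed
    then show "\<forall>\<^sub>F q in coords.pf 0 n' l (bpt x z). hs (t0 c) (emb_diff (bpt x z) q) ((\<lambda>(t, x, z). g x z) q)"
      unfolding coords.eventually_pf using r(1) by blast
  qed
  then show ?thesis unfolding coords.analytic_iff_expands[OF TS'] by blast
qed

lemma expands_continuous:
  assumes c: "expands c f p" and e: "0 < e"
  shows "\<forall>\<^sub>F q in pf p. cmod (f q - f p) < e"
proof -
  let ?c = "c - cst (f p)"
  have c': "expands ?c (\<lambda>q. f q - f p) p"
    by (rule expands_diff[OF c expands_cst[OF expands_TS[OF c]]])
  have c0: "cf ?c 0 = 0" using expands_at[OF c'] by simp
  obtain s B where s: "0 < s" and B: "bd (\<lambda>\<kappa>. s ^ deg \<kappa>) ?c B" using expands_conv[OF c'] unfolding conv_def by blast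
  have B0: "0 \<le> B" by (rule bd_nonneg[OF B])
  define \<theta> where "\<theta> = min 1 (e / (2 * (B + 1)))"
  have \<theta>: "0 < \<theta>" "\<theta> \<le> 1" using e B0 by (auto simp: \<theta>_def)
  have "\<theta> * B \<le> e / (2 * (B + 1)) * B" using B0 by (intro mult_right_mono) (auto simp: \<theta>_def)
  also have "\<dots> < e" using e B0 by (simp add: field_simps add_nonneg_pos)
  finally have \<theta>B: "\<theta> * B < e" .
  have small: "\<forall>\<^sub>F q in pf p. q \<in> pd p (\<theta> * s)" unfolding eventually_pf using \<theta>(1) s mult_pos_pos by blast
  show ?thesis
    using eventually_conj[OF small expandsD[OF c']]
  proof (rule eventually_mono)
    fix q assume q: "q \<in> pd p (\<theta> * s) \<and> hs ?c (emb_diff p q) (f q - f p)"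
    let ?g = "\<lambda>\<kappa>. cf ?c \<kappa> * mon \<kappa> (emb_diff p q)"
    have g: "cmod (?g \<kappa>) \<le> cmod (cf ?c \<kappa>) * s ^ deg \<kappa> * \<theta>" for \<kappa>
    proof (cases "cf ?c \<kappa> = 0")
      case True
      then show ?thesis by (simp only: mult_zero_left norm_zero order_refl)
    next
      case False
      have "\<kappa> \<noteq> 0" using False c0 by metis
      then have "W 1 \<kappa> \<noteq> 0" using W_eq_0_iff[of 1 \<kappa>, OF zero_less_one] by blast
      then have d: "deg \<kappa> \<noteq> 0" unfolding W_eq deg_eq by simp
      have "keys \<kappa> \<subseteq> V" using False expands_Vsup[OF c'] unfolding Vsup_def by blast
      then have "mon_abs (emb_diff p q) \<kappa> \<le> mon \<kappa> (\<lambda>_. \<theta> * s)"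
        unfolding mon_def using q by (intro prod_mono conjI power_mono) (auto simp: pd_def intro: less_imp_le)
      also have "\<dots> = \<theta> ^ deg \<kappa> * s ^ deg \<kappa>" by (simp only: mon_const power_mult_distrib)
      also have "\<dots> \<le> \<theta> ^ 1 * s ^ deg \<kappa>"
        using d \<theta> s zero_le_power[of s "deg \<kappa>"] by (intro mult_right_mono power_decreasing) linarith+
      finally have "mon_abs (emb_diff p q) \<kappa> \<le> s ^ deg \<kappa> * \<theta>" by (simp only: power_one_right mult.commute)
      moreover have "cmod (mon \<kappa> (emb_diff p q)) = mon_abs (emb_diff p q) \<kappa>"
        by (simp add: mon_def norm_power[symmetric] prod_norm)
      ultimately show ?thesis
        unfolding norm_mult mult.assoc by (intro mult_left_mono) simp_all
    qed
    have "((\<lambda>F. norm (sum ?g F)) \<longlongrightarrow> norm (f q - f p)) (finite_subsets_at_top UNIV)"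
      using q unfolding hs_def has_sum_def by (intro tendsto_norm) blast
    then have "norm (f q - f p) \<le> \<theta> * B"
    proof (rule tendsto_upperbound)
      show "\<forall>\<^sub>F F in finite_subsets_at_top UNIV. norm (sum ?g F) \<le> \<theta> * B"
      proof (rule eventually_finite_subsets_at_top_weakI)
        fix F :: "mindex set" assume F: "finite F"
        have "norm (sum ?g F) \<le> (\<Sum>\<kappa>\<in>F. cmod (cf ?c \<kappa>) * s ^ deg \<kappa> * \<theta>)" by (rule sum_norm_le[OF g])
        also have "\<dots> = (\<Sum>\<kappa>\<in>F. cmod (cf ?c \<kappa>) * s ^ deg \<kappa>) * \<theta>" by (simp only: sum_distrib_right)
        also have "\<dots> \<le> B * \<theta>" by (rule mult_right_mono[OF bdD[OF B F] less_imp_le[OF \<theta>(1)]])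
        finally show "norm (sum ?g F) \<le> \<theta> * B" by (simp only: mult.commute)
      qed
    qed (rule finite_subsets_at_top_neq_bot)
    then show "cmod (f q - f p) < e" using \<theta>B by linarith
  qed
qed

lemma expV_0_eventually:
  fixes f :: "pt \<Rightarrow> complex ^ 'm::finite"
  assumes "expV 0 f p"
  shows "\<forall>\<^sub>F q in pf p. f q = 0"
proof -
  have "expV 0 (\<lambda>_. 0 :: complex ^ 'm) p" using expV_TS[OF assms] by (simp add: expV_def expands_0)
  then show ?thesis by (rule expV_eqD[OF assms])
qed

subsection \<open>Operators on the boundary\<close>

lemma theta_tw_bpt:
  "multi_iter (theta_tw lam) N \<alpha> g (bpt x z) = mpow N (lam z) \<alpha> *s (g (bpt x z) :: complex ^ 'm::finite)"
proof (induction N)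
  case 0
  then show ?case by (simp add: mpow_def)
next
  case (Suc N)
  have "(theta_tw lam N ^^ k) h (bpt x z) = lam z N ^ k *s (h (bpt x z) :: complex ^ 'm)" for h k
  proof (induction k)
    case (Suc k)
    have "theta_tw lam N h' (bpt x z) = lam z N *s (h' (bpt x z) :: complex ^ 'm)" for h'
      by (simp add: theta_tw_def theta_def bpt_def)
    then show ?case by (simp add: Suc vec_eq_iff)
  qed simp
  then show ?case by (simp add: Suc vec_eq_iff mpow_def)
qed

lemma openin_locus:
  assumes "openin (prod_topology (Euclidean_space n) (Euclidean_space n')) M"
  shows "openin (Euclidean_space n') (locus M)"
proof -
  have "continuous_map (Euclidean_space n') (prod_topology (Euclidean_space n) (Euclidean_space n')) (\<lambda>x. (\<lambda>_. 0, x))"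
    by (intro continuous_map_pairedI) (auto simp: topspace_Euclidean_space)
  from openin_continuous_map_preimage[OF this assms]
  have "openin (Euclidean_space n') {x \<in> topspace (Euclidean_space n'). (\<lambda>_. 0, x) \<in> M}" .
  moreover have "{x \<in> topspace (Euclidean_space n'). (\<lambda>_. 0, x) \<in> M} = locus M"
    using openin_subset[OF assms] by (auto simp: locus_def)
  ultimately show ?thesis by simp
qed

lemma dx_bpt:
  fixes g :: "pt \<Rightarrow> complex ^ 'm::finite"
  assumes N: "openin (Euclidean_space n') N" and g: "\<And>x. x \<in> N \<Longrightarrow> g (bpt x z) = h (x, z)" and x: "x \<in> N" and j: "j < n'"
  shows "dx j g (bpt x z) = dxN j h (x, z)"
proof -
  obtain T where T: "open T" "N = T \<inter> {x. \<forall>i\<ge>n'. x i = 0}"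
    using N unfolding Euclidean_space_def openin_subtopology euclidean_product_topology open_openin[symmetric] by blast
  have "continuous_on UNIV (\<lambda>s. x(j := s))"
  proof (rule continuous_on_coordinatewise_then_product)
    show "continuous_on UNIV (\<lambda>s. (x(j := s)) i)" for i by (cases "i = j") simp_all
  qed
  then have "open ((\<lambda>s. x(j := s)) -` T)" using T(1) open_vimage by blast
  moreover have "x j \<in> (\<lambda>s. x(j := s)) -` T" using x T(2) by simp
  ultimately have "\<forall>\<^sub>F s in nhds (x j). s \<in> (\<lambda>s. x(j := s)) -` T" by (rule eventually_nhds_in_open)
  then have "\<forall>\<^sub>F s in nhds (x j). s \<in> UNIV \<longrightarrow> g (bpt (x(j := s)) z) = h (x(j := s), z)"
  proof (rule eventually_mono)
    fix s assume "s \<in> (\<lambda>s. x(j := s)) -` T"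
    then have "x(j := s) \<in> N" using x j T(2) by simp
    then show "s \<in> UNIV \<longrightarrow> g (bpt (x(j := s)) z) = h (x(j := s), z)" using g by blast
  qed
  from vector_derivative_cong_eq[OF this refl refl UNIV_I]
  show ?thesis by (simp add: dx_def dxN_def bpt_def)
qed

lemma multi_iter_dx_bpt:
  fixes g :: "pt \<Rightarrow> complex ^ 'm::finite"
  assumes N: "openin (Euclidean_space n') N" and g: "\<And>x. x \<in> N \<Longrightarrow> g (bpt x z) = h (x, z)" and "K \<le> n'"
  shows "x \<in> N \<Longrightarrow> multi_iter dx K \<beta> g (bpt x z) = multi_iter dxN K \<beta> h (x, z)"
  using \<open>K \<le> n'\<close>
proof (induction K arbitrary: x)
  case 0
  then show ?case by (simp add: g)
next
  case (Suc K)
  have K: "K < n'" using Suc.prems(2) by simp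
  have "x \<in> N \<Longrightarrow> (dx K ^^ m) (multi_iter dx K \<beta> g) (bpt x z) = (dxN K ^^ m) (multi_iter dxN K \<beta> h) (x, z)" for x m
  proof (induction m arbitrary: x)
    case 0
    then show ?case using Suc by simp
  next
    case (Suc m)
    show ?case unfolding funpow.simps comp_apply
    proof (rule dx_bpt[where N = N])
      show "x \<in> N \<Longrightarrow> (dx K ^^ m) (multi_iter dx K \<beta> g) (bpt x z) = (dxN K ^^ m) (multi_iter dxN K \<beta> h) (x, z)" for x
        by (rule Suc.IH)
    qed (use N Suc.prems K in auto)
  qed
  then show ?case using Suc.prems(1) by simp
qed

lemma op_tw_bpt:
  fixes A :: "'m::finite oper"
  assumes "openin (Euclidean_space n') N" "\<And>x. x \<in> N \<Longrightarrow> w (bpt x z) = v (x, z)" "x \<in> N"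
  shows "op_tw n n' A lam w (bpt x z) = sigma_op n n' A lam v (x, z)"
  unfolding op_tw_def sigma_op_def prod.case
  by (intro sum.cong refl)
    (simp add: case_prod_beta theta_tw_bpt multi_iter_dx_bpt[where N = N and g = w and h = v, OF assms(1,2) order_refl assms(3)] vector_scalar_commute bpt_def[symmetric])

lemma sigma_op_UD:
  fixes A :: "'m::finite oper"
  assumes fin: "finite (supp A)" and A: "\<And>\<alpha> \<beta>. \<beta> \<noteq> (\<lambda>_. 0) \<Longrightarrow> A \<alpha> \<beta> (\<lambda>_. 0, x, z) = 0"
  shows "sigma_op n n' A lam v (x, z) = sigma_mat n A x z (lam z) *v v (x, z)"
proof -
  let ?t = "\<lambda>(\<alpha>, \<beta>). mpow n (lam z) \<alpha> *s (A \<alpha> \<beta> (\<lambda>_. 0, x, z) *v multi_iter dxN n' \<beta> v (x, z))"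
  let ?S = "{\<alpha>. (\<alpha>, \<lambda>_. 0) \<in> supp A}"
  have "sum ?t (supp A) = sum ?t ((\<lambda>\<alpha>. (\<alpha>, \<lambda>_. 0)) ` ?S)"
  proof (rule sum.mono_neutral_right[OF fin])
    show "\<forall>i\<in>supp A - (\<lambda>\<alpha>. (\<alpha>, \<lambda>_. 0)) ` ?S. ?t i = 0"
    proof
      fix i assume i: "i \<in> supp A - (\<lambda>\<alpha>. (\<alpha>, \<lambda>_. 0)) ` ?S"
      obtain \<alpha> \<beta> where ab: "i = (\<alpha>, \<beta>)" by (cases i)
      with i have "\<beta> \<noteq> (\<lambda>_. 0)" by auto
      then show "?t i = 0" using A by (simp add: ab)
    qed
  qed auto
  also have "\<dots> = (\<Sum>\<alpha>\<in>?S. mpow n (lam z) \<alpha> *s (A \<alpha> (\<lambda>_. 0) (\<lambda>_. 0, x, z) *v v (x, z)))"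
  proof (subst sum.reindex)
    have "multi_iter F N (\<lambda>_. 0) f = f" for F :: "nat \<Rightarrow> 'f \<Rightarrow> 'f" and N f by (induction N) auto
    then show "sum (?t \<circ> (\<lambda>\<alpha>. (\<alpha>, \<lambda>_. 0))) ?S =
      (\<Sum>\<alpha>\<in>?S. mpow n (lam z) \<alpha> *s (A \<alpha> (\<lambda>_. 0) (\<lambda>_. 0, x, z) *v v (x, z)))" by (intro sum.cong refl) simp
  qed (auto intro: inj_onI)
  also have "\<dots> = sigma_mat n A x z (lam z) *v v (x, z)"
  proof -
    have "(\<Sum>\<alpha>\<in>?S. mpow n (lam z) \<alpha> * (\<Sum>j\<in>UNIV. A \<alpha> (\<lambda>_. 0) (\<lambda>_. 0, x, z) $ i $ j * v (x, z) $ j)) =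
      (\<Sum>j\<in>UNIV. (\<Sum>\<alpha>\<in>?S. A \<alpha> (\<lambda>_. 0) (\<lambda>_. 0, x, z) $ i $ j * mpow n (lam z) \<alpha>) * v (x, z) $ j)" for i
      unfolding sum_distrib_left sum_distrib_right by (subst sum.swap) (simp add: mult_ac)
    then show ?thesis
      by (simp add: vec_eq_iff sigma_mat_def matrix_vector_mult_def)
  qed
  finally show ?thesis by (simp add: sigma_op_def)
qed

lemma op_zero_iff:
  fixes A :: "'m::finite oper"
  assumes c: "expV c w (bpt x z)" and tw: "twisted lam (bpt x z) u w" and L: "expL L lam (bpt x z)"
    and a: "expO a A (bpt x z)" and fin: "finite (supp A)"
  shows "(\<forall>\<^sub>F q in pf (bpt x z). pos n q \<longrightarrow> op_apply n n' A u q = 0) \<longleftrightarrow> fop (supp A) a L c = 0"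
proof
  have e: "expV (fop (supp A) a L c) (op_tw n n' A lam w) (bpt x z)" by (rule expV_op_tw[OF c L a])
  have t: "\<forall>\<^sub>F q in pf (bpt x z). pos n q \<longrightarrow> op_apply n n' A u q = twist n lam q *s op_tw n n' A lam w q"
    by (rule op_apply_twisted[OF tw c L fin])
  {
    assume "\<forall>\<^sub>F q in pf (bpt x z). pos n q \<longrightarrow> op_apply n n' A u q = 0"
    then have "\<forall>\<^sub>F q in pf (bpt x z). pos n q \<longrightarrow> op_tw n n' A lam w q = 0"
      using t by eventually_elim (metis twist_nonzero vector_mul_eq_0)
    then show "fop (supp A) a L c = 0" by (rule expV_zero_pos[OF e])
  next
    assume "fop (supp A) a L c = 0"
    then have "expV 0 (op_tw n n' A lam w) (bpt x z)" using e by (simp only:)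
    then have "\<forall>\<^sub>F q in pf (bpt x z). op_tw n n' A lam w q = 0" by (rule expV_0_eventually)
    then show "\<forall>\<^sub>F q in pf (bpt x z). pos n q \<longrightarrow> op_apply n n' A u q = 0"
      using t by eventually_elim (simp only: vector_smult_rzero simp_thms)
  }
qed

lemma UAM_iff:
  fixes w :: "pt \<Rightarrow> complex ^ 'm::finite"
  assumes open_sets: "openin (prod_topology (Euclidean_space n) (Euclidean_space n')) M" "openin (Complex_space l) U"
  shows "w \<in> UAM n n' l M U \<longleftrightarrow> (\<forall>x\<in>locus M. \<forall>z\<in>U. \<exists>c. expV c w (bpt x z))"
  unfolding UAM_def mem_Collect_eq near_iff[OF open_sets]
proof (intro ball_cong refl iffI)
  fix x z assume xz: "x \<in> locus M" "z \<in> U"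
  have TS: "bpt x z \<in> TS" by (rule bpt_in_TS[OF open_sets xz])
  {
    assume "\<forall>\<^sub>F p in pf (bpt x z). \<forall>i. analytic_at_pt n n' l (\<lambda>q. w q $ i) p"
    then have "\<forall>i. analytic_at_pt n n' l (\<lambda>q. w q $ i) (bpt x z)" by (rule eventually_pf_self[OF _ TS])
    then have "\<forall>i. \<exists>c. expands c (\<lambda>q. w q $ i) (bpt x z)" unfolding analytic_iff_expands[OF TS] .
    then obtain c where "\<forall>i. expands (c i) (\<lambda>q. w q $ i) (bpt x z)" by (rule choice[THEN exE])
    then have "expV (\<chi> i. c i) w (bpt x z)" by (simp add: expV_def)
    then show "\<exists>c. expV c w (bpt x z)" by (rule exI)
  next
    assume "\<exists>c. expV c w (bpt x z)"
    then obtain c where c: "expV c w (bpt x z)" by (rule exE)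
    have "\<forall>\<^sub>F p in pf (bpt x z). p \<in> TS \<and> (\<exists>d. expands d (\<lambda>q. w q $ i) p)" for i
      using c unfolding expV_def by (intro eventually_conj eventually_pf_TS expands_eventually_expands) blast
    then have "\<forall>\<^sub>F p in pf (bpt x z). analytic_at_pt n n' l (\<lambda>q. w q $ i) p" for i
      by (rule eventually_mono) (use analytic_iff_expands in blast)
    then show "\<forall>\<^sub>F p in pf (bpt x z). \<forall>i. analytic_at_pt n n' l (\<lambda>q. w q $ i) p"
      by (rule eventually_all_finite)
  }
qed

lemma eventually_base:
  assumes "openin (prod_topology (Euclidean_space n) (Euclidean_space n')) M" "openin (Complex_space l) U"
    "x \<in> locus M" "z \<in> U"
  shows "\<forall>\<^sub>F q in pf (bpt x z). fst (snd q) \<in> locus M \<and> snd (snd q) \<in> U"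
  using eventually_pf_bpt[OF eventually_MU[OF assms]]
  by (rule eventually_mono) (simp add: MU_def bpt_def locus_def case_prod_beta)

subsection \<open>The formal problem at a boundary point\<close>

definition local_data :: "((nat \<Rightarrow> complex) \<Rightarrow> nat \<Rightarrow> complex) \<Rightarrow> 'm::finite oper \<Rightarrow> nat \<Rightarrow> (nat \<Rightarrow> 'm oper) \<Rightarrow> pt \<Rightarrow>
    (nat \<Rightarrow> mps) \<Rightarrow> ((nat \<Rightarrow> nat) \<Rightarrow> (nat \<Rightarrow> nat) \<Rightarrow> mps ^ 'm ^ 'm) \<Rightarrow>
    (nat \<Rightarrow> (nat \<Rightarrow> nat) \<Rightarrow> (nat \<Rightarrow> nat) \<Rightarrow> mps ^ 'm ^ 'm) \<Rightarrow> bool" where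
  "local_data lam P p Ps b L a aa \<longleftrightarrow>
     (\<forall>i. Zonly (L i)) \<and> expL L lam b \<and> expO a P b \<and> (\<forall>i<p. expO (aa i) (Ps i) b) \<and>
     (\<exists>s S' a'. 0 < s \<and> UD_data s (supp P) a \<and>
       (\<forall>i<p. \<forall>j<p. UD_data s (S' i j) (a' i j) \<and> (\<forall>\<gamma>. lead (S' i j) (a' i j) L \<gamma> = 0)) \<and>
       (\<forall>i<p. \<forall>w. (\<forall>k. Vsup (w $ k)) \<longrightarrow> fop (supp P) a L w = 0 \<longrightarrow>
         fop (supp P) a L (fop (supp (Ps i)) (aa i) L w) =
         (\<Sum>j<p. fop (S' i j) (a' i j) L (fop (supp (Ps j)) (aa j) L w)))) \<and>
     (\<exists>c r. 0 < c \<and>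
       (\<forall>\<kappa> y. keys \<kappa> \<subseteq> V \<longrightarrow> tdeg \<kappa> \<noteq> 0 \<longrightarrow>
         c * (1 + real (tdeg \<kappa>)) ^ r * norm y \<le> norm (lead (supp P) a L (\<lambda>k. lookup \<kappa> (Tv k)) *v y)) \<and>
       (\<forall>\<alpha> \<beta> i j. (\<alpha>, \<beta>) \<in> supp P \<longrightarrow> a \<alpha> \<beta> $ i $ j \<noteq> 0 \<longrightarrow> (\<Sum>i<n. \<alpha> i) + bsum \<beta> \<le> r))"

lemma local_dataD:
  assumes "local_data lam P p Ps b L a aa"
  shows "\<And>i. Zonly (L i)" "expL L lam b" "expO a P b" "\<And>i. i < p \<Longrightarrow> expO (aa i) (Ps i) b"
  using assms unfolding local_data_def by blast+

lemma local_data_lead: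
  assumes "local_data lam P p Ps b L a aa" "keys \<kappa> \<subseteq> V" "tdeg \<kappa> \<noteq> 0"
    "lead (supp P) a L (\<lambda>k. lookup \<kappa> (Tv k)) *v y = 0"
  shows "y = 0"
proof -
  obtain c r where c: "0 < c" "\<forall>\<kappa> y. keys \<kappa> \<subseteq> V \<longrightarrow> tdeg \<kappa> \<noteq> 0 \<longrightarrow>
         c * (1 + real (tdeg \<kappa>)) ^ r * norm y \<le> norm (lead (supp P) a L (\<lambda>k. lookup \<kappa> (Tv k)) *v y)"
    using assms(1) unfolding local_data_def by (elim conjE exE) blast
  have "c * (1 + real (tdeg \<kappa>)) ^ r * norm y \<le> norm (lead (supp P) a L (\<lambda>k. lookup \<kappa> (Tv k)) *v y)"
    by (rule c(2)[rule_format, OF assms(2,3)])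
  then have "c * (1 + real (tdeg \<kappa>)) ^ r * norm y \<le> 0" unfolding assms(4) by (simp only: norm_zero)
  moreover have "0 < c * (1 + real (tdeg \<kappa>)) ^ r" using c(1) by (intro mult_pos_pos zero_less_power) auto
  ultimately have "norm y \<le> 0" by (metis mult_pos_pos not_le)
  then show ?thesis by simp
qed

lemma local_unique:
  fixes P :: "'m::finite oper"
  assumes ld: "local_data lam P p Ps (bpt x z) L a aa"
    and c: "expV c f (bpt x z)" "\<forall>\<^sub>F q in pf (bpt x z). pos n q \<longrightarrow> op_tw n n' P lam f q = 0"
    and d: "expV d g (bpt x z)" "\<forall>\<^sub>F q in pf (bpt x z). pos n q \<longrightarrow> op_tw n n' P lam g q = 0"
    and fg: "\<forall>\<^sub>F q in pf (bpt x z). f (bpt (fst (snd q)) (snd (snd q))) = g (bpt (fst (snd q)) (snd (snd q)))"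
  shows "c = d"
proof -
  note L = local_dataD(2)[OF ld] and a = local_dataD(3)[OF ld]
  obtain s where s: "0 < s" "UD_data s (supp P) a" using ld unfolding local_data_def by (elim conjE exE) blast
  have "fop (supp P) a L c = 0" by (rule expV_zero_pos[OF expV_op_tw[OF c(1) L a] c(2)])
  moreover have "fop (supp P) a L d = 0" by (rule expV_zero_pos[OF expV_op_tw[OF d(1) L a] d(2)])
  ultimately have e: "fop (supp P) a L (c - d) = 0" by (simp add: fop_diff)
  have t: "t0 ((c - d) $ k) = 0" for k
  proof -
    have "expands (c $ k) (\<lambda>q. f q $ k) (bpt x z)" "expands (d $ k) (\<lambda>q. g q $ k) (bpt x z)"
      using c(1) d(1) unfolding expV_def by blast+
    from expands_diff[OF this[THEN expands_proj]]
    have "t0 (c $ k) - t0 (d $ k) = 0"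
      by (rule expands_zero) (use fg in \<open>eventually_elim, simp\<close>)
    then show ?thesis by (simp add: t0_diff)
  qed
  have V: "Vsup ((c - d) $ k)" for k
  proof -
    have "Vsup (c $ k)" "Vsup (d $ k)" using c(1) d(1) expands_Vsup unfolding expV_def by blast+
    then show ?thesis by (simp add: Vsup_diff)
  qed
  have "c - d = 0"
  proof (rule formal_uniqueness[of s "supp P" a 1 "\<lambda>_ _. {}" "\<lambda>_ _. a" L "\<lambda>_. c - d" 0])
    show "UD_data s {} a" for i j :: nat by (simp add: UD_data_def)
    show "lead {} a L \<gamma> = 0" for i j :: nat and \<gamma> by (simp add: lead_def vec_eq_iff)
    show "y = 0" if "keys \<kappa> \<subseteq> V" "tdeg \<kappa> \<noteq> 0" "lead (supp P) a L (\<lambda>k. lookup \<kappa> (Tv k)) *v y = 0" for \<kappa> y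
      by (rule local_data_lead[OF ld that])
    have "fop {} a L (c - d) = 0" by (simp add: fop_def vec_eq_iff)
    then show "fop (supp P) a L (c - d) = (\<Sum>j<1. fop {} a L (c - d))" for i :: nat using e by simp
  qed (use s t V in auto)
  then show ?thesis by simp
qed

end

lemma untwist_iff:
  assumes "pos n q"
  shows "w q = untwist n lam u q \<longleftrightarrow> u q = twist n lam q *s (w q :: complex ^ 'm::finite)"
proof -
  obtain t x z where q: "q = (t, x, z)" by (rule prod_cases3)
  have "tpow n t (\<lambda>i. - lam z i) * tpow n t (lam z) = 1"
    unfolding tpow_def prod.distrib[symmetric]
  proof (rule prod.neutral, rule ballI)
    fix i assume "i \<in> {..<n}"
    then have "t i \<noteq> 0" using assms by (auto simp: pos_def q)
    then show "complex_of_real (t i) powr - lam z i * complex_of_real (t i) powr lam z i = 1"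
      by (simp add: powr_minus)
  qed
  then have *: "twist n lam q * tpow n t (\<lambda>i. - lam z i) = 1" by (simp add: twist_def q mult.commute)
  have u: "untwist n lam u q = tpow n t (\<lambda>i. - lam z i) *s u q" by (simp add: untwist_def q)
  show ?thesis
    unfolding u using * by (auto simp: vector_smult_assoc mult.commute)
qed

lemma bij_betw_quotient:
  assumes "\<And>u. (u, u) \<in> R" "\<And>u u'. (u, u') \<in> R \<Longrightarrow> (u', u) \<in> R"
    "\<And>u u' u''. (u, u') \<in> R \<Longrightarrow> (u', u'') \<in> R \<Longrightarrow> (u, u'') \<in> R"
    and g: "\<And>u u'. (u, u') \<in> R \<Longrightarrow> g u = g u'"
    and inj: "\<And>u u'. u \<in> A \<Longrightarrow> u' \<in> A \<Longrightarrow> g u = g u' \<Longrightarrow> (u, u') \<in> R"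
    and B: "g ` A = B"
  shows "bij_betw (\<lambda>G. the_elem (g ` G)) (A // R) B"
proof -
  have val: "the_elem (g ` (R `` {u})) = g u" for u
  proof -
    have "g ` (R `` {u}) = {g u}" using assms(1) g by force
    then show ?thesis by simp
  qed
  have cls: "R `` {u} = R `` {u'}" if "(u, u') \<in> R" for u u'
    using that assms(2,3) by blast
  show ?thesis
    unfolding bij_betw_def
  proof
    show "inj_on (\<lambda>G. the_elem (g ` G)) (A // R)"
    proof (rule inj_onI)
      fix G H assume "G \<in> A // R" "H \<in> A // R" and eq: "the_elem (g ` G) = the_elem (g ` H)"
      then obtain u u' where u: "u \<in> A" "G = R `` {u}" "u' \<in> A" "H = R `` {u'}" by (auto simp: quotient_def)
      then show "G = H" using eq cls inj by (simp add: val)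
    qed
    show "(\<lambda>G. the_elem (g ` G)) ` (A // R) = B"
    proof (intro set_eqI iffI)
      fix y assume "y \<in> (\<lambda>G. the_elem (g ` G)) ` (A // R)"
      then show "y \<in> B" using B by (auto simp: quotient_def val)
    next
      fix y assume "y \<in> B"
      then obtain u where "u \<in> A" "y = g u" using B by blast
      then have "R `` {u} \<in> A // R" "y = the_elem (g ` (R `` {u}))" by (auto simp: val quotientI)
      then show "y \<in> (\<lambda>G. the_elem (g ` G)) ` (A // R)" by blast
    qed
  qed
qed

subsection \<open>The boundary value problem\<close>

locale boundary_problem = coords n n' l for n n' l +
  fixes M :: "((nat \<Rightarrow> real) \<times> (nat \<Rightarrow> real)) set" and U :: "(nat \<Rightarrow> complex) set"
    and lam :: "(nat \<Rightarrow> complex) \<Rightarrow> nat \<Rightarrow> complex"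
    and P :: "'m::finite oper" and p :: nat and Ps :: "nat \<Rightarrow> 'm oper"
    and L :: "pt \<Rightarrow> nat \<Rightarrow> mps" and a :: "pt \<Rightarrow> (nat \<Rightarrow> nat) \<Rightarrow> (nat \<Rightarrow> nat) \<Rightarrow> mps ^ 'm ^ 'm"
    and aa :: "pt \<Rightarrow> nat \<Rightarrow> (nat \<Rightarrow> nat) \<Rightarrow> (nat \<Rightarrow> nat) \<Rightarrow> mps ^ 'm ^ 'm"
  assumes M_open: "openin (prod_topology (Euclidean_space n) (Euclidean_space n')) M"
    and U_open: "openin (Complex_space l) U"
    and finite_supp_P: "finite (supp P)" and finite_supp_Ps: "\<And>i. i < p \<Longrightarrow> finite (supp (Ps i))"
    and P_boundary: "\<And>\<alpha> \<beta> x z. \<beta> \<noteq> (\<lambda>_. 0) \<Longrightarrow> x \<in> locus M \<Longrightarrow> z \<in> U \<Longrightarrow> P \<alpha> \<beta> (\<lambda>_. 0, x, z) = 0"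
    and data: "\<And>x z. x \<in> locus M \<Longrightarrow> z \<in> U \<Longrightarrow>
      local_data lam P p Ps (bpt x z) (L (bpt x z)) (a (bpt x z)) (aa (bpt x z))"
begin

lemma extends_iff:
  "extends_untwist n n' l M U lam u w \<longleftrightarrow>
    (\<forall>x\<in>locus M. \<forall>z\<in>U. (\<exists>c. expV c w (bpt x z)) \<and> twisted lam (bpt x z) u (w :: pt \<Rightarrow> complex ^ 'm))"
proof -
  have "(\<lambda>q. pos n q \<longrightarrow> w q = untwist n lam u q) = (\<lambda>q. pos n q \<longrightarrow> u q = twist n lam q *s w q)"
    using untwist_iff[of n _ w lam u] by blast
  then show ?thesis
    unfolding extends_untwist_def UAM_iff[OF M_open U_open] near_pos_iff[OF M_open U_open] twisted_def by auto
qed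

lemma boundary_value_eq:
  fixes w :: "pt \<Rightarrow> complex ^ 'm"
  assumes ext: "extends_untwist n n' l M U lam u w" and xz: "x \<in> locus M" "z \<in> U"
  shows "boundary_value n n' l M U lam u (x, z) = w (bpt x z)"
proof -
  define w' where "w' = (SOME w. extends_untwist n n' l M U lam u w)"
  have ext': "extends_untwist n n' l M U lam u w'" unfolding w'_def by (rule someI[of _ w]) (rule ext)
  obtain c where c: "expV c w (bpt x z)" and t: "twisted lam (bpt x z) u w"
    using ext xz unfolding extends_iff by blast
  obtain c' where c': "expV c' w' (bpt x z)" and t': "twisted lam (bpt x z) u w'"
    using ext' xz unfolding extends_iff by blast
  have "\<forall>\<^sub>F q in pf (bpt x z). pos n q \<longrightarrow> w q = w' q"
    using t t' unfolding twisted_def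
    by eventually_elim (metis twist_nonzero vector_mul_lcancel)
  then have "c = c'" by (rule expV_unique_pos[OF c c'])
  then have "w (bpt x z) $ k = w' (bpt x z) $ k" for k
    using c c' expands_at[of "c $ k" "\<lambda>q. w q $ k" "bpt x z"] expands_at[of "c $ k" "\<lambda>q. w' q $ k" "bpt x z"]
    unfolding expV_def by simp
  then have "w' (bpt x z) = w (bpt x z)" by (simp add: vec_eq_iff)
  then show ?thesis using xz by (simp add: boundary_value_def w'_def bpt_def)
qed

lemma solutions_iff:
  fixes w :: "pt \<Rightarrow> complex ^ 'm"
  assumes ext: "extends_untwist n n' l M U lam u w"
  shows "u \<in> solutions n n' l M U lam P p Ps \<longleftrightarrow>
    (\<forall>x\<in>locus M. \<forall>z\<in>U. \<forall>c. expV c w (bpt x z) \<longrightarrow> fop (supp P) (a (bpt x z)) (L (bpt x z)) c = 0 \<and>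
      (\<forall>i<p. fop (supp (Ps i)) (aa (bpt x z) i) (L (bpt x z)) c = 0))"
proof -
  have iff: "(\<forall>\<^sub>F q in pf (bpt x z). pos n q \<longrightarrow> op_apply n n' P u q = 0) \<longleftrightarrow> fop (supp P) (a (bpt x z)) (L (bpt x z)) c = 0"
    "\<And>i. i < p \<Longrightarrow> (\<forall>\<^sub>F q in pf (bpt x z). pos n q \<longrightarrow> op_apply n n' (Ps i) u q = 0) \<longleftrightarrow>
      fop (supp (Ps i)) (aa (bpt x z) i) (L (bpt x z)) c = 0"
    if xz: "x \<in> locus M" "z \<in> U" and c: "expV c w (bpt x z)" for x z c
  proof -
    have t: "twisted lam (bpt x z) u w" using ext xz unfolding extends_iff by blast
    note D = local_dataD[OF data[OF xz]]
    show "(\<forall>\<^sub>F q in pf (bpt x z). pos n q \<longrightarrow> op_apply n n' P u q = 0) \<longleftrightarrow> fop (supp P) (a (bpt x z)) (L (bpt x z)) c = 0"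
      by (rule op_zero_iff[OF c t D(2) D(3) finite_supp_P])
    show "(\<forall>\<^sub>F q in pf (bpt x z). pos n q \<longrightarrow> op_apply n n' (Ps i) u q = 0) \<longleftrightarrow>
      fop (supp (Ps i)) (aa (bpt x z) i) (L (bpt x z)) c = 0" if "i < p" for i
      by (rule op_zero_iff[OF c t D(2) D(4)[OF that] finite_supp_Ps[OF that]])
  qed
  have ex: "\<exists>c. expV c w (bpt x z)" if "x \<in> locus M" "z \<in> U" for x z
    using ext that unfolding extends_iff by blast
  show ?thesis
  proof
    assume "u \<in> solutions n n' l M U lam P p Ps"
    then have u: "\<forall>x\<in>locus M. \<forall>z\<in>U. \<forall>\<^sub>F q in pf (bpt x z). pos n q \<longrightarrow> op_apply n n' P u q = 0"
      "\<forall>i<p. \<forall>x\<in>locus M. \<forall>z\<in>U. \<forall>\<^sub>F q in pf (bpt x z). pos n q \<longrightarrow> op_apply n n' (Ps i) u q = 0"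
      unfolding solutions_def near_pos_iff[OF M_open U_open] by blast+
    show "\<forall>x\<in>locus M. \<forall>z\<in>U. \<forall>c. expV c w (bpt x z) \<longrightarrow> fop (supp P) (a (bpt x z)) (L (bpt x z)) c = 0 \<and>
      (\<forall>i<p. fop (supp (Ps i)) (aa (bpt x z) i) (L (bpt x z)) c = 0)"
    proof (intro ballI allI impI conjI)
      fix x z c assume xz: "x \<in> locus M" "z \<in> U" and c: "expV c w (bpt x z)"
      show "fop (supp P) (a (bpt x z)) (L (bpt x z)) c = 0"
        unfolding iff(1)[OF xz c, symmetric] by (rule u(1)[rule_format, OF xz])
      show "fop (supp (Ps i)) (aa (bpt x z) i) (L (bpt x z)) c = 0" if "i < p" for i
        unfolding iff(2)[OF xz c that, symmetric] by (rule u(2)[rule_format, OF that xz])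
    qed
  next
    assume f: "\<forall>x\<in>locus M. \<forall>z\<in>U. \<forall>c. expV c w (bpt x z) \<longrightarrow> fop (supp P) (a (bpt x z)) (L (bpt x z)) c = 0 \<and>
      (\<forall>i<p. fop (supp (Ps i)) (aa (bpt x z) i) (L (bpt x z)) c = 0)"
    have "\<forall>\<^sub>F q in pf (bpt x z). pos n q \<longrightarrow> op_apply n n' P u q = 0" if xz: "x \<in> locus M" "z \<in> U" for x z
    proof -
      obtain c where c: "expV c w (bpt x z)" using ex[OF xz] by (rule exE)
      show ?thesis unfolding iff(1)[OF xz c] by (rule f[rule_format, OF xz c, THEN conjunct1])
    qed
    moreover have "\<forall>\<^sub>F q in pf (bpt x z). pos n q \<longrightarrow> op_apply n n' (Ps i) u q = 0" if i: "i < p" and xz: "x \<in> locus M" "z \<in> U" for i x z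
    proof -
      obtain c where c: "expV c w (bpt x z)" using ex[OF xz] by (rule exE)
      show ?thesis unfolding iff(2)[OF xz c i] by (rule f[rule_format, OF xz c, THEN conjunct2, rule_format, OF i])
    qed
    ultimately show "u \<in> solutions n n' l M U lam P p Ps"
      unfolding solutions_def near_pos_iff[OF M_open U_open] mem_Collect_eq using ext by blast
  qed
qed

lemma sigma_op_eq:
  fixes w :: "pt \<Rightarrow> complex ^ 'm"
  assumes xz: "x \<in> locus M" "z \<in> U" and w: "\<And>x z. x \<in> locus M \<Longrightarrow> z \<in> U \<Longrightarrow> w (bpt x z) = v (x, z)"
  shows "op_tw n n' A lam w (bpt x z) = sigma_op n n' A lam v (x, z)"
    and "op_tw n n' P lam w (bpt x z) = sigma_mat n P x z (lam z) *v v (x, z)"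
proof -
  show 1: "op_tw n n' A lam w (bpt x z) = sigma_op n n' A lam v (x, z)" for A
    by (rule op_tw_bpt[where N = "locus M" and w = w and v = v, OF openin_locus[OF M_open] w[OF _ xz(2)] xz(1)])
  show "op_tw n n' P lam w (bpt x z) = sigma_mat n P x z (lam z) *v v (x, z)"
    unfolding 1 by (rule sigma_op_UD[OF finite_supp_P]) (rule P_boundary[OF _ xz])
qed

lemma expV_at: "expV c w b \<Longrightarrow> w b = (\<chi> k. cf (c $ k) 0)"
  using expands_at unfolding expV_def vec_eq_iff by fastforce

lemma boundary_value_in:
  assumes u: "u \<in> solutions n n' l M U lam P p Ps"
  shows "boundary_value n n' l M U lam u \<in> boundary_solutions n n' l M U lam P p Ps"
proof -
  obtain w where ext: "extends_untwist n n' l M U lam u w" using u unfolding solutions_def by blast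
  let ?v = "boundary_value n n' l M U lam u"
  have w: "w (bpt x z) = ?v (x, z)" if "x \<in> locus M" "z \<in> U" for x z
    using boundary_value_eq[OF ext that] by simp
  have "analytic_at_pt 0 n' l (\<lambda>(t, x, z). ?v (x, z) $ i) (\<lambda>_. 0, x, z) \<and>
      sigma_mat n P x z (lam z) *v ?v (x, z) = 0 \<and> (\<forall>i<p. sigma_op n n' (Ps i) lam ?v (x, z) = 0)"
    if xz: "x \<in> locus M" "z \<in> U" for x z i
  proof -
    note D = local_dataD[OF data[OF xz]]
    obtain c where c: "expV c w (bpt x z)" using ext xz unfolding extends_iff by blast
    have f: "fop (supp P) (a (bpt x z)) (L (bpt x z)) c = 0"
      "\<And>i. i < p \<Longrightarrow> fop (supp (Ps i)) (aa (bpt x z) i) (L (bpt x z)) c = 0"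
      using u c xz unfolding solutions_iff[OF ext] by blast+
    have 1: "analytic_at_pt 0 n' l (\<lambda>(t, x, z). ?v (x, z) $ i) (bpt x z)"
    proof (rule analytic_boundary_drop)
      show "expands (c $ i) (\<lambda>q. w q $ i) (bpt x z)" using c unfolding expV_def by blast
      show "\<forall>\<^sub>F q in pf (bpt x z). ?v (fst (snd q), snd (snd q)) $ i = w (bpt (fst (snd q)) (snd (snd q))) $ i"
        using eventually_base[OF M_open U_open xz] by (rule eventually_mono) (simp add: w)
    qed
    have "op_tw n n' P lam w (bpt x z) = 0"
      using expV_at[OF expV_op_tw[OF c D(2) D(3)]] unfolding f(1) by (simp add: vec_eq_iff)
    then have 2: "sigma_mat n P x z (lam z) *v ?v (x, z) = 0" using sigma_op_eq(2)[where w = w and v = ?v, OF xz w] by simp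
    have "sigma_op n n' (Ps i) lam ?v (x, z) = 0" if "i < p" for i
    proof -
      have "op_tw n n' (Ps i) lam w (bpt x z) = 0"
        using expV_at[OF expV_op_tw[OF c D(2) D(4)[OF that]]] unfolding f(2)[OF that] by (simp add: vec_eq_iff)
      then show ?thesis using sigma_op_eq(1)[where w = w and v = ?v, OF xz w] by simp
    qed
    with 1 2 show ?thesis by (simp add: bpt_def)
  qed
  then show ?thesis
    by (auto simp: boundary_solutions_def UAN_def boundary_value_def[of n n' l M U lam u])
qed

lemma solution_unique:
  assumes u: "u \<in> solutions n n' l M U lam P p Ps" and u': "u' \<in> solutions n n' l M U lam P p Ps"
    and eq: "boundary_value n n' l M U lam u = boundary_value n n' l M U lam u'"
  shows "(u, u') \<in> germ_rel n n' l M U"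
proof -
  obtain w where ext: "extends_untwist n n' l M U lam u w" using u unfolding solutions_def by blast
  obtain w' where ext': "extends_untwist n n' l M U lam u' w'" using u' unfolding solutions_def by blast
  have "\<forall>\<^sub>F q in pf (bpt x z). pos n q \<longrightarrow> u q = u' q" if xz: "x \<in> locus M" "z \<in> U" for x z
  proof -
    note D = local_dataD[OF data[OF xz]]
    obtain c where c: "expV c w (bpt x z)" and t: "twisted lam (bpt x z) u w"
      using ext xz unfolding extends_iff by blast
    obtain c' where c': "expV c' w' (bpt x z)" and t': "twisted lam (bpt x z) u' w'"
      using ext' xz unfolding extends_iff by blast
    have "fop (supp P) (a (bpt x z)) (L (bpt x z)) c = 0" using u c xz unfolding solutions_iff[OF ext] by blast
    with expV_op_tw[OF c D(2) D(3)] have "expV 0 (op_tw n n' P lam w) (bpt x z)" by simp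
    from expV_0_eventually[OF this] have P: "\<forall>\<^sub>F q in pf (bpt x z). pos n q \<longrightarrow> op_tw n n' P lam w q = 0"
      by (rule eventually_mono) blast
    have "fop (supp P) (a (bpt x z)) (L (bpt x z)) c' = 0" using u' c' xz unfolding solutions_iff[OF ext'] by blast
    with expV_op_tw[OF c' D(2) D(3)] have "expV 0 (op_tw n n' P lam w') (bpt x z)" by simp
    from expV_0_eventually[OF this] have P': "\<forall>\<^sub>F q in pf (bpt x z). pos n q \<longrightarrow> op_tw n n' P lam w' q = 0"
      by (rule eventually_mono) blast
    have "\<forall>\<^sub>F q in pf (bpt x z). w (bpt (fst (snd q)) (snd (snd q))) = w' (bpt (fst (snd q)) (snd (snd q)))"
      using eventually_base[OF M_open U_open xz]
    proof (rule eventually_mono)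
      fix q :: pt assume q: "fst (snd q) \<in> locus M \<and> snd (snd q) \<in> U"
      show "w (bpt (fst (snd q)) (snd (snd q))) = w' (bpt (fst (snd q)) (snd (snd q)))"
        using boundary_value_eq[OF ext] boundary_value_eq[OF ext'] q eq by simp
    qed
    then have "c = c'" by (rule local_unique[OF data[OF xz] c P c' P'])
    then have "\<forall>\<^sub>F q in pf (bpt x z). w q = w' q" using expV_eqD[OF c] c' by blast
    then show ?thesis using t t' unfolding twisted_def by eventually_elim simp
  qed
  then show ?thesis by (simp add: germ_rel_def near_pos_iff[OF M_open U_open])
qed

lemma formal_solution:
  assumes xz: "x \<in> locus M" "z \<in> U" and v: "v \<in> boundary_solutions n n' l M U lam P p Ps"
  shows "\<exists>c. (\<forall>k. Vsup (c $ k)) \<and> (\<forall>k. conv (c $ k)) \<and> fop (supp P) (a (bpt x z)) (L (bpt x z)) c = 0 \<and>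
    (\<forall>k. expands (t0 (c $ k)) (\<lambda>q. v (fst (snd q), snd (snd q)) $ k) (bpt x z))"
proof -
  let ?b = "bpt x z"
  let ?v = "\<lambda>q::pt. v (fst (snd q), snd (snd q))"
  note ld = data[OF xz] and D = local_dataD[OF data[OF xz]]
  have TS: "?b \<in> TS" by (rule bpt_in_TS[OF M_open U_open xz])
  have vA: "v \<in> UAN n' l (locus M) U" and vP: "\<And>x z. x \<in> locus M \<Longrightarrow> z \<in> U \<Longrightarrow> sigma_mat n P x z (lam z) *v v (x, z) = 0"
    using v unfolding boundary_solutions_def by blast+
  have "\<exists>c. expands c (\<lambda>q. ?v q $ k) ?b \<and> t0 c = c" for k
  proof (rule analytic_boundary_lift[OF _ TS])
    show "analytic_at_pt 0 n' l (\<lambda>(t, x, z). v (x, z) $ k) ?b"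
      using vA xz unfolding UAN_def bpt_def by blast
  qed
  then have "\<forall>k. \<exists>c. expands c (\<lambda>q. ?v q $ k) ?b \<and> t0 c = c" by blast
  then obtain h where h: "\<forall>k. expands (h k) (\<lambda>q. ?v q $ k) ?b \<and> t0 (h k) = h k" by (rule choice[THEN exE])
  define vh where "vh = (\<chi> k. h k)"
  have vh: "expV vh ?v ?b" and t0v: "\<And>k. t0 (vh $ k) = vh $ k" using h by (auto simp: expV_def vh_def)
  have e: "expV (fop (supp P) (a ?b) (L ?b) vh) (op_tw n n' P lam ?v) ?b" by (rule expV_op_tw[OF vh D(2) D(3)])
  have z: "t0 (fop (supp P) (a ?b) (L ?b) vh $ k) = 0" for k
  proof (rule expands_zero)
    show "expands (t0 (fop (supp P) (a ?b) (L ?b) vh $ k)) (\<lambda>q. op_tw n n' P lam ?v (bpt (fst (snd q)) (snd (snd q))) $ k) ?b"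
      by (rule expands_proj[where f = "\<lambda>q. op_tw n n' P lam ?v q $ k"]) (use e in \<open>unfold expV_def, blast\<close>)
    show "\<forall>\<^sub>F q in pf ?b. op_tw n n' P lam ?v (bpt (fst (snd q)) (snd (snd q))) $ k = 0"
      using eventually_base[OF M_open U_open xz]
    proof (rule eventually_mono)
      fix q :: pt assume q: "fst (snd q) \<in> locus M \<and> snd (snd q) \<in> U"
      have "op_tw n n' P lam ?v (bpt (fst (snd q)) (snd (snd q))) = 0"
        using sigma_op_eq(2)[of "fst (snd q)" "snd (snd q)" ?v v] q vP[of "fst (snd q)" "snd (snd q)"] by (simp add: bpt_def)
      then show "op_tw n n' P lam ?v (bpt (fst (snd q)) (snd (snd q))) $ k = 0" by simp
    qed
  qed
  obtain s where s: "0 < s" "UD_data s (supp P) (a ?b)" using ld unfolding local_data_def by (elim conjE exE) blast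
  obtain c r where c: "0 < c" and cr: "\<forall>\<kappa> y. keys \<kappa> \<subseteq> V \<longrightarrow> tdeg \<kappa> \<noteq> 0 \<longrightarrow>
         c * (1 + real (tdeg \<kappa>)) ^ r * norm y \<le> norm (lead (supp P) (a ?b) (L ?b) (\<lambda>k. lookup \<kappa> (Tv k)) *v y)"
    and r: "\<forall>\<alpha> \<beta> i j. (\<alpha>, \<beta>) \<in> supp P \<longrightarrow> a ?b \<alpha> \<beta> $ i $ j \<noteq> 0 \<longrightarrow> (\<Sum>i<n. \<alpha> i) + bsum \<beta> \<le> r"
    using ld unfolding local_data_def by (elim conjE exE)
  have exa: "expands (a ?b \<alpha> \<beta> $ i $ j) (\<lambda>q. P \<alpha> \<beta> q $ i $ j) ?b" for \<alpha> \<beta> i j using D(3) unfolding expO_def by blast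
  have exL: "expands (L ?b i) (\<lambda>q. lam (snd (snd q)) i) ?b" if "i < n" for i using D(2) that unfolding expL_def by blast
  have exv: "expands (vh $ k) (\<lambda>q. ?v q $ k) ?b" for k using vh unfolding expV_def by blast
  have "\<exists>w. fop (supp P) (a ?b) (L ?b) w = 0 \<and> (\<forall>i. t0 (w $ i) = vh $ i) \<and> (\<forall>i. Vsup (w $ i)) \<and> (\<forall>i. conv (w $ i))"
  proof (rule formal_existence[of s "supp P" "a ?b" "L ?b" vh r c])
    show "tdeg \<kappa> = 0" if "cf (L ?b i) \<kappa> \<noteq> 0" for i \<kappa>
    proof -
      have "keys \<kappa> \<subseteq> range Zv" using D(1)[of i] that unfolding Zonly_def by blast
      then have "Tv j \<notin> keys \<kappa>" for j by auto
      then show ?thesis by (simp add: tdeg_eq_0_iff in_keys_iff)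
    qed
    show "c * (1 + real (tdeg \<kappa>)) ^ r * norm y \<le> norm (lead (supp P) (a ?b) (L ?b) (\<lambda>k. lookup \<kappa> (Tv k)) *v y)"
      if "keys \<kappa> \<subseteq> V" "tdeg \<kappa> \<noteq> 0" for \<kappa> y by (rule cr[rule_format, OF that])
    show "(\<Sum>i<n. \<alpha> i) + bsum \<beta> \<le> r" if "(\<alpha>, \<beta>) \<in> supp P" "a ?b \<alpha> \<beta> $ i $ j \<noteq> 0" for \<alpha> \<beta> i j
      by (rule r[rule_format, OF that])
  qed (use s c z t0v exa[THEN expands_conv] exL[THEN expands_conv] exv[THEN expands_conv]
      exa[THEN expands_Vsup] exL[THEN expands_Vsup] exv[THEN expands_Vsup] in blast)+
  then obtain w where w: "fop (supp P) (a ?b) (L ?b) w = 0" "\<forall>i. t0 (w $ i) = vh $ i" "\<forall>i. Vsup (w $ i)" "\<forall>i. conv (w $ i)"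
    by (elim exE conjE)
  then show ?thesis using exv by (intro exI[of _ w]) simp
qed

lemma solution_exists:
  assumes v: "v \<in> boundary_solutions n n' l M U lam P p Ps"
  shows "\<exists>u\<in>solutions n n' l M U lam P p Ps. boundary_value n n' l M U lam u = v"
proof -
  define vv where "vv q = v (fst (snd q), snd (snd q))" for q :: pt
  define Q where "Q x z c \<longleftrightarrow> (\<forall>k. Vsup (c $ k)) \<and> (\<forall>k. conv (c $ k)) \<and> fop (supp P) (a (bpt x z)) (L (bpt x z)) c = 0 \<and>
    (\<forall>k. expands (t0 (c $ k)) (\<lambda>q. vv q $ k) (bpt x z))" for x z and c :: "mps ^ 'm"
  define W where "W x z = (SOME c. Q x z c)" for x z
  have Q: "Q x z (W x z)" if "x \<in> locus M" "z \<in> U" for x z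
    unfolding W_def by (rule someI_ex) (use formal_solution[OF that v] in \<open>unfold Q_def vv_def\<close>)
  define F where "F x z q = (\<chi> k. psum (W x z $ k) (bpt x z) q)" for x z q
  have TS: "bpt x z \<in> TS" if "x \<in> locus M" "z \<in> U" for x z by (rule bpt_in_TS[OF M_open U_open that])
  have FE: "expV (W x z) (F x z) (bpt x z)" if xz: "x \<in> locus M" "z \<in> U" for x z
  proof -
    have "expands (W x z $ k) (psum (W x z $ k) (bpt x z)) (bpt x z)" for k
      using Q[OF xz] conv_expands[OF _ TS[OF xz]] unfolding Q_def by blast
    then show ?thesis by (simp add: expV_def F_def)
  qed
  have Fop: "\<forall>\<^sub>F q in pf (bpt x z). op_tw n n' P lam (F x z) q = 0" if xz: "x \<in> locus M" "z \<in> U" for x z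
  proof -
    note D = local_dataD[OF data[OF xz]]
    have "fop (supp P) (a (bpt x z)) (L (bpt x z)) (W x z) = 0" using Q[OF xz] unfolding Q_def by blast
    with expV_op_tw[OF FE[OF xz] D(2) D(3)] have "expV 0 (op_tw n n' P lam (F x z)) (bpt x z)" by simp
    then show ?thesis by (rule expV_0_eventually)
  qed
  have Fv: "\<forall>\<^sub>F q in pf (bpt x z). F x z (bpt (fst (snd q)) (snd (snd q))) = vv (bpt (fst (snd q)) (snd (snd q)))"
    if xz: "x \<in> locus M" "z \<in> U" for x z
  proof -
    have "\<forall>\<^sub>F q in pf (bpt x z). F x z (bpt (fst (snd q)) (snd (snd q))) $ k = vv q $ k" for k
    proof (rule expands_eqD)
      show "expands (t0 (W x z $ k)) (\<lambda>q. F x z (bpt (fst (snd q)) (snd (snd q))) $ k) (bpt x z)"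
        by (rule expands_proj[where f = "\<lambda>q. F x z q $ k"]) (use FE[OF xz] in \<open>unfold expV_def, blast\<close>)
      show "expands (t0 (W x z $ k)) (\<lambda>q. vv q $ k) (bpt x z)" using Q[OF xz] unfolding Q_def by blast
    qed
    then have "\<forall>\<^sub>F q in pf (bpt x z). \<forall>k. F x z (bpt (fst (snd q)) (snd (snd q))) $ k = vv q $ k"
      by (rule eventually_all_finite)
    then show ?thesis by (rule eventually_mono) (simp add: vec_eq_iff vv_def bpt_def)
  qed
  define w where "w q = F (fst (snd q)) (snd (snd q)) q" for q
  have wF: "\<forall>\<^sub>F q in pf (bpt x z). F x z q = w q" if xz: "x \<in> locus M" "z \<in> U" for x z
  proof -
    let ?b = "bpt x z"
    let ?E = "\<lambda>q. (\<forall>k. hs (W x z $ k) (emb_diff ?b q) (F x z q $ k)) \<and> (fst (snd q) \<in> locus M \<and> snd (snd q) \<in> U) \<and>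
        (\<forall>\<^sub>F q in pf q. op_tw n n' P lam (F x z) q = 0) \<and>
        (\<forall>\<^sub>F q in pf q. F x z (bpt (fst (snd q)) (snd (snd q))) = vv (bpt (fst (snd q)) (snd (snd q))))"
    have "\<forall>\<^sub>F q in pf ?b. hs (W x z $ k) (emb_diff ?b q) (F x z q $ k)" for k
      by (rule expandsD) (use FE[OF xz] in \<open>unfold expV_def, blast\<close>)
    then have "\<forall>\<^sub>F q in pf ?b. ?E q"
      by (intro eventually_conj eventually_all_finite eventually_base[OF M_open U_open xz]
          eventually_pf_pf[OF Fop[OF xz]] eventually_pf_pf[OF Fv[OF xz]])
    then obtain r where r: "0 < r" and E: "\<forall>q\<in>pd ?b r. ?E q" unfolding eventually_pf by blast
    have "F x z q = w q" if q: "q \<in> pd ?b (r / 2)" for q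
    proof -
      obtain t' x' z' where q': "q = (t', x', z')" by (rule prod_cases3)
      let ?c = "bpt x' z'"
      have c2: "?c \<in> pd ?b (r / 2)" using bpt_near q unfolding q' by blast
      then have c: "?c \<in> pd ?b r" by (rule subsetD[OF pd_mono, rotated]) (use r in simp)
      note Ec = E[rule_format, OF c]
      have xz': "x' \<in> locus M" "z' \<in> U" using Ec by (simp_all add: bpt_def)
      have d: "cmod (emb_diff ?b ?c v) \<le> r / 2" if "v \<in> V" for v
        using c2 that unfolding pd_def by (blast intro: less_imp_le)
      have qc: "q \<in> pd ?c (r - r / 2)"
        unfolding pd_def mem_Collect_eq
      proof (intro conjI ballI)
        show "q \<in> TS" using q unfolding pd_def by blast
        fix u assume u: "u \<in> V"
        then have *: "cmod (emb_diff ?b q u) < r / 2" using q unfolding pd_def by blast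
        show "cmod (emb_diff ?c q u) < r - r / 2"
          using * r by (cases u) (simp_all add: q' emb_diff_def bpt_def)
      qed
      have Vs: "Vsup (W x z $ k)" for k using Q[OF xz] unfolding Q_def by blast
      have hsk: "hs (W x z $ k) (emb_diff ?b q) (F x z q $ k)" if "q \<in> pd ?b r" for k q using E that by blast
      define d where "d = (\<chi> k. recenter (emb_diff ?b ?c) (W x z $ k))"
      have dE: "expV d (F x z) ?c"
        unfolding expV_def d_def vec_lambda_beta
        by (intro allI expands_recenter[OF Vs TS[OF xz] r hsk c])
      have "W x' z' = d"
      proof (rule local_unique[OF data[OF xz'] FE[OF xz'] _ dE])
        show "\<forall>\<^sub>F q in pf ?c. pos n q \<longrightarrow> op_tw n n' P lam (F x' z') q = 0"
          using Fop[OF xz'] by (rule eventually_mono) blast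
        show "\<forall>\<^sub>F q in pf ?c. pos n q \<longrightarrow> op_tw n n' P lam (F x z) q = 0"
          using Ec[THEN conjunct2, THEN conjunct2, THEN conjunct1] by (rule eventually_mono) blast
        show "\<forall>\<^sub>F q in pf ?c. F x' z' (bpt (fst (snd q)) (snd (snd q))) = F x z (bpt (fst (snd q)) (snd (snd q)))"
          using Fv[OF xz'] Ec[THEN conjunct2, THEN conjunct2, THEN conjunct2] by eventually_elim simp
      qed
      then have "hs (W x' z' $ k) (emb_diff ?c q) (F x z q $ k)" for k
        using hs_recenter_pd(1)[OF Vs TS[OF xz] r hsk c d qc] by (simp add: d_def)
      then have "F x' z' q $ k = F x z q $ k" for k using psum_eq by (simp add: F_def)
      then show ?thesis by (simp add: vec_eq_iff w_def q')
    qed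
    then show ?thesis unfolding eventually_pf using r by (intro exI[of _ "r / 2"]) simp
  qed
  have wE: "expV (W x z) w (bpt x z)" if "x \<in> locus M" "z \<in> U" for x z
    by (rule expV_cong[OF FE[OF that] wF[OF that]])
  have wv: "w (bpt x z) = v (x, z)" if xz: "x \<in> locus M" "z \<in> U" for x z
  proof -
    have "expands (t0 (W x z $ k)) (\<lambda>q. vv q $ k) (bpt x z)" for k using Q[OF xz] unfolding Q_def by blast
    from expands_at[OF this] have "vv (bpt x z) $ k = cf (W x z $ k) 0" for k by (simp add: cf_t0)
    then show ?thesis using expV_at[OF wE[OF xz]] by (simp add: vec_eq_iff vv_def bpt_def)
  qed
  define u where "u q = twist n lam q *s w q" for q
  have ext: "extends_untwist n n' l M U lam u w"
    unfolding extends_iff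
  proof (intro ballI conjI)
    fix x z assume xz: "x \<in> locus M" "z \<in> U"
    show "\<exists>c. expV c w (bpt x z)" using wE[OF xz] by (rule exI)
    show "twisted lam (bpt x z) u w" by (simp add: twisted_def u_def)
  qed
  have sol: "u \<in> solutions n n' l M U lam P p Ps"
    unfolding solutions_iff[OF ext]
  proof (intro ballI allI impI)
    fix x z c assume xz: "x \<in> locus M" "z \<in> U" and c: "expV c w (bpt x z)"
    let ?b = "bpt x z"
    note ld = data[OF xz] and D = local_dataD[OF data[OF xz]]
    have cW: "c = W x z" by (rule expV_unique_pos[OF c wE[OF xz]]) simp
    have fP: "fop (supp P) (a ?b) (L ?b) c = 0" using Q[OF xz] unfolding Q_def cW by blast
    define g where "g i = fop (supp (Ps i)) (aa ?b i) (L ?b) c" for i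
    have ge: "expV (g i) (op_tw n n' (Ps i) lam w) ?b" if "i < p" for i
      unfolding g_def by (rule expV_op_tw[OF c D(2) D(4)[OF that]])
    have g0: "t0 (g i $ k) = 0" if i: "i < p" for i k
    proof (rule expands_zero)
      show "expands (t0 (g i $ k)) (\<lambda>q. op_tw n n' (Ps i) lam w (bpt (fst (snd q)) (snd (snd q))) $ k) ?b"
        by (rule expands_proj[where f = "\<lambda>q. op_tw n n' (Ps i) lam w q $ k"]) (use ge[OF i] in \<open>unfold expV_def, blast\<close>)
      show "\<forall>\<^sub>F q in pf ?b. op_tw n n' (Ps i) lam w (bpt (fst (snd q)) (snd (snd q))) $ k = 0"
        using eventually_base[OF M_open U_open xz]
      proof (rule eventually_mono)
        fix q :: pt assume q: "fst (snd q) \<in> locus M \<and> snd (snd q) \<in> U"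
        have "op_tw n n' (Ps i) lam w (bpt (fst (snd q)) (snd (snd q))) = sigma_op n n' (Ps i) lam v (fst (snd q), snd (snd q))"
          using q by (intro sigma_op_eq(1) wv) blast+
        also have "\<dots> = 0" using v q i unfolding boundary_solutions_def by blast
        finally show "op_tw n n' (Ps i) lam w (bpt (fst (snd q)) (snd (snd q))) $ k = 0" by simp
      qed
    qed
    have gV: "Vsup (g i $ k)" if "i < p" for i k using ge[OF that] expands_Vsup unfolding expV_def by blast
    have cV: "\<forall>k. Vsup (c $ k)" using c expands_Vsup unfolding expV_def by blast
    obtain s S' a' where s: "0 < s" "UD_data s (supp P) (a ?b)"
      and S': "\<forall>i<p. \<forall>j<p. UD_data s (S' i j) (a' i j) \<and> (\<forall>\<gamma>. lead (S' i j) (a' i j) (L ?b) \<gamma> = 0)"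
      and eq: "\<forall>i<p. \<forall>w. (\<forall>k. Vsup (w $ k)) \<longrightarrow> fop (supp P) (a ?b) (L ?b) w = 0 \<longrightarrow>
         fop (supp P) (a ?b) (L ?b) (fop (supp (Ps i)) (aa ?b i) (L ?b) w) =
         (\<Sum>j<p. fop (S' i j) (a' i j) (L ?b) (fop (supp (Ps j)) (aa ?b j) (L ?b) w))"
      using ld unfolding local_data_def by (elim conjE exE)
    have "g i = 0" if "i < p" for i
    proof (rule formal_uniqueness[of s "supp P" "a ?b" p S' a' "L ?b" g i])
      show "y = 0" if "keys \<kappa> \<subseteq> V" "tdeg \<kappa> \<noteq> 0" "lead (supp P) (a ?b) (L ?b) (\<lambda>k. lookup \<kappa> (Tv k)) *v y = 0" for \<kappa> y
        by (rule local_data_lead[OF ld that])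
      show "fop (supp P) (a ?b) (L ?b) (g i) = (\<Sum>j<p. fop (S' i j) (a' i j) (L ?b) (g j))" if "i < p" for i
        unfolding g_def by (rule eq[rule_format, OF that cV[rule_format] fP])
      show "UD_data s (S' i j) (a' i j)" if "i < p" "j < p" for i j using S' that by blast
      show "lead (S' i j) (a' i j) (L ?b) \<gamma> = 0" if "i < p" "j < p" for i j \<gamma> using S' that by blast
    qed (rule s g0 gV that, assumption?)+
    then show "fop (supp P) (a ?b) (L ?b) c = 0 \<and> (\<forall>i<p. fop (supp (Ps i)) (aa ?b i) (L ?b) c = 0)"
      using fP unfolding g_def by blast
  qed
  have "boundary_value n n' l M U lam u = v"
  proof (rule extensionalityI[where A = "locus M \<times> U"])
    show "boundary_value n n' l M U lam u \<in> extensional (locus M \<times> U)" by (simp add: boundary_value_def)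
    show "v \<in> extensional (locus M \<times> U)" using v unfolding boundary_solutions_def UAN_def by blast
    fix y assume "y \<in> locus M \<times> U"
    then show "boundary_value n n' l M U lam u y = v y"
      by (cases y) (simp add: boundary_value_eq[OF ext] wv)
  qed
  with sol show ?thesis by blast
qed

theorem boundary_value_bij:
  "bij_betw (\<lambda>G. the_elem (boundary_value n n' l M U lam ` G))
    (solutions n n' l M U lam P p Ps // germ_rel n n' l M U) (boundary_solutions n n' l M U lam P p Ps)"
proof (rule bij_betw_quotient)
  note N = near_pos_iff[OF M_open U_open]
  show "(u, u) \<in> germ_rel n n' l M U" for u :: "pt \<Rightarrow> complex ^ 'm" by (simp add: germ_rel_def N)
  show sym: "(u', u) \<in> germ_rel n n' l M U" if "(u, u') \<in> germ_rel n n' l M U" for u u' :: "pt \<Rightarrow> complex ^ 'm"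
    using that by (simp add: germ_rel_def eq_commute)
  show tr: "(u, u'') \<in> germ_rel n n' l M U" if "(u, u') \<in> germ_rel n n' l M U" "(u', u'') \<in> germ_rel n n' l M U"
    for u u' u'' :: "pt \<Rightarrow> complex ^ 'm"
    unfolding germ_rel_def mem_Collect_eq prod.case N
  proof (intro ballI)
    fix x z assume "x \<in> locus M" "z \<in> U"
    then have "\<forall>\<^sub>F q in pf (bpt x z). pos n q \<longrightarrow> u q = u' q" "\<forall>\<^sub>F q in pf (bpt x z). pos n q \<longrightarrow> u' q = u'' q"
      using that unfolding germ_rel_def mem_Collect_eq prod.case N by blast+
    then show "\<forall>\<^sub>F q in pf (bpt x z). pos n q \<longrightarrow> u q = u'' q" by eventually_elim simp
  qed
  have le: "extends_untwist n n' l M U lam u' w" if "(u, u') \<in> germ_rel n n' l M U" "extends_untwist n n' l M U lam u w"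
    for u u' w :: "pt \<Rightarrow> complex ^ 'm"
    unfolding extends_iff
  proof (intro ballI conjI)
    fix x z assume xz: "x \<in> locus M" "z \<in> U"
    show "\<exists>c. expV c w (bpt x z)" using that(2) xz unfolding extends_iff by blast
    have "twisted lam (bpt x z) u w" using that(2) xz unfolding extends_iff by blast
    moreover have "\<forall>\<^sub>F q in pf (bpt x z). pos n q \<longrightarrow> u q = u' q"
      using that(1) xz unfolding germ_rel_def mem_Collect_eq prod.case N by blast
    ultimately show "twisted lam (bpt x z) u' w" unfolding twisted_def by eventually_elim simp
  qed
  show "boundary_value n n' l M U lam u = boundary_value n n' l M U lam u'" if "(u, u') \<in> germ_rel n n' l M U"
    for u u' :: "pt \<Rightarrow> complex ^ 'm"
  proof -
    have "extends_untwist n n' l M U lam u = extends_untwist n n' l M U lam u'"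
      using le[OF that] le[OF sym[OF that]] by blast
    then show ?thesis by (simp add: boundary_value_def)
  qed
  show "(u, u') \<in> germ_rel n n' l M U" if "u \<in> solutions n n' l M U lam P p Ps" "u' \<in> solutions n n' l M U lam P p Ps"
    "boundary_value n n' l M U lam u = boundary_value n n' l M U lam u'" for u u'
    by (rule solution_unique[OF that])
  show "boundary_value n n' l M U lam ` solutions n n' l M U lam P p Ps = boundary_solutions n n' l M U lam P p Ps"
    using boundary_value_in solution_exists by blast
qed

end

subsection \<open>The formal problem attached to a system\<close>

context coords
begin

lemma expO_exists:
  assumes open_sets: "openin (prod_topology (Euclidean_space n) (Euclidean_space n')) M" "openin (Complex_space l) U"
    and xz: "x \<in> locus M" "z \<in> U" and A: "A \<in> UDtilde n n' l M U"
  shows "\<exists>a. expO a A (bpt x z)"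
proof -
  have TS: "bpt x z \<in> TS" by (rule bpt_in_TS[OF open_sets xz])
  have ex: "\<exists>c. expands c (\<lambda>q. A \<alpha> \<beta> q $ i $ j) (bpt x z)" for \<alpha> \<beta> i j
  proof -
    have "\<forall>\<^sub>F p in pf (bpt x z). \<forall>i j. analytic_at_pt n n' l (\<lambda>q. A \<alpha> \<beta> q $ i $ j) p"
      using A xz unfolding UDtilde_def near_iff[OF open_sets] by blast
    from eventually_pf_self[OF this TS] show ?thesis unfolding analytic_iff_expands[OF TS] by blast
  qed
  have "expO (\<lambda>\<alpha> \<beta>. \<chi> i j. SOME c. expands c (\<lambda>q. A \<alpha> \<beta> q $ i $ j) (bpt x z)) A (bpt x z)"
    unfolding expO_def vec_lambda_beta by (intro allI) (rule someI_ex[OF ex])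
  then show ?thesis by (rule exI[of "\<lambda>a. expO a A (bpt x z)"])
qed

lemma UD_t0:
  assumes open_sets: "openin (prod_topology (Euclidean_space n) (Euclidean_space n')) M" "openin (Complex_space l) U"
    and xz: "x \<in> locus M" "z \<in> U" and A: "A \<in> UD n n' l M U" and a: "expO a A (bpt x z)" and \<beta>: "\<beta> \<noteq> (\<lambda>_. 0)"
  shows "t0 (a \<alpha> \<beta> $ i $ j) = 0"
proof (rule expands_zero)
  show "expands (t0 (a \<alpha> \<beta> $ i $ j)) (\<lambda>q. A \<alpha> \<beta> (bpt (fst (snd q)) (snd (snd q))) $ i $ j) (bpt x z)"
    by (rule expands_proj[where f = "\<lambda>q. A \<alpha> \<beta> q $ i $ j"]) (use a in \<open>unfold expO_def, blast\<close>)
  show "\<forall>\<^sub>F q in pf (bpt x z). A \<alpha> \<beta> (bpt (fst (snd q)) (snd (snd q))) $ i $ j = 0"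
    using eventually_base[OF open_sets xz]
  proof (rule eventually_mono)
    fix q :: pt assume "fst (snd q) \<in> locus M \<and> snd (snd q) \<in> U"
    then have "A \<alpha> \<beta> (bpt (fst (snd q)) (snd (snd q))) = 0"
      using A \<beta> unfolding UD_def bpt_def by blast
    then show "A \<alpha> \<beta> (bpt (fst (snd q)) (snd (snd q))) $ i $ j = 0" by simp
  qed
qed

lemma UD_data_supp:
  assumes "openin (prod_topology (Euclidean_space n) (Euclidean_space n')) M" "openin (Complex_space l) U"
    "x \<in> locus M" "z \<in> U" "A \<in> UD n n' l M U" "expO a A (bpt x z)"
    and "(\<Sum>(\<alpha>, \<beta>)\<in>supp A. bsum \<beta>) < s"
  shows "UD_data s (supp A) a"
proof -
  have fin: "finite (supp A)" using assms(5) unfolding UD_def UDtilde_def by blast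
  have "bsum \<beta> < s" if "(\<alpha>, \<beta>) \<in> supp A" for \<alpha> \<beta>
    using member_le_sum[OF that _ fin, of "\<lambda>(\<alpha>, \<beta>). bsum \<beta>"] assms(7) by auto
  moreover have "t0 (a \<alpha> \<beta> $ i $ j) = 0" if "\<beta> \<noteq> (\<lambda>_. 0)" for \<alpha> \<beta> i j
    by (rule UD_t0[OF assms(1-6) that])
  ultimately show ?thesis unfolding UD_data_def using fin by blast
qed

lemma lead_eq_sigma_mat:
  assumes a: "expO a A (bpt x z)" and L: "expL L lam (bpt x z)"
  shows "lead (supp A) a L \<gamma> = sigma_mat n A x z (\<lambda>k. lam z k + of_nat (\<gamma> k))"
proof -
  have "cf (a \<alpha> \<beta> $ i $ j) 0 = A \<alpha> \<beta> (\<lambda>_. 0, x, z) $ i $ j" for \<alpha> \<beta> i j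
  proof -
    have "expands (a \<alpha> \<beta> $ i $ j) (\<lambda>q. A \<alpha> \<beta> q $ i $ j) (bpt x z)" using a unfolding expO_def by blast
    from expands_at[OF this] show ?thesis by (simp add: bpt_def)
  qed
  moreover have "cf (L k) 0 = lam z k" if "k < n" for k
  proof -
    have "expands (L k) (\<lambda>q. lam (snd (snd q)) k) (bpt x z)" using L that unfolding expL_def by blast
    from expands_at[OF this] show ?thesis by (simp add: bpt_def)
  qed
  ultimately show ?thesis by (simp add: lead_def sigma_mat_def mpow_def)
qed

lemma expL_exists:
  assumes lam: "\<And>i. i < n \<Longrightarrow> (\<lambda>z. lam z i) \<in> hol l U" and z: "z \<in> U" and TS: "bpt x z \<in> TS"
  shows "\<exists>L. (\<forall>i. Zonly (L i)) \<and> expL L lam (bpt x z)"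
proof -
  have TS': "(\<lambda>_. 0, \<lambda>_. 0, z) \<in> coords.TS 0 0 l" using TS by (simp add: bpt_def coords.TS_iff)
  have "\<exists>c. Zonly c \<and> (i < n \<longrightarrow> expands c (\<lambda>q. lam (snd (snd q)) i) (bpt x z))" for i
  proof (cases "i < n")
    case True
    have "analytic_at_pt 0 0 l (\<lambda>(t, x, z). lam z i) (\<lambda>_. 0, \<lambda>_. 0, z)"
      using lam[OF True] z unfolding hol_def by blast
    then obtain c where c: "coords.expands 0 0 l c (\<lambda>(t, x, z). lam z i) (\<lambda>_. 0, \<lambda>_. 0, z)"
      unfolding coords.analytic_iff_expands[OF TS'] by blast
    have "(\<lambda>(t :: nat \<Rightarrow> real, x :: nat \<Rightarrow> real, z). lam z i) = (\<lambda>q. lam (snd (snd q)) i)"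
      by (simp add: case_prod_unfold)
    with c have c': "coords.expands 0 0 l c (\<lambda>q. lam (snd (snd q)) i) (\<lambda>_. 0, \<lambda>_. 0, z)" by (simp only:)
    have "expands c (\<lambda>q. lam (snd (snd (\<lambda>_::nat. 0::real, \<lambda>_::nat. 0::real, snd (snd q)))) i) (bpt x z)"
    proof (rule expands_lift[where f = "\<lambda>q. lam (snd (snd q)) i" and \<pi> = "\<lambda>q. (\<lambda>_. 0, \<lambda>_. 0, snd (snd q))", OF c' TS])
      show "coords.V 0 0 l \<subseteq> V" unfolding coords.V_def by auto
      fix q :: pt assume q: "q \<in> TS"
      obtain t' x' z' where q': "q = (t', x', z')" by (rule prod_cases3)
      show "(\<lambda>_. 0, \<lambda>_. 0, snd (snd q)) \<in> coords.TS 0 0 l"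
        using q unfolding q' by (simp add: coords.TS_iff)
      fix v assume "v \<in> coords.V 0 0 l"
      then show "emb_diff (\<lambda>_. 0, \<lambda>_. 0, z) (\<lambda>_. 0, \<lambda>_. 0, snd (snd q)) v = emb_diff (bpt x z) q v"
        unfolding q' by (cases v) (auto simp: coords.V_def emb_diff_def bpt_def)
    qed
    then have "expands c (\<lambda>q. lam (snd (snd q)) i) (bpt x z)" by simp
    moreover have "Zonly c"
    proof -
      have "coords.V 0 0 l \<subseteq> range Zv" by (auto simp: coords.V_def)
      then show ?thesis using coords.expands_Vsup[OF c] unfolding Zonly_def coords.Vsup_def by blast
    qed
    ultimately show ?thesis by blast
  next
    case False
    then show ?thesis by (intro exI[of _ 0]) (simp add: Zonly_def)
  qed
  then have "\<forall>i. \<exists>c. Zonly c \<and> (i < n \<longrightarrow> expands c (\<lambda>q. lam (snd (snd q)) i) (bpt x z))" by blast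
  then obtain L where "\<forall>i. Zonly (L i) \<and> (i < n \<longrightarrow> expands (L i) (\<lambda>q. lam (snd (snd q)) i) (bpt x z))"
    by (rule choice[THEN exE])
  then show ?thesis unfolding expL_def by blast
qed

lemma tdeg_eq_order:
  assumes "keys \<kappa> \<subseteq> V"
  shows "tdeg \<kappa> = (\<Sum>i<n. lookup \<kappa> (Tv i))"
proof -
  have "tdeg \<kappa> = (\<Sum>v\<in>V. tweight v * lookup \<kappa> v)" by (rule wdeg_superset[OF finite_V assms])
  also have "\<dots> = (\<Sum>v\<in>Tv ` {..<n}. tweight v * lookup \<kappa> v)"
    by (rule sum.mono_neutral_right) (auto simp: V_def)
  also have "\<dots> = (\<Sum>i<n. lookup \<kappa> (Tv i))" by (subst sum.reindex) (auto intro: inj_onI)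
  finally show ?thesis .
qed

lemma order_bound:
  assumes open_sets: "openin (prod_topology (Euclidean_space n) (Euclidean_space n')) M" "openin (Complex_space l) U"
    and fin: "finite (supp A)" and ord: "ord_op n n' l M U A < (\<Sum>i<n. \<alpha> i) + bsum \<beta>"
  shows "near n n' l M U (\<lambda>p. A \<alpha> \<beta> p = 0)"
proof (rule ccontr)
  let ?X = "{(\<Sum>i<n. \<alpha> i) + (\<Sum>j<n'. \<beta> j) | \<alpha> \<beta>. \<not> near n n' l M U (\<lambda>p. A \<alpha> \<beta> p = 0)}"
  assume "\<not> near n n' l M U (\<lambda>p. A \<alpha> \<beta> p = 0)"
  then have mem: "(\<Sum>i<n. \<alpha> i) + bsum \<beta> \<in> ?X" by blast
  have "?X \<subseteq> (\<lambda>(\<alpha>, \<beta>). (\<Sum>i<n. \<alpha> i) + bsum \<beta>) ` supp A"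
  proof
    fix k assume "k \<in> ?X"
    then obtain \<alpha> \<beta> where k: "k = (\<Sum>i<n. \<alpha> i) + bsum \<beta>" and nn: "\<not> near n n' l M U (\<lambda>p. A \<alpha> \<beta> p = 0)" by blast
    have "A \<alpha> \<beta> \<noteq> (\<lambda>_. 0)" using nn unfolding near_iff[OF open_sets] by force
    then have "(\<alpha>, \<beta>) \<in> supp A" by (simp add: supp_def)
    then show "k \<in> (\<lambda>(\<alpha>, \<beta>). (\<Sum>i<n. \<alpha> i) + bsum \<beta>) ` supp A" unfolding k by (rule rev_image_eqI) simp
  qed
  then have "finite ?X" using fin finite_surj by blast
  then have "(\<Sum>i<n. \<alpha> i) + bsum \<beta> \<le> Sup ?X" using mem by (intro cSup_upper bdd_above_finite)
  then show False using ord unfolding ord_op_def by simp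
qed

lemma expV_diff: "expV c f p \<Longrightarrow> expV d g p \<Longrightarrow> expV (c - d) (\<lambda>q. f q - g q) p"
  unfolding expV_def by (simp add: expands_diff)

lemma expV_sum:
  "(\<And>i. i \<in> I \<Longrightarrow> expV (c i) (f i) p) \<Longrightarrow> p \<in> TS \<Longrightarrow> expV (sum c I) (\<lambda>q. \<Sum>i\<in>I. f i q) p"
  unfolding expV_def by (simp add: expands_sum)

lemma polynomial_expands:
  assumes c: "Vsup c" and fin: "finite {\<kappa>. cf c \<kappa> \<noteq> 0}" and TS: "b \<in> TS" "b' \<in> TS"
  shows "expands c (psum c b) b" and "\<exists>c'. expands c' (psum c b) b'"
proof -
  have h: "hs c (emb_diff b q) (psum c b q)" for q
    unfolding psum_def
  proof (rule bd_imp_hs)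
    show "bd (mon_abs (emb_diff b q)) c (\<Sum>\<kappa> | cf c \<kappa> \<noteq> 0. cmod (cf c \<kappa>) * mon_abs (emb_diff b q) \<kappa>)"
    proof (rule bdI)
      fix F :: "mindex set" assume F: "finite F"
      have "(\<Sum>\<kappa>\<in>F. cmod (cf c \<kappa>) * mon_abs (emb_diff b q) \<kappa>) =
          (\<Sum>\<kappa>\<in>F \<inter> {\<kappa>. cf c \<kappa> \<noteq> 0}. cmod (cf c \<kappa>) * mon_abs (emb_diff b q) \<kappa>)"
        by (rule sum.mono_neutral_right[OF F]) auto
      also have "\<dots> \<le> (\<Sum>\<kappa> | cf c \<kappa> \<noteq> 0. cmod (cf c \<kappa>) * mon_abs (emb_diff b q) \<kappa>)"
        by (rule sum_mono2[OF fin]) (auto intro!: mult_nonneg_nonneg mon_abs_nonneg)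
      finally show "(\<Sum>\<kappa>\<in>F. cmod (cf c \<kappa>) * mon_abs (emb_diff b q) \<kappa>) \<le>
        (\<Sum>\<kappa> | cf c \<kappa> \<noteq> 0. cmod (cf c \<kappa>) * mon_abs (emb_diff b q) \<kappa>)" .
    qed
  qed
  show "expands c (psum c b) b" by (rule expandsI[OF c TS(1)]) (simp add: h)
  define r where "r = 1 + (\<Sum>v\<in>V. cmod (emb_diff b b' v))"
  have r: "0 < r" unfolding r_def by (intro add_pos_nonneg sum_nonneg) auto
  have "cmod (emb_diff b b' v) < r" if "v \<in> V" for v
    using member_le_sum[OF that _ finite_V, of "\<lambda>v. cmod (emb_diff b b' v)"] by (simp add: r_def)
  then have "b' \<in> pd b r" using TS(2) unfolding pd_def by blast
  from expands_recenter[OF c TS(1) r h this] show "\<exists>c'. expands c' (psum c b) b'" by (rule exI)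
qed

end

locale boundary_system = coords n n' l for n n' l +
  fixes M :: "((nat \<Rightarrow> real) \<times> (nat \<Rightarrow> real)) set" and U :: "(nat \<Rightarrow> complex) set"
    and lam :: "(nat \<Rightarrow> complex) \<Rightarrow> nat \<Rightarrow> complex"
    and P :: "'m::finite oper" and p :: nat and Ps S :: "nat \<Rightarrow> 'm oper" and T :: "nat \<Rightarrow> nat \<Rightarrow> 'm oper"
  assumes M_open: "openin (prod_topology (Euclidean_space n) (Euclidean_space n')) M"
    and U_open: "openin (Complex_space l) U"
    and lam_hol: "\<And>i. i < n \<Longrightarrow> (\<lambda>z. lam z i) \<in> hol l U"
    and P_UD: "P \<in> UD n n' l M U"
    and sigma_bar: "\<And>x z \<xi>. x \<in> locus M \<Longrightarrow> z \<in> U \<Longrightarrow> \<xi> \<in> topspace (Euclidean_space n) \<Longrightarrow>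
           (\<forall>i<n. \<xi> i \<ge> 0) \<Longrightarrow> \<xi> \<noteq> (\<lambda>_. 0) \<Longrightarrow>
           det (sigma_bar_mat n n' l M U P x z (\<lambda>i. of_real (\<xi> i))) \<noteq> 0"
    and Ps_UD: "\<And>i. i < p \<Longrightarrow> Ps i \<in> UDtilde n n' l M U"
    and S_UD: "\<And>i. i < p \<Longrightarrow> S i \<in> UDtilde n n' l M U"
    and T_UD: "\<And>i j. i < p \<Longrightarrow> j < p \<Longrightarrow> T i j \<in> UD n n' l M U"
    and commutators: "\<And>i w. i < p \<Longrightarrow> w \<in> UAM n n' l M U \<Longrightarrow>
           near n n' l M U (\<lambda>q.
             op_apply n n' P (op_apply n n' (Ps i) w) q - op_apply n n' (Ps i) (op_apply n n' P w) q =
             op_apply n n' (S i) (op_apply n n' P w) q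
               + (\<Sum>j<p. op_apply n n' (T i j) (op_apply n n' (Ps j) w) q))"
    and sigma_T: "\<And>i j x z \<xi>. i < p \<Longrightarrow> j < p \<Longrightarrow> x \<in> locus M \<Longrightarrow> z \<in> U \<Longrightarrow> sigma_mat n (T i j) x z \<xi> = 0"
begin

lemma UD_UDtilde: "A \<in> UD n n' l M U \<Longrightarrow> A \<in> UDtilde n n' l M U"
  and UDtilde_finite: "A \<in> UDtilde n n' l M U \<Longrightarrow> finite (supp A)"
  unfolding UD_def UDtilde_def by blast+

definition A0 :: "(nat \<Rightarrow> nat) set" where
  "A0 = {\<alpha>. (\<alpha>, \<lambda>_. 0) \<in> supp P}"

definition C0 :: "(nat \<Rightarrow> real) \<Rightarrow> (nat \<Rightarrow> complex) \<Rightarrow> (nat \<Rightarrow> nat) \<Rightarrow> complex ^ 'm ^ 'm" where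
  "C0 x z \<alpha> = P \<alpha> (\<lambda>_. 0) (bpt x z)"

lemma finite_A0: "finite A0"
proof (rule finite_subset)
  show "A0 \<subseteq> fst ` supp P" unfolding A0_def by force
qed (use UDtilde_finite[OF UD_UDtilde[OF P_UD]] in blast)

lemma sigma_mat_eq: "sigma_mat n P x z \<xi> = symb n A0 (C0 x z) \<xi>"
  by (simp add: sigma_mat_def symb_def A0_def C0_def bpt_def)

lemma C0_order:
  assumes xz: "x \<in> locus M" "z \<in> U" and "ord_op n n' l M U P < (\<Sum>i<n. \<alpha> i)"
  shows "C0 x z \<alpha> = 0"
proof -
  have "near n n' l M U (\<lambda>p. P \<alpha> (\<lambda>_. 0) p = 0)"
    by (rule order_bound[OF M_open U_open UDtilde_finite[OF UD_UDtilde[OF P_UD]]]) (use assms(3) in simp)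
  then have "\<forall>\<^sub>F q in pf (bpt x z). P \<alpha> (\<lambda>_. 0) q = 0" using xz unfolding near_iff[OF M_open U_open] by blast
  from eventually_pf_self[OF this bpt_in_TS[OF M_open U_open xz]] show ?thesis by (simp add: C0_def)
qed

lemma symbol_bound:
  assumes xz: "x \<in> locus M" "z \<in> U"
    and nz: "\<And>\<gamma>. \<gamma> \<in> multi_indices n \<Longrightarrow> \<gamma> \<noteq> (\<lambda>_. 0) \<Longrightarrow> det (sigma_mat n P x z (\<lambda>i. lam z i + of_nat (\<gamma> i))) \<noteq> 0"
  shows "\<exists>c>0. \<forall>\<gamma>\<in>multi_indices n. \<gamma> \<noteq> (\<lambda>_. 0) \<longrightarrow> (\<forall>y. c * (1 + real (\<Sum>i<n. \<gamma> i)) ^ ord_op n n' l M U P * norm y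
    \<le> norm (symb n A0 (C0 x z) (\<lambda>i. lam z i + of_nat (\<gamma> i)) *v y))"
proof (rule symbol_lower_bound[OF finite_A0])
  show "C0 x z \<alpha> = 0" if "ord_op n n' l M U P < (\<Sum>i<n. \<alpha> i)" for \<alpha> by (rule C0_order[OF xz that])
  show "det (symb n A0 (C0 x z) (\<lambda>i. lam z i + of_nat (\<gamma> i))) \<noteq> 0" if "\<gamma> \<in> multi_indices n" "\<gamma> \<noteq> (\<lambda>_. 0)" for \<gamma>
    using nz[OF that] unfolding sigma_mat_eq .
  fix \<xi> :: "nat \<Rightarrow> real" assume \<xi>: "\<forall>i<n. 0 \<le> \<xi> i" "\<forall>i\<ge>n. \<xi> i = 0" "\<xi> \<noteq> (\<lambda>_. 0)"
  have "det (sigma_bar_mat n n' l M U P x z (\<lambda>i. of_real (\<xi> i))) \<noteq> 0"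
    by (rule sigma_bar[OF xz _ \<xi>(1,3)]) (use \<xi>(2) in \<open>simp add: topspace_Euclidean_space\<close>)
  then show "det (symb n {\<alpha> \<in> A0. (\<Sum>i<n. \<alpha> i) = ord_op n n' l M U P} (C0 x z) (\<lambda>i. of_real (\<xi> i))) \<noteq> 0"
    by (simp add: sigma_bar_mat_def symb_def A0_def C0_def bpt_def)
qed

lemma formal_commutators:
  assumes xz: "x \<in> locus M" "z \<in> U" and i: "i < p"
    and a: "expO a P (bpt x z)" and aa: "\<forall>i<p. expO (aa i) (Ps i) (bpt x z)" and as: "expO as (S i) (bpt x z)"
    and tt: "\<forall>j<p. expO (tt j) (T i j) (bpt x z)"
    and w: "\<And>k. Vsup (w $ k)" "\<And>k. finite {\<kappa>. cf (w $ k) \<kappa> \<noteq> 0}"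
  shows "com (supp P, a) (supp (Ps i), aa i) (supp (S i), as) p (\<lambda>j. (supp (T i j), tt j)) (\<lambda>j. (supp (Ps j), aa j)) (\<lambda>_. 0) w = 0"
proof -
  let ?b = "bpt x z"
  have TS: "?b \<in> TS" by (rule bpt_in_TS[OF M_open U_open xz])
  define g where "g q = (\<chi> k. psum (w $ k) ?b q)" for q
  have gb: "expV w g ?b" unfolding expV_def g_def vec_lambda_beta by (intro allI polynomial_expands(1)[OF w TS TS])
  have "g \<in> UAM n n' l M U"
    unfolding UAM_iff[OF M_open U_open]
  proof (intro ballI)
    fix x' z' assume xz': "x' \<in> locus M" "z' \<in> U"
    have "\<forall>k. \<exists>c'. expands c' (psum (w $ k) ?b) (bpt x' z')"
      by (intro allI polynomial_expands(2)[OF w TS bpt_in_TS[OF M_open U_open xz']])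
    then obtain c' where "\<forall>k. expands (c' k) (psum (w $ k) ?b) (bpt x' z')" by (rule choice[THEN exE])
    then have "expV (\<chi> k. c' k) g (bpt x' z')" by (simp add: expV_def g_def)
    then show "\<exists>c. expV c g (bpt x' z')" by (rule exI)
  qed
  then have ev: "\<forall>\<^sub>F q in pf ?b. op_apply n n' P (op_apply n n' (Ps i) g) q - op_apply n n' (Ps i) (op_apply n n' P g) q =
             op_apply n n' (S i) (op_apply n n' P g) q + (\<Sum>j<p. op_apply n n' (T i j) (op_apply n n' (Ps j) g) q)"
    using commutators[OF i] xz unfolding near_iff[OF M_open U_open] by blast
  have L: "expL (\<lambda>_. 0) (\<lambda>_ _. 0) ?b" using TS by (simp add: expL_def expands_0)
  have app: "expV (fop (supp A) b (\<lambda>_. 0) c) (op_apply n n' A f) ?b" if "expO b A ?b" "expV c f ?b"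
    for A :: "'m oper" and b c f
    using expV_op_tw[OF that(2) L that(1)] by (simp only: op_tw_0)
  have "expV (com (supp P, a) (supp (Ps i), aa i) (supp (S i), as) p (\<lambda>j. (supp (T i j), tt j)) (\<lambda>j. (supp (Ps j), aa j)) (\<lambda>_. 0) w)
    (\<lambda>q. op_apply n n' P (op_apply n n' (Ps i) g) q - op_apply n n' (Ps i) (op_apply n n' P g) q -
      op_apply n n' (S i) (op_apply n n' P g) q - (\<Sum>j<p. op_apply n n' (T i j) (op_apply n n' (Ps j) g) q)) ?b"
    unfolding com_def prod.case
    by (intro expV_diff expV_sum app gb a aa[rule_format] as tt[rule_format] TS i) simp_all
  moreover have "\<forall>\<^sub>F q in pf ?b. pos n q \<longrightarrow> op_apply n n' P (op_apply n n' (Ps i) g) q - op_apply n n' (Ps i) (op_apply n n' P g) q -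
      op_apply n n' (S i) (op_apply n n' P g) q - (\<Sum>j<p. op_apply n n' (T i j) (op_apply n n' (Ps j) g) q) = 0"
    using ev by (rule eventually_mono) simp
  ultimately show ?thesis by (rule expV_zero_pos)
qed

lemma local_data_exists:
  assumes xz: "x \<in> locus M" "z \<in> U"
    and nz: "\<And>\<gamma>. \<gamma> \<in> multi_indices n \<Longrightarrow> \<gamma> \<noteq> (\<lambda>_. 0) \<Longrightarrow> det (sigma_mat n P x z (\<lambda>i. lam z i + of_nat (\<gamma> i))) \<noteq> 0"
  shows "\<exists>L a aa. local_data lam P p Ps (bpt x z) L a aa"
proof -
  let ?b = "bpt x z"
  note O = M_open U_open
  have TS: "?b \<in> TS" by (rule bpt_in_TS[OF O xz])
  obtain L where L: "\<forall>i. Zonly (L i)" "expL L lam ?b" using expL_exists[where lam = lam, OF lam_hol xz(2) TS] by blast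
  obtain a where a: "expO a P ?b" using expO_exists[OF O xz UD_UDtilde[OF P_UD]] by blast
  have "\<forall>i. \<exists>a. i < p \<longrightarrow> expO a (Ps i) ?b" using expO_exists[OF O xz Ps_UD] by blast
  then obtain aa where aa: "\<forall>i. i < p \<longrightarrow> expO (aa i) (Ps i) ?b" by (rule choice[THEN exE])
  have "\<forall>i. \<exists>a. i < p \<longrightarrow> expO a (S i) ?b" using expO_exists[OF O xz S_UD] by blast
  then obtain as where as: "\<forall>i. i < p \<longrightarrow> expO (as i) (S i) ?b" by (rule choice[THEN exE])
  have "\<forall>i. \<exists>a. \<forall>j. i < p \<longrightarrow> j < p \<longrightarrow> expO (a j) (T i j) ?b"
  proof
    fix i
    have "\<forall>j. \<exists>a. i < p \<longrightarrow> j < p \<longrightarrow> expO a (T i j) ?b" using expO_exists[OF O xz UD_UDtilde[OF T_UD]] by blast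
    then show "\<exists>a. \<forall>j. i < p \<longrightarrow> j < p \<longrightarrow> expO (a j) (T i j) ?b" by (rule choice)
  qed
  then obtain tt where tt: "\<forall>i j. i < p \<longrightarrow> j < p \<longrightarrow> expO (tt i j) (T i j) ?b" by (rule choice[THEN exE])
  define s where "s = Suc ((\<Sum>(\<alpha>, \<beta>)\<in>supp P. bsum \<beta>) + (\<Sum>i<p. \<Sum>j<p. \<Sum>(\<alpha>, \<beta>)\<in>supp (T i j). bsum \<beta>))"
  have UDP: "UD_data s (supp P) a" by (rule UD_data_supp[OF O xz P_UD a]) (simp add: s_def)
  have T: "UD_data s (supp (T i j)) (tt i j)" if ij: "i < p" "j < p" for i j
  proof (rule UD_data_supp[OF O xz T_UD[OF ij] tt[rule_format, OF ij]])
    have "(\<Sum>(\<alpha>, \<beta>)\<in>supp (T i j). bsum \<beta>) \<le> (\<Sum>j<p. \<Sum>(\<alpha>, \<beta>)\<in>supp (T i j). bsum \<beta>)"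
      by (rule member_le_sum[of j "{..<p}" "\<lambda>j. \<Sum>(\<alpha>, \<beta>)\<in>supp (T i j). bsum \<beta>"]) (simp_all only: ij lessThan_iff zero_le finite_lessThan)
    also have "\<dots> \<le> (\<Sum>i<p. \<Sum>j<p. \<Sum>(\<alpha>, \<beta>)\<in>supp (T i j). bsum \<beta>)"
      by (rule member_le_sum[of i "{..<p}" "\<lambda>i. \<Sum>j<p. \<Sum>(\<alpha>, \<beta>)\<in>supp (T i j). bsum \<beta>"]) (simp_all only: ij lessThan_iff zero_le finite_lessThan)
    finally show "(\<Sum>(\<alpha>, \<beta>)\<in>supp (T i j). bsum \<beta>) < s" unfolding s_def by linarith
  qed
  have leadT: "lead (supp (T i j)) (tt i j) L \<gamma> = 0" if ij: "i < p" "j < p" for i j \<gamma>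
    unfolding lead_eq_sigma_mat[OF tt[rule_format, OF ij] L(2)] by (rule sigma_T[OF ij xz])
  have comT: "fop (supp P) a L (fop (supp (Ps i)) (aa i) L w) =
       (\<Sum>j<p. fop (supp (T i j)) (tt i j) L (fop (supp (Ps j)) (aa j) L w))"
    if i: "i < p" and w: "\<forall>k. Vsup (w $ k)" and f: "fop (supp P) a L w = 0" for i w
  proof -
    have "com (supp P, a) (supp (Ps i), aa i) (supp (S i), as i) p (\<lambda>j. (supp (T i j), tt i j)) (\<lambda>j. (supp (Ps j), aa j)) L w = 0"
    proof (rule com_twisted)
      show "com (supp P, a) (supp (Ps i), aa i) (supp (S i), as i) p (\<lambda>j. (supp (T i j), tt i j)) (\<lambda>j. (supp (Ps j), aa j)) (\<lambda>_. 0) w = 0"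
        if "\<And>k. Vsup (w $ k)" "\<And>k. finite {\<kappa>. cf (w $ k) \<kappa> \<noteq> 0}" for w
        by (rule formal_commutators[OF xz i a _ as[rule_format, OF i] _ that]) (use aa tt i in blast)+
      show "finite (fst (supp P, a))" using UDtilde_finite[OF UD_UDtilde[OF P_UD]] by simp
      show "finite (fst (supp (Ps i), aa i))" using UDtilde_finite[OF Ps_UD[OF i]] by simp
      show "finite (fst (supp (S i), as i))" using UDtilde_finite[OF S_UD[OF i]] by simp
      show "\<forall>j<p. finite (fst (supp (T i j), tt i j))" using UDtilde_finite[OF UD_UDtilde[OF T_UD[OF i]]] by simp
      show "\<forall>j<p. finite (fst (supp (Ps j), aa j))" using UDtilde_finite[OF Ps_UD] by simp
      show "Vsup (w $ k)" for k using w by blast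
      show "Zonly (L i)" for i using L(1) by blast
    qed
    then show ?thesis unfolding com_def prod.case f fop_0 by simp
  qed
  obtain c where c: "0 < c" "\<forall>\<gamma>\<in>multi_indices n. \<gamma> \<noteq> (\<lambda>_. 0) \<longrightarrow> (\<forall>y. c * (1 + real (\<Sum>i<n. \<gamma> i)) ^ ord_op n n' l M U P * norm y
    \<le> norm (symb n A0 (C0 x z) (\<lambda>i. lam z i + of_nat (\<gamma> i)) *v y))"
  proof -
    have "\<exists>c>0. \<forall>\<gamma>\<in>multi_indices n. \<gamma> \<noteq> (\<lambda>_. 0) \<longrightarrow> (\<forall>y. c * (1 + real (\<Sum>i<n. \<gamma> i)) ^ ord_op n n' l M U P * norm y
      \<le> norm (symb n A0 (C0 x z) (\<lambda>i. lam z i + of_nat (\<gamma> i)) *v y))"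
      by (rule symbol_bound[OF xz]) (rule nz)
    then show ?thesis using that by (elim exE conjE)
  qed
  have leadP: "c * (1 + real (tdeg \<kappa>)) ^ ord_op n n' l M U P * norm y \<le> norm (lead (supp P) a L (\<lambda>k. lookup \<kappa> (Tv k)) *v y)"
    if \<kappa>: "keys \<kappa> \<subseteq> V" "tdeg \<kappa> \<noteq> 0" for \<kappa> y
  proof -
    have mi: "(\<lambda>k. lookup \<kappa> (Tv k)) \<in> multi_indices n"
      using \<kappa>(1) unfolding multi_indices_def by (force simp: in_keys_iff)
    have ne: "(\<lambda>k. lookup \<kappa> (Tv k)) \<noteq> (\<lambda>_. 0)" using \<kappa>(2) by (auto simp: tdeg_eq_0_iff fun_eq_iff)
    show ?thesis
      unfolding lead_eq_sigma_mat[OF a L(2)] sigma_mat_eq tdeg_eq_order[OF \<kappa>(1)]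
      by (rule c(2)[rule_format, OF mi ne])
  qed
  have ord: "(\<Sum>i<n. \<alpha> i) + bsum \<beta> \<le> ord_op n n' l M U P" if "a \<alpha> \<beta> $ i $ j \<noteq> 0" for \<alpha> \<beta> i j
  proof (rule ccontr)
    assume "\<not> (\<Sum>i<n. \<alpha> i) + bsum \<beta> \<le> ord_op n n' l M U P"
    then have "near n n' l M U (\<lambda>p. P \<alpha> \<beta> p = 0)"
      by (intro order_bound[OF O UDtilde_finite[OF UD_UDtilde[OF P_UD]]]) simp
    then have "\<forall>\<^sub>F q in pf ?b. P \<alpha> \<beta> q = 0" using xz unfolding near_iff[OF O] by blast
    then have "\<forall>\<^sub>F q in pf ?b. P \<alpha> \<beta> q $ i $ j = 0" by (rule eventually_mono) simp
    moreover have "expands (a \<alpha> \<beta> $ i $ j) (\<lambda>q. P \<alpha> \<beta> q $ i $ j) ?b" using a unfolding expO_def by blast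
    ultimately have "a \<alpha> \<beta> $ i $ j = 0" by (rule expands_zero[rotated])
    then show False using that by contradiction
  qed
  have 1: "\<exists>s S' a'. 0 < s \<and> UD_data s (supp P) a \<and>
       (\<forall>i<p. \<forall>j<p. UD_data s (S' i j) (a' i j) \<and> (\<forall>\<gamma>. lead (S' i j) (a' i j) L \<gamma> = 0)) \<and>
       (\<forall>i<p. \<forall>w. (\<forall>k. Vsup (w $ k)) \<longrightarrow> fop (supp P) a L w = 0 \<longrightarrow>
         fop (supp P) a L (fop (supp (Ps i)) (aa i) L w) =
         (\<Sum>j<p. fop (S' i j) (a' i j) L (fop (supp (Ps j)) (aa j) L w)))"
  proof (intro exI[of _ s] exI[of _ "\<lambda>i j. supp (T i j)"] exI[of _ tt] conjI allI impI)
    show "0 < s" by (simp add: s_def)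
    show "UD_data s (supp P) a" by (rule UDP)
    show "UD_data s (supp (T i j)) (tt i j)" if "i < p" "j < p" for i j by (rule T[OF that])
    show "lead (supp (T i j)) (tt i j) L \<gamma> = 0" if "i < p" "j < p" for i j \<gamma> by (rule leadT[OF that])
    show "fop (supp P) a L (fop (supp (Ps i)) (aa i) L w) =
       (\<Sum>j<p. fop (supp (T i j)) (tt i j) L (fop (supp (Ps j)) (aa j) L w))"
      if "i < p" "\<forall>k. Vsup (w $ k)" "fop (supp P) a L w = 0" for i w by (rule comT[OF that])
  qed
  have 2: "\<exists>c r. 0 < c \<and>
       (\<forall>\<kappa> y. keys \<kappa> \<subseteq> V \<longrightarrow> tdeg \<kappa> \<noteq> 0 \<longrightarrow>
         c * (1 + real (tdeg \<kappa>)) ^ r * norm y \<le> norm (lead (supp P) a L (\<lambda>k. lookup \<kappa> (Tv k)) *v y)) \<and>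
       (\<forall>\<alpha> \<beta> i j. (\<alpha>, \<beta>) \<in> supp P \<longrightarrow> a \<alpha> \<beta> $ i $ j \<noteq> 0 \<longrightarrow> (\<Sum>i<n. \<alpha> i) + bsum \<beta> \<le> r)"
  proof (intro exI[of _ c] exI[of _ "ord_op n n' l M U P"] conjI allI impI)
    show "0 < c" by (rule c(1))
    show "c * (1 + real (tdeg \<kappa>)) ^ ord_op n n' l M U P * norm y \<le> norm (lead (supp P) a L (\<lambda>k. lookup \<kappa> (Tv k)) *v y)"
      if "keys \<kappa> \<subseteq> V" "tdeg \<kappa> \<noteq> 0" for \<kappa> y by (rule leadP[OF that])
    show "(\<Sum>i<n. \<alpha> i) + bsum \<beta> \<le> ord_op n n' l M U P" if "a \<alpha> \<beta> $ i $ j \<noteq> 0" for \<alpha> \<beta> i j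
      by (rule ord[OF that])
  qed
  have "local_data lam P p Ps ?b L a aa"
    unfolding local_data_def using L a aa 1 2 by (intro conjI) assumption+
  then show ?thesis by blast
qed

lemma sigma_mat_nonzero_nearby:
  assumes xz: "x0 \<in> locus M" "z0 \<in> U"
    and nz: "\<And>\<gamma>. \<gamma> \<in> multi_indices n \<Longrightarrow> \<gamma> \<noteq> (\<lambda>_. 0) \<Longrightarrow> det (sigma_mat n P x0 z0 (\<lambda>i. lam z0 i + of_nat (\<gamma> i))) \<noteq> 0"
  shows "\<exists>r>0. \<forall>q\<in>pd (bpt x0 z0) r. q \<in> MU M U \<and> (\<forall>x z. q = bpt x z \<longrightarrow>
    (\<forall>\<gamma>\<in>multi_indices n. \<gamma> \<noteq> (\<lambda>_. 0) \<longrightarrow> det (sigma_mat n P x z (\<lambda>i. lam z i + of_nat (\<gamma> i))) \<noteq> 0))"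
proof -
  let ?b = "bpt x0 z0"
  note O = M_open U_open
  have TS: "?b \<in> TS" by (rule bpt_in_TS[OF O xz])
  obtain L where L: "expL L lam ?b" using expL_exists[where lam = lam, OF lam_hol xz(2) TS] by blast
  obtain a where a: "expO a P ?b" using expO_exists[OF O xz UD_UDtilde[OF P_UD]] by blast
  obtain c where c: "0 < c" "\<forall>\<gamma>\<in>multi_indices n. \<gamma> \<noteq> (\<lambda>_. 0) \<longrightarrow> (\<forall>y. c * (1 + real (\<Sum>i<n. \<gamma> i)) ^ ord_op n n' l M U P * norm y
    \<le> norm (symb n A0 (C0 x0 z0) (\<lambda>i. lam z0 i + of_nat (\<gamma> i)) *v y))"
  proof -
    have "\<exists>c>0. \<forall>\<gamma>\<in>multi_indices n. \<gamma> \<noteq> (\<lambda>_. 0) \<longrightarrow> (\<forall>y. c * (1 + real (\<Sum>i<n. \<gamma> i)) ^ ord_op n n' l M U P * norm y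
      \<le> norm (symb n A0 (C0 x0 z0) (\<lambda>i. lam z0 i + of_nat (\<gamma> i)) *v y))"
      by (rule symbol_bound[OF xz]) (rule nz)
    then show ?thesis using that by (elim exE conjE)
  qed
  have "\<exists>\<delta>>0. \<forall>C' \<mu>'. (\<forall>\<alpha>\<in>A0. ord_op n n' l M U P < (\<Sum>i<n. \<alpha> i) \<longrightarrow> C' \<alpha> = 0) \<longrightarrow>
    (\<forall>\<alpha>\<in>A0. \<forall>i j. cmod (C' \<alpha> $ i $ j - C0 x0 z0 \<alpha> $ i $ j) \<le> \<delta>) \<longrightarrow> (\<forall>i<n. cmod (\<mu>' i - lam z0 i) \<le> \<delta>) \<longrightarrow>
    (\<forall>\<gamma>\<in>multi_indices n. \<gamma> \<noteq> (\<lambda>_. 0) \<longrightarrow> det (symb n A0 C' (\<lambda>i. \<mu>' i + of_nat (\<gamma> i))) \<noteq> 0)"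
    by (rule symbol_perturbation[OF finite_A0 C0_order[OF xz] c(1) c(2)[rule_format]]) assumption+
  then obtain \<delta> where \<delta>: "0 < \<delta>" and pert: "\<forall>C' \<mu>'. (\<forall>\<alpha>\<in>A0. ord_op n n' l M U P < (\<Sum>i<n. \<alpha> i) \<longrightarrow> C' \<alpha> = 0) \<longrightarrow>
    (\<forall>\<alpha>\<in>A0. \<forall>i j. cmod (C' \<alpha> $ i $ j - C0 x0 z0 \<alpha> $ i $ j) \<le> \<delta>) \<longrightarrow> (\<forall>i<n. cmod (\<mu>' i - lam z0 i) \<le> \<delta>) \<longrightarrow>
    (\<forall>\<gamma>\<in>multi_indices n. \<gamma> \<noteq> (\<lambda>_. 0) \<longrightarrow> det (symb n A0 C' (\<lambda>i. \<mu>' i + of_nat (\<gamma> i))) \<noteq> 0)"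
    by (elim exE conjE)
  have "\<forall>\<^sub>F q in pf ?b. cmod (P \<alpha> (\<lambda>_. 0) q $ i $ j - P \<alpha> (\<lambda>_. 0) ?b $ i $ j) < \<delta>" for \<alpha> i j
    by (rule expands_continuous[OF _ \<delta>, of "a \<alpha> (\<lambda>_. 0) $ i $ j"]) (use a in \<open>unfold expO_def, blast\<close>)
  then have 1: "\<forall>\<^sub>F q in pf ?b. \<forall>\<alpha>\<in>A0. \<forall>i j. cmod (P \<alpha> (\<lambda>_. 0) q $ i $ j - P \<alpha> (\<lambda>_. 0) ?b $ i $ j) < \<delta>"
    by (intro eventually_ball_finite finite_A0 ballI eventually_all_finite)
  have "\<forall>\<^sub>F q in pf ?b. cmod (lam (snd (snd q)) i - lam (snd (snd ?b)) i) < \<delta>" if "i < n" for i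
    by (rule expands_continuous[OF _ \<delta>, of "L i" "\<lambda>q. lam (snd (snd q)) i"]) (use L that in \<open>unfold expL_def, blast\<close>)
  then have 2: "\<forall>\<^sub>F q in pf ?b. \<forall>i\<in>{..<n}. cmod (lam (snd (snd q)) i - lam (snd (snd ?b)) i) < \<delta>"
    by (intro eventually_ball_finite ballI) auto
  obtain r where r: "0 < r" and R: "\<forall>q\<in>pd ?b r. q \<in> MU M U \<and>
      (\<forall>\<alpha>\<in>A0. \<forall>i j. cmod (P \<alpha> (\<lambda>_. 0) q $ i $ j - P \<alpha> (\<lambda>_. 0) ?b $ i $ j) < \<delta>) \<and>
      (\<forall>i\<in>{..<n}. cmod (lam (snd (snd q)) i - lam (snd (snd ?b)) i) < \<delta>)"
    using eventually_conj[OF eventually_MU[OF O xz] eventually_conj[OF 1 2]] unfolding eventually_pf by blast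
  have "det (sigma_mat n P x z (\<lambda>i. lam z i + of_nat (\<gamma> i))) \<noteq> 0"
    if q: "bpt x z \<in> pd ?b r" and \<gamma>: "\<gamma> \<in> multi_indices n" "\<gamma> \<noteq> (\<lambda>_. 0)" for x z \<gamma>
  proof -
    note Rq = R[rule_format, OF q]
    have xz': "x \<in> locus M" "z \<in> U" using Rq by (simp_all add: MU_def bpt_def locus_def)
    have A: "\<forall>\<alpha>\<in>A0. ord_op n n' l M U P < (\<Sum>i<n. \<alpha> i) \<longrightarrow> C0 x z \<alpha> = 0" using C0_order[OF xz'] by blast
    have B: "\<forall>\<alpha>\<in>A0. \<forall>i j. cmod (C0 x z \<alpha> $ i $ j - C0 x0 z0 \<alpha> $ i $ j) \<le> \<delta>"
      using Rq[THEN conjunct2, THEN conjunct1] unfolding C0_def by (blast intro: less_imp_le)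
    have C: "\<forall>i<n. cmod (lam z i - lam z0 i) \<le> \<delta>"
      using Rq[THEN conjunct2, THEN conjunct2] by (simp add: bpt_def less_imp_le)
    show ?thesis
      unfolding sigma_mat_eq by (rule pert[THEN spec, THEN spec, THEN mp, OF A, THEN mp, OF B, THEN mp, OF C, rule_format, OF \<gamma>])
  qed
  then show ?thesis using R r by (intro exI[of _ r]) blast
qed

end

subsection \<open>Polydiscs\<close>

definition polydisc :: "nat \<Rightarrow> (nat \<Rightarrow> 'a) \<Rightarrow> real \<Rightarrow> (nat \<Rightarrow> 'a::real_normed_vector) set" where
  "polydisc k f r = {g. (\<forall>i\<ge>k. g i = 0) \<and> (\<forall>i<k. norm (g i - f i) < r)}"

lemma openin_polydisc:
  "openin (subtopology (product_topology (\<lambda>_. euclidean) UNIV) {g. \<forall>i\<ge>k. g i = 0}) (polydisc k f r)"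
proof -
  have "open (\<Inter>i\<in>{..<k}. {g :: nat \<Rightarrow> 'a. norm (g i - f i) < r})"
    by (intro open_INT ballI finite_lessThan open_Collect_less continuous_intros continuous_on_product_coordinates)
  moreover have "polydisc k f r = (\<Inter>i\<in>{..<k}. {g. norm (g i - f i) < r}) \<inter> {g. \<forall>i\<ge>k. g i = 0}"
    by (auto simp: polydisc_def)
  ultimately show ?thesis
    unfolding openin_subtopology euclidean_product_topology open_openin[symmetric]
    by (intro exI[of _ "\<Inter>i\<in>{..<k}. {g. norm (g i - f i) < r}"] conjI)
qed

lemma connectedin_polydisc:
  "connectedin (subtopology (product_topology (\<lambda>_. euclidean) UNIV) {g. \<forall>i\<ge>k. g i = 0}) (polydisc k f r)"
proof -
  have "connected (polydisc k f r)"
    unfolding connected_iff_connected_component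
  proof (intro ballI)
    fix g h assume g: "g \<in> polydisc k f r" and h: "h \<in> polydisc k f r"
    define \<phi> where "\<phi> s = (\<lambda>i. (1 - s) *\<^sub>R g i + s *\<^sub>R h i)" for s :: real
    have "continuous_on {0..1} \<phi>"
      unfolding \<phi>_def by (intro continuous_on_coordinatewise_then_product continuous_intros)
    then have c: "connected (\<phi> ` {0..1})" by (rule connected_continuous_image) simp
    have sub: "\<phi> ` {0..1} \<subseteq> polydisc k f r"
    proof
      fix y assume "y \<in> \<phi> ` {0..1}"
      then obtain s where s: "0 \<le> s" "s \<le> 1" "y = \<phi> s" by auto
      have "norm (\<phi> s i - f i) < r" if "i < k" for i
      proof -
        have "g i \<in> ball (f i) r" "h i \<in> ball (f i) r"
          using g h that by (auto simp: polydisc_def dist_norm norm_minus_commute)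
        then have "(1 - s) *\<^sub>R g i + s *\<^sub>R h i \<in> ball (f i) r"
          using s by (intro convexD[OF convex_ball]) auto
        then show ?thesis by (simp add: \<phi>_def dist_norm norm_minus_commute)
      qed
      then show "y \<in> polydisc k f r" using g h s(3) by (simp add: polydisc_def \<phi>_def)
    qed
    have "g \<in> \<phi> ` {0..1}" by (rule rev_image_eqI[of 0]) (simp_all add: \<phi>_def)
    moreover have "h \<in> \<phi> ` {0..1}" by (rule rev_image_eqI[of 1]) (simp_all add: \<phi>_def)
    ultimately show "connected_component (polydisc k f r) g h"
      unfolding connected_component_def using c sub by (intro exI[of _ "\<phi> ` {0..1}"] conjI)
  qed
  then show ?thesis
    unfolding connectedin_subtopology euclidean_product_topology connectedin_iff_connected
    by (intro conjI subsetI) (simp_all add: polydisc_def)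
qed

theorem theorem4p1:
  fixes n n' l p :: nat
    and M :: "((nat \<Rightarrow> real) \<times> (nat \<Rightarrow> real)) set"
    and U :: "(nat \<Rightarrow> complex) set"
    and x0 :: "nat \<Rightarrow> real" and z0 :: "nat \<Rightarrow> complex"
    and lam :: "(nat \<Rightarrow> complex) \<Rightarrow> nat \<Rightarrow> complex"
    and P :: "'m::finite oper"
    and Ps S :: "nat \<Rightarrow> 'm oper"
    and T :: "nat \<Rightarrow> nat \<Rightarrow> 'm oper"
  assumes "admissible n n' l M U x0 z0"
    and "\<And>i. i < n \<Longrightarrow> (\<lambda>z. lam z i) \<in> hol l U"
    and "P \<in> UD n n' l M U"
    and "\<And>x z \<xi>. x \<in> locus M \<Longrightarrow> z \<in> U \<Longrightarrow> \<xi> \<in> topspace (Euclidean_space n) \<Longrightarrow>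
           (\<forall>i<n. \<xi> i \<ge> 0) \<Longrightarrow> \<xi> \<noteq> (\<lambda>_. 0) \<Longrightarrow>
           det (sigma_bar_mat n n' l M U P x z (\<lambda>i. of_real (\<xi> i))) \<noteq> 0"
    and "\<And>\<gamma>. \<gamma> \<in> multi_indices n \<Longrightarrow> \<gamma> \<noteq> (\<lambda>_. 0) \<Longrightarrow>
           det (sigma_mat n P x0 z0 (\<lambda>i. lam z0 i + of_nat (\<gamma> i))) \<noteq> 0"
    and "\<And>i. i < p \<Longrightarrow> Ps i \<in> UDtilde n n' l M U"
    and "\<And>i. i < p \<Longrightarrow> S i \<in> UDtilde n n' l M U"
    and "\<And>i j. i < p \<Longrightarrow> j < p \<Longrightarrow> T i j \<in> UD n n' l M U"
    and "\<And>i w. i < p \<Longrightarrow> w \<in> UAM n n' l M U \<Longrightarrow>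
           near n n' l M U (\<lambda>q.
             op_apply n n' P (op_apply n n' (Ps i) w) q - op_apply n n' (Ps i) (op_apply n n' P w) q =
             op_apply n n' (S i) (op_apply n n' P w) q
               + (\<Sum>j<p. op_apply n n' (T i j) (op_apply n n' (Ps j) w) q))"
    and "\<And>i j x z \<xi>. i < p \<Longrightarrow> j < p \<Longrightarrow> x \<in> locus M \<Longrightarrow> z \<in> U \<Longrightarrow> sigma_mat n (T i j) x z \<xi> = 0"
  shows "\<exists>M' U'. M' \<subseteq> M \<and> U' \<subseteq> U \<and> admissible n n' l M' U' x0 z0 \<and>
    bij_betw (\<lambda>G. the_elem (boundary_value n n' l M' U' lam ` G))
      (solutions n n' l M' U' lam P p Ps // germ_rel n n' l M' U')
      (boundary_solutions n n' l M' U' lam P p Ps)"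
proof -
  have adm: "openin (prod_topology (Euclidean_space n) (Euclidean_space n')) M" "openin (Complex_space l) U"
    "x0 \<in> locus M" "z0 \<in> U" using assms(1) unfolding admissible_def by blast+
  interpret boundary_system n n' l M U lam P p Ps S T
    by unfold_locales (fact adm assms)+
  have "\<exists>r>0. \<forall>q\<in>pd (bpt x0 z0) r. q \<in> MU M U \<and> (\<forall>x z. q = bpt x z \<longrightarrow>
    (\<forall>\<gamma>\<in>multi_indices n. \<gamma> \<noteq> (\<lambda>_. 0) \<longrightarrow> det (sigma_mat n P x z (\<lambda>i. lam z i + of_nat (\<gamma> i))) \<noteq> 0))"
    by (rule sigma_mat_nonzero_nearby[OF adm(3,4)]) (rule assms(5))
  then obtain r where r: "0 < r" and R: "\<forall>q\<in>pd (bpt x0 z0) r. q \<in> MU M U \<and> (\<forall>x z. q = bpt x z \<longrightarrow>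
    (\<forall>\<gamma>\<in>multi_indices n. \<gamma> \<noteq> (\<lambda>_. 0) \<longrightarrow> det (sigma_mat n P x z (\<lambda>i. lam z i + of_nat (\<gamma> i))) \<noteq> 0))"
    by (elim exE conjE)
  have TS0: "bpt x0 z0 \<in> TS" by (rule bpt_in_TS[OF adm])
  define M' where "M' = polydisc n (\<lambda>_. 0 :: real) r \<times> polydisc n' x0 r"
  define U' where "U' = polydisc l z0 r"
  have z0: "z0 \<in> U'" using TS0 r by (simp add: U'_def polydisc_def bpt_def TS_iff)
  have x0: "x0 \<in> polydisc n' x0 r" using TS0 r by (simp add: polydisc_def bpt_def TS_iff)
  have t0: "(\<lambda>_. 0) \<in> polydisc n (\<lambda>_. 0 :: real) r" using r by (simp add: polydisc_def)
  have locus: "locus M' = polydisc n' x0 r" using t0 by (simp add: locus_def M'_def)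
  have pd: "(t, x, z) \<in> pd (bpt x0 z0) r" if "(t, x) \<in> M'" "z \<in> U'" for t x z
    using that unfolding bpt_def pd_iff TS_def[symmetric] TS_iff M'_def U'_def polydisc_def by simp
  have MM: "M' \<subseteq> M"
  proof
    fix y assume y: "y \<in> M'"
    obtain t x where tx: "y = (t, x)" by (cases y)
    have "(t, x, z0) \<in> MU M U" using R pd[OF y[unfolded tx] z0] by blast
    then show "y \<in> M" by (simp add: MU_def tx)
  qed
  have UU: "U' \<subseteq> U"
  proof
    fix z assume z: "z \<in> U'"
    have "(\<lambda>_. 0, x0) \<in> M'" using x0 t0 by (simp add: M'_def)
    from pd[OF this z] have "(\<lambda>_. 0, x0, z) \<in> MU M U" using R by blast
    then show "z \<in> U" by (simp add: MU_def)
  qed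
  have ex: "openin (Euclidean_space k) (polydisc k f r)" "connectedin (Euclidean_space k) (polydisc k f r)" for k f
    unfolding Euclidean_space_def by (rule openin_polydisc connectedin_polydisc)+
  have M'_open: "openin (prod_topology (Euclidean_space n) (Euclidean_space n')) M'"
    unfolding M'_def openin_prod_Times_iff using ex(1) by blast
  have U'_open: "openin (Complex_space l) U'"
    unfolding U'_def Complex_space_def by (rule openin_polydisc)
  have "connectedin (prod_topology (Euclidean_space n) (Euclidean_space n')) M'"
    unfolding M'_def connectedin_Times using ex(2) by blast
  moreover have "connectedin (Complex_space l) U'"
    unfolding U'_def Complex_space_def by (rule connectedin_polydisc)
  ultimately have adm': "admissible n n' l M' U' x0 z0"
    unfolding admissible_def locus using M'_open U'_open ex(2) x0 z0 by blast
  have loc: "x \<in> locus M" if "x \<in> locus M'" for x using that MM unfolding locus_def by blast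
  have "\<exists>L a aa. local_data lam P p Ps (bpt x z) L a aa" if xz: "x \<in> locus M'" "z \<in> U'" for x z
  proof (rule local_data_exists)
    show "x \<in> locus M" by (rule loc[OF xz(1)])
    show "z \<in> U" using UU xz(2) by blast
    have "(\<lambda>_. 0, x) \<in> M'" using xz(1) by (simp add: locus_def)
    from pd[OF this xz(2)] have "bpt x z \<in> pd (bpt x0 z0) r" unfolding bpt_def[of x z] .
    from R[rule_format, OF this, THEN conjunct2, rule_format, OF refl]
    show "det (sigma_mat n P x z (\<lambda>i. lam z i + of_nat (\<gamma> i))) \<noteq> 0" if "\<gamma> \<in> multi_indices n" "\<gamma> \<noteq> (\<lambda>_. 0)" for \<gamma>
      using that by blast
  qed
  then have "\<forall>b. \<exists>D. (\<exists>x\<in>locus M'. \<exists>z\<in>U'. b = bpt x z) \<longrightarrow> local_data lam P p Ps b (fst D) (fst (snd D)) (snd (snd D))"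
    by (metis fst_conv snd_conv)
  then obtain D where D: "\<forall>b. (\<exists>x\<in>locus M'. \<exists>z\<in>U'. b = bpt x z) \<longrightarrow>
      local_data lam P p Ps b (fst (D b)) (fst (snd (D b))) (snd (snd (D b)))"
    by (rule choice[THEN exE])
  interpret B: boundary_problem n n' l M' U' lam P p Ps "\<lambda>b. fst (D b)" "\<lambda>b. fst (snd (D b))" "\<lambda>b. snd (snd (D b))"
  proof unfold_locales
    show "openin (prod_topology (Euclidean_space n) (Euclidean_space n')) M'" by (rule M'_open)
    show "openin (Complex_space l) U'" by (rule U'_open)
    show "finite (supp P)" by (rule UDtilde_finite[OF UD_UDtilde[OF P_UD]])
    show "finite (supp (Ps i))" if "i < p" for i by (rule UDtilde_finite[OF Ps_UD[OF that]])
    show "P \<alpha> \<beta> (\<lambda>_. 0, x, z) = 0" if "\<beta> \<noteq> (\<lambda>_. 0)" "x \<in> locus M'" "z \<in> U'" for \<alpha> \<beta> x z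
      using P_UD that loc UU unfolding UD_def by blast
    show "local_data lam P p Ps (bpt x z) (fst (D (bpt x z))) (fst (snd (D (bpt x z)))) (snd (snd (D (bpt x z))))"
      if "x \<in> locus M'" "z \<in> U'" for x z
      by (rule D[rule_format]) (use that in blast)
  qed
  show ?thesis
    by (intro exI[of _ M'] exI[of _ U'] conjI MM UU adm' B.boundary_value_bij)
qed

end
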